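(* Let $T$ be a Calderón–Zygmund operator in $\mathbb{R}^n$ with maximal truncated version $T_{\natural}$. There is a constant $c(n,T)$, depending only on $n$ and $T$, such that for every $A_1$ weight $w$: $$\|T_{\natural}f\|_{L^p(w)}\le c(n,T)\,pp'\,\|w\|_{A_1}^{1/p}\|w\|_{A_{\infty}}^{1/p'}\|f\|_{L^p(w)}\qquad\text{for all }1<p<\infty,\ f\in L^p(w),$$ where $p'=p/(p-1)$, and $$\|T_{\natural}f\|_{L^{1,\infty}(w)}\le c(n,T)\,\|w\|_{A_1}\log(1+\|w\|_{A_{\infty}})\,\|f\|_{L^1(w)}\qquad\text{for all }f\in L^1(w).$$
   Context: A weight is a non-negative locally integrable function on $\mathbb{R}^n$; $\|f\|_{L^p(w)}=(\int|f|^pw\,dx)^{1/p}$; $\|f\|_{L^{1,\infty}(w)}=\sup_{\alpha>0}\alpha\,w(\{|f|>\alpha\})$, $w(E)=\int_Ew$. $M$ is the Hardy–Littlewood maximal operator. $w$ is an $A_1$ weight if there is $c>0$ with $Mw(x)\le cw(x)$ a.e.; the smallest such $c$ is $\|w\|_{A_1}$. The $A_\infty$ characteristic is $\|w\|_{A_{\infty}}=\sup_{Q\subset\mathbb{R}^n}\frac1{w(Q)}\int_QM(w\chi_Q)\,dx$ (supremum over all cubes). Calderón–Zygmund operator: an $L^2(\mathbb{R}^n)$-bounded integral operator $T$ with kernel $K$ (so $Tf(x)=\int K(x,y)f(y)\,dy$ for $x\notin\operatorname{supp} f$) satisfying, for some constant $c$ and some $0<\delta\le 1$: (i) $|K(x,y)|\le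 \frac{c}{|x-y|^n}$ for all $x\ne y$; (ii) $|K(x,y)-K(x',y)|+|K(y,x)-K(y,x')|\le c\frac{|x-x'|^{\delta}}{|x-y|^{n+\delta}}$ whenever $|x-x'|<|x-y|/2$. Its maximal truncated version is $$T_{\natural}f(x)=\sup_{0<\varepsilon<\nu}\Big|\int_{\varepsilon<|x-y|<\nu}K(x,y)f(y)\,dy\Big|.$$ *)

theory Defs
  imports "HOL-Analysis.Analysis"
begin

text \<open>
  Measurability and integration refer to the completed Lebesgue measure on \<open>real ^ 'n\<close>; functions
  acted on by operators are complex-valued. Quantities that may be infinite take values in
  \<^typ>\<open>ennreal\<close>.
\<close>

text \<open>Real power of an extended nonnegative real; only used for exponents \<open>a > 0\<close>.\<close>

definition ennreal_powr :: "ennreal \<Rightarrow> real \<Rightarrow> ennreal" where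
  "ennreal_powr x a = (if x = \<infinity> then \<infinity> else ennreal (enn2real x powr a))"

definition weight :: "(real ^ 'n \<Rightarrow> real) \<Rightarrow> bool" where
  "weight w \<longleftrightarrow> (\<forall>x. 0 \<le> w x) \<and> (\<forall>S. compact S \<longrightarrow> set_integrable lebesgue S w)"

definition weight_of :: "(real ^ 'n \<Rightarrow> real) \<Rightarrow> (real ^ 'n) set \<Rightarrow> ennreal" where
  "weight_of w E = (\<integral>\<^sup>+x\<in>E. ennreal (w x) \<partial>lebesgue)"

text \<open>
  The (quasi-)norms take the modulus of a function as an \<^typ>\<open>ennreal\<close>-valued argument, because the
  maximal truncation may attain the value \<open>\<infinity>\<close>.
\<close>

definition Lp_norm :: "real \<Rightarrow> (real ^ 'n \<Rightarrow> real) \<Rightarrow> (real ^ 'n \<Rightarrow> ennreal) \<Rightarrow> ennreal" where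
  "Lp_norm p w g = ennreal_powr (\<integral>\<^sup>+x. ennreal_powr (g x) p * ennreal (w x) \<partial>lebesgue) (1 / p)"

definition weak_L1_norm :: "(real ^ 'n \<Rightarrow> real) \<Rightarrow> (real ^ 'n \<Rightarrow> ennreal) \<Rightarrow> ennreal" where
  "weak_L1_norm w g = (SUP \<alpha>\<in>{0::real<..}. ennreal \<alpha> * weight_of w {x. g x > ennreal \<alpha>})"

definition modulus :: "('a \<Rightarrow> 'b::real_normed_vector) \<Rightarrow> 'a \<Rightarrow> ennreal" where
  "modulus f x = ennreal (norm (f x))"

definition Lp_space :: "real \<Rightarrow> (real ^ 'n \<Rightarrow> real) \<Rightarrow> (real ^ 'n \<Rightarrow> complex) set" where
  "Lp_space p w = {f. f \<in> borel_measurable lebesgue \<and> Lp_norm p w (modulus f) < \<infinity>}"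

definition cubes :: "(real ^ 'n) set set" where
  "cubes = {cbox a (\<chi> i. a $ i + h) | a h. 0 < h}"

definition HL_maximal :: "(real ^ 'n \<Rightarrow> real) \<Rightarrow> real ^ 'n \<Rightarrow> ennreal" where
  "HL_maximal g x =
     (SUP Q\<in>{Q \<in> cubes. x \<in> Q}. (\<integral>\<^sup>+y\<in>Q. modulus g y \<partial>lebesgue) / emeasure lebesgue Q)"

definition A1_bound :: "(real ^ 'n \<Rightarrow> real) \<Rightarrow> real \<Rightarrow> bool" where
  "A1_bound w c \<longleftrightarrow> 0 < c \<and> (AE x in lebesgue. HL_maximal w x \<le> ennreal (c * w x))"

definition A1_weight :: "(real ^ 'n \<Rightarrow> real) \<Rightarrow> bool" where
  "A1_weight w \<longleftrightarrow> weight w \<and> (\<exists>c. A1_bound w c)"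

text \<open>
  The infimum is attained unless \<open>w\<close> vanishes almost everywhere, in which case it is \<open>0\<close>.
\<close>

definition A1_const :: "(real ^ 'n \<Rightarrow> real) \<Rightarrow> real" where
  "A1_const w = Inf {c. A1_bound w c}"

definition Ainf_char :: "(real ^ 'n \<Rightarrow> real) \<Rightarrow> ennreal" where
  "Ainf_char w =
     (SUP Q\<in>cubes. (\<integral>\<^sup>+x\<in>Q. HL_maximal (\<lambda>y. indicator Q y * w y) x \<partial>lebesgue) / weight_of w Q)"

text \<open>
  The real value of the characteristic; for an \<open>A\<^sub>1\<close> weight nothing is lost, since
  \<open>Ainf_char w \<le> A1_const w < \<infinity>\<close>.
\<close>

definition Ainf_const :: "(real ^ 'n \<Rightarrow> real) \<Rightarrow> real" where
  "Ainf_const w = enn2real (Ainf_char w)"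

definition standard_kernel :: "(real ^ 'n \<Rightarrow> real ^ 'n \<Rightarrow> complex) \<Rightarrow> bool" where
  "standard_kernel K \<longleftrightarrow>
     (\<exists>c \<delta>. 0 < \<delta> \<and> \<delta> \<le> 1 \<and>
        (\<forall>x y. x \<noteq> y \<longrightarrow> norm (K x y) \<le> c / norm (x - y) ^ CARD('n)) \<and>
        (\<forall>x x' y. norm (x - x') < norm (x - y) / 2 \<longrightarrow>
           norm (K x y - K x' y) + norm (K y x - K y x')
             \<le> c * norm (x - x') powr \<delta> / norm (x - y) powr (real CARD('n) + \<delta>)))"

text \<open>
  Operators on \<open>L\<^sup>2\<close> act on functions; identities between their values are required almost
  everywhere. Linearity and boundedness make them well defined on classes modulo null sets.
\<close>

abbreviation L2 :: "(real ^ 'n \<Rightarrow> complex) set" where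
  "L2 \<equiv> Lp_space 2 (\<lambda>_. 1)"

definition L2_bounded_operator ::
    "((real ^ 'n \<Rightarrow> complex) \<Rightarrow> (real ^ 'n \<Rightarrow> complex)) \<Rightarrow> bool" where
  "L2_bounded_operator T \<longleftrightarrow>
     (\<forall>f\<in>L2. \<forall>g\<in>L2. AE x in lebesgue. T (\<lambda>y. f y + g y) x = T f x + T g x) \<and>
     (\<forall>a. \<forall>f\<in>L2. AE x in lebesgue. T (\<lambda>y. a * f y) x = a * T f x) \<and>
     (\<forall>f\<in>L2. T f \<in> L2) \<and>
     (\<exists>B\<ge>0. \<forall>f\<in>L2.
        Lp_norm 2 (\<lambda>_. 1) (modulus (T f)) \<le> ennreal B * Lp_norm 2 (\<lambda>_. 1) (modulus f))"

definition CZ_operator ::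
    "((real ^ 'n \<Rightarrow> complex) \<Rightarrow> (real ^ 'n \<Rightarrow> complex)) \<Rightarrow>
     (real ^ 'n \<Rightarrow> real ^ 'n \<Rightarrow> complex) \<Rightarrow> bool" where
  "CZ_operator T K \<longleftrightarrow>
     L2_bounded_operator T \<and> standard_kernel K \<and>
     (\<forall>f\<in>L2. AE x in lebesgue.
        x \<notin> closure {y. f y \<noteq> 0} \<longrightarrow> T f x = (LINT y|lebesgue. K x y * f y))"

definition max_truncation ::
    "(real ^ 'n \<Rightarrow> real ^ 'n \<Rightarrow> complex) \<Rightarrow> (real ^ 'n \<Rightarrow> complex) \<Rightarrow> real ^ 'n \<Rightarrow> ennreal" where
  "max_truncation K f x =
     (SUP (\<epsilon>, \<nu>)\<in>{(\<epsilon>, \<nu>). 0 < \<epsilon> \<and> \<epsilon> < \<nu>}.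
        ennreal (norm (LINT y:{y. \<epsilon> < norm (x - y) \<and> norm (x - y) < \<nu>}|lebesgue. K x y * f y)))"

end

theory Submission
  imports Defs
begin

text \<open>
  The operator is reduced to positive sparse operators. A Cotlar-type inequality bounds the maximal
  truncation by maximal functions of \<open>|f|\<close>, \<open>|f|\<^sup>2\<close> and \<open>|T f|\<^sup>2\<close>; a Calderon-Zygmund decomposition
  turns this into a weak \<open>(1,1)\<close> bound. Hence in every dyadic cube \<open>Q\<close> the truncations of
  \<open>f 1\<^bsub>3Q\<^esub>\<close> exceed a multiple of the average of \<open>|f|\<close> over \<open>3Q\<close> only on stopping cubes that fill at
  most half of \<open>Q\<close>, and iterating inside these cubes gives a pointwise bound by
  \<open>\<Sum>\<^sub>Q \<langle>|f|\<rangle>\<^bsub>3Q\<^esub> 1\<^sub>Q\<close> over a sparse family.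

  Since \<open>\<langle>w\<rangle>\<^bsub>3Q\<^esub> \<le> ||w||\<^bsub>A\<^sub>1\<^esub> w\<close> on \<open>3Q\<close>, each application of the \<open>A\<^sub>1\<close> condition costs one factor
  \<open>||w||\<^bsub>A\<^sub>1\<^esub>\<close>, whereas the definition of \<open>||w||\<^bsub>A\<^sub>\<infinity>\<^esub>\<close> yields the Carleson condition
  \<open>\<Sum>\<^bsub>Q \<subseteq> R\<^esub> w(Q) \<le> 2 ||w||\<^bsub>A\<^sub>\<infinity>\<^esub> w(R)\<close>. For \<open>p > 1\<close> the sparse sum is paired with its own
  power \<open>p - 1\<close> and split by Young's inequality into \<open>\<Sum>\<^sub>Q w(Q) \<langle>|f|\<rangle>\<^bsub>3Q\<^esub>\<^sup>p\<close>, which uses \<open>A\<^sub>1\<close>, and a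
  dual sum, which uses the Carleson embedding. For \<open>p = 1\<close> only about \<open>log ||w||\<^bsub>A\<^sub>\<infinity>\<^esub>\<close> levels of the
  averages have to be estimated separately.
\<close>

subsection \<open>Dyadic cubes\<close>

text \<open>Truncations are dominated only up to the radius \<open>2 powi k0\<close>, where
  \<open>f\<close> may be replaced by its restriction to a tripled cube of generation
  \<open>k0\<close>. Families for different \<open>k0\<close> are unrelated, so the maximal
  truncation is bounded by a limit inferior of sparse sums, and all weighted estimates are proved
  for finite families, with constants that depend neither on the family nor on \<open>k0\<close>.

  Keeping the product \<open>p * p'\<close> linear and the two characteristics apart dictates the
  split. The factor \<open>p'\<close> comes from interpolating averages of \<open>f\<close> in
  Lebesgue measure, with the power \<open>1 / p\<close> of the weight moved into the function; the
  factor \<open>p\<close> comes from interpolating, at exponent \<open>p'\<close>, averages in the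
  measure given by \<open>w\<close>. At the endpoint the \<open>A\<^sub>1\<close> constant may enter
  only once for a whole level of averages, so the weights of all its cubes are summed together.

  Exceptional sets of maximal operators are carried as measurable supersets. Their open enlargements
  are cut into maximal dyadic cubes, both for the Calderon-Zygmund decomposition and for the
  stopping cubes.\<close>

text \<open>
  A pair \<open>(k, v)\<close> encodes the half-open dyadic cube \<open>dset (k, v) = 2\<^sup>k (v + [0, 1)\<^sup>n)\<close>;
  \<open>ccube\<close> is its closure and \<open>tri\<close> the concentric closed cube of three times the side length.
\<close>

type_synonym 'n dyad = "int \<times> (int ^ 'n)"

definition side :: "'n::finite dyad \<Rightarrow> real" where
  "side q = 2 powi (fst q)"

definition corner :: "'n::finite dyad \<Rightarrow> real ^ 'n" where
  "corner q = (\<chi> i. side q * real_of_int (snd q $ i))"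

definition dset :: "'n::finite dyad \<Rightarrow> (real ^ 'n) set" where
  "dset q = {y. \<forall>i. \<lfloor>y $ i / side q\<rfloor> = snd q $ i}"

definition dyad_at :: "int \<Rightarrow> real ^ 'n \<Rightarrow> 'n::finite dyad" where
  "dyad_at k y = (k, \<chi> i. \<lfloor>y $ i / 2 powi k\<rfloor>)"

definition ccube :: "'n::finite dyad \<Rightarrow> (real ^ 'n) set" where
  "ccube q = cbox (corner q) (\<chi> i. corner q $ i + side q)"

text \<open>The upper corner repeats the lower one so that the box literally has the shape
  \<open>cbox a (\<chi> i. a $ i + h)\<close> of \<open>cubes\<close>, with
  \<open>h = 3 * side q\<close>.\<close>

definition tri :: "'n::finite dyad \<Rightarrow> (real ^ 'n) set" where
  "tri q = cbox (\<chi> i. corner q $ i - side q) (\<chi> i. (\<chi> i. corner q $ i - side q) $ i + 3 * side q)"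

definition parent :: "'n::finite dyad \<Rightarrow> 'n dyad" where
  "parent q = dyad_at (fst q + 1) (corner q)"

lemma side_pos [simp]: "0 < side q"
  by (simp add: side_def)

lemma side_nonneg [simp]: "0 \<le> side q"
  using side_pos less_imp_le by blast

lemma fst_dyad_at [simp]: "fst (dyad_at k y) = k"
  by (simp add: dyad_at_def)

lemma side_dyad_at [simp]: "side (dyad_at k y) = 2 powi k"
  by (simp add: side_def)

lemma mem_dset_iff: "y \<in> dset q \<longleftrightarrow> dyad_at (fst q) y = q"
  by (auto simp: dset_def dyad_at_def side_def vec_eq_iff prod_eq_iff)

lemma mem_dset_dyad_at [simp]: "y \<in> dset (dyad_at k y)"
  by (simp add: mem_dset_iff)

lemma dset_eq_corner: "dset q = {y. \<forall>i. corner q $ i \<le> y $ i \<and> y $ i < corner q $ i + side q}"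
proof -
  have "\<lfloor>t / side q\<rfloor> = m \<longleftrightarrow> side q * real_of_int m \<le> t \<and> t < side q * real_of_int m + side q" for t m
    by (simp add: floor_eq_iff pos_le_divide_eq pos_divide_less_eq distrib_left mult.commute[of _ "side q"])
  then show ?thesis by (auto simp: dset_def corner_def)
qed

lemma corner_in_dset [simp]: "corner q \<in> dset q"
  by (simp add: dset_eq_corner)

text \<open>Floors and integer \<open>div\<close> both round downwards, for negative numbers too.
  Hence the index at scale \<open>l\<close> is a function of the index at scale \<open>k\<close>,
  and the nesting of dyadic cubes is a restatement of this.\<close>

lemma dyad_at_coarsen:
  fixes x y :: "real ^ 'n"
  assumes "k \<le> l" "dyad_at k x = dyad_at k y"
  shows "dyad_at l x = dyad_at l y"
proof -
  have pw: "(2::real) powi l = 2 powi k * real_of_int (2 ^ nat (l - k))"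
  proof -
    have "(2::real) powi l = 2 powi (k + int (nat (l - k)))" using assms(1) by simp
    also have "\<dots> = 2 powi k * 2 powi int (nat (l - k))" by (rule power_int_add) simp
    also have "2 powi int (nat (l - k)) = real_of_int (2 ^ nat (l - k))"
      unfolding power_int_of_nat by simp
    finally show ?thesis .
  qed
  have "\<lfloor>t / 2 powi l\<rfloor> = \<lfloor>t / 2 powi k\<rfloor> div (2 ^ nat (l - k))" for t :: real
    unfolding pw divide_divide_eq_left[symmetric] by (rule floor_divide_real_eq_div) simp
  then show ?thesis using assms(2) by (auto simp: dyad_at_def vec_eq_iff)
qed

lemma dset_nested:
  assumes "fst q \<le> fst r"
  shows "dset q \<subseteq> dset r \<or> dset q \<inter> dset r = {}"
proof (cases "dset q \<inter> dset r = {}")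
  case False
  then obtain y where y: "dyad_at (fst q) y = q" "dyad_at (fst r) y = r"
    by (auto simp: mem_dset_iff)
  have "dset q \<subseteq> dset r"
  proof
    fix z assume "z \<in> dset q"
    then have "dyad_at (fst q) z = dyad_at (fst q) y" using y by (simp add: mem_dset_iff)
    then have "dyad_at (fst r) z = dyad_at (fst r) y" using dyad_at_coarsen[OF assms] by blast
    then show "z \<in> dset r" using y by (simp add: mem_dset_iff)
  qed
  then show ?thesis by blast
qed simp

lemma dset_same_gen:
  "fst q = fst r \<Longrightarrow> y \<in> dset q \<Longrightarrow> y \<in> dset r \<Longrightarrow> q = r"
  by (metis mem_dset_iff)

lemma fst_parent [simp]: "fst (parent q) = fst q + 1"
  by (simp add: parent_def)

lemma side_parent [simp]: "side (parent q) = 2 * side q"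
  by (simp add: parent_def side_def power_int_add)

lemma parent_eq: "x \<in> dset q \<Longrightarrow> parent q = dyad_at (fst q + 1) x"
  unfolding parent_def
  by (rule dyad_at_coarsen[of "fst q"]) (use corner_in_dset[of q] in \<open>auto simp: mem_dset_iff\<close>)

lemma dset_subset_parent: "dset q \<subseteq> dset (parent q)"
  by (metis parent_eq mem_dset_dyad_at subsetI)

lemma dset_subset_ccube: "dset q \<subseteq> ccube q"
  by (auto simp: dset_eq_corner ccube_def mem_box_cart less_imp_le)

lemma ccube_subset_tri: "ccube q \<subseteq> tri q"
proof
  fix x assume "x \<in> ccube q"
  then have "corner q $ i \<le> x $ i \<and> x $ i \<le> corner q $ i + side q" for i
    by (simp add: ccube_def mem_box_cart)
  then have "corner q $ i - side q \<le> x $ i \<and> x $ i \<le> corner q $ i - side q + 3 * side q" for i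
    using side_pos[of q] by (smt (verit))
  then show "x \<in> tri q" by (simp add: tri_def mem_box_cart)
qed

lemma dset_subset_tri: "dset q \<subseteq> tri q"
  using dset_subset_ccube ccube_subset_tri by blast

lemma ccube_in_cubes: "ccube q \<in> cubes"
  unfolding ccube_def cubes_def using side_pos[of q] by blast

lemma tri_in_cubes: "tri q \<in> cubes"
  unfolding cubes_def tri_def using side_pos[of q]
  by (intro CollectI exI[of _ "\<chi> i. corner q $ i - side q"] exI[of _ "3 * side q"]) auto

lemma emeasure_cube:
  fixes a :: "real ^ 'n"
  assumes "0 \<le> h"
  shows "emeasure lebesgue (cbox a (\<chi> i. a $ i + h)) = ennreal (h ^ CARD('n))"
proof -
  have "cbox a (\<chi> i. a $ i + h) \<noteq> {}"
    using assms by (auto simp: interval_ne_empty_cart)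
  then have "measure lebesgue (cbox a (\<chi> i. a $ i + h)) = h ^ CARD('n)"
    using content_cbox_cart[of a "\<chi> i. a $ i + h"] by simp
  moreover have "emeasure lebesgue (cbox a (\<chi> i. a $ i + h)) = ennreal (measure lebesgue (cbox a (\<chi> i. a $ i + h)))"
    by (intro emeasure_eq_ennreal_measure) (simp add: emeasure_lborel_cbox_eq)
  ultimately show ?thesis by simp
qed

lemma emeasure_ccube: "emeasure lebesgue (ccube (q :: 'n::finite dyad)) = ennreal (side q ^ CARD('n))"
  unfolding ccube_def by (rule emeasure_cube) simp

lemma emeasure_tri: "emeasure lebesgue (tri (q :: 'n::finite dyad)) = ennreal ((3 * side q) ^ CARD('n))"
  unfolding tri_def by (rule emeasure_cube) simp

lemma box_subset_dset: "box (corner q) (\<chi> i. corner q $ i + side q) \<subseteq> dset q"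
  by (auto simp: dset_eq_corner mem_box_cart less_imp_le)

lemma ccube_diff_null: "ccube q - box (corner q) (\<chi> i. corner q $ i + side q) \<in> null_sets lebesgue"
  unfolding ccube_def using negligible_frontier_interval by (simp flip: negligible_iff_null_sets)

lemma ccube_diff_dset_null: "ccube q - dset q \<in> null_sets lebesgue"
  by (rule null_sets_completion_subset[OF _ ccube_diff_null]) (use box_subset_dset[of q] in blast)

lemma dset_sets_lebesgue [measurable, simp]: "dset q \<in> sets lebesgue"
proof -
  have "dset q = ccube q - (ccube q - dset q)" using dset_subset_ccube[of q] by blast
  then show ?thesis using ccube_diff_dset_null[of q]
    by (metis ccube_def lmeasurable_cbox fmeasurableD null_setsD2 sets.Diff)
qed

lemma ccube_sets_lebesgue [measurable, simp]: "ccube q \<in> sets lebesgue"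
  by (simp add: ccube_def)

lemma tri_sets_lebesgue [measurable, simp]: "tri q \<in> sets lebesgue"
  by (simp add: tri_def)

lemma compact_tri [simp]: "compact (tri q)"
  by (simp add: tri_def compact_cbox)

lemma compact_ccube [simp]: "compact (ccube q)"
  by (simp add: ccube_def compact_cbox)

lemma AE_indicator_ccube: "AE x in lebesgue. indicator (ccube q) x = (indicator (dset q) x :: 'a::zero_neq_one)"
proof (rule AE_I')
  show "ccube q - dset q \<in> null_sets lebesgue" by (rule ccube_diff_dset_null)
qed (use dset_subset_ccube[of q] in \<open>auto split: split_indicator\<close>)

lemma emeasure_dset: "emeasure lebesgue (dset (q :: 'n::finite dyad)) = ennreal (side q ^ CARD('n))"
proof -
  have "emeasure lebesgue (ccube q) = emeasure lebesgue (dset q \<union> (ccube q - dset q))"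
    using dset_subset_ccube[of q] by (metis Un_Diff_cancel sup.absorb2)
  also have "\<dots> = emeasure lebesgue (dset q)"
    using ccube_diff_dset_null[of q] by (intro emeasure_Un_null_set) simp_all
  finally show ?thesis by (simp add: emeasure_ccube)
qed

text \<open>The comparison through the l1 norm costs a factor \<open>CARD('n)\<close>; it is the
  source of bases such as \<open>4 * real CARD('n)\<close> in the constants below.\<close>

lemma norm_le_card_sup:
  fixes x :: "real ^ 'n"
  assumes "\<And>i. \<bar>x $ i\<bar> \<le> (r :: real)"
  shows "norm x \<le> real CARD('n) * r"
proof -
  have "norm x \<le> (\<Sum>i\<in>UNIV. \<bar>x $ i\<bar>)" by (rule norm_le_l1_cart)
  also have "\<dots> \<le> CARD('n) * r" using sum_bounded_above[of UNIV "\<lambda>i. \<bar>x $ i\<bar>" r] assms by simp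
  finally show ?thesis .
qed

lemma dset_diam:
  fixes x y :: "real ^ 'n"
  assumes "x \<in> dset q" "y \<in> dset q"
  shows "norm (x - y) \<le> CARD('n) * side q"
proof (rule norm_le_card_sup)
  fix i show "\<bar>(x - y) $ i\<bar> \<le> side q"
  proof -
    have "corner q $ i \<le> z $ i \<and> z $ i < corner q $ i + side q" if "z \<in> dset q" for z
      using that by (simp add: dset_eq_corner)
    from this[OF assms(1)] this[OF assms(2)] show ?thesis by simp linarith
  qed
qed

lemma tri_diam:
  fixes x y :: "real ^ 'n"
  assumes "x \<in> tri q" "y \<in> tri q"
  shows "norm (x - y) \<le> CARD('n) * (3 * side q)"
proof (rule norm_le_card_sup)
  fix i show "\<bar>(x - y) $ i\<bar> \<le> 3 * side q"
  proof -
    have "corner q $ i - side q \<le> z $ i \<and> z $ i \<le> corner q $ i - side q + 3 * side q" if "z \<in> tri q" for z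
      using that by (simp add: tri_def mem_box_cart)
    from this[OF assms(1)] this[OF assms(2)] show ?thesis by simp linarith
  qed
qed

text \<open>Read in both directions: truncations of radius at most \<open>side q\<close> centred in
  \<open>dset q\<close> see only \<open>tri q\<close>, and everything off \<open>tri q\<close> is
  farther away than \<open>side q\<close>, so that the kernel is bounded there.\<close>

lemma near_dset_in_tri:
  fixes x y :: "real ^ 'n"
  assumes "x \<in> dset q" "norm (x - y) \<le> side q"
  shows "y \<in> tri q"
proof -
  have "corner q $ i - side q \<le> y $ i \<and> y $ i \<le> corner q $ i - side q + 3 * side q" for i
  proof -
    have "\<bar>(x - y) $ i\<bar> \<le> side q" using component_le_norm_cart[of "x - y" i] assms(2) by linarith
    moreover have "corner q $ i \<le> x $ i \<and> x $ i < corner q $ i + side q"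
      using assms(1) by (simp add: dset_eq_corner)
    ultimately show ?thesis by simp linarith
  qed
  then show ?thesis by (simp add: tri_def mem_box_cart)
qed

section \<open>Maximal dyadic cubes of an open set\<close>

lemma small_dyad_subset:
  fixes x :: "real ^ 'n"
  assumes "open U" "x \<in> U"
  shows "\<exists>k. dset (dyad_at k x) \<subseteq> U"
proof -
  obtain e where e: "e > 0" "ball x e \<subseteq> U" using assms openE by blast
  obtain m :: nat where m: "CARD('n) / e < 2 ^ m" using real_arch_pow[of 2] by auto
  have "dset (dyad_at (- int m) x) \<subseteq> ball x e"
  proof
    fix y assume "y \<in> dset (dyad_at (- int m) x)"
    then have "norm (x - y) \<le> CARD('n) * 2 powi (- int m)"
      using dset_diam[of x "dyad_at (- int m) x" y] by simp
    also have "\<dots> < e" using m e(1) by (simp add: power_int_minus field_simps)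
    finally show "y \<in> ball x e" by (simp add: dist_norm)
  qed
  then show ?thesis using e by blast
qed

text \<open>The maximal dyadic cubes contained in \<open>U\<close>. They may touch the complement of
  \<open>U\<close>; the parent, which sticks out of \<open>U\<close>, bounds the distance to the
  complement from above.\<close>

definition whitney :: "(real ^ 'n::finite) set \<Rightarrow> 'n dyad set" where
  "whitney U = {q. dset q \<subseteq> U \<and> \<not> dset (parent q) \<subseteq> U}"

lemma whitney_subset: "q \<in> whitney U \<Longrightarrow> dset q \<subseteq> U"
  by (simp add: whitney_def)

text \<open>If two of the cubes met at different generations, the parent of the smaller one would
  lie in the larger one and hence in \<open>U\<close>.\<close>

lemma whitney_disjoint:
  assumes "q \<in> whitney U" "r \<in> whitney U" "q \<noteq> r"
  shows "dset q \<inter> dset r = {}"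
proof -
  have aux: False if qr: "q \<in> whitney U" "r \<in> whitney U" "q \<noteq> r" "fst q \<le> fst r" "y \<in> dset q" "y \<in> dset r"
    for q r :: "'a dyad" and y
  proof -
    have "fst q \<noteq> fst r" using qr dset_same_gen by blast
    then have "fst (parent q) \<le> fst r" using qr(4) by simp
    moreover have "y \<in> dset (parent q)" using qr(5) dset_subset_parent by blast
    ultimately have "dset (parent q) \<subseteq> dset r" using dset_nested[of "parent q" r] qr(6) by blast
    then show False using qr by (auto simp: whitney_def)
  qed
  show ?thesis
  proof (rule ccontr)
    assume "dset q \<inter> dset r \<noteq> {}"
    then obtain y where "y \<in> dset q" "y \<in> dset r" by blast
    then show False using aux[of q r y] aux[of r q y] assms by (metis linear)
  qed
qed

text \<open>Openness gives some dyadic cube around \<open>x\<close> inside \<open>U\<close>. Finite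
  measure bounds the generation of all such cubes, because \<open>k < 2 ^ k\<close> and the latter
  is at most the volume of a cube of generation \<open>k > 0\<close>. Hence a largest one
  exists.\<close>

lemma whitney_cover:
  fixes U :: "(real ^ 'n) set"
  assumes "open U" "emeasure lebesgue U < \<infinity>" "x \<in> U"
  obtains q where "q \<in> whitney U" "x \<in> dset q"
proof -
  obtain B where B: "emeasure lebesgue U = ennreal B" "0 \<le> B"
    using assms(2) by (metis ennreal_cases infinity_ennreal_def less_irrefl)
  let ?P = "\<lambda>k. dset (dyad_at k x) \<subseteq> U"
  obtain k0 where k0: "?P k0" using small_dyad_subset[OF assms(1,3)] by blast
  have bd: "real_of_int k \<le> B + 1" if "?P k" for k
  proof (cases "k \<le> 0")
    case False
    then obtain m where m: "k = int m" "m > 0" by (metis not_le zero_less_imp_eq_int)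
    have "emeasure lebesgue (dset (dyad_at k x)) \<le> emeasure lebesgue U"
      using that assms(1) by (intro emeasure_mono) auto
    then have "(2 ^ m) ^ CARD('n) \<le> B" using B by (simp add: emeasure_dset m)
    moreover have "(2::real) ^ m \<le> (2 ^ m) ^ CARD('n)" by (rule self_le_power) auto
    moreover have "real m < 2 ^ m" by (rule of_nat_less_two_power)
    ultimately have "real m \<le> B + 1" by (meson add_increasing2 less_imp_le order_trans zero_le_one)
    then show ?thesis by (simp add: m(1))
  qed (use B in auto)
  \<comment> \<open>Generations are counted upwards from \<open>k0\<close>, so that the largest
    admissible one is the maximum of a finite set of naturals.\<close>
  define S where "S = {m::nat. ?P (k0 + int m)}"
  have "S \<subseteq> {.. nat \<lceil>B + 1 + \<bar>real_of_int k0\<bar>\<rceil>}"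
  proof
    fix m assume "m \<in> S"
    then have "real_of_int (k0 + int m) \<le> B + 1" unfolding S_def by (intro bd) simp
    then show "m \<in> {.. nat \<lceil>B + 1 + \<bar>real_of_int k0\<bar>\<rceil>}" by simp linarith
  qed
  then have fin: "finite S" by (rule finite_subset) simp
  moreover have "0 \<in> S" using k0 by (simp add: S_def)
  ultimately have mx: "Max S \<in> S" by (intro Max_in) auto
  have mx': "Suc (Max S) \<notin> S" using Max_ge[OF fin, of "Suc (Max S)"] by auto
  define q where "q = dyad_at (k0 + int (Max S)) x"
  have "x \<in> dset q" by (simp add: q_def)
  moreover have "q \<in> whitney U"
    using mx mx' parent_eq[OF \<open>x \<in> dset q\<close>] by (simp add: whitney_def q_def S_def add_ac)
  ultimately show ?thesis using that by blast
qed

lemma whitney_Union: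
  assumes "open U" "emeasure lebesgue U < \<infinity>"
  shows "(\<Union>q\<in>whitney U. dset q) = U"
proof
  show "U \<subseteq> (\<Union>q\<in>whitney U. dset q)"
  proof
    fix x assume "x \<in> U"
    then obtain q where "q \<in> whitney U" "x \<in> dset q" by (rule whitney_cover[OF assms])
    then show "x \<in> (\<Union>q\<in>whitney U. dset q)" by (rule UN_I)
  qed
qed (auto simp: whitney_def)

text \<open>The point \<open>z\<close> of the parent outside \<open>U\<close> is the nearby good
  point from which every estimate on the cube is transferred.\<close>

lemma whitney_near:
  fixes U :: "(real ^ 'n) set"
  assumes "q \<in> whitney U"
  obtains z where "z \<in> dset (parent q)" "z \<notin> U" "\<And>x. x \<in> dset q \<Longrightarrow> norm (x - z) \<le> 2 * CARD('n) * side q"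
proof -
  obtain z where z: "z \<in> dset (parent q)" "z \<notin> U" using assms unfolding whitney_def by blast
  have "norm (x - z) \<le> 2 * CARD('n) * side q" if "x \<in> dset q" for x
    using dset_diam[of x "parent q" z] that z(1) dset_subset_parent[of q] by (auto simp: mult_ac)
  with z show ?thesis by (rule that)
qed

subsection \<open>Maximal inequalities\<close>

lemma ball_sets_lebesgue [measurable, simp]: "ball (x :: 'a::euclidean_space) r \<in> sets lebesgue"
  by (simp add: fmeasurableD)

text \<open>Countable sums are written as integrals over counting measure, so that sums and
  integrals can be exchanged by Fubini without enumerating the index set.\<close>

lemma emeasure_UN_le_count:
  assumes "countable C" "\<And>c. c \<in> C \<Longrightarrow> B c \<in> sets M"
  shows "emeasure M (\<Union>c\<in>C. B c) \<le> (\<integral>\<^sup>+c. emeasure M (B c) \<partial>count_space C)"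
proof -
  have U: "(\<Union>c\<in>C. B c) \<in> sets M" using assms by (intro sets.countable_UN') auto
  have "emeasure M (\<Union>c\<in>C. B c) = (\<integral>\<^sup>+x. indicator (\<Union>c\<in>C. B c) x \<partial>M)"
    using U by simp
  also have "\<dots> \<le> (\<integral>\<^sup>+x. \<integral>\<^sup>+c. indicator (B c) x \<partial>count_space C \<partial>M)"
  proof (rule nn_integral_mono)
    fix x
    show "indicator (\<Union>c\<in>C. B c) x \<le> (\<integral>\<^sup>+c. indicator (B c) x \<partial>count_space C)"
    proof (cases "x \<in> (\<Union>c\<in>C. B c)")
      case True
      then obtain c where c: "c \<in> C" "x \<in> B c" by blast
      have "indicator (\<Union>c\<in>C. B c) x = (1::ennreal)" using True by simp
      also have "\<dots> = (\<integral>\<^sup>+d. indicator {c} d \<partial>count_space C)" using c by (subst nn_integral_count_space'[of "{c}"]) auto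
      also have "\<dots> \<le> (\<integral>\<^sup>+c. indicator (B c) x \<partial>count_space C)"
        using c by (intro nn_integral_mono) (auto split: split_indicator)
      finally show ?thesis .
    qed simp
  qed
  also have "\<dots> = (\<integral>\<^sup>+c. \<integral>\<^sup>+x. indicator (B c) x \<partial>M \<partial>count_space C)"
    using assms by (intro nn_integral_count_space_nn_integral) auto
  also have "\<dots> = (\<integral>\<^sup>+c. emeasure M (B c) \<partial>count_space C)"
    using assms by (intro nn_integral_cong) auto
  finally show ?thesis .
qed

lemma nn_integral_disjoint_le:
  assumes C: "countable C" "\<And>c. c \<in> C \<Longrightarrow> B c \<in> sets M"
    and disj: "\<And>c d. c \<in> C \<Longrightarrow> d \<in> C \<Longrightarrow> c \<noteq> d \<Longrightarrow> B c \<inter> B d = {}"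
    and g: "g \<in> borel_measurable M"
  shows "(\<integral>\<^sup>+c. (\<integral>\<^sup>+x. g x * indicator (B c) x \<partial>M) \<partial>count_space C) = (\<integral>\<^sup>+x. g x * indicator (\<Union>c\<in>C. B c) x \<partial>M)"
proof -
  have "(\<integral>\<^sup>+c. (\<integral>\<^sup>+x. g x * indicator (B c) x \<partial>M) \<partial>count_space C) = (\<integral>\<^sup>+x. (\<integral>\<^sup>+c. g x * indicator (B c) x \<partial>count_space C) \<partial>M)"
    using C g by (intro nn_integral_count_space_nn_integral[symmetric]) auto
  also have "\<dots> = (\<integral>\<^sup>+x. g x * indicator (\<Union>c\<in>C. B c) x \<partial>M)"
  proof (rule nn_integral_cong)
    fix x
    show "(\<integral>\<^sup>+c. g x * indicator (B c) x \<partial>count_space C) = g x * indicator (\<Union>c\<in>C. B c) x"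
    proof (cases "x \<in> (\<Union>c\<in>C. B c)")
      case True
      then obtain c where c: "c \<in> C" "x \<in> B c" by blast
      have "(\<integral>\<^sup>+c. g x * indicator (B c) x \<partial>count_space C) = (\<Sum>d\<in>{c}. g x * indicator (B d) x)"
      proof (rule nn_integral_count_space')
        fix d assume "d \<in> C" "d \<notin> {c}"
        then have "x \<notin> B d" using disj[of c d] c by blast
        then show "g x * indicator (B d) x = 0" by simp
      qed (use c in auto)
      then show ?thesis using True c by simp
    next
      case False
      then have "(\<integral>\<^sup>+c. g x * indicator (B c) x \<partial>count_space C) = (\<integral>\<^sup>+c. 0 \<partial>count_space C)"
        by (intro nn_integral_cong) auto
      then show ?thesis using False by simp
    qed
  qed
  finally show ?thesis .
qed

lemma emeasure_cball_le:
  fixes x :: "real ^ 'n"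
  assumes "0 \<le> r"
  shows "emeasure lebesgue (cball x r) \<le> ennreal ((2 * r) ^ CARD('n))"
proof -
  have "cball x r \<subseteq> cbox (\<chi> i. x $ i - r) (\<chi> i. (\<chi> i. x $ i - r) $ i + 2 * r)"
  proof
    fix y assume "y \<in> cball x r"
    then have "\<bar>(x - y) $ i\<bar> \<le> r" for i using component_le_norm_cart[of "x - y" i] by (simp add: dist_norm)
    then have "x $ i - r \<le> y $ i \<and> y $ i \<le> x $ i - r + 2 * r" for i by (simp add: abs_le_iff) (smt (verit))
    then show "y \<in> cbox (\<chi> i. x $ i - r) (\<chi> i. (\<chi> i. x $ i - r) $ i + 2 * r)" by (simp add: mem_box_cart)
  qed
  then have "emeasure lebesgue (cball x r) \<le> emeasure lebesgue (cbox (\<chi> i. x $ i - r) (\<chi> i. (\<chi> i. x $ i - r) $ i + 2 * r))"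
    by (intro emeasure_mono) auto
  also have "\<dots> = ennreal ((2 * r) ^ CARD('n))" using assms by (intro emeasure_cube) simp
  finally show ?thesis .
qed

lemma emeasure_ball_le:
  fixes x :: "real ^ 'n"
  assumes "0 \<le> r"
  shows "emeasure lebesgue (ball x r) \<le> ennreal ((2 * r) ^ CARD('n))"
  using emeasure_mono[of "ball x r" "cball x r" lebesgue] emeasure_cball_le[OF assms, of x]
  by (meson ball_subset_cball lmeasurable_cball fmeasurableD order_trans)

text \<open>Up to the volume of the unit ball, \<open>growth g x A\<close> says that the centred
  Hardy-Littlewood maximal function of \<open>g\<close> at \<open>x\<close> is at most
  \<open>A\<close>.\<close>

definition growth :: "(real ^ 'n \<Rightarrow> ennreal) \<Rightarrow> real ^ 'n \<Rightarrow> real \<Rightarrow> bool" where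
  "growth g x A \<longleftrightarrow> (\<forall>r>0. (\<integral>\<^sup>+y\<in>ball x r. g y \<partial>lebesgue) \<le> ennreal (A * r ^ CARD('n)))"

lemma growthD: "growth (g :: real ^ 'n \<Rightarrow> ennreal) x A \<Longrightarrow> 0 < r \<Longrightarrow> (\<integral>\<^sup>+y\<in>ball x r. g y \<partial>lebesgue) \<le> ennreal (A * r ^ CARD('n))"
  by (simp add: growth_def)

text \<open>The Vitali argument: among the balls that violate the bound a disjoint subfamily is
  chosen whose fivefold enlargements cover everything. A ball of radius \<open>5 * r\<close> lies in
  a cube of side \<open>10 * r\<close>, whence the constant \<open>10 ^ CARD('n)\<close>. The
  measurable set \<open>G\<close> is the union of the enlarged balls.\<close>

lemma growth_weak_type:
  fixes g :: "real ^ 'n \<Rightarrow> ennreal"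
  assumes g [measurable]: "g \<in> borel_measurable lebesgue" and A: "0 < A"
  shows "\<exists>G\<in>sets lebesgue. {x. \<not> growth g x A} \<subseteq> G \<and>
    emeasure lebesgue G \<le> ennreal (10 ^ CARD('n) / A) * (\<integral>\<^sup>+x. g x \<partial>lebesgue)"
proof (cases "(\<integral>\<^sup>+x. g x \<partial>lebesgue) = \<infinity>")
  case True
  have "ennreal (10 ^ CARD('n) / A) \<noteq> 0" using A by (simp add: ennreal_eq_0_iff not_le)
  then have "ennreal (10 ^ CARD('n) / A) * (\<integral>\<^sup>+x. g x \<partial>lebesgue) = \<infinity>"
    unfolding True by (simp add: ennreal_mult_top)
  then show ?thesis by (intro bexI[of _ UNIV]) auto
next
  case False
  then obtain I where I: "(\<integral>\<^sup>+x. g x \<partial>lebesgue) = ennreal I" "0 \<le> I"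
    by (metis ennreal_cases infinity_ennreal_def)
  define K where "K = {c :: (real ^ 'n) \<times> real. 0 < snd c \<and>
     \<not> (\<integral>\<^sup>+y\<in>ball (fst c) (snd c). g y \<partial>lebesgue) \<le> ennreal (A * snd c ^ CARD('n))}"
  have big: "ennreal (A * snd c ^ CARD('n)) \<le> (\<integral>\<^sup>+y\<in>ball (fst c) (snd c). g y \<partial>lebesgue)" "0 < snd c" if "c \<in> K" for c
    using that by (auto simp: K_def not_le less_imp_le)
  \<comment> \<open>The covering lemma requires bounded radii. A violating ball has
    \<open>A * r ^ CARD('n)\<close> at most the total mass \<open>I\<close>, and
    \<open>r \<le> r ^ CARD('n)\<close> once \<open>r > 1\<close>.\<close>
  have rad: "snd c \<le> max 1 (I / A)" if "c \<in> K" for c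
  proof (cases "snd c \<le> 1")
    case False
    have "ennreal (A * snd c ^ CARD('n)) \<le> (\<integral>\<^sup>+y\<in>ball (fst c) (snd c). g y \<partial>lebesgue)" by (rule big[OF that])
    also have "\<dots> \<le> ennreal I" unfolding I(1)[symmetric]
      by (intro nn_integral_mono) (auto split: split_indicator)
    finally have "A * snd c ^ CARD('n) \<le> I" using I(2) by simp
    moreover have "snd c \<le> snd c ^ CARD('n)" using False by (intro self_le_power) auto
    then have "A * snd c \<le> A * snd c ^ CARD('n)" using A by simp
    ultimately have "A * snd c \<le> I" by linarith
    then have "snd c \<le> I / A" using A by (simp add: field_simps)
    then show ?thesis by simp
  qed simp
  obtain C where C: "countable C" "C \<subseteq> K"
      "pairwise (\<lambda>i j. disjnt (cball (fst i) (snd i)) (cball (fst j) (snd j))) C"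
      "(\<Union>i\<in>K. cball (fst i) (snd i)) \<subseteq> (\<Union>i\<in>C. cball (fst i) (5 * snd i))"
    by (rule Vitali_covering_lemma_cballs[of "\<Union>i\<in>K. cball (fst i) (snd i)" fst snd K "max 1 (I / A)"])
       (use rad big(2) in auto)
  define G where "G = (\<Union>i\<in>C. cball (fst i) (5 * snd i))"
  have meas: "G \<in> sets lebesgue" unfolding G_def using C(1) by (intro sets.countable_UN') auto
  have sub: "{x. \<not> growth g x A} \<subseteq> G"
  proof
    fix x assume "x \<in> {x. \<not> growth g x A}"
    then obtain r where r: "0 < r" "\<not> (\<integral>\<^sup>+y\<in>ball x r. g y \<partial>lebesgue) \<le> ennreal (A * r ^ CARD('n))"
      by (auto simp: growth_def)
    then have "(x, r) \<in> K" by (simp add: K_def)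
    moreover have "x \<in> cball (fst (x, r)) (snd (x, r))" using r by simp
    ultimately have "x \<in> (\<Union>i\<in>K. cball (fst i) (snd i))" by blast
    then show "x \<in> G" unfolding G_def using C(4) by blast
  qed
  have "emeasure lebesgue G \<le> (\<integral>\<^sup>+i. emeasure lebesgue (cball (fst i) (5 * snd i)) \<partial>count_space C)"
    unfolding G_def using C(1) by (intro emeasure_UN_le_count) auto
  also have "\<dots> \<le> (\<integral>\<^sup>+i. ennreal (10 ^ CARD('n) / A) * (\<integral>\<^sup>+y. g y * indicator (ball (fst i) (snd i)) y \<partial>lebesgue) \<partial>count_space C)"
  proof (rule nn_integral_mono)
    fix i assume "i \<in> space (count_space C)"
    then have i: "i \<in> K" using C(2) by auto
    have "emeasure lebesgue (cball (fst i) (5 * snd i)) \<le> ennreal ((2 * (5 * snd i)) ^ CARD('n))"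
      using big(2)[OF i] by (intro emeasure_cball_le) simp
    also have "\<dots> = ennreal (10 ^ CARD('n) / A * (A * snd i ^ CARD('n)))"
      using A by (simp add: power_mult_distrib)
    also have "\<dots> = ennreal (10 ^ CARD('n) / A) * ennreal (A * snd i ^ CARD('n))"
      using A by (intro ennreal_mult') simp
    also have "\<dots> \<le> ennreal (10 ^ CARD('n) / A) * (\<integral>\<^sup>+y. g y * indicator (ball (fst i) (snd i)) y \<partial>lebesgue)"
      by (intro mult_left_mono big[OF i]) simp
    finally show "emeasure lebesgue (cball (fst i) (5 * snd i)) \<le> \<dots>" .
  qed
  also have "\<dots> = ennreal (10 ^ CARD('n) / A) * (\<integral>\<^sup>+i. (\<integral>\<^sup>+y. g y * indicator (ball (fst i) (snd i)) y \<partial>lebesgue) \<partial>count_space C)"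
    by (rule nn_integral_cmult) simp
  also have "(\<integral>\<^sup>+i. (\<integral>\<^sup>+y. g y * indicator (ball (fst i) (snd i)) y \<partial>lebesgue) \<partial>count_space C)
      = (\<integral>\<^sup>+x. g x * indicator (\<Union>i\<in>C. ball (fst i) (snd i)) x \<partial>lebesgue)"
  proof (rule nn_integral_disjoint_le[OF C(1)])
    fix c d assume "c \<in> C" "d \<in> C" "c \<noteq> d"
    then have "disjnt (cball (fst c) (snd c)) (cball (fst d) (snd d))" using C(3) by (auto simp: pairwise_def)
    then show "ball (fst c) (snd c) \<inter> ball (fst d) (snd d) = {}"
      using ball_subset_cball unfolding disjnt_def by fast
  qed auto
  also have "\<dots> \<le> (\<integral>\<^sup>+x. g x \<partial>lebesgue)" by (intro nn_integral_mono) (auto split: split_indicator)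
  finally have "emeasure lebesgue G \<le> ennreal (10 ^ CARD('n) / A) * (\<integral>\<^sup>+x. g x \<partial>lebesgue)"
    by (simp only: mult_left_mono zero_le)
  then show ?thesis using meas sub by blast
qed

text \<open>The sum of the geometric series of ratio \<open>2 powr (- \<delta>)\<close> over dyadic
  annuli; the factor \<open>2 ^ n\<close> compares the outer with the inner radius of one
  annulus.\<close>

definition tailc :: "nat \<Rightarrow> real \<Rightarrow> real" where
  "tailc n \<delta> = 2 ^ n / (1 - 2 powr (- \<delta>))"

lemma tailc_pos: "0 < \<delta> \<Longrightarrow> 0 < tailc n \<delta>"
  by (simp add: tailc_def powr_minus_divide)

lemma dyadic_annulus:
  fixes s \<rho> :: real
  assumes "0 < s" "s \<le> \<rho>"
  obtains j :: nat where "2 ^ j * s \<le> \<rho>" "\<rho> < 2 ^ (Suc j) * s"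
proof -
  obtain m :: nat where m: "\<rho> / s < 2 ^ m" using real_arch_pow[of 2] by auto
  define k where "k = (LEAST k. \<rho> / s < 2 ^ k)"
  have k: "\<rho> / s < 2 ^ k" unfolding k_def by (rule LeastI[of _ m]) (rule m)
  have "k \<noteq> 0"
  proof
    assume "k = 0"
    then have "\<rho> < s" using k assms(1) by simp
    then show False using assms(2) by simp
  qed
  then obtain j where j: "k = Suc j" by (cases k) auto
  have "\<not> \<rho> / s < 2 ^ j" using j not_less_Least[of j "\<lambda>k. \<rho> / s < 2 ^ k"] k_def by simp
  then show ?thesis using k j assms by (intro that[of j]) (auto simp: field_simps)
qed

text \<open>On the annulus between \<open>2 ^ j * s\<close> and \<open>2 ^ Suc j * s\<close> the
  decaying factor is at most \<open>(2 powr (- \<delta>)) ^ j\<close> divided by the volume scale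
  \<open>(2 ^ j * s) ^ CARD('n)\<close>, and the growth hypothesis cancels that volume.\<close>

lemma tail_estimate:
  fixes g :: "real ^ 'n \<Rightarrow> ennreal" and s \<delta> A :: real
  assumes g [measurable]: "g \<in> borel_measurable lebesgue" and s: "0 < s" and \<delta>: "0 < \<delta>" and A: "0 \<le> A"
    and gr: "\<And>r. s \<le> r \<Longrightarrow> (\<integral>\<^sup>+y\<in>ball x r. g y \<partial>lebesgue) \<le> ennreal (A * r ^ CARD('n))"
  shows "(\<integral>\<^sup>+y\<in>{y. s \<le> norm (x - y)}. ennreal (s powr \<delta> / norm (x - y) powr (CARD('n) + \<delta>)) * g y \<partial>lebesgue)
    \<le> ennreal (tailc CARD('n) \<delta> * A)"
proof -
  define q where "q = 2 powr (- \<delta>)"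
  have q: "0 < q" "q < 1" using \<delta> by (auto simp: q_def powr_minus_divide)
  define a where "a j = q ^ j / (2 ^ j * s) ^ CARD('n)" for j :: nat
  have a0: "0 \<le> a j" for j using q s by (simp add: a_def)
  have pt: "ennreal (s powr \<delta> / norm (x - y) powr (CARD('n) + \<delta>)) * g y * indicator {y. s \<le> norm (x - y)} y
     \<le> (\<Sum>j. ennreal (a j) * (g y * indicator (ball x (2 ^ Suc j * s)) y))" for y
  proof (cases "s \<le> norm (x - y)")
    case True
    obtain j where j: "2 ^ j * s \<le> norm (x - y)" "norm (x - y) < 2 ^ Suc j * s"
      using dyadic_annulus[OF s True] by blast
    have "(2 ^ j * s) powr (CARD('n) + \<delta>) \<le> norm (x - y) powr (CARD('n) + \<delta>)"
      using j s \<delta> by (intro powr_mono2) auto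
    then have "s powr \<delta> / norm (x - y) powr (CARD('n) + \<delta>) \<le> s powr \<delta> / (2 ^ j * s) powr (CARD('n) + \<delta>)"
      using s by (intro divide_left_mono mult_pos_pos) (auto intro: less_le_trans)
    also have "\<dots> = a j"
    proof -
      have "(2 ^ j) powr \<delta> = (2 powr \<delta>) ^ j"
        by (simp add: powr_powr mult.commute flip: powr_realpow)
      then show ?thesis
        using s by (simp add: a_def q_def powr_add powr_realpow powr_mult powr_minus_divide power_divide power_mult_distrib)
    qed
    finally have "ennreal (s powr \<delta> / norm (x - y) powr (CARD('n) + \<delta>)) * g y * indicator {y. s \<le> norm (x - y)} y
      \<le> ennreal (a j) * (g y * indicator (ball x (2 ^ Suc j * s)) y)"
      using True j by (simp add: dist_norm mult_right_mono ennreal_leI)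
    also have "\<dots> = (\<Sum>i\<in>{j}. ennreal (a i) * (g y * indicator (ball x (2 ^ Suc i * s)) y))" by simp
    also have "\<dots> \<le> (\<Sum>j. ennreal (a j) * (g y * indicator (ball x (2 ^ Suc j * s)) y))"
      by (intro sum_le_suminf) auto
    finally show ?thesis .
  qed simp
  have "(\<integral>\<^sup>+y\<in>{y. s \<le> norm (x - y)}. ennreal (s powr \<delta> / norm (x - y) powr (CARD('n) + \<delta>)) * g y \<partial>lebesgue)
     \<le> (\<integral>\<^sup>+y. (\<Sum>j. ennreal (a j) * (g y * indicator (ball x (2 ^ Suc j * s)) y)) \<partial>lebesgue)"
    by (intro nn_integral_mono pt)
  also have "\<dots> = (\<Sum>j. \<integral>\<^sup>+y. ennreal (a j) * (g y * indicator (ball x (2 ^ Suc j * s)) y) \<partial>lebesgue)"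
    by (intro nn_integral_suminf) simp
  also have "\<dots> = (\<Sum>j. ennreal (a j) * (\<integral>\<^sup>+y. g y * indicator (ball x (2 ^ Suc j * s)) y \<partial>lebesgue))"
    by (simp add: nn_integral_cmult)
  also have "\<dots> \<le> (\<Sum>j. ennreal (2 ^ CARD('n) * A * q ^ j))"
  proof (intro suminf_le summableI)
    fix j
    have "s * 1 \<le> s * 2 ^ Suc j" using s by (intro mult_left_mono one_le_power) auto
    then have "(\<integral>\<^sup>+y. g y * indicator (ball x (2 ^ Suc j * s)) y \<partial>lebesgue) \<le> ennreal (A * (2 ^ Suc j * s) ^ CARD('n))"
      by (intro gr) (simp add: mult_ac)
    then have "ennreal (a j) * (\<integral>\<^sup>+y. g y * indicator (ball x (2 ^ Suc j * s)) y \<partial>lebesgue)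
       \<le> ennreal (a j) * ennreal (A * (2 ^ Suc j * s) ^ CARD('n))" by (intro mult_left_mono) auto
    also have "\<dots> = ennreal (a j * (A * (2 ^ Suc j * s) ^ CARD('n)))" using a0 by (intro ennreal_mult'[symmetric])
    also have "a j * (A * (2 ^ Suc j * s) ^ CARD('n)) = 2 ^ CARD('n) * A * q ^ j"
      using s by (simp add: a_def power_mult_distrib)
    finally show "ennreal (a j) * (\<integral>\<^sup>+y. g y * indicator (ball x (2 ^ Suc j * s)) y \<partial>lebesgue) \<le> ennreal (2 ^ CARD('n) * A * q ^ j)" .
  qed
  also have "\<dots> = ennreal (\<Sum>j. 2 ^ CARD('n) * A * q ^ j)"
    using q A by (intro suminf_ennreal2) (auto intro!: summable_mult summable_geometric)
  also have "(\<Sum>j. 2 ^ CARD('n) * A * q ^ j) = tailc CARD('n) \<delta> * A"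
    using q by (subst suminf_mult) (auto intro!: summable_geometric simp: suminf_geometric tailc_def q_def)
  finally show ?thesis .
qed

subsection \<open>Truncations of standard kernels\<close>

definition loc_int :: "(real ^ 'n \<Rightarrow> complex) \<Rightarrow> bool" where
  "loc_int f \<longleftrightarrow> (\<forall>x r. set_integrable lebesgue (ball x r) f)"

definition ann :: "real ^ 'n \<Rightarrow> real \<Rightarrow> real \<Rightarrow> (real ^ 'n) set" where
  "ann x e v = {y. e < norm (x - y) \<and> norm (x - y) < v}"

definition tr :: "(real ^ 'n \<Rightarrow> real ^ 'n \<Rightarrow> complex) \<Rightarrow> (real ^ 'n \<Rightarrow> complex) \<Rightarrow> real \<Rightarrow> real \<Rightarrow> real ^ 'n \<Rightarrow> complex" where
  "tr K f e v x = (LINT y:ann x e v|lebesgue. K x y * f y)"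

lemma open_ann [simp]: "open (ann x e v)"
  unfolding ann_def by (intro open_Collect_conj open_Collect_less continuous_intros)

lemma ann_sets [measurable, simp]: "ann x e v \<in> sets lebesgue"
  using lmeasurable_ball by (metis open_ann borel_open sets_completionI_sets sets_lborel)

lemma ann_subset_ball: "ann x e v \<subseteq> ball x v"
  by (auto simp: ann_def dist_norm)

lemma closed_norm_ge [measurable, simp]: "{y :: real ^ 'n. s \<le> norm (x - y)} \<in> sets lebesgue"
proof -
  have "closed {y :: real ^ 'n. s \<le> norm (x - y)}" by (intro closed_Collect_le continuous_intros)
  then show ?thesis by (metis borel_closed sets_completionI_sets sets_lborel)
qed

lemma loc_int_measurable:
  assumes "loc_int f"
  shows "f \<in> borel_measurable lebesgue"
proof (rule borel_measurable_LIMSEQ_metric)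
  show "(\<lambda>x. indicat_real (ball 0 (real m)) x *\<^sub>R f x) \<in> borel_measurable lebesgue" for m
    using assms borel_measurable_integrable unfolding loc_int_def set_integrable_def by blast
  show "(\<lambda>m. indicat_real (ball 0 (real m)) x *\<^sub>R f x) \<longlonglongrightarrow> f x" for x
  proof (rule tendsto_eventually)
    obtain m0 :: nat where "norm x < real m0" using reals_Archimedean2 by blast
    then show "\<forall>\<^sub>F m in sequentially. indicat_real (ball 0 (real m)) x *\<^sub>R f x = f x"
      by (intro eventually_sequentiallyI[of m0]) (auto simp: dist_norm)
  qed
qed

lemma integrable_imp_loc_int: "integrable lebesgue f \<Longrightarrow> loc_int f"
  unfolding loc_int_def set_integrable_def by (intro allI integrable_mult_indicator) auto

lemma loc_int_indicator:
  assumes "loc_int f" "S \<in> sets lebesgue"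
  shows "loc_int (\<lambda>y. indicator S y * f y)"
  unfolding loc_int_def
proof (intro allI)
  fix x r
  have "integrable lebesgue (\<lambda>y. indicat_real (ball x r) y *\<^sub>R f y)"
    using assms(1) by (simp add: loc_int_def set_integrable_def)
  then have "integrable lebesgue (\<lambda>y. indicat_real S y *\<^sub>R (indicat_real (ball x r) y *\<^sub>R f y))"
    using assms(2) by (rule integrable_mult_indicator[rotated])
  then show "set_integrable lebesgue (ball x r) (\<lambda>y. indicator S y * f y)"
    unfolding set_integrable_def by (rule Bochner_Integration.integrable_cong[THEN iffD1, OF refl, rotated])
       (auto split: split_indicator)
qed

text \<open>A function that is not integrable has Bochner integral 0, so the bound covers that case
  as well and integrability need not be tracked where only the size matters.\<close>

lemma norm_set_integral_le:
  fixes h :: "'a \<Rightarrow> complex"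
  assumes "(\<integral>\<^sup>+y\<in>S. ennreal (norm (h y)) \<partial>M) \<le> ennreal B" "0 \<le> B"
  shows "norm (LINT y:S|M. h y) \<le> B"
proof (cases "set_integrable M S h")
  case True
  have "ennreal (norm (LINT y:S|M. h y)) \<le> (\<integral>\<^sup>+y. ennreal (norm (indicator S y *\<^sub>R h y)) \<partial>M)"
    using True unfolding set_lebesgue_integral_def set_integrable_def by (rule integral_norm_bound_ennreal)
  also have "\<dots> = (\<integral>\<^sup>+y\<in>S. ennreal (norm (h y)) \<partial>M)"
    by (intro nn_integral_cong) (auto split: split_indicator)
  also note assms(1)
  finally show ?thesis using assms(2) by simp
next
  case False
  then have "(LINT y:S|M. h y) = 0"
    unfolding set_lebesgue_integral_def set_integrable_def by (rule not_integrable_integral_eq)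
  then show ?thesis using assms(2) by simp
qed

lemma max_truncation_leI:
  assumes "\<And>e v. 0 < e \<Longrightarrow> e < v \<Longrightarrow> norm (tr K f e v x) \<le> B"
  shows "max_truncation K f x \<le> ennreal B"
  unfolding max_truncation_def using assms
  by (auto intro!: SUP_least ennreal_leI simp: tr_def ann_def)

lemma tr_le_max_truncation:
  assumes "0 < e" "e < v"
  shows "ennreal (norm (tr K f e v x)) \<le> max_truncation K f x"
  unfolding max_truncation_def tr_def ann_def
  by (rule SUP_upper2[of "(e, v)"]) (use assms in auto)

lemma tr_le_of_max_truncation:
  assumes "0 < e" "e < v" "max_truncation K f x \<le> ennreal B" "0 \<le> B"
  shows "norm (tr K f e v x) \<le> B"
  using order_trans[OF tr_le_max_truncation[OF assms(1,2)] assms(3)] assms(4) by simp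

lemma growth_mono: "growth g x A \<Longrightarrow> A \<le> B \<Longrightarrow> growth g x B"
  unfolding growth_def by (meson ennreal_leI mult_right_mono order_trans zero_le_power less_imp_le)

locale std_kernel =
  fixes K :: "real ^ 'n \<Rightarrow> real ^ 'n \<Rightarrow> complex" and c \<delta> :: real
  assumes c_pos: "0 < c" and \<delta>_pos: "0 < \<delta>"
    and size: "\<And>x y. x \<noteq> y \<Longrightarrow> norm (K x y) \<le> c / norm (x - y) ^ CARD('n)"
    and reg: "\<And>x x' y. norm (x - x') < norm (x - y) / 2 \<Longrightarrow>
           norm (K x y - K x' y) + norm (K y x - K y x')
             \<le> c * norm (x - x') powr \<delta> / norm (x - y) powr (real CARD('n) + \<delta>)"
begin

lemma reg1: "norm (x - x') < norm (x - y) / 2 \<Longrightarrow>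
   norm (K x y - K x' y) \<le> c * norm (x - x') powr \<delta> / norm (x - y) powr (real CARD('n) + \<delta>)"
  using reg[of x x' y] norm_ge_zero[of "K y x - K y x'"] by linarith

lemma reg2: "norm (y - y') < norm (x - y) / 2 \<Longrightarrow>
   norm (K x y - K x y') \<le> c * norm (y - y') powr \<delta> / norm (x - y) powr (real CARD('n) + \<delta>)"
  using reg[of y y' x] norm_ge_zero[of "K y x - K y' x"] unfolding norm_minus_commute[of x y] by linarith

text \<open>The Hoelder condition in the second variable gives continuity off the diagonal, and with
  it the measurability of \<open>K x\<close>, which the definition of a standard kernel leaves
  implicit.\<close>

lemma K_continuous: "continuous_on (- {x}) (K x)"
proof (rule continuous_at_imp_continuous_on, rule ballI)
  fix y assume "y \<in> - {x}"
  then have yx: "norm (x - y) > 0" by auto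
  have lim: "((\<lambda>z. c * norm (y - z) powr \<delta> / norm (x - y) powr (real CARD('n) + \<delta>)) \<longlongrightarrow>
      c * norm (y - y) powr \<delta> / norm (x - y) powr (real CARD('n) + \<delta>)) (at y)"
    using \<delta>_pos by (intro tendsto_intros) (use yx in \<open>auto intro!: always_eventually\<close>)
  have "((\<lambda>z. K x y - K x z) \<longlongrightarrow> 0) (at y)"
  proof (rule Lim_null_comparison)
    show "((\<lambda>z. c * norm (y - z) powr \<delta> / norm (x - y) powr (real CARD('n) + \<delta>)) \<longlongrightarrow> 0) (at y)"
      using lim \<delta>_pos by simp
    have "\<forall>\<^sub>F z in at y. dist z y < norm (x - y) / 2"
      using yx by (auto simp: eventually_at intro!: exI[of _ "norm (x - y) / 2"])
    then show "\<forall>\<^sub>F z in at y. norm (K x y - K x z) \<le> c * norm (y - z) powr \<delta> / norm (x - y) powr (real CARD('n) + \<delta>)"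
      by eventually_elim (rule reg2, simp add: dist_norm norm_minus_commute)
  qed
  then have "((\<lambda>z. K x y - (K x y - K x z)) \<longlongrightarrow> K x y - 0) (at y)" by (intro tendsto_intros)
  then show "isCont (K x) y" by (simp add: isCont_def)
qed

lemma K_measurable [measurable]: "K x \<in> borel_measurable lebesgue"
proof -
  have "(\<lambda>y. if y \<in> - {x} then K x y else K x x) \<in> borel_measurable borel"
    by (rule borel_measurable_continuous_on_if) (auto simp: K_continuous)
  moreover have "(\<lambda>y. if y \<in> - {x} then K x y else K x x) = K x" by auto
  ultimately have "K x \<in> borel_measurable borel" by simp
  then show ?thesis by (simp add: measurable_completion)
qed

lemma size_ge:
  assumes "0 < r" "r \<le> norm (x - y)"
  shows "norm (K x y) \<le> c / r ^ CARD('n)"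
proof -
  have "norm (K x y) \<le> c / norm (x - y) ^ CARD('n)" using assms by (intro size) auto
  also have "\<dots> \<le> c / r ^ CARD('n)"
    using assms c_pos by (intro divide_left_mono power_mono mult_pos_pos zero_less_power) auto
  finally show ?thesis .
qed

lemma tr_integrable:
  assumes "loc_int f" "0 < e"
  shows "set_integrable lebesgue (ann x e v) (\<lambda>y. K x y * f y)"
  unfolding set_integrable_def
proof (rule Bochner_Integration.integrable_bound)
  have [measurable]: "f \<in> borel_measurable lebesgue" using assms(1) by (rule loc_int_measurable)
  have "integrable lebesgue (\<lambda>y. indicat_real (ball x v) y *\<^sub>R f y)"
    using assms by (simp add: loc_int_def set_integrable_def)
  then show "integrable lebesgue (\<lambda>y. (c / e ^ CARD('n)) *\<^sub>R (indicat_real (ball x v) y *\<^sub>R f y))"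
    by (rule integrable_scaleR_right)
  show "(\<lambda>y. indicat_real (ann x e v) y *\<^sub>R (K x y * f y)) \<in> borel_measurable lebesgue" by measurable
  have "norm (indicat_real (ann x e v) y *\<^sub>R (K x y * f y))
      \<le> norm ((c / e ^ CARD('n)) *\<^sub>R (indicat_real (ball x v) y *\<^sub>R f y))" for y
  proof (cases "y \<in> ann x e v")
    case True
    then have "norm (K x y) \<le> c / e ^ CARD('n)" using assms by (intro size_ge) (auto simp: ann_def)
    moreover have "y \<in> ball x v" using True ann_subset_ball by blast
    moreover have "norm (K x y) * norm (f y) \<le> c / e ^ CARD('n) * norm (f y)"
      using \<open>norm (K x y) \<le> c / e ^ CARD('n)\<close> by (rule mult_right_mono) simp
    ultimately show ?thesis using True c_pos assms by (simp add: norm_mult)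
  qed simp
  then show "AE y in lebesgue. norm (indicat_real (ann x e v) y *\<^sub>R (K x y * f y))
      \<le> norm ((c / e ^ CARD('n)) *\<^sub>R (indicat_real (ball x v) y *\<^sub>R f y))" by simp
qed

lemma tr_add:
  assumes "loc_int f" "loc_int g" "0 < e"
  shows "tr K (\<lambda>y. f y + g y) e v x = tr K f e v x + tr K g e v x"
  unfolding tr_def distrib_left
  by (rule set_integral_add(2)) (intro tr_integrable assms)+

lemma max_truncation_add:
  assumes "loc_int f" "loc_int g"
  shows "max_truncation K (\<lambda>y. f y + g y) x \<le> max_truncation K f x + max_truncation K g x"
proof -
  have "ennreal (norm (tr K (\<lambda>y. f y + g y) e v x)) \<le> max_truncation K f x + max_truncation K g x"
    if "0 < e" "e < v" for e v
  proof -
    have "ennreal (norm (tr K (\<lambda>y. f y + g y) e v x)) \<le> ennreal (norm (tr K f e v x) + norm (tr K g e v x))"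
      unfolding tr_add[OF assms that(1)] by (intro ennreal_leI norm_triangle_ineq)
    also have "\<dots> = ennreal (norm (tr K f e v x)) + ennreal (norm (tr K g e v x))" by simp
    also have "\<dots> \<le> max_truncation K f x + max_truncation K g x"
      by (intro add_mono tr_le_max_truncation that)
    finally show ?thesis .
  qed
  then show ?thesis unfolding max_truncation_def[of K "\<lambda>y. f y + g y"]
    by (auto intro!: SUP_least simp: tr_def ann_def)
qed

text \<open>Regularity turns the difference of kernels into exactly the weight of
  \<open>tail_estimate\<close>, with the displacement of the centre enlarged to
  \<open>s\<close>.\<close>

lemma kernel_diff_integral:
  fixes g :: "real ^ 'n \<Rightarrow> ennreal"
  assumes [measurable]: "g \<in> borel_measurable lebesgue" and s: "norm (x - z) < s / 2" and A: "0 \<le> A"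
    and gr: "growth g x A"
  shows "(\<integral>\<^sup>+y\<in>{y. s \<le> norm (x - y)}. ennreal (norm (K x y - K z y)) * g y \<partial>lebesgue)
     \<le> ennreal (c * tailc CARD('n) \<delta> * A)"
proof -
  have s0: "0 < s" using s norm_ge_zero[of "x - z"] by linarith
  have "(\<integral>\<^sup>+y\<in>{y. s \<le> norm (x - y)}. ennreal (norm (K x y - K z y)) * g y \<partial>lebesgue)
    \<le> (\<integral>\<^sup>+y. ennreal c * (ennreal (s powr \<delta> / norm (x - y) powr (CARD('n) + \<delta>)) * g y * indicator {y. s \<le> norm (x - y)} y) \<partial>lebesgue)"
  proof (rule nn_integral_mono)
    fix y
    show "ennreal (norm (K x y - K z y)) * g y * indicator {y. s \<le> norm (x - y)} y
      \<le> ennreal c * (ennreal (s powr \<delta> / norm (x - y) powr (CARD('n) + \<delta>)) * g y * indicator {y. s \<le> norm (x - y)} y)"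
    proof (cases "s \<le> norm (x - y)")
      case True
      have "norm (K x y - K z y) \<le> c * norm (x - z) powr \<delta> / norm (x - y) powr (real CARD('n) + \<delta>)"
        using True s by (intro reg1) linarith
      also have "\<dots> \<le> c * s powr \<delta> / norm (x - y) powr (real CARD('n) + \<delta>)"
        using s s0 c_pos \<delta>_pos by (intro divide_right_mono mult_left_mono powr_mono2) auto
      finally have "ennreal (norm (K x y - K z y)) \<le> ennreal (c * (s powr \<delta> / norm (x - y) powr (CARD('n) + \<delta>)))"
        by (intro ennreal_leI) simp
      also have "\<dots> = ennreal c * ennreal (s powr \<delta> / norm (x - y) powr (CARD('n) + \<delta>))"
        using c_pos by (intro ennreal_mult') simp
      finally show ?thesis using True by (simp add: mult_right_mono flip: mult.assoc)
    qed simp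
  qed
  also have "\<dots> = ennreal c * (\<integral>\<^sup>+y\<in>{y. s \<le> norm (x - y)}. ennreal (s powr \<delta> / norm (x - y) powr (CARD('n) + \<delta>)) * g y \<partial>lebesgue)"
  proof (rule nn_integral_cmult)
    have W: "(\<lambda>y. ennreal (s powr \<delta> / norm (x - y) powr (CARD('n) + \<delta>))) \<in> borel_measurable lebesgue"
    proof -
      have "(\<lambda>y. norm (x - y)) \<in> borel_measurable borel"
        by (intro borel_measurable_continuous_onI continuous_intros)
      then have "(\<lambda>y. ennreal (s powr \<delta> / norm (x - y) powr (CARD('n) + \<delta>))) \<in> borel_measurable borel"
        by measurable
      then show ?thesis by (simp add: measurable_completion)
    qed
    show "(\<lambda>y. ennreal (s powr \<delta> / norm (x - y) powr (CARD('n) + \<delta>)) * g y * indicator {y. s \<le> norm (x - y)} y) \<in> borel_measurable lebesgue"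
      by (rule borel_measurable_times_ennreal[OF borel_measurable_times_ennreal[OF W assms(1)] borel_measurable_indicator[OF closed_norm_ge]])
  qed
  also have "\<dots> \<le> ennreal c * ennreal (tailc CARD('n) \<delta> * A)"
    by (rule mult_left_mono[OF tail_estimate[OF assms(1) s0 \<delta>_pos A]])
       (use s0 gr in \<open>auto simp: growth_def\<close>)
  also have "\<dots> = ennreal (c * tailc CARD('n) \<delta> * A)"
    using c_pos by (subst ennreal_mult'[symmetric]) (auto simp: mult_ac)
  finally show ?thesis .
qed

text \<open>In a shell of bounded ratio \<open>R / r\<close> the size condition is enough: the
  kernel is at most \<open>c / r ^ CARD('n)\<close> and the mass at most
  \<open>A * R ^ CARD('n)\<close>. It handles the edges of truncations, where cancellation
  fails.\<close>

lemma kernel_shell_integral: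
  fixes g :: "real ^ 'n \<Rightarrow> ennreal"
  assumes [measurable]: "g \<in> borel_measurable lebesgue" and r: "0 < r" and A: "0 \<le> A"
    and gr: "growth g x A"
    and S: "S \<subseteq> {y. r \<le> norm (x - y) \<and> norm (x - y) < R}"
  shows "(\<integral>\<^sup>+y\<in>S. ennreal (norm (K x y)) * g y \<partial>lebesgue) \<le> ennreal (c * (R / r) ^ CARD('n) * A)"
proof (cases "R > 0")
  case True
  have "(\<integral>\<^sup>+y\<in>S. ennreal (norm (K x y)) * g y \<partial>lebesgue)
     \<le> (\<integral>\<^sup>+y. ennreal (c / r ^ CARD('n)) * (g y * indicator (ball x R) y) \<partial>lebesgue)"
  proof (rule nn_integral_mono)
    fix y
    show "ennreal (norm (K x y)) * g y * indicator S y \<le> ennreal (c / r ^ CARD('n)) * (g y * indicator (ball x R) y)"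
    proof (cases "y \<in> S")
      case True
      then have "r \<le> norm (x - y)" "norm (x - y) < R" using S by auto
      then have "ennreal (norm (K x y)) \<le> ennreal (c / r ^ CARD('n))" "y \<in> ball x R"
        using r by (auto intro!: ennreal_leI size_ge simp: dist_norm)
      then show ?thesis using True by (simp add: mult_right_mono)
    qed simp
  qed
  also have "\<dots> = ennreal (c / r ^ CARD('n)) * (\<integral>\<^sup>+y\<in>ball x R. g y \<partial>lebesgue)"
    by (intro nn_integral_cmult) measurable
  also have "\<dots> \<le> ennreal (c / r ^ CARD('n)) * ennreal (A * R ^ CARD('n))"
    using gr True by (intro mult_left_mono growthD) auto
  also have "\<dots> = ennreal (c / r ^ CARD('n) * (A * R ^ CARD('n)))"
    using c_pos r by (intro ennreal_mult'[symmetric]) simp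
  also have "c / r ^ CARD('n) * (A * R ^ CARD('n)) = c * (R / r) ^ CARD('n) * A"
    by (simp add: power_divide)
  finally show ?thesis .
next
  case False
  have "y \<notin> S" for y
  proof
    assume "y \<in> S"
    then have "norm (x - y) < R" using S by blast
    then show False using False norm_ge_zero[of "x - y"] by linarith
  qed
  then have "S = {}" by blast
  then show ?thesis by simp
qed

definition shiftc :: real where
  "shiftc = c * (tailc CARD('n) \<delta> + 2 * 4 ^ CARD('n))"

lemma shiftc_pos: "0 < shiftc"
  using c_pos tailc_pos[OF \<delta>_pos, of "CARD('n)"] by (auto simp: shiftc_def intro!: mult_pos_pos add_pos_pos)

text \<open>Where both annuli are present, regularity gives the \<open>tailc\<close> part of
  \<open>shiftc\<close>. The symmetric difference of the annuli lies in two shells around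
  \<open>x'\<close>, near the radii \<open>e\<close> and \<open>v\<close>, each of ratio 4; they
  give the part \<open>2 * 4 ^ CARD('n)\<close>.\<close>

lemma tr_shift:
  assumes f: "loc_int f" and xx: "norm (x - x') \<le> s" and s: "0 < s" and e: "4 * s \<le> e" "e < v"
    and gr: "growth (modulus f) x' A" and A: "0 \<le> A"
  shows "norm (tr K f e v x - tr K f e v x') \<le> shiftc * A"
proof -
  have [measurable]: "f \<in> borel_measurable lebesgue" using f by (rule loc_int_measurable)
  have [measurable]: "modulus f \<in> borel_measurable lebesgue" unfolding modulus_def[abs_def] by measurable
  \<comment> \<open>The radius \<open>3 * s\<close> is more than twice the displacement, so
    regularity applies beyond it, and \<open>4 * s \<le> e\<close> places both annuli there.\<close>
  let ?S1 = "{y. 3 * s \<le> norm (x' - y)}"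
  let ?S2 = "{y. e / 2 \<le> norm (x' - y)} \<inter> ball x' (2 * e)"
  let ?S3 = "{y. v / 2 \<le> norm (x' - y)} \<inter> ball x' (2 * v)"
  have i: "set_integrable lebesgue (ann x e v) (\<lambda>y. K x y * f y)" "set_integrable lebesgue (ann x' e v) (\<lambda>y. K x' y * f y)"
    using f s e by (intro tr_integrable; simp)+
  have "tr K f e v x - tr K f e v x' =
     (LINT y:UNIV|lebesgue. indicator (ann x e v) y *\<^sub>R (K x y * f y) - indicator (ann x' e v) y *\<^sub>R (K x' y * f y))"
    using i unfolding tr_def set_lebesgue_integral_def set_integrable_def by simp
  also have "norm \<dots> \<le> shiftc * A"
  proof (rule norm_set_integral_le)
    have "(\<integral>\<^sup>+y\<in>UNIV. ennreal (norm (indicator (ann x e v) y *\<^sub>R (K x y * f y) - indicator (ann x' e v) y *\<^sub>R (K x' y * f y))) \<partial>lebesgue)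
      \<le> (\<integral>\<^sup>+y. (ennreal (norm (K x' y - K x y)) * modulus f y * indicator ?S1 y
         + (ennreal (norm (K x' y)) * modulus f y * indicator ?S2 y + ennreal (norm (K x' y)) * modulus f y * indicator ?S3 y)) \<partial>lebesgue)"
    proof (rule nn_integral_mono)
      fix y
      let ?R = "ennreal (norm (K x' y - K x y)) * modulus f y * indicator ?S1 y
         + (ennreal (norm (K x' y)) * modulus f y * indicator ?S2 y + ennreal (norm (K x' y)) * modulus f y * indicator ?S3 y)"
      have tri: "norm (x - y) \<le> norm (x' - y) + s" "norm (x' - y) \<le> norm (x - y) + s"
        using norm_triangle_ineq[of "x - x'" "x' - y"] norm_triangle_ineq[of "x' - x" "x - y"] xx
        by (auto simp: norm_minus_commute)
      have part: "ennreal (norm (K x' y * f y)) \<le> ?R" if "y \<in> ?S2 \<or> y \<in> ?S3"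
      proof -
        have "ennreal (norm (K x' y * f y)) = ennreal (norm (K x' y)) * modulus f y"
          by (simp add: norm_mult ennreal_mult modulus_def)
        also have "\<dots> \<le> ennreal (norm (K x' y)) * modulus f y * indicator ?S2 y + ennreal (norm (K x' y)) * modulus f y * indicator ?S3 y"
          using that by (cases "y \<in> ?S2"; cases "y \<in> ?S3") auto
        finally show ?thesis by (simp add: add_increasing)
      qed
      have "ennreal (norm (indicator (ann x e v) y *\<^sub>R (K x y * f y) - indicator (ann x' e v) y *\<^sub>R (K x' y * f y))) \<le> ?R"
      proof -
        consider (both) "y \<in> ann x e v" "y \<in> ann x' e v" | (one) "y \<in> ann x e v" "y \<notin> ann x' e v"
          | (two) "y \<notin> ann x e v" "y \<in> ann x' e v" | (none) "y \<notin> ann x e v" "y \<notin> ann x' e v" by blast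
        then show ?thesis
        proof cases
          case both
          then have "3 * s \<le> norm (x' - y)" using e s by (auto simp: ann_def)
          then have "ennreal (norm (K x' y - K x y)) * modulus f y \<le> ?R"
            by (simp add: add_increasing2)
          moreover have "ennreal (norm (K x y * f y - K x' y * f y)) = ennreal (norm (K x' y - K x y)) * modulus f y"
            by (simp add: modulus_def flip: left_diff_distrib ennreal_mult norm_mult) (simp add: norm_mult norm_minus_commute ennreal_mult)
          ultimately show ?thesis using both by simp
        next
          \<comment> \<open>Here only the kernel centred at \<open>x\<close> occurs; it is written
            as the one at \<open>x'\<close> minus a difference, so a regularity term and a shell
            term both appear.\<close>
          case one
          then have S1: "3 * s \<le> norm (x' - y)" using e s tri by (auto simp: ann_def)
          have S23: "y \<in> ?S2 \<or> y \<in> ?S3" using one e s tri by (auto simp: ann_def dist_norm)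
          have "ennreal (norm (K x y * f y)) \<le> ennreal (norm ((K x' y - K x y) * f y) + norm (K x' y * f y))"
            using norm_triangle_ineq4[of "K x' y * f y" "(K x' y - K x y) * f y"]
            by (intro ennreal_leI) (simp add: algebra_simps)
          also have "\<dots> = ennreal (norm (K x' y - K x y)) * modulus f y + ennreal (norm (K x' y)) * modulus f y"
            by (simp add: norm_mult modulus_def ennreal_mult)
          also have "\<dots> \<le> ?R"
          proof (intro add_mono)
            show "ennreal (norm (K x' y)) * modulus f y
             \<le> ennreal (norm (K x' y)) * modulus f y * indicator ?S2 y + ennreal (norm (K x' y)) * modulus f y * indicator ?S3 y"
              using S23 by (cases "y \<in> ?S2"; cases "y \<in> ?S3") auto
          qed (use S1 in simp)
          finally show ?thesis using one by simp
        next
          case two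
          then have "y \<in> ?S2 \<or> y \<in> ?S3" using e s tri by (auto simp: ann_def dist_norm)
          then show ?thesis using two part by simp
        qed simp
      qed
      then show "ennreal (norm (indicator (ann x e v) y *\<^sub>R (K x y * f y) - indicator (ann x' e v) y *\<^sub>R (K x' y * f y))) * indicator UNIV y \<le> ?R"
        by simp
    qed
    also have "\<dots> = (\<integral>\<^sup>+y\<in>?S1. ennreal (norm (K x' y - K x y)) * modulus f y \<partial>lebesgue)
         + ((\<integral>\<^sup>+y\<in>?S2. ennreal (norm (K x' y)) * modulus f y \<partial>lebesgue) + (\<integral>\<^sup>+y\<in>?S3. ennreal (norm (K x' y)) * modulus f y \<partial>lebesgue))"
    proof -
      have [measurable]: "?S1 \<in> sets lebesgue" "?S2 \<in> sets lebesgue" "?S3 \<in> sets lebesgue"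
        by auto
      show ?thesis by (subst nn_integral_add, measurable)+
    qed
    also have "\<dots> \<le> ennreal (c * tailc CARD('n) \<delta> * A) + (ennreal (c * ((2 * e) / (e / 2)) ^ CARD('n) * A) + ennreal (c * ((2 * v) / (v / 2)) ^ CARD('n) * A))"
      using xx s e gr A
      by (intro add_mono kernel_diff_integral kernel_shell_integral)
         (auto simp: norm_minus_commute dist_norm)
    also have "\<dots> = ennreal (c * tailc CARD('n) \<delta> * A + (c * 4 ^ CARD('n) * A + c * 4 ^ CARD('n) * A))"
    proof -
      have n: "0 \<le> c * tailc CARD('n) \<delta> * A" "0 \<le> c * 4 ^ CARD('n) * A"
        using A c_pos tailc_pos[OF \<delta>_pos, of "CARD('n)"] by simp_all
      have eqs: "(2 * e) / (e / 2) = 4" "(2 * v) / (v / 2) = 4" using s e by simp_all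
      show ?thesis
        by (simp only: eqs ennreal_plus[OF n(1) add_nonneg_nonneg[OF n(2) n(2)]] ennreal_plus[OF n(2) n(2)])
    qed
    also have "\<dots> = ennreal (shiftc * A)" by (simp add: shiftc_def algebra_simps)
    finally show "(\<integral>\<^sup>+y\<in>UNIV. ennreal (norm (indicator (ann x e v) y *\<^sub>R (K x y * f y) - indicator (ann x' e v) y *\<^sub>R (K x' y * f y))) \<partial>lebesgue) \<le> ennreal (shiftc * A)" .
  qed (use A shiftc_pos in simp)
  finally show ?thesis .
qed

end

subsection \<open>Cotlar's inequality\<close>

definition sqf :: "('a \<Rightarrow> complex) \<Rightarrow> 'a \<Rightarrow> ennreal" where
  "sqf f x = ennreal ((norm (f x))\<^sup>2)"

definition sqint :: "(real ^ 'n \<Rightarrow> complex) \<Rightarrow> bool" where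
  "sqint f \<longleftrightarrow> f \<in> borel_measurable lebesgue \<and> (\<integral>\<^sup>+x. sqf f x \<partial>lebesgue) < \<infinity>"

lemma sqf_measurable [measurable]: "f \<in> borel_measurable M \<Longrightarrow> sqf f \<in> borel_measurable M"
  unfolding sqf_def[abs_def] by measurable

lemma modulus_measurable [measurable]: "(f :: _ \<Rightarrow> complex) \<in> borel_measurable M \<Longrightarrow> modulus f \<in> borel_measurable M"
  unfolding modulus_def[abs_def] by measurable

lemma sqint_indicator:
  assumes "sqint f" "S \<in> sets lebesgue"
  shows "sqint (\<lambda>y. indicator S y * f y)"
proof -
  have [measurable]: "f \<in> borel_measurable lebesgue" using assms by (simp add: sqint_def)
  have "(\<lambda>y. indicator S y * f y) \<in> borel_measurable lebesgue"
    using assms(2) by measurable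
  moreover have "(\<integral>\<^sup>+x. sqf (\<lambda>y. indicator S y * f y) x \<partial>lebesgue) \<le> (\<integral>\<^sup>+x. sqf f x \<partial>lebesgue)"
    by (intro nn_integral_mono) (auto simp: sqf_def split: split_indicator)
  ultimately show ?thesis using assms(1) by (auto simp: sqint_def intro: le_less_trans)
qed

lemma sqf_indicator_integral:
  "(\<integral>\<^sup>+x. sqf (\<lambda>y. indicator S y * f y) x \<partial>M) = (\<integral>\<^sup>+x\<in>S. sqf f x \<partial>M)"
  by (intro nn_integral_cong) (auto simp: sqf_def split: split_indicator)

text \<open>Cauchy-Schwarz in its additive form: \<open>norm (f y)\<close> is at most
  \<open>A / 2\<close> plus \<open>(norm (f y))\<^sup>2 / (2 * A)\<close>. The factor
  \<open>2 ^ CARD('n)\<close> bounds the volume of a ball by that of a cube.\<close>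

lemma growth_modulus_of_sqf:
  fixes f :: "real ^ 'n \<Rightarrow> complex"
  assumes [measurable]: "f \<in> borel_measurable lebesgue" and A: "0 < A" and gr: "growth (sqf f) x (A\<^sup>2)"
  shows "growth (modulus f) x (2 ^ CARD('n) * A)"
  unfolding growth_def
proof (intro allI impI)
  fix r :: real assume r: "0 < r"
  have "modulus f y * indicator (ball x r) y \<le> ennreal (A / 2) * indicator (ball x r) y + ennreal (1 / (2 * A)) * (sqf f y * indicator (ball x r) y)" for y
  proof -
    have "0 \<le> (A - norm (f y))\<^sup>2" by simp
    then have "2 * A * norm (f y) \<le> A\<^sup>2 + (norm (f y))\<^sup>2" by (simp add: power2_diff)
    then have "norm (f y) \<le> A / 2 + (1 / (2 * A)) * (norm (f y))\<^sup>2"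
      using A by (simp add: field_simps power2_eq_square)
    then have "ennreal (norm (f y)) \<le> ennreal (A / 2 + (1 / (2 * A)) * (norm (f y))\<^sup>2)" by (rule ennreal_leI)
    also have "\<dots> = ennreal (A / 2) + ennreal (1 / (2 * A)) * ennreal ((norm (f y))\<^sup>2)"
    proof -
      have n: "0 \<le> A / 2" "0 \<le> 1 / (2 * A)" "0 \<le> (norm (f y))\<^sup>2" using A by auto
      show ?thesis by (simp only: ennreal_plus[OF n(1) mult_nonneg_nonneg[OF n(2,3)]] ennreal_mult[OF n(2,3)])
    qed
    finally show ?thesis by (auto simp: modulus_def sqf_def split: split_indicator)
  qed
  then have "(\<integral>\<^sup>+y\<in>ball x r. modulus f y \<partial>lebesgue) \<le>
     (\<integral>\<^sup>+y. (ennreal (A / 2) * indicator (ball x r) y + ennreal (1 / (2 * A)) * (sqf f y * indicator (ball x r) y)) \<partial>lebesgue)"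
    by (intro nn_integral_mono)
  also have "\<dots> = ennreal (A / 2) * emeasure lebesgue (ball x r) + ennreal (1 / (2 * A)) * (\<integral>\<^sup>+y\<in>ball x r. sqf f y \<partial>lebesgue)"
    by (subst nn_integral_add, measurable) (simp add: nn_integral_cmult)
  also have "\<dots> \<le> ennreal (A / 2) * ennreal ((2 * r) ^ CARD('n)) + ennreal (1 / (2 * A)) * ennreal (A\<^sup>2 * r ^ CARD('n))"
    using r gr by (intro add_mono mult_left_mono emeasure_ball_le growthD) auto
  also have "\<dots> = ennreal (A / 2 * (2 * r) ^ CARD('n) + 1 / (2 * A) * (A\<^sup>2 * r ^ CARD('n)))"
  proof -
    have n: "0 \<le> A / 2" "0 \<le> 1 / (2 * A)" "0 \<le> A\<^sup>2 * r ^ CARD('n)" "0 \<le> (2 * r) ^ CARD('n)" using A r by auto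
    show ?thesis
      by (simp only: ennreal_plus[OF mult_nonneg_nonneg[OF n(1,4)] mult_nonneg_nonneg[OF n(2,3)]] ennreal_mult[OF n(2,3)] ennreal_mult[OF n(1,4)])
  qed
  also have "\<dots> \<le> ennreal (2 ^ CARD('n) * A * r ^ CARD('n))"
  proof (rule ennreal_leI)
    have "A * r ^ CARD('n) * 1 \<le> A * r ^ CARD('n) * 2 ^ CARD('n)"
      using A r by (intro mult_left_mono) auto
    then show "A / 2 * (2 * r) ^ CARD('n) + 1 / (2 * A) * (A\<^sup>2 * r ^ CARD('n)) \<le> 2 ^ CARD('n) * A * r ^ CARD('n)"
      using A by (simp add: power_mult_distrib power2_eq_square field_simps)
  qed
  finally show "(\<integral>\<^sup>+y\<in>ball x r. modulus f y \<partial>lebesgue) \<le> ennreal (2 ^ CARD('n) * A * r ^ CARD('n))" .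
qed

text \<open>The operator bound is stated for integrals of squares, so that roots of extended reals
  occur only where it is extracted from \<open>CZ_operator\<close>.\<close>

locale cz = std_kernel K c \<delta> for K :: "real ^ 'n \<Rightarrow> real ^ 'n \<Rightarrow> complex" and c \<delta> :: real +
  fixes T :: "(real ^ 'n \<Rightarrow> complex) \<Rightarrow> (real ^ 'n \<Rightarrow> complex)" and B :: real
  assumes B0: "0 \<le> B"
    and T_add: "\<And>f g. sqint f \<Longrightarrow> sqint g \<Longrightarrow> AE x in lebesgue. T (\<lambda>y. f y + g y) x = T f x + T g x"
    and T_sqint: "\<And>f. sqint f \<Longrightarrow> sqint (T f)"
    and T_bound: "\<And>f. sqint f \<Longrightarrow> (\<integral>\<^sup>+x. sqf (T f) x \<partial>lebesgue) \<le> ennreal (B\<^sup>2) * (\<integral>\<^sup>+x. sqf f x \<partial>lebesgue)"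
    and T_kernel: "\<And>f. sqint f \<Longrightarrow> AE x in lebesgue.
        x \<notin> closure {y. f y \<noteq> 0} \<longrightarrow> T f x = (LINT y|lebesgue. K x y * f y)"
begin

text \<open>The product of kernel and function is at most the sum of their squares. The square of
  the kernel decays like the power \<open>-2n\<close> of the distance, hence is integrable away from
  \<open>x\<close>.\<close>

lemma kernel_far_integrable:
  assumes f: "sqint f" and s: "0 < s" and U: "U \<in> sets lebesgue" "U \<subseteq> {y. s \<le> norm (x - y)}"
  shows "set_integrable lebesgue U (\<lambda>y. K x y * f y)"
  unfolding set_integrable_def
proof (rule integrableI_bounded)
  have [measurable]: "f \<in> borel_measurable lebesgue" using f by (simp add: sqint_def)
  note U(1)[measurable]
  show "(\<lambda>y. indicat_real U y *\<^sub>R (K x y * f y)) \<in> borel_measurable lebesgue" by measurable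
  let ?N = "real CARD('n)"
  \<comment> \<open>This is the integrand of \<open>tail_estimate\<close> with exponent \<delta>
    equal to the dimension and with the constant function 1 in place of \<open>g\<close>, hence the
    factor \<open>* 1\<close>.\<close>
  define W where "W y = ennreal (s powr ?N / norm (x - y) powr (?N + ?N)) * 1" for y :: "real ^ 'n"
  have Wm [measurable]: "W \<in> borel_measurable lebesgue"
  proof -
    have "(\<lambda>y. norm (x - y)) \<in> borel_measurable borel"
      by (intro borel_measurable_continuous_onI continuous_intros)
    then have "W \<in> borel_measurable borel" unfolding W_def by measurable
    then show ?thesis by (simp add: measurable_completion)
  qed
  have pt: "ennreal (norm (indicat_real U y *\<^sub>R (K x y * f y)))
      \<le> ennreal (c\<^sup>2 / s ^ CARD('n)) * (W y * indicator {y. s \<le> norm (x - y)} y) + sqf f y" for y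
  proof (cases "y \<in> U")
    case True
    then have sy: "s \<le> norm (x - y)" using U by auto
    let ?k = "norm (K x y)"
    have "?k \<le> c / norm (x - y) ^ CARD('n)" using sy s by (intro size) auto
    then have "?k\<^sup>2 \<le> (c / norm (x - y) ^ CARD('n))\<^sup>2" by (intro power_mono) auto
    also have "\<dots> = c\<^sup>2 / s ^ CARD('n) * (s powr ?N / norm (x - y) powr (?N + ?N))"
    proof -
      have "0 < norm (x - y)" using sy s by linarith
      then have "norm (x - y) powr (?N + ?N) = norm (x - y) ^ CARD('n) * norm (x - y) ^ CARD('n)"
        by (simp only: powr_add) (simp add: powr_realpow)
      moreover have "s powr ?N = s ^ CARD('n)" using s by (rule powr_realpow)
      ultimately show ?thesis using s by (simp only:) (simp add: power_divide power2_eq_square)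
    qed
    finally have k: "?k\<^sup>2 \<le> c\<^sup>2 / s ^ CARD('n) * (s powr ?N / norm (x - y) powr (?N + ?N))" .
    have "0 \<le> (?k - norm (f y))\<^sup>2" by simp
    then have "2 * (?k * norm (f y)) \<le> ?k\<^sup>2 + (norm (f y))\<^sup>2" by (simp add: power2_diff mult_ac)
    moreover have "0 \<le> ?k * norm (f y)" by simp
    ultimately have "?k * norm (f y) \<le> ?k\<^sup>2 + (norm (f y))\<^sup>2" by linarith
    then have "ennreal (?k * norm (f y)) \<le> ennreal (c\<^sup>2 / s ^ CARD('n) * (s powr ?N / norm (x - y) powr (?N + ?N)) + (norm (f y))\<^sup>2)"
      using k by (intro ennreal_leI) linarith
    also have "\<dots> = ennreal (c\<^sup>2 / s ^ CARD('n)) * W y + sqf f y"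
    proof -
      have n: "0 \<le> c\<^sup>2 / s ^ CARD('n)" "0 \<le> s powr ?N / norm (x - y) powr (?N + ?N)" "0 \<le> (norm (f y))\<^sup>2" using s by auto
      show ?thesis unfolding W_def sqf_def mult_1_right
        by (simp only: ennreal_plus[OF mult_nonneg_nonneg[OF n(1,2)] n(3)] ennreal_mult[OF n(1,2)])
    qed
    finally show ?thesis using True sy by (simp add: norm_mult)
  qed simp
  have sb: "(\<integral>\<^sup>+y\<in>ball x r. 1 \<partial>lebesgue) \<le> ennreal (2 ^ CARD('n) * r ^ CARD('n))" if "s \<le> r" for r
    using emeasure_ball_le[of r x] that s by (simp add: power_mult_distrib)
  have "(\<integral>\<^sup>+y. ennreal (norm (indicat_real U y *\<^sub>R (K x y * f y))) \<partial>lebesgue)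
    \<le> (\<integral>\<^sup>+y. (ennreal (c\<^sup>2 / s ^ CARD('n)) * (W y * indicator {y. s \<le> norm (x - y)} y) + sqf f y) \<partial>lebesgue)"
    by (intro nn_integral_mono pt)
  also have "\<dots> = ennreal (c\<^sup>2 / s ^ CARD('n)) * (\<integral>\<^sup>+y. W y * indicator {y. s \<le> norm (x - y)} y \<partial>lebesgue) + (\<integral>\<^sup>+y. sqf f y \<partial>lebesgue)"
    by (subst nn_integral_add, measurable) (simp add: nn_integral_cmult)
  also have "\<dots> \<le> ennreal (c\<^sup>2 / s ^ CARD('n)) * ennreal (tailc CARD('n) ?N * 2 ^ CARD('n)) + (\<integral>\<^sup>+y. sqf f y \<partial>lebesgue)"
    unfolding W_def
    by (intro add_mono mult_left_mono order_refl tail_estimate[of "\<lambda>_. 1" s ?N "2 ^ CARD('n)" x])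
       (use s sb in auto)
  also have "\<dots> < \<infinity>" using f by (auto simp: sqint_def ennreal_mult_less_top)
  finally show "(\<integral>\<^sup>+y. ennreal (norm (indicat_real U y *\<^sub>R (K x y * f y))) \<partial>lebesgue) < \<infinity>" .
qed

text \<open>The 3 comes from squaring a sum of three terms. The averages over the ball of radius
  \<open>s / 2\<close> contribute, besides the kernel difference, \<open>1\<close> for
  \<open>T f\<close> and \<open>B\<^sup>2 * 4 ^ CARD('n)\<close> for \<open>T\<close> of the near
  part, which lives in a ball of radius \<open>2 * s\<close>.\<close>

definition cotc :: real where
  "cotc = sqrt (3 * ((c * tailc CARD('n) \<delta>)\<^sup>2 + (1 + B\<^sup>2 * 4 ^ CARD('n)) / unit_ball_vol (real CARD('n))))"

lemma cotc_nonneg: "0 \<le> cotc"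
  unfolding cotc_def by (intro real_sqrt_ge_zero mult_nonneg_nonneg add_nonneg_nonneg divide_nonneg_nonneg) auto

text \<open>
  The far part of \<open>f\<close> is compared at \<open>x\<close> and at a.e. \<open>z\<close> near \<open>x\<close>, where it equals
  \<open>T f z\<close> minus \<open>T\<close> of the near part; averaging over \<open>z\<close> only uses \<open>L\<^sup>2\<close> bounds.
\<close>

lemma cotlar_half:
  assumes f: "sqint f" and s: "0 < s" and A: "0 \<le> A"
    and U: "U \<in> sets lebesgue" "U \<subseteq> {y. s \<le> norm (x - y)}" "- U \<subseteq> ball x (2 * s)"
    and g1: "growth (modulus f) x A" and g2: "growth (sqf f) x (A\<^sup>2)" and g3: "growth (sqf (T f)) x (A\<^sup>2)"
  shows "norm (LINT y:U|lebesgue. K x y * f y) \<le> cotc * A"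
proof -
  note fm [measurable] = f[unfolded sqint_def, THEN conjunct1]
  note U(1)[measurable]
  define X where "X = norm (LINT y:U|lebesgue. K x y * f y)"
  define f1 where "f1 y = indicator (- U) y * f y" for y
  define f2 where "f2 y = indicator U y * f y" for y
  define D where "D = c * tailc CARD('n) \<delta>"
  define \<omega> where "\<omega> = unit_ball_vol (real CARD('n))"
  have \<omega>: "0 < \<omega>" by (simp add: \<omega>_def)
  have D0: "0 \<le> D" using c_pos tailc_pos[OF \<delta>_pos, of "CARD('n)"] by (simp add: D_def)
  have sq1: "sqint f1" unfolding f1_def using U by (intro sqint_indicator f) (simp add: Compl_eq_Diff_UNIV sets.Diff)
  have sq2: "sqint f2" unfolding f2_def by (intro sqint_indicator f U)
  have [measurable]: "T f1 \<in> borel_measurable lebesgue" "T f \<in> borel_measurable lebesgue"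
    using T_sqint[OF sq1] T_sqint[OF f] by (auto simp: sqint_def)
  have fsum: "(\<lambda>y. f1 y + f2 y) = f" by (auto simp: f1_def f2_def split: split_indicator)
  \<comment> \<open>The closed set of points at distance at least \<open>s\<close> contains the
    support of the far part, so every \<open>z\<close> within \<open>s / 2\<close> of
    \<open>x\<close> is off that support and the kernel formula applies.\<close>
  have cl: "closure {y. f2 y \<noteq> 0} \<subseteq> {y. s \<le> norm (x - y)}"
    by (rule closure_minimal) (use U in \<open>auto simp: f2_def split: split_indicator intro!: closed_Collect_le continuous_intros\<close>)
  have "AE z in lebesgue. T f z = T f1 z + T f2 z"
    using T_add[OF sq1 sq2] unfolding fsum by simp
  moreover have "AE z in lebesgue. z \<notin> closure {y. f2 y \<noteq> 0} \<longrightarrow> T f2 z = (LINT y|lebesgue. K z y * f2 y)"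
    by (rule T_kernel[OF sq2])
  ultimately have ae: "AE z in lebesgue. z \<in> ball x (s / 2) \<longrightarrow> X \<le> D * A + norm (T f z) + norm (T f1 z)"
  proof eventually_elim
    case (elim z)
    show ?case
    proof
      assume z: "z \<in> ball x (s / 2)"
      then have zx: "norm (x - z) < s / 2" by (simp add: dist_norm)
      then have "z \<notin> closure {y. f2 y \<noteq> 0}" using cl s by auto
      then have "T f2 z = (LINT y|lebesgue. K z y * f2 y)" using elim by blast
      also have "\<dots> = (LINT y:U|lebesgue. K z y * f y)"
        unfolding set_lebesgue_integral_def
        by (intro Bochner_Integration.integral_cong) (auto simp: f2_def split: split_indicator)
      finally have Tz: "T f2 z = (LINT y:U|lebesgue. K z y * f y)" .
      have "s / 2 \<le> norm (z - y)" if "y \<in> U" for y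
      proof -
        have "s \<le> norm (x - y)" using that U(2) by auto
        then show ?thesis using zx norm_triangle_ineq[of "x - z" "z - y"] by simp
      qed
      then have i: "set_integrable lebesgue U (\<lambda>y. K x y * f y)" "set_integrable lebesgue U (\<lambda>y. K z y * f y)"
        using kernel_far_integrable[OF f s U(1,2)] kernel_far_integrable[OF f _ U(1), of "s / 2" z] s by auto
      have "norm ((LINT y:U|lebesgue. K x y * f y) - (LINT y:U|lebesgue. K z y * f y)) = norm (LINT y:U|lebesgue. (K x y - K z y) * f y)"
        using set_integral_diff(2)[OF i] by (simp add: left_diff_distrib)
      also have "\<dots> \<le> D * A"
      proof (rule norm_set_integral_le)
        have "(\<integral>\<^sup>+y\<in>U. ennreal (norm ((K x y - K z y) * f y)) \<partial>lebesgue)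
          \<le> (\<integral>\<^sup>+y\<in>{y. s \<le> norm (x - y)}. ennreal (norm (K x y - K z y)) * modulus f y \<partial>lebesgue)"
          using U(2) by (intro nn_integral_mono) (auto simp: modulus_def norm_mult ennreal_mult split: split_indicator)
        also have "\<dots> \<le> ennreal (D * A)" unfolding D_def
          by (rule kernel_diff_integral[OF _ zx A g1]) simp
        finally show "(\<integral>\<^sup>+y\<in>U. ennreal (norm ((K x y - K z y) * f y)) \<partial>lebesgue) \<le> ennreal (D * A)" .
      qed (use D0 A in simp)
      finally have "X \<le> D * A + norm (T f2 z)" unfolding X_def Tz
        using norm_triangle_sub[of "LINT y:U|lebesgue. K x y * f y" "LINT y:U|lebesgue. K z y * f y"] by linarith
      moreover have "norm (T f2 z) \<le> norm (T f z) + norm (T f1 z)"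
        using elim(1) norm_triangle_ineq4[of "T f z" "T f1 z"] by simp
      ultimately show "X \<le> D * A + norm (T f z) + norm (T f1 z)" by linarith
    qed
  qed
  have X0: "0 \<le> X" by (simp add: X_def)
  let ?b = "ball x (s / 2)"
  have em: "emeasure lebesgue ?b = ennreal (\<omega> * (s / 2) ^ CARD('n))"
    using emeasure_ball[of "s / 2" x] s by (simp add: \<omega>_def)
  have "ennreal (X\<^sup>2) * ennreal (\<omega> * (s / 2) ^ CARD('n)) = (\<integral>\<^sup>+z. ennreal (X\<^sup>2) * indicator ?b z \<partial>lebesgue)"
    by (simp add: nn_integral_cmult em)
  also have "\<dots> \<le> (\<integral>\<^sup>+z. (ennreal (3 * (D * A)\<^sup>2) * indicator ?b z + (3 * (sqf (T f) z * indicator ?b z) + 3 * sqf (T f1) z)) \<partial>lebesgue)"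
  proof (rule nn_integral_mono_AE)
    show "AE z in lebesgue. ennreal (X\<^sup>2) * indicator ?b z \<le> ennreal (3 * (D * A)\<^sup>2) * indicator ?b z + (3 * (sqf (T f) z * indicator ?b z) + 3 * sqf (T f1) z)"
      using ae
    proof eventually_elim
      case (elim z)
      show ?case
      proof (cases "z \<in> ?b")
        case True
        let ?u = "D * A" and ?v = "norm (T f z)" and ?w = "norm (T f1 z)"
        have "X\<^sup>2 \<le> (?u + ?v + ?w)\<^sup>2" using elim True X0 by (intro power_mono) auto
        also have "\<dots> \<le> 3 * ?u\<^sup>2 + (3 * ?v\<^sup>2 + 3 * ?w\<^sup>2)"
        proof -
          have "0 \<le> (?u - ?v)\<^sup>2 + (?v - ?w)\<^sup>2 + (?u - ?w)\<^sup>2" by simp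
          then show ?thesis by (simp add: power2_eq_square algebra_simps)
        qed
        finally have "ennreal (X\<^sup>2) \<le> ennreal (3 * ?u\<^sup>2 + (3 * ?v\<^sup>2 + 3 * ?w\<^sup>2))" by (rule ennreal_leI)
        also have "\<dots> = ennreal (3 * ?u\<^sup>2) + (3 * sqf (T f) z + 3 * sqf (T f1) z)"
          by (simp add: ennreal_plus sqf_def ennreal_mult)
        finally show ?thesis using True by simp
      qed simp
    qed
  qed
  also have "\<dots> = ennreal (3 * (D * A)\<^sup>2) * emeasure lebesgue ?b + (3 * (\<integral>\<^sup>+z\<in>?b. sqf (T f) z \<partial>lebesgue) + 3 * (\<integral>\<^sup>+z. sqf (T f1) z \<partial>lebesgue))"
    by (simp add: nn_integral_add nn_integral_cmult)
  also have "\<dots> \<le> ennreal (3 * (D * A)\<^sup>2) * ennreal (\<omega> * (s / 2) ^ CARD('n)) + (3 * ennreal (A\<^sup>2 * (s / 2) ^ CARD('n)) + 3 * ennreal (B\<^sup>2 * (A\<^sup>2 * (2 * s) ^ CARD('n))))"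
  proof (intro add_mono mult_left_mono)
    have "(\<integral>\<^sup>+z. sqf (T f1) z \<partial>lebesgue) \<le> ennreal (B\<^sup>2) * (\<integral>\<^sup>+z. sqf f1 z \<partial>lebesgue)"
      by (rule T_bound[OF sq1])
    also have "(\<integral>\<^sup>+z. sqf f1 z \<partial>lebesgue) = (\<integral>\<^sup>+z\<in>-U. sqf f z \<partial>lebesgue)"
      unfolding f1_def by (rule sqf_indicator_integral)
    also have "\<dots> \<le> (\<integral>\<^sup>+z\<in>ball x (2 * s). sqf f z \<partial>lebesgue)"
      using U(3) by (intro nn_integral_mono) (auto split: split_indicator)
    also have "\<dots> \<le> ennreal (A\<^sup>2 * (2 * s) ^ CARD('n))" using s g2 by (intro growthD) auto
    finally show "(\<integral>\<^sup>+z. sqf (T f1) z \<partial>lebesgue) \<le> ennreal (B\<^sup>2 * (A\<^sup>2 * (2 * s) ^ CARD('n)))"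
      using s by (simp add: ennreal_mult mult_left_mono)
  qed (use s g3 em in \<open>auto intro!: growthD\<close>)
  also have "\<dots> = ennreal (3 * (D * A)\<^sup>2 * (\<omega> * (s / 2) ^ CARD('n)) + (3 * (A\<^sup>2 * (s / 2) ^ CARD('n)) + 3 * (B\<^sup>2 * (A\<^sup>2 * (2 * s) ^ CARD('n)))))"
    using s \<omega> by (simp add: ennreal_plus ennreal_mult)
  finally have "ennreal (X\<^sup>2 * (\<omega> * (s / 2) ^ CARD('n))) \<le> \<dots>"
    using s \<omega> by (simp only: ennreal_mult zero_le_power2 mult_nonneg_nonneg less_imp_le zero_le_power divide_nonneg_pos zero_less_numeral)
  then have "X\<^sup>2 * (\<omega> * (s / 2) ^ CARD('n)) \<le> 3 * (D * A)\<^sup>2 * (\<omega> * (s / 2) ^ CARD('n)) + (3 * (A\<^sup>2 * (s / 2) ^ CARD('n)) + 3 * (B\<^sup>2 * (A\<^sup>2 * (2 * s) ^ CARD('n))))"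
    using s \<omega> by (subst (asm) ennreal_le_iff) auto
  also have "(2 * s) ^ CARD('n) = 4 ^ CARD('n) * (s / 2) ^ CARD('n)"
  proof -
    have "(2 * s) ^ CARD('n) = (4 * (s / 2)) ^ CARD('n)" by simp
    then show ?thesis by (simp only: power_mult_distrib)
  qed
  also have "3 * (D * A)\<^sup>2 * (\<omega> * (s / 2) ^ CARD('n)) + (3 * (A\<^sup>2 * (s / 2) ^ CARD('n)) + 3 * (B\<^sup>2 * (A\<^sup>2 * (4 ^ CARD('n) * (s / 2) ^ CARD('n)))))
    = (3 * (D\<^sup>2 + (1 + B\<^sup>2 * 4 ^ CARD('n)) / \<omega>) * A\<^sup>2) * (\<omega> * (s / 2) ^ CARD('n))"
    using \<omega> by (simp add: field_simps power_mult_distrib)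
  also have "3 * (D\<^sup>2 + (1 + B\<^sup>2 * 4 ^ CARD('n)) / \<omega>) = cotc\<^sup>2"
    unfolding cotc_def D_def[symmetric] \<omega>_def[symmetric] using \<omega>
    by (subst real_sqrt_pow2) (auto intro!: mult_nonneg_nonneg add_nonneg_nonneg divide_nonneg_nonneg)
  finally have "X\<^sup>2 * (\<omega> * (s / 2) ^ CARD('n)) \<le> (cotc * A)\<^sup>2 * (\<omega> * (s / 2) ^ CARD('n))"
    by (simp only: power_mult_distrib)
  moreover have "0 < \<omega> * (s / 2) ^ CARD('n)" using s \<omega> by simp
  ultimately have "X\<^sup>2 \<le> (cotc * A)\<^sup>2" by (rule mult_right_le_imp_le)
  then have "X \<le> cotc * A" using cotc_nonneg A by (rule power2_le_imp_le[OF _ mult_nonneg_nonneg])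
  then show ?thesis by (simp only: X_def)
qed

text \<open>A two-sided truncation is the difference of two one-sided ones, over
  \<open>{y. e < norm (x - y)}\<close> and \<open>{y. v \<le> norm (x - y)}\<close>. The one-sided
  estimate allows any \<open>U\<close> between a closed exterior region and the complement of a ball
  precisely to cover both kinds of boundary.\<close>

lemma cotlar:
  assumes f: "sqint f" and A: "0 \<le> A"
    and gr: "growth (modulus f) x A" "growth (sqf f) x (A\<^sup>2)" "growth (sqf (T f)) x (A\<^sup>2)"
  shows "max_truncation K f x \<le> ennreal (2 * cotc * A)"
proof (rule max_truncation_leI)
  fix e v :: real assume ev: "0 < e" "e < v"
  let ?U = "{y. e < norm (x - y)}" and ?V = "{y. v \<le> norm (x - y)}"
  have U: "?U \<in> sets lebesgue"
  proof -
    have "open ?U" by (intro open_Collect_less continuous_intros)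
    then show ?thesis by (metis borel_open sets_completionI_sets sets_lborel)
  qed
  have UV: "?U = ann x e v \<union> ?V" "ann x e v \<inter> ?V = {}" using ev by (auto simp: ann_def)
  have "(LINT y:?U|lebesgue. K x y * f y) = tr K f e v x + (LINT y:?V|lebesgue. K x y * f y)"
    unfolding UV(1) tr_def using ev
    by (intro set_integral_Un UV(2) kernel_far_integrable[OF f, of e] kernel_far_integrable[OF f, of v])
       (auto simp: ann_def)
  then have "tr K f e v x = (LINT y:?U|lebesgue. K x y * f y) - (LINT y:?V|lebesgue. K x y * f y)" by simp
  then have "norm (tr K f e v x) \<le> norm (LINT y:?U|lebesgue. K x y * f y) + norm (LINT y:?V|lebesgue. K x y * f y)"
    by (simp only: norm_triangle_ineq4)
  also have "\<dots> \<le> cotc * A + cotc * A"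
    using ev U by (intro add_mono cotlar_half[OF f _ A _ _ _ gr, of e] cotlar_half[OF f _ A _ _ _ gr, of v])
      (auto simp: dist_norm)
  finally show "norm (tr K f e v x) \<le> 2 * cotc * A" by (simp add: mult_ac)
qed

text \<open>Outside the sets where the maximal functions of the squares of \<open>f\<close> and
  \<open>T f\<close> exceed \<open>A\<^sup>2\<close>, Cotlar's inequality applies; their masses give
  \<open>1\<close> and \<open>B\<^sup>2\<close> in the constant.\<close>

lemma max_truncation_weak22:
  assumes f: "sqint f" and A: "0 < A"
  shows "\<exists>G\<in>sets lebesgue. {x. \<not> max_truncation K f x \<le> ennreal (2 * cotc * 2 ^ CARD('n) * A)} \<subseteq> G \<and>
    emeasure lebesgue G \<le> ennreal (10 ^ CARD('n) * (1 + B\<^sup>2) / A\<^sup>2) * (\<integral>\<^sup>+x. sqf f x \<partial>lebesgue)"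
proof -
  have [measurable]: "T f \<in> borel_measurable lebesgue" "f \<in> borel_measurable lebesgue"
    using T_sqint[OF f] f by (auto simp: sqint_def)
  obtain G1 where G1: "G1 \<in> sets lebesgue" "{x. \<not> growth (sqf f) x (A\<^sup>2)} \<subseteq> G1"
      "emeasure lebesgue G1 \<le> ennreal (10 ^ CARD('n) / A\<^sup>2) * (\<integral>\<^sup>+x. sqf f x \<partial>lebesgue)"
    using growth_weak_type[of "sqf f" "A\<^sup>2"] A by auto
  obtain G2 where G2: "G2 \<in> sets lebesgue" "{x. \<not> growth (sqf (T f)) x (A\<^sup>2)} \<subseteq> G2"
      "emeasure lebesgue G2 \<le> ennreal (10 ^ CARD('n) / A\<^sup>2) * (\<integral>\<^sup>+x. sqf (T f) x \<partial>lebesgue)"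
    using growth_weak_type[of "sqf (T f)" "A\<^sup>2"] A by auto
  have sub: "{x. \<not> max_truncation K f x \<le> ennreal (2 * cotc * 2 ^ CARD('n) * A)} \<subseteq> G1 \<union> G2"
  proof (rule subsetI, rule ccontr)
    fix x assume x: "x \<in> {x. \<not> max_truncation K f x \<le> ennreal (2 * cotc * 2 ^ CARD('n) * A)}" "x \<notin> G1 \<union> G2"
    then have gr: "growth (sqf f) x (A\<^sup>2)" "growth (sqf (T f)) x (A\<^sup>2)" using G1(2) G2(2) by auto
    \<comment> \<open>Growth of the square controls growth of the modulus only with
      \<open>2 ^ CARD('n) * A\<close>, so all three hypotheses of \<open>cotlar\<close> are brought
      to that common constant.\<close>
    have AA: "A\<^sup>2 \<le> (2 ^ CARD('n) * A)\<^sup>2"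
      using A by (intro power_mono) (simp_all add: mult_le_cancel_right1)
    have "max_truncation K f x \<le> ennreal (2 * cotc * (2 ^ CARD('n) * A))"
      using A gr by (intro cotlar f growth_modulus_of_sqf growth_mono[OF gr(1) AA] growth_mono[OF gr(2) AA]) auto
    then show False using x(1) by (simp add: mult.assoc)
  qed
  have "emeasure lebesgue (G1 \<union> G2) \<le> emeasure lebesgue G1 + emeasure lebesgue G2"
    using G1 G2 by (intro emeasure_subadditive)
  also have "\<dots> \<le> ennreal (10 ^ CARD('n) / A\<^sup>2) * (\<integral>\<^sup>+x. sqf f x \<partial>lebesgue)
      + ennreal (10 ^ CARD('n) / A\<^sup>2) * (ennreal (B\<^sup>2) * (\<integral>\<^sup>+x. sqf f x \<partial>lebesgue))"
    by (intro add_mono G1 order_trans[OF G2(3)] mult_left_mono T_bound f) simp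
  also have "\<dots> = ennreal (10 ^ CARD('n) / A\<^sup>2 + 10 ^ CARD('n) / A\<^sup>2 * B\<^sup>2) * (\<integral>\<^sup>+x. sqf f x \<partial>lebesgue)"
  proof -
    have n: "0 \<le> 10 ^ CARD('n) / A\<^sup>2" "0 \<le> B\<^sup>2" by auto
    show ?thesis
      by (simp only: ennreal_plus[OF n(1) mult_nonneg_nonneg[OF n(1,2)]] ennreal_mult[OF n(1,2)] distrib_right mult.assoc)
  qed
  also have "10 ^ CARD('n) / A\<^sup>2 + 10 ^ CARD('n) / A\<^sup>2 * B\<^sup>2 = 10 ^ CARD('n) * (1 + B\<^sup>2) / A\<^sup>2"
    by (simp add: distrib_left add_divide_distrib)
  finally show ?thesis using G1 G2 sub by blast
qed

end

subsection \<open>The weak (1,1) bound for the maximal truncation\<close>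

lemma side_nonzero [simp]: "side q \<noteq> 0"
  using side_pos[of q] by linarith

text \<open>The countable triangle inequality: finite partial unions satisfy it, and their integrals
  converge because the function is integrable on the whole union.\<close>

lemma norm_integral_UN_le:
  fixes h :: "'a \<Rightarrow> complex" and W :: "'i::countable set"
  assumes S [measurable]: "\<And>q. q \<in> W \<Longrightarrow> S q \<in> sets M"
    and disj: "\<And>q r. q \<in> W \<Longrightarrow> r \<in> W \<Longrightarrow> q \<noteq> r \<Longrightarrow> S q \<inter> S r = {}"
    and int: "set_integrable M (\<Union>q\<in>W. S q) h"
  shows "ennreal (norm (LINT y:(\<Union>q\<in>W. S q)|M. h y)) \<le> (\<integral>\<^sup>+q. ennreal (norm (LINT y:S q|M. h y)) \<partial>count_space W)"
proof -
  define F where "F i = {q \<in> W. to_nat q < i}" for i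
  define A where "A i = (\<Union>q\<in>F i. S q)" for i
  have fin: "finite (F i)" for i
  proof (rule finite_imageD)
    show "finite (to_nat ` F i)" by (rule finite_subset[of _ "{..<i}"]) (auto simp: F_def)
  qed (auto intro: inj_on_subset[OF inj_to_nat])
  have FW: "F i \<subseteq> W" for i by (auto simp: F_def)
  have Am: "A i \<in> sets M" for i unfolding A_def using fin[of i] FW[of i] S by (intro sets.finite_UN) auto
  have UA: "(\<Union>i. A i) = (\<Union>q\<in>W. S q)" by (auto simp: A_def F_def)
  have "(\<lambda>i. LINT y:A i|M. h y) \<longlonglongrightarrow> (LINT y:(\<Union>i. A i)|M. h y)"
    using Am by (rule set_integral_cont_up) (use int UA in \<open>auto simp: A_def F_def incseq_def\<close>, fastforce?)
  then have lim: "(\<lambda>i. ennreal (norm (LINT y:A i|M. h y))) \<longlonglongrightarrow> ennreal (norm (LINT y:(\<Union>q\<in>W. S q)|M. h y))"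
    unfolding UA by (intro tendsto_ennrealI tendsto_norm)
  show ?thesis
  proof (rule LIMSEQ_le_const2[OF lim], intro exI allI impI)
    fix i :: nat
    have "(LINT y:A i|M. h y) = (\<Sum>q\<in>F i. LINT y:S q|M. h y)"
      unfolding A_def
    proof (rule set_integral_finite_Union[OF fin])
      show "disjoint_family_on S (F i)" using disj FW by (auto simp: disjoint_family_on_def F_def)
      fix q assume "q \<in> F i"
      then have q: "q \<in> W" using FW by blast
      show "S q \<in> sets M" using q by (rule S)
      show "set_integrable M (S q) h" by (rule set_integrable_subset[OF int S[OF q]]) (use q in blast)
    qed
    then have "ennreal (norm (LINT y:A i|M. h y)) \<le> ennreal (\<Sum>q\<in>F i. norm (LINT y:S q|M. h y))"
      by (intro ennreal_leI) (simp add: sum_norm_le)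
    also have "\<dots> = (\<Sum>q\<in>F i. ennreal (norm (LINT y:S q|M. h y)))" by simp
    also have "\<dots> = (\<integral>\<^sup>+q. ennreal (norm (LINT y:S q|M. h y)) * indicator (F i) q \<partial>count_space W)"
      by (subst nn_integral_count_space'[OF fin[of i]]) (use FW in auto)
    also have "\<dots> \<le> (\<integral>\<^sup>+q. ennreal (norm (LINT y:S q|M. h y)) \<partial>count_space W)"
      by (intro nn_integral_mono) (auto split: split_indicator)
    finally show "ennreal (norm (LINT y:A i|M. h y)) \<le> \<dots>" .
  qed
qed

lemma measurable_nn_integral_count_space:
  fixes f :: "'i \<Rightarrow> 'a \<Rightarrow> ennreal"
  assumes "countable C" "\<And>c. c \<in> C \<Longrightarrow> f c \<in> borel_measurable M"
  shows "(\<lambda>x. \<integral>\<^sup>+c. f c x \<partial>count_space C) \<in> borel_measurable M"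
proof (cases "finite C")
  case True
  then show ?thesis using assms by (simp add: nn_integral_count_space_finite)
next
  case False
  have bij: "bij_betw (from_nat_into C) UNIV C" using assms(1) False by (rule bij_betw_from_nat_into)
  have "(\<integral>\<^sup>+c. f c x \<partial>count_space C) = (\<Sum>i. f (from_nat_into C i) x)" for x
    using nn_integral_bij_count_space[OF bij, of "\<lambda>c. f c x"] by (simp add: nn_integral_count_space_nat)
  moreover have "(\<lambda>x. \<Sum>i. f (from_nat_into C i) x) \<in> borel_measurable M"
    using assms False by (intro borel_measurable_suminf_order) (auto intro!: from_nat_into)
  ultimately show ?thesis by simp
qed

lemma nn_integral_split:
  assumes [measurable]: "h \<in> borel_measurable M" "S \<in> sets M"
  shows "(\<integral>\<^sup>+x. h x \<partial>M) = (\<integral>\<^sup>+x\<in>S. h x \<partial>M) + (\<integral>\<^sup>+x\<in>space M - S. h x \<partial>M)"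
proof -
  have "(\<integral>\<^sup>+x. h x \<partial>M) = (\<integral>\<^sup>+x. (h x * indicator S x + h x * indicator (space M - S) x) \<partial>M)"
    by (intro nn_integral_cong) (auto split: split_indicator)
  also have "\<dots> = (\<integral>\<^sup>+x\<in>S. h x \<partial>M) + (\<integral>\<^sup>+x\<in>space M - S. h x \<partial>M)"
    by (intro nn_integral_add) auto
  finally show ?thesis .
qed

section \<open>Calderon-Zygmund decomposition\<close>

lemma outer_open:
  fixes S :: "'a::euclidean_space set"
  assumes "S \<in> sets lebesgue" "emeasure lebesgue S \<le> ennreal a" "0 \<le> a" "0 < e"
  obtains U where "open U" "S \<subseteq> U" "emeasure lebesgue U \<le> ennreal (a + e)"
proof -
  obtain U where U: "open U" "S \<subseteq> U" "U - S \<in> lmeasurable" "emeasure lebesgue (U - S) < ennreal e"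
    using sets_lebesgue_outer_open[OF assms(1,4)] by blast
  have "emeasure lebesgue (S \<union> (U - S)) \<le> emeasure lebesgue S + emeasure lebesgue (U - S)"
    using U(3) assms(1) by (intro emeasure_subadditive) auto
  also have "\<dots> \<le> ennreal a + ennreal e" using assms(2) U(4) by (intro add_mono) auto
  also have "\<dots> = ennreal (a + e)" using assms by simp
  also have "S \<union> (U - S) = U" using U(2) by blast
  finally show ?thesis using that U by blast
qed

text \<open>Selects the maximal cube around \<open>y\<close>. Since the values are countable and the
  fibres are dyadic cubes, anything depending on \<open>y\<close> only through its cube is
  measurable; off \<open>U\<close> the value is a mere default.\<close>

definition wsel :: "(real ^ 'n::finite) set \<Rightarrow> real ^ 'n \<Rightarrow> 'n dyad" where
  "wsel U y = (if y \<in> U then THE q. q \<in> whitney U \<and> y \<in> dset q else (0, 0))"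

lemma wsel_eq:
  assumes "q \<in> whitney U" "y \<in> dset q"
  shows "wsel U y = q"
proof -
  have "y \<in> U" using assms whitney_subset by blast
  moreover have "(THE q. q \<in> whitney U \<and> y \<in> dset q) = q"
    by (rule the_equality) (use assms whitney_disjoint[of q U] in blast)+
  ultimately show ?thesis by (simp add: wsel_def)
qed

lemma wsel_measurable [measurable]:
  fixes U :: "(real ^ 'n) set"
  assumes "open U" "emeasure lebesgue U < \<infinity>"
  shows "wsel U \<in> measurable lebesgue (count_space UNIV)"
  unfolding measurable_count_space_eq2_countable
proof (intro conjI ballI)
  fix q :: "'n dyad"
  have U: "U \<in> sets lebesgue" using assms(1) by (metis borel_open sets_completionI_sets sets_lborel)
  have "wsel U -` {q} \<inter> space lebesgue = (if q \<in> whitney U then dset q else {}) \<union> (if q = (0, 0) then UNIV - U else {})"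
    (is "?L = ?R")
  proof (rule set_eqI)
    fix y
    show "y \<in> ?L \<longleftrightarrow> y \<in> ?R"
    proof (cases "y \<in> U")
      case True
      obtain r where r: "r \<in> whitney U" "y \<in> dset r" using whitney_cover[OF assms True] by blast
      then have "wsel U y = r" by (rule wsel_eq)
      moreover have "q \<in> whitney U \<Longrightarrow> y \<in> dset q \<Longrightarrow> q = r" using r whitney_disjoint[of q U r] by blast
      ultimately show ?thesis using r True by auto
    next
      case False
      then have "q \<in> whitney U \<Longrightarrow> y \<notin> dset q" using whitney_subset by blast
      then show ?thesis using False by (auto simp: wsel_def)
    qed
  qed
  moreover have "?R \<in> sets lebesgue" using U by (intro sets.Un) auto
  ultimately show "wsel U -` {q} \<inter> space lebesgue \<in> sets lebesgue" by simp
qed simp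

lemma nn_integral_whitney:
  fixes U :: "(real ^ 'n) set"
  assumes "open U" "emeasure lebesgue U < \<infinity>" "h \<in> borel_measurable lebesgue"
  shows "(\<integral>\<^sup>+q. (\<integral>\<^sup>+y. h y * indicator (dset q) y \<partial>lebesgue) \<partial>count_space (whitney U)) = (\<integral>\<^sup>+y\<in>U. h y \<partial>lebesgue)"
proof -
  have "(\<integral>\<^sup>+q. (\<integral>\<^sup>+y. h y * indicator (dset q) y \<partial>lebesgue) \<partial>count_space (whitney U))
     = (\<integral>\<^sup>+y. h y * indicator (\<Union>q\<in>whitney U. dset q) y \<partial>lebesgue)"
    by (rule nn_integral_disjoint_le) (use assms in \<open>auto intro: countableI_type dest: whitney_disjoint\<close>)
  then show ?thesis by (simp only: whitney_Union[OF assms(1,2)])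
qed

text \<open>The open set \<open>U\<close> contains both the points with
  \<open>norm (f x) \<ge> lam\<close> and the points where growth at level \<open>lam\<close> fails.
  The former makes \<open>f\<close> small off \<open>U\<close> at every point. The latter bounds the
  average on each maximal cube, because the cube lies in a ball of radius
  \<open>4 * CARD('n) * side q\<close> around a point outside \<open>U\<close>. In the measure of
  \<open>U\<close>, \<open>10 ^ CARD('n)\<close> is the maximal inequality, and the 2 is one unit
  for Markov's inequality and one for the passage to an open set.\<close>

lemma cz_decomposition:
  fixes f :: "real ^ 'n \<Rightarrow> complex" and lam M :: real
  assumes f: "integrable lebesgue f" and lam: "0 < lam" and M: "0 < M"
    and fM: "(\<integral>\<^sup>+x. modulus f x \<partial>lebesgue) \<le> ennreal M"
  obtains U g b where "open U" "emeasure lebesgue U \<le> ennreal ((10 ^ CARD('n) + 2) * M / lam)"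
    "f = (\<lambda>y. g y + b y)" "integrable lebesgue g" "integrable lebesgue b"
    "\<And>y. norm (g y) \<le> (4 * real CARD('n)) ^ CARD('n) * lam"
    "(\<integral>\<^sup>+x. modulus g x \<partial>lebesgue) \<le> ennreal M"
    "(\<integral>\<^sup>+x. modulus b x \<partial>lebesgue) \<le> ennreal (2 * M)"
    "\<And>y. y \<notin> U \<Longrightarrow> b y = 0"
    "\<And>q. q \<in> whitney U \<Longrightarrow> (LINT y:dset q|lebesgue. b y) = 0"
proof -
  note fm [measurable] = borel_measurable_integrable[OF f]
  let ?n = "CARD('n)"
  let ?L = "(4 * real ?n) ^ ?n"
  have n1: "1 \<le> real ?n" using zero_less_card_finite[where 'a='n] by linarith
  have L1: "1 \<le> ?L" using n1 by (intro one_le_power) linarith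
  define E where "E = {x \<in> space lebesgue. 1 \<le> ennreal (1 / lam) * modulus f x}"
  have E: "E \<in> sets lebesgue" unfolding E_def by measurable
  have Em: "emeasure lebesgue E \<le> ennreal (M / lam)"
  proof -
    have "emeasure lebesgue {x \<in> space lebesgue. 1 \<le> ennreal (1 / lam) * modulus f x}
       \<le> ennreal (1 / lam) * (\<integral>\<^sup>+x. modulus f x * indicator (space lebesgue) x \<partial>lebesgue)"
      by (rule nn_integral_Markov_inequality) auto
    also have "\<dots> \<le> ennreal (1 / lam) * ennreal M" using fM by (intro mult_left_mono) auto
    also have "\<dots> = ennreal (M / lam)" using lam M by (subst ennreal_mult[symmetric]) auto
    finally show ?thesis unfolding E_def .
  qed
  obtain G where G: "G \<in> sets lebesgue" "{x. \<not> growth (modulus f) x lam} \<subseteq> G"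
      "emeasure lebesgue G \<le> ennreal (10 ^ ?n / lam) * (\<integral>\<^sup>+x. modulus f x \<partial>lebesgue)"
    using growth_weak_type[of "modulus f" lam] lam by auto
  have Gm: "emeasure lebesgue G \<le> ennreal (10 ^ ?n * M / lam)"
  proof -
    have "ennreal (10 ^ ?n / lam) * (\<integral>\<^sup>+x. modulus f x \<partial>lebesgue) \<le> ennreal (10 ^ ?n / lam) * ennreal M"
      using fM by (intro mult_left_mono) auto
    also have "\<dots> = ennreal (10 ^ ?n * M / lam)" using lam M by (subst ennreal_mult[symmetric]) auto
    finally show ?thesis using G(3) by (rule order_trans[rotated])
  qed
  have "emeasure lebesgue (E \<union> G) \<le> emeasure lebesgue E + emeasure lebesgue G"
    using E G by (intro emeasure_subadditive)
  also have "\<dots> \<le> ennreal (M / lam) + ennreal (10 ^ ?n * M / lam)" by (intro add_mono Em Gm)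
  also have "\<dots> = ennreal (M / lam + 10 ^ ?n * M / lam)" using lam M by (intro ennreal_plus[symmetric]) auto
  finally have EGm: "emeasure lebesgue (E \<union> G) \<le> ennreal (M / lam + 10 ^ ?n * M / lam)" .
  obtain U where U: "open U" "E \<union> G \<subseteq> U" "emeasure lebesgue U \<le> ennreal (M / lam + 10 ^ ?n * M / lam + M / lam)"
    by (rule outer_open[OF sets.Un[OF E G(1)] EGm, of "M / lam"]) (use lam M in auto)
  have Um: "emeasure lebesgue U \<le> ennreal ((10 ^ ?n + 2) * M / lam)"
  proof -
    have "M / lam + 10 ^ ?n * M / lam + M / lam = (10 ^ ?n + 2) * M / lam"
      by (simp only: distrib_right add_divide_distrib mult_2 add_ac)
    then show ?thesis using U(3) by (simp only:)
  qed
  have Ufin: "emeasure lebesgue U < \<infinity>" using order_le_less_trans[OF Um ennreal_less_top] by simp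
  have Us [measurable]: "U \<in> sets lebesgue" using U(1) by (metis borel_open sets_completionI_sets sets_lborel)
  have small: "norm (f y) \<le> lam" if "y \<notin> U" for y
  proof -
    have "y \<notin> E" using that U(2) by blast
    then have "\<not> 1 \<le> ennreal (1 / lam * norm (f y))"
      using lam by (simp add: E_def modulus_def ennreal_mult'[symmetric])
    then have "\<not> 1 \<le> 1 / lam * norm (f y)" using ennreal_leI[of 1 "1 / lam * norm (f y)"] by auto
    then show ?thesis using lam by (simp add: field_simps)
  qed
  let ?W = "whitney U"
  have mass: "(\<integral>\<^sup>+y\<in>dset q. modulus f y \<partial>lebesgue) \<le> ennreal (?L * lam * side q ^ ?n)" if q: "q \<in> ?W" for q
  proof -
    obtain z where z: "z \<notin> U" "\<And>x. x \<in> dset q \<Longrightarrow> norm (x - z) \<le> 2 * ?n * side q"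
      using whitney_near[OF q] by blast
    have "2 * ?n * side q < 4 * ?n * side q" using n1 by simp
    then have sub: "dset q \<subseteq> ball z (4 * ?n * side q)"
    proof (intro subsetI)
      fix x assume "x \<in> dset q"
      from z(2)[OF this] have "norm (x - z) < 4 * ?n * side q" using \<open>2 * ?n * side q < 4 * ?n * side q\<close> by linarith
      then show "x \<in> ball z (4 * ?n * side q)" by (simp add: dist_norm norm_minus_commute)
    qed
    have "growth (modulus f) z lam" using z(1) U(2) G(2) by blast
    then have "(\<integral>\<^sup>+y\<in>ball z (4 * ?n * side q). modulus f y \<partial>lebesgue) \<le> ennreal (lam * (4 * ?n * side q) ^ ?n)"
      using n1 by (intro growthD) auto
    moreover have "(\<integral>\<^sup>+y\<in>dset q. modulus f y \<partial>lebesgue) \<le> (\<integral>\<^sup>+y\<in>ball z (4 * ?n * side q). modulus f y \<partial>lebesgue)"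
      using sub by (intro nn_integral_mono) (auto split: split_indicator)
    ultimately show ?thesis by (simp add: power_mult_distrib mult_ac)
  qed
  define a where "a q = (1 / side q ^ ?n) *\<^sub>R (LINT y:dset q|lebesgue. f y)" for q :: "'n dyad"
  have fd: "set_integrable lebesgue (dset q) f" for q
    unfolding set_integrable_def by (intro integrable_mult_indicator f) simp
  have amass: "ennreal (norm (a q) * side q ^ ?n) \<le> (\<integral>\<^sup>+y\<in>dset q. modulus f y \<partial>lebesgue)" for q
  proof -
    have "norm (a q) * side q ^ ?n = norm (LINT y:dset q|lebesgue. f y)"
      using side_pos[of q] by (simp add: a_def)
    moreover have "ennreal (norm (LINT y:dset q|lebesgue. f y)) \<le> (\<integral>\<^sup>+y. ennreal (norm (indicator (dset q) y *\<^sub>R f y)) \<partial>lebesgue)"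
      using fd[of q] unfolding set_lebesgue_integral_def set_integrable_def by (rule integral_norm_bound_ennreal)
    moreover have "\<dots> = (\<integral>\<^sup>+y\<in>dset q. modulus f y \<partial>lebesgue)"
      by (intro nn_integral_cong) (auto simp: modulus_def split: split_indicator)
    ultimately show ?thesis by simp
  qed
  have abd: "norm (a q) \<le> ?L * lam" if "q \<in> ?W" for q
  proof -
    have "ennreal (norm (a q) * side q ^ ?n) \<le> ennreal (?L * lam * side q ^ ?n)"
      using amass[of q] mass[OF that] by (rule order_trans)
    then have "norm (a q) * side q ^ ?n \<le> ?L * lam * side q ^ ?n"
      using lam L1 by (subst (asm) ennreal_le_iff) auto
    then show ?thesis using side_pos[of q] by (simp add: mult_le_cancel_right)
  qed
  define g where "g y = (if y \<in> U then a (wsel U y) else f y)" for y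
  define b where "b y = f y - g y" for y
  have [measurable]: "(\<lambda>y. a (wsel U y)) \<in> borel_measurable lebesgue"
    using wsel_measurable[OF U(1) Ufin] by (rule measurable_compose) simp
  have gm [measurable]: "g \<in> borel_measurable lebesgue" unfolding g_def by measurable
  have gq: "g y = a q" if "q \<in> ?W" "y \<in> dset q" for q y
    using that wsel_eq[OF that] whitney_subset[OF that(1)] by (auto simp: g_def)
  have gb: "norm (g y) \<le> ?L * lam" for y
  proof (cases "y \<in> U")
    case True
    then obtain q where "q \<in> ?W" "y \<in> dset q" using whitney_cover[OF U(1) Ufin True] by blast
    then show ?thesis using gq abd by simp
  next
    case False
    have "lam \<le> ?L * lam" using mult_right_mono[OF L1, of lam] lam by simp
    with small[OF False] have "norm (f y) \<le> ?L * lam" by (rule order_trans)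
    then show ?thesis using False by (simp only: g_def if_False)
  qed
  have cW: "countable ?W" by (rule countableI_type)
  have Weq: "(\<integral>\<^sup>+q. (\<integral>\<^sup>+y\<in>dset q. h y \<partial>lebesgue) \<partial>count_space ?W) = (\<integral>\<^sup>+y\<in>U. h y \<partial>lebesgue)"
    if "h \<in> borel_measurable lebesgue" for h
    using U(1) Ufin that by (rule nn_integral_whitney)
  have gq1: "(\<integral>\<^sup>+y\<in>dset q. modulus g y \<partial>lebesgue) \<le> (\<integral>\<^sup>+y\<in>dset q. modulus f y \<partial>lebesgue)" if q: "q \<in> ?W" for q
  proof -
    have "(\<integral>\<^sup>+y\<in>dset q. modulus g y \<partial>lebesgue) = (\<integral>\<^sup>+y. ennreal (norm (a q)) * indicator (dset q) y \<partial>lebesgue)"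
      using gq[OF q] by (intro nn_integral_cong) (auto simp: modulus_def split: split_indicator)
    also have "\<dots> = ennreal (norm (a q) * side q ^ ?n)"
      by (simp add: nn_integral_cmult emeasure_dset ennreal_mult)
    also note amass[of q]
    finally show ?thesis .
  qed
  have gint: "(\<integral>\<^sup>+x. modulus g x \<partial>lebesgue) \<le> (\<integral>\<^sup>+x. modulus f x \<partial>lebesgue)"
  proof -
    have "(\<integral>\<^sup>+x\<in>U. modulus g x \<partial>lebesgue) \<le> (\<integral>\<^sup>+x\<in>U. modulus f x \<partial>lebesgue)"
      unfolding Weq[OF modulus_measurable[OF gm], symmetric] Weq[OF modulus_measurable[OF fm], symmetric]
      by (rule nn_integral_mono) (simp add: gq1)
    moreover have "(\<integral>\<^sup>+x\<in>space lebesgue - U. modulus g x \<partial>lebesgue) = (\<integral>\<^sup>+x\<in>space lebesgue - U. modulus f x \<partial>lebesgue)"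
      by (intro nn_integral_cong) (auto simp: g_def modulus_def split: split_indicator)
    ultimately show ?thesis
      unfolding nn_integral_split[OF modulus_measurable[OF gm] Us] nn_integral_split[OF modulus_measurable[OF fm] Us]
      by (simp add: add_right_mono)
  qed
  have gi: "integrable lebesgue g"
    by (rule integrableI_bounded[OF gm]) (use order_le_less_trans[OF order_trans[OF gint fM] ennreal_less_top] in \<open>simp add: modulus_def[abs_def]\<close>)
  have bi: "integrable lebesgue b" unfolding b_def using f gi by simp
  have bint: "(\<integral>\<^sup>+x. modulus b x \<partial>lebesgue) \<le> ennreal (2 * M)"
  proof -
    have "(\<integral>\<^sup>+x. modulus b x \<partial>lebesgue) \<le> (\<integral>\<^sup>+x. (modulus f x + modulus g x) \<partial>lebesgue)"
    proof (rule nn_integral_mono)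
      fix x
      have "ennreal (norm (b x)) \<le> ennreal (norm (f x) + norm (g x))" unfolding b_def by (intro ennreal_leI norm_triangle_ineq4)
      then show "modulus b x \<le> modulus f x + modulus g x" by (simp add: modulus_def)
    qed
    also have "\<dots> = (\<integral>\<^sup>+x. modulus f x \<partial>lebesgue) + (\<integral>\<^sup>+x. modulus g x \<partial>lebesgue)"
      by (intro nn_integral_add) auto
    also have "\<dots> \<le> ennreal M + ennreal M" using fM gint by (intro add_mono) auto
    also have "\<dots> = ennreal (2 * M)" using M by (simp flip: ennreal_plus)
    finally show ?thesis .
  qed
  have b0: "b y = 0" if "y \<notin> U" for y using that by (simp add: b_def g_def)
  have bq: "(LINT y:dset q|lebesgue. b y) = 0" if q: "q \<in> ?W" for q
  proof -
    have "(LINT y:dset q|lebesgue. b y) = (LINT y:dset q|lebesgue. f y - a q)"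
      using gq[OF q] by (intro set_lebesgue_integral_cong) (auto simp: b_def)
    also have "\<dots> = (LINT y:dset q|lebesgue. f y) - (LINT y:dset q|lebesgue. a q)"
      by (intro set_integral_diff fd) (auto simp: set_integrable_def integrable_indicator_iff emeasure_dset
        intro!: integrable_scaleR_left)
    also have "(LINT y:dset q|lebesgue. a q) = (side q ^ ?n) *\<^sub>R a q"
      by (subst set_integral_const) (auto simp: emeasure_dset measure_def)
    also have "\<dots> = (LINT y:dset q|lebesgue. f y)" using side_pos[of q] by (simp add: a_def)
    finally show ?thesis by simp
  qed
  show ?thesis
    by (rule that[of U g b]) (use U(1) Um gi bi gb gint fM bint b0 bq in \<open>auto simp: b_def intro: order_trans\<close>)
qed

lemma emeasure_le_add:
  assumes "A \<in> sets M" "B \<in> sets M" "emeasure M A \<le> ennreal a" "emeasure M B \<le> ennreal b" "0 \<le> a" "0 \<le> b"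
  shows "emeasure M (A \<union> B) \<le> ennreal (a + b)"
proof -
  have "emeasure M (A \<union> B) \<le> emeasure M A + emeasure M B" using assms by (intro emeasure_subadditive)
  also have "\<dots> \<le> ennreal a + ennreal b" using assms by (intro add_mono)
  finally show ?thesis using assms by simp
qed

context std_kernel
begin

text \<open>A cube inside the annulus profits from the vanishing mean, with the kernel compared to
  its value at the corner; a cube outside contributes nothing. A cube crossing an edge is small
  compared with its distance to \<open>x\<close>, so it lies entirely in a shell around that edge,
  where size is enough. Both shells are added so that the bound does not depend on the case.\<close>

lemma bad_part_cube:
  fixes b :: "real ^ 'n \<Rightarrow> complex"
  assumes b: "integrable lebesgue b" and b0: "(LINT y:dset q|lebesgue. b y) = 0"
    and x: "4 * r < norm (x - corner q)" and r: "r = real CARD('n) * side q" and ev: "0 < e" "e < v"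
  shows "ennreal (norm (LINT y:ann x e v \<inter> dset q|lebesgue. K x y * b y))
    \<le> ennreal (c * (r powr \<delta> / norm (x - corner q) powr (CARD('n) + \<delta>))) * (\<integral>\<^sup>+y\<in>dset q. modulus b y \<partial>lebesgue)
     + ((\<integral>\<^sup>+y\<in>dset q \<inter> {y. e / 2 \<le> norm (x - y) \<and> norm (x - y) < 2 * e}. ennreal (norm (K x y)) * modulus b y \<partial>lebesgue)
     + (\<integral>\<^sup>+y\<in>dset q \<inter> {y. v / 2 \<le> norm (x - y) \<and> norm (x - y) < 2 * v}. ennreal (norm (K x y)) * modulus b y \<partial>lebesgue))"
    (is "?l \<le> ?A + (?S e + ?S v)")
proof -
  note bm [measurable] = borel_measurable_integrable[OF b]
  have r0: "0 < r" using r by simp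
  have near: "norm (corner q - y) \<le> r" "norm (x - corner q) \<le> norm (x - y) + r" "norm (x - y) \<le> norm (x - corner q) + r" if "y \<in> dset q" for y
    using dset_diam[OF corner_in_dset that] norm_triangle_ineq[of "x - y" "y - corner q"]
      norm_triangle_ineq[of "x - corner q" "corner q - y"] r by (simp_all add: norm_minus_commute)
  have near2: "norm (x - y) \<le> norm (x - y') + r" if "y \<in> dset q" "y' \<in> dset q" for y y'
    using dset_diam[OF that(2,1)] norm_triangle_ineq[of "x - y'" "y' - y"] r by simp
  have far: "3 * r < norm (x - y)" if "y \<in> dset q" for y using near(2)[OF that] x by linarith
  consider (inside) "dset q \<subseteq> ann x e v" | (outside) "dset q \<inter> ann x e v = {}"
    | (cross) y1 y2 where "y1 \<in> dset q" "y2 \<in> dset q" "y1 \<in> ann x e v" "y2 \<notin> ann x e v" by blast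
  then show ?thesis
  proof cases
    case inside
    then have eq: "ann x e v \<inter> dset q = dset q" by blast
    have i1: "set_integrable lebesgue (dset q) (\<lambda>y. K x y * b y)"
      by (rule set_integrable_subset[OF tr_integrable[OF integrable_imp_loc_int[OF b] ev(1), of x v]]) (use inside in auto)
    have i2: "set_integrable lebesgue (dset q) (\<lambda>y. K x (corner q) * b y)"
      unfolding set_integrable_def by (intro integrable_mult_indicator integrable_mult_right b) simp
    have "(LINT y:dset q|lebesgue. (K x y - K x (corner q)) * b y) = (LINT y:dset q|lebesgue. K x y * b y) - (LINT y:dset q|lebesgue. K x (corner q) * b y)"
      unfolding left_diff_distrib by (rule set_integral_diff(2)[OF i1 i2])
    then have "(LINT y:dset q|lebesgue. K x y * b y) = (LINT y:dset q|lebesgue. (K x y - K x (corner q)) * b y)"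
      using b0 by simp
    then have "?l = ennreal (norm (LINT y:dset q|lebesgue. (K x y - K x (corner q)) * b y))" unfolding eq by simp
    also have "\<dots> \<le> (\<integral>\<^sup>+y. ennreal (norm (indicator (dset q) y *\<^sub>R ((K x y - K x (corner q)) * b y))) \<partial>lebesgue)"
      unfolding set_lebesgue_integral_def
      by (rule integral_norm_bound_ennreal)
         (use set_integral_diff(1)[OF i1 i2] in \<open>simp add: left_diff_distrib set_integrable_def\<close>)
    also have "\<dots> \<le> (\<integral>\<^sup>+y. ennreal (c * (r powr \<delta> / norm (x - corner q) powr (CARD('n) + \<delta>))) * (modulus b y * indicator (dset q) y) \<partial>lebesgue)"
    proof (rule nn_integral_mono)
      fix y
      show "ennreal (norm (indicator (dset q) y *\<^sub>R ((K x y - K x (corner q)) * b y))) \<le> ennreal (c * (r powr \<delta> / norm (x - corner q) powr (CARD('n) + \<delta>))) * (modulus b y * indicator (dset q) y)"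
      proof (cases "y \<in> dset q")
        case True
        have "norm (K x (corner q) - K x y) \<le> c * norm (corner q - y) powr \<delta> / norm (x - corner q) powr (real CARD('n) + \<delta>)"
          using near(1)[OF True] x r0 by (intro reg2) linarith
        also have "\<dots> \<le> c * r powr \<delta> / norm (x - corner q) powr (real CARD('n) + \<delta>)"
          using near(1)[OF True] \<delta>_pos c_pos by (intro divide_right_mono mult_left_mono powr_mono2) auto
        finally have "norm (K x y - K x (corner q)) \<le> c * (r powr \<delta> / norm (x - corner q) powr (CARD('n) + \<delta>))"
          by (simp add: norm_minus_commute)
        then have "ennreal (norm (K x y - K x (corner q))) * modulus b y \<le> ennreal (c * (r powr \<delta> / norm (x - corner q) powr (CARD('n) + \<delta>))) * modulus b y"
          by (intro mult_right_mono ennreal_leI) auto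
        then show ?thesis using True by (simp add: norm_mult ennreal_mult modulus_def)
      qed simp
    qed
    also have "\<dots> = ?A" by (rule nn_integral_cmult) measurable
    finally show ?thesis by (simp add: add_increasing2)
  next
    case outside
    then have "ann x e v \<inter> dset q = {}" by blast
    then show ?thesis by (simp add: set_lebesgue_integral_def)
  next
    case cross
    have le: "?l \<le> ?S t" if "\<And>y. y \<in> dset q \<Longrightarrow> t / 2 \<le> norm (x - y) \<and> norm (x - y) < 2 * t" for t
    proof -
      have "set_integrable lebesgue (ann x e v \<inter> dset q) (\<lambda>y. K x y * b y)"
        by (rule set_integrable_subset[OF tr_integrable[OF integrable_imp_loc_int[OF b] ev(1), of x v]]) auto
      then have "?l \<le> (\<integral>\<^sup>+y. ennreal (norm (indicator (ann x e v \<inter> dset q) y *\<^sub>R (K x y * b y))) \<partial>lebesgue)"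
        unfolding set_lebesgue_integral_def set_integrable_def by (rule integral_norm_bound_ennreal)
      also have "\<dots> \<le> ?S t"
        using that by (intro nn_integral_mono) (auto simp: modulus_def norm_mult ennreal_mult split: split_indicator)
      finally show ?thesis .
    qed
    from cross(4) consider "norm (x - y2) \<le> e" | "v \<le> norm (x - y2)" by (auto simp: ann_def)
    then have "?l \<le> ?S e \<or> ?l \<le> ?S v"
    proof cases
      case 1
      \<comment> \<open>Since \<open>3 * r\<close> is less than the distance to \<open>y2\<close>,
        which is at most \<open>e\<close>, all distances from \<open>x\<close> to the cube lie
        between \<open>2 * e / 3\<close> and \<open>4 * e / 3\<close>.\<close>
      have "e / 2 \<le> norm (x - y) \<and> norm (x - y) < 2 * e" if "y \<in> dset q" for y
        using near2[OF that cross(2)] near2[OF cross(1) that] far[OF cross(2)] cross(3) 1 r0 by (auto simp: ann_def)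
      then show ?thesis using le by blast
    next
      case 2
      have "v / 2 \<le> norm (x - y) \<and> norm (x - y) < 2 * v" if "y \<in> dset q" for y
        using near2[OF that cross(1)] near2[OF cross(2) that] far[OF cross(1)] cross(3) 2 r0 by (auto simp: ann_def)
      then show ?thesis using le by blast
    qed
    then show ?thesis
      by (meson add_increasing add_increasing2 order_trans zero_le order_refl)
  qed
qed

end

context cz
begin

definition w11c :: real where
  "w11c = 2 * cotc * 2 ^ CARD('n) + c * (1 + 2 * 4 ^ CARD('n))"

text \<open>One summand for each exceptional set: the large truncations of the good part, the
  failing growth of the bad part, the dilated cubes, and the points where the accumulated tails of
  the bad part are large.\<close>

definition w11k :: real where
  "w11k = 10 ^ CARD('n) * (1 + B\<^sup>2) * (4 * real CARD('n)) ^ CARD('n) + 2 * 10 ^ CARD('n)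
     + (8 * real CARD('n)) ^ CARD('n) * (10 ^ CARD('n) + 2) + 2 * (tailc CARD('n) \<delta> * 2 ^ CARD('n))"

lemma w11c_pos: "0 < w11c"
  unfolding w11c_def using cotc_nonneg c_pos by (intro add_nonneg_pos mult_nonneg_nonneg mult_pos_pos) (auto intro: add_pos_pos)

lemma w11k_pos: "0 < w11k"
  unfolding w11k_def using tailc_pos[OF \<delta>_pos, of "CARD('n)"]
  by (intro add_nonneg_pos add_nonneg_nonneg mult_nonneg_nonneg mult_pos_pos) auto

text \<open>The good part is bounded by a multiple of \<open>lam\<close>, so its square integral is
  at most that multiple times its mass, and the weak (2,2) bound applies. For the bad part the
  contributions of the cubes are summed: cancellation leaves an integrable tail per cube, and the
  crossing cubes together fill only two shells.\<close>

lemma max_truncation_weak11: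
  fixes lam M :: real
  assumes f: "integrable lebesgue f" and lam: "0 < lam" and M: "0 < M"
    and fM: "(\<integral>\<^sup>+x. modulus f x \<partial>lebesgue) \<le> ennreal M"
  shows "\<exists>G\<in>sets lebesgue. {x. \<not> max_truncation K f x \<le> ennreal (w11c * lam)} \<subseteq> G \<and>
    emeasure lebesgue G \<le> ennreal (w11k * M / lam)"
proof -
  let ?n = "CARD('n)"
  let ?L = "(4 * real ?n) ^ ?n"
  have n1: "1 \<le> real ?n" using zero_less_card_finite[where 'a='n] by linarith
  obtain U g b where U: "open U" "emeasure lebesgue U \<le> ennreal ((10 ^ ?n + 2) * M / lam)"
    and fgb: "f = (\<lambda>y. g y + b y)" and gi: "integrable lebesgue g" and bi: "integrable lebesgue b"
    and gb: "\<And>y. norm (g y) \<le> ?L * lam"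
    and gM: "(\<integral>\<^sup>+x. modulus g x \<partial>lebesgue) \<le> ennreal M"
    and bM: "(\<integral>\<^sup>+x. modulus b x \<partial>lebesgue) \<le> ennreal (2 * M)"
    and b0: "\<And>y. y \<notin> U \<Longrightarrow> b y = 0"
    and bq: "\<And>q. q \<in> whitney U \<Longrightarrow> (LINT y:dset q|lebesgue. b y) = 0"
    using cz_decomposition[OF f lam M fM] by blast
  note gm [measurable] = borel_measurable_integrable[OF gi]
  note bm [measurable] = borel_measurable_integrable[OF bi]
  have Ufin: "emeasure lebesgue U < \<infinity>" using order_le_less_trans[OF U(2) ennreal_less_top] by simp
  let ?W = "whitney U"
  have cW: "countable ?W" by (rule countableI_type)
  have WU: "(\<Union>q\<in>?W. dset q) = U" by (rule whitney_Union[OF U(1) Ufin])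
  have Weq: "(\<integral>\<^sup>+q. (\<integral>\<^sup>+y. h y * indicator (dset q) y \<partial>lebesgue) \<partial>count_space ?W) = (\<integral>\<^sup>+y\<in>U. h y \<partial>lebesgue)"
    if "h \<in> borel_measurable lebesgue" for h
    using U(1) Ufin that by (rule nn_integral_whitney)

  have gsq: "(\<integral>\<^sup>+x. sqf g x \<partial>lebesgue) \<le> ennreal (?L * lam * M)"
  proof -
    have "(\<integral>\<^sup>+x. sqf g x \<partial>lebesgue) \<le> (\<integral>\<^sup>+x. ennreal (?L * lam) * modulus g x \<partial>lebesgue)"
    proof (rule nn_integral_mono)
      fix x
      have "(norm (g x))\<^sup>2 \<le> ?L * lam * norm (g x)"
        unfolding power2_eq_square by (intro mult_right_mono gb) simp
      then show "sqf g x \<le> ennreal (?L * lam) * modulus g x"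
        using lam by (simp add: sqf_def modulus_def flip: ennreal_mult')
    qed
    also have "\<dots> = ennreal (?L * lam) * (\<integral>\<^sup>+x. modulus g x \<partial>lebesgue)" by (rule nn_integral_cmult) simp
    also have "\<dots> \<le> ennreal (?L * lam) * ennreal M" by (intro mult_left_mono gM) simp
    also have "\<dots> = ennreal (?L * lam * M)" using lam M by (simp flip: ennreal_mult')
    finally show ?thesis .
  qed
  then have gsi: "sqint g" using gm by (auto simp: sqint_def intro: order_le_less_trans)
  obtain G2 where G2: "G2 \<in> sets lebesgue" "{x. \<not> max_truncation K g x \<le> ennreal (2 * cotc * 2 ^ ?n * lam)} \<subseteq> G2"
      "emeasure lebesgue G2 \<le> ennreal (10 ^ ?n * (1 + B\<^sup>2) / lam\<^sup>2) * (\<integral>\<^sup>+x. sqf g x \<partial>lebesgue)"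
    using max_truncation_weak22[OF gsi lam] by blast
  have G2m: "emeasure lebesgue G2 \<le> ennreal (10 ^ ?n * (1 + B\<^sup>2) * ?L * M / lam)"
  proof -
    have "ennreal (10 ^ ?n * (1 + B\<^sup>2) / lam\<^sup>2) * (\<integral>\<^sup>+x. sqf g x \<partial>lebesgue) \<le> ennreal (10 ^ ?n * (1 + B\<^sup>2) / lam\<^sup>2) * ennreal (?L * lam * M)"
      by (intro mult_left_mono gsq) simp
    also have "\<dots> = ennreal (10 ^ ?n * (1 + B\<^sup>2) / lam\<^sup>2 * (?L * lam * M))"
      by (intro ennreal_mult'[symmetric]) (auto intro: divide_nonneg_nonneg)
    also have "10 ^ ?n * (1 + B\<^sup>2) / lam\<^sup>2 * (?L * lam * M) = 10 ^ ?n * (1 + B\<^sup>2) * ?L * M / lam"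
      using lam by (simp add: power2_eq_square)
    finally show ?thesis using G2(3) by (rule order_trans[rotated])
  qed
  obtain G3 where G3: "G3 \<in> sets lebesgue" "{x. \<not> growth (modulus b) x lam} \<subseteq> G3"
      "emeasure lebesgue G3 \<le> ennreal (10 ^ ?n / lam) * (\<integral>\<^sup>+x. modulus b x \<partial>lebesgue)"
    using growth_weak_type[of "modulus b" lam] lam by auto
  have G3m: "emeasure lebesgue G3 \<le> ennreal (2 * 10 ^ ?n * M / lam)"
  proof -
    have "ennreal (10 ^ ?n / lam) * (\<integral>\<^sup>+x. modulus b x \<partial>lebesgue) \<le> ennreal (10 ^ ?n / lam) * ennreal (2 * M)"
      by (intro mult_left_mono bM) simp
    also have "\<dots> = ennreal (10 ^ ?n / lam * (2 * M))" using lam by (intro ennreal_mult'[symmetric]) simp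
    also have "10 ^ ?n / lam * (2 * M) = 2 * 10 ^ ?n * M / lam" by simp
    finally show ?thesis using G3(3) by (rule order_trans[rotated])
  qed
  define r where "r q = real ?n * side q" for q :: "'n dyad"
  have r0: "0 < r q" for q by (simp add: r_def)
  \<comment> \<open>Off these balls every cube is farther from \<open>x\<close> than four times its
    diameter bound, as \<open>bad_part_cube\<close> requires.\<close>
  define G4 where "G4 = (\<Union>q\<in>?W. cball (corner q) (4 * r q))"
  have G4: "G4 \<in> sets lebesgue" unfolding G4_def using cW by (intro sets.countable_UN') auto
  have G4m: "emeasure lebesgue G4 \<le> ennreal ((8 * real ?n) ^ ?n * (10 ^ ?n + 2) * M / lam)"
  proof -
    have "emeasure lebesgue G4 \<le> (\<integral>\<^sup>+q. emeasure lebesgue (cball (corner q) (4 * r q)) \<partial>count_space ?W)"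
      unfolding G4_def using cW by (intro emeasure_UN_le_count) auto
    also have "\<dots> \<le> (\<integral>\<^sup>+q. ennreal ((8 * real ?n) ^ ?n) * (\<integral>\<^sup>+y. 1 * indicator (dset q) y \<partial>lebesgue) \<partial>count_space ?W)"
    proof (rule nn_integral_mono)
      fix q
      have "emeasure lebesgue (cball (corner q) (4 * r q)) \<le> ennreal ((2 * (4 * r q)) ^ ?n)"
        using r0[of q] by (intro emeasure_cball_le) simp
      also have "(2 * (4 * r q)) ^ ?n = (8 * real ?n) ^ ?n * side q ^ ?n"
        by (simp add: r_def power_mult_distrib)
      also have "ennreal \<dots> = ennreal ((8 * real ?n) ^ ?n) * (\<integral>\<^sup>+y. 1 * indicator (dset q) y \<partial>lebesgue)"
        by (simp add: emeasure_dset ennreal_mult)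
      finally show "emeasure lebesgue (cball (corner q) (4 * r q)) \<le> \<dots>" .
    qed
    also have "\<dots> = ennreal ((8 * real ?n) ^ ?n) * (\<integral>\<^sup>+q. (\<integral>\<^sup>+y. 1 * indicator (dset q) y \<partial>lebesgue) \<partial>count_space ?W)"
      by (rule nn_integral_cmult) simp
    also have "(\<integral>\<^sup>+q. (\<integral>\<^sup>+y. 1 * indicator (dset q) y \<partial>lebesgue) \<partial>count_space ?W) = emeasure lebesgue U"
    proof -
      have "U \<in> sets lebesgue" using U(1) by (metis borel_open sets_completionI_sets sets_lborel)
      then show ?thesis by (subst Weq) simp_all
    qed
    also have "ennreal ((8 * real ?n) ^ ?n) * emeasure lebesgue U \<le> ennreal ((8 * real ?n) ^ ?n) * ennreal ((10 ^ ?n + 2) * M / lam)"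
      by (intro mult_left_mono U(2)) simp
    also have "\<dots> = ennreal ((8 * real ?n) ^ ?n * ((10 ^ ?n + 2) * M / lam))" by (intro ennreal_mult'[symmetric]) simp
    finally show ?thesis by (simp add: mult.assoc)
  qed
  define \<beta> where "\<beta> q = (\<integral>\<^sup>+y\<in>dset q. modulus b y \<partial>lebesgue)" for q
  have \<beta>sum: "(\<integral>\<^sup>+q. \<beta> q \<partial>count_space ?W) \<le> ennreal (2 * M)"
  proof -
    have "(\<integral>\<^sup>+q. \<beta> q \<partial>count_space ?W) = (\<integral>\<^sup>+y\<in>U. modulus b y \<partial>lebesgue)"
      unfolding \<beta>_def by (rule Weq) simp
    also have "\<dots> \<le> (\<integral>\<^sup>+y. modulus b y \<partial>lebesgue)" by (intro nn_integral_mono) (auto split: split_indicator)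
    finally show ?thesis using bM by (rule order_trans)
  qed
  \<comment> \<open>The decaying bump of one cube, written in the form of
    \<open>tail_estimate\<close> with the constant function 1, so that its integral is bounded
    independently of the cube.\<close>
  define k where "k q x = ennreal (r q powr \<delta> / norm (corner q - x) powr (?n + \<delta>)) * 1 * indicator {x. r q \<le> norm (corner q - x)} x" for q x
  have km [measurable]: "k q \<in> borel_measurable lebesgue" for q
  proof -
    have "(\<lambda>x. norm (corner q - x)) \<in> borel_measurable borel"
      by (intro borel_measurable_continuous_onI continuous_intros)
    then have "(\<lambda>x. ennreal (r q powr \<delta> / norm (corner q - x) powr (?n + \<delta>))) \<in> borel_measurable borel" by measurable
    then have "(\<lambda>x. ennreal (r q powr \<delta> / norm (corner q - x) powr (?n + \<delta>))) \<in> borel_measurable lebesgue"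
      by (simp add: measurable_completion)
    then show ?thesis unfolding k_def mult_1_right
      by (rule borel_measurable_times_ennreal[OF _ borel_measurable_indicator[OF closed_norm_ge]])
  qed
  have ki: "(\<integral>\<^sup>+x. k q x \<partial>lebesgue) \<le> ennreal (tailc ?n \<delta> * 2 ^ ?n)" for q
    unfolding k_def
  proof (rule tail_estimate)
    fix \<rho> assume "r q \<le> \<rho>"
    then show "(\<integral>\<^sup>+y\<in>ball (corner q) \<rho>. 1 \<partial>lebesgue) \<le> ennreal (2 ^ ?n * \<rho> ^ ?n)"
      using emeasure_ball_le[of \<rho> "corner q"] r0[of q] by (simp add: power_mult_distrib)
  qed (use r0 \<delta>_pos in auto)
  \<comment> \<open>The bumps weighted by the mass of the bad part on each cube. Its integral is a
    multiple of \<open>M\<close>, so Markov's inequality makes it at most \<open>lam\<close> off a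
    small set.\<close>
  define H where "H x = (\<integral>\<^sup>+q. k q x * \<beta> q \<partial>count_space ?W)" for x
  have Hm [measurable]: "H \<in> borel_measurable lebesgue"
    unfolding H_def using cW by (intro measurable_nn_integral_count_space) auto
  have Hi: "(\<integral>\<^sup>+x. H x \<partial>lebesgue) \<le> ennreal (2 * (tailc ?n \<delta> * 2 ^ ?n) * M)"
  proof -
    have "(\<integral>\<^sup>+x. H x \<partial>lebesgue) = (\<integral>\<^sup>+q. (\<integral>\<^sup>+x. k q x * \<beta> q \<partial>lebesgue) \<partial>count_space ?W)"
      unfolding H_def using cW by (intro nn_integral_count_space_nn_integral) auto
    also have "\<dots> \<le> (\<integral>\<^sup>+q. ennreal (tailc ?n \<delta> * 2 ^ ?n) * \<beta> q \<partial>count_space ?W)"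
      by (intro nn_integral_mono) (simp add: nn_integral_multc ki mult_right_mono)
    also have "\<dots> = ennreal (tailc ?n \<delta> * 2 ^ ?n) * (\<integral>\<^sup>+q. \<beta> q \<partial>count_space ?W)"
      by (rule nn_integral_cmult) simp
    also have "\<dots> \<le> ennreal (tailc ?n \<delta> * 2 ^ ?n) * ennreal (2 * M)" by (intro mult_left_mono \<beta>sum) simp
    also have "\<dots> = ennreal (tailc ?n \<delta> * 2 ^ ?n * (2 * M))"
      using tailc_pos[OF \<delta>_pos, of ?n] by (intro ennreal_mult'[symmetric]) simp
    also have "tailc ?n \<delta> * 2 ^ ?n * (2 * M) = 2 * (tailc ?n \<delta> * 2 ^ ?n) * M" by simp
    finally show ?thesis .
  qed
  define G5 where "G5 = {x \<in> space lebesgue. 1 \<le> ennreal (1 / lam) * H x}"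
  have G5: "G5 \<in> sets lebesgue" unfolding G5_def by measurable
  have G5m: "emeasure lebesgue G5 \<le> ennreal (2 * (tailc ?n \<delta> * 2 ^ ?n) * M / lam)"
  proof -
    have "emeasure lebesgue G5 \<le> ennreal (1 / lam) * (\<integral>\<^sup>+x. H x * indicator (space lebesgue) x \<partial>lebesgue)"
      unfolding G5_def by (rule nn_integral_Markov_inequality) auto
    also have "\<dots> \<le> ennreal (1 / lam) * ennreal (2 * (tailc ?n \<delta> * 2 ^ ?n) * M)"
      using Hi by (intro mult_left_mono) auto
    also have "\<dots> = ennreal (2 * (tailc ?n \<delta> * 2 ^ ?n) * M / lam)" using lam by (subst ennreal_mult'[symmetric]) auto
    finally show ?thesis .
  qed
  have bad: "max_truncation K b x \<le> ennreal (c * (1 + 2 * 4 ^ ?n) * lam)" if x: "x \<notin> G3" "x \<notin> G4" "x \<notin> G5" for x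
  proof (rule max_truncation_leI)
    fix e v :: real assume ev: "0 < e" "e < v"
    have gr: "growth (modulus b) x lam" using x(1) G3(2) by blast
    have Hx: "H x \<le> ennreal lam"
    proof (rule ccontr)
      assume "\<not> H x \<le> ennreal lam"
      then have "ennreal (1 / lam) * ennreal lam \<le> ennreal (1 / lam) * H x" by (intro mult_left_mono) auto
      then have "1 \<le> ennreal (1 / lam) * H x" using lam by (simp flip: ennreal_mult')
      then show False using x(3) by (simp add: G5_def)
    qed
    have xf: "4 * r q < norm (x - corner q)" if "q \<in> ?W" for q
      using x(2) that by (auto simp: G4_def dist_norm norm_minus_commute not_le)
    let ?sh = "\<lambda>t. {y. t / 2 \<le> norm (x - y) \<and> norm (x - y) < 2 * t}"
    have shm [measurable]: "?sh t \<in> sets lebesgue" for t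
    proof -
      have "?sh t = {y. t / 2 \<le> norm (x - y)} \<inter> ball x (2 * t)" by (auto simp: dist_norm)
      then show ?thesis by simp
    qed
    \<comment> \<open>The bad part vanishes off \<open>U\<close>, which is the disjoint union of its
      maximal cubes.\<close>
    have "tr K b e v x = (LINT y:(\<Union>q\<in>?W. ann x e v \<inter> dset q)|lebesgue. K x y * b y)"
      unfolding tr_def set_lebesgue_integral_def
      using b0 WU by (intro Bochner_Integration.integral_cong) (auto split: split_indicator)
    then have "ennreal (norm (tr K b e v x)) \<le> (\<integral>\<^sup>+q. ennreal (norm (LINT y:ann x e v \<inter> dset q|lebesgue. K x y * b y)) \<partial>count_space ?W)"
    proof (simp only:, intro norm_integral_UN_le)
      show "set_integrable lebesgue (\<Union>q\<in>?W. ann x e v \<inter> dset q) (\<lambda>y. K x y * b y)"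
        by (rule set_integrable_subset[OF tr_integrable[OF integrable_imp_loc_int[OF bi] ev(1), of x v]])
           (use cW in \<open>auto intro!: sets.countable_UN'\<close>)
      fix q q' assume "q \<in> ?W" "q' \<in> ?W" "q \<noteq> q'"
      then have "dset q \<inter> dset q' = {}" by (rule whitney_disjoint)
      then show "ann x e v \<inter> dset q \<inter> (ann x e v \<inter> dset q') = {}" by blast
    qed simp_all
    also have "\<dots> \<le> (\<integral>\<^sup>+q. (ennreal c * (k q x * \<beta> q)
      + ((\<integral>\<^sup>+y. (ennreal (norm (K x y)) * modulus b y * indicator (?sh e) y) * indicator (dset q) y \<partial>lebesgue)
       + (\<integral>\<^sup>+y. (ennreal (norm (K x y)) * modulus b y * indicator (?sh v) y) * indicator (dset q) y \<partial>lebesgue))) \<partial>count_space ?W)"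
    proof (rule nn_integral_mono)
      fix q assume "q \<in> space (count_space ?W)"
      then have q: "q \<in> ?W" by simp
      have "ennreal (norm (LINT y:ann x e v \<inter> dset q|lebesgue. K x y * b y))
        \<le> ennreal (c * (r q powr \<delta> / norm (x - corner q) powr (?n + \<delta>))) * (\<integral>\<^sup>+y\<in>dset q. modulus b y \<partial>lebesgue)
         + ((\<integral>\<^sup>+y\<in>dset q \<inter> ?sh e. ennreal (norm (K x y)) * modulus b y \<partial>lebesgue)
         + (\<integral>\<^sup>+y\<in>dset q \<inter> ?sh v. ennreal (norm (K x y)) * modulus b y \<partial>lebesgue))"
        by (rule bad_part_cube[OF bi bq[OF q] xf[OF q] r_def ev])
      also have "ennreal (c * (r q powr \<delta> / norm (x - corner q) powr (?n + \<delta>))) * (\<integral>\<^sup>+y\<in>dset q. modulus b y \<partial>lebesgue) = ennreal c * (k q x * \<beta> q)"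
      proof -
        have "r q \<le> norm (corner q - x)" using xf[OF q] r0[of q] norm_minus_commute[of x "corner q"] by linarith
        moreover have em: "ennreal (c * (r q powr \<delta> / norm (x - corner q) powr (?n + \<delta>))) = ennreal c * ennreal (r q powr \<delta> / norm (x - corner q) powr (?n + \<delta>))"
          using c_pos by (intro ennreal_mult) auto
        ultimately show ?thesis unfolding k_def \<beta>_def em
          by (simp add: norm_minus_commute mult.assoc)
      qed
      also have "(\<integral>\<^sup>+y\<in>dset q \<inter> ?sh e. ennreal (norm (K x y)) * modulus b y \<partial>lebesgue) = (\<integral>\<^sup>+y. (ennreal (norm (K x y)) * modulus b y * indicator (?sh e) y) * indicator (dset q) y \<partial>lebesgue)"
        by (intro nn_integral_cong) (auto split: split_indicator)
      also have "(\<integral>\<^sup>+y\<in>dset q \<inter> ?sh v. ennreal (norm (K x y)) * modulus b y \<partial>lebesgue) = (\<integral>\<^sup>+y. (ennreal (norm (K x y)) * modulus b y * indicator (?sh v) y) * indicator (dset q) y \<partial>lebesgue)"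
        by (intro nn_integral_cong) (auto split: split_indicator)
      finally show "ennreal (norm (LINT y:ann x e v \<inter> dset q|lebesgue. K x y * b y)) \<le> ennreal c * (k q x * \<beta> q)
      + ((\<integral>\<^sup>+y. (ennreal (norm (K x y)) * modulus b y * indicator (?sh e) y) * indicator (dset q) y \<partial>lebesgue)
       + (\<integral>\<^sup>+y. (ennreal (norm (K x y)) * modulus b y * indicator (?sh v) y) * indicator (dset q) y \<partial>lebesgue))" .
    qed
    also have "\<dots> = ennreal c * H x
      + ((\<integral>\<^sup>+y\<in>U. ennreal (norm (K x y)) * modulus b y * indicator (?sh e) y \<partial>lebesgue)
       + (\<integral>\<^sup>+y\<in>U. ennreal (norm (K x y)) * modulus b y * indicator (?sh v) y \<partial>lebesgue))"
    proof -
      have m: "(\<lambda>y. ennreal (norm (K x y)) * modulus b y * indicator (?sh t) y) \<in> borel_measurable lebesgue" for t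
        by measurable
      show ?thesis
        unfolding H_def Weq[OF m, symmetric] by (simp add: nn_integral_add nn_integral_cmult)
    qed
    also have "\<dots> \<le> ennreal c * ennreal lam + (ennreal (c * (2 * e / (e / 2)) ^ ?n * lam) + ennreal (c * (2 * v / (v / 2)) ^ ?n * lam))"
    proof (intro add_mono mult_left_mono Hx)
      have sh: "(\<integral>\<^sup>+y\<in>U. ennreal (norm (K x y)) * modulus b y * indicator (?sh t) y \<partial>lebesgue) \<le> ennreal (c * (2 * t / (t / 2)) ^ ?n * lam)" if "0 < t" for t
      proof -
        have "(\<integral>\<^sup>+y\<in>U. ennreal (norm (K x y)) * modulus b y * indicator (?sh t) y \<partial>lebesgue) \<le> (\<integral>\<^sup>+y\<in>?sh t. ennreal (norm (K x y)) * modulus b y \<partial>lebesgue)"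
          by (intro nn_integral_mono) (auto split: split_indicator)
        also have "\<dots> \<le> ennreal (c * (2 * t / (t / 2)) ^ ?n * lam)"
          by (rule kernel_shell_integral[OF _ _ _ gr]) (use that lam in auto)
        finally show ?thesis .
      qed
      show "(\<integral>\<^sup>+y\<in>U. ennreal (norm (K x y)) * modulus b y * indicator (?sh e) y \<partial>lebesgue) \<le> ennreal (c * (2 * e / (e / 2)) ^ ?n * lam)"
        using ev by (intro sh) simp
      show "(\<integral>\<^sup>+y\<in>U. ennreal (norm (K x y)) * modulus b y * indicator (?sh v) y \<partial>lebesgue) \<le> ennreal (c * (2 * v / (v / 2)) ^ ?n * lam)"
        using ev by (intro sh) simp
    qed simp
    also have "\<dots> = ennreal (c * (1 + 2 * 4 ^ ?n) * lam)"
    proof -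
      have q4: "2 * e / (e / 2) = 4" "2 * v / (v / 2) = 4" using ev by simp_all
      have n0: "0 \<le> c" "0 \<le> lam" "0 \<le> c * lam" "0 \<le> c * 4 ^ ?n * lam" using c_pos lam by auto
      have "c * lam + (c * 4 ^ ?n * lam + c * 4 ^ ?n * lam) = c * (1 + 2 * 4 ^ ?n) * lam"
        by (simp add: algebra_simps)
      then show ?thesis unfolding q4
        by (simp only: ennreal_mult[OF n0(1,2), symmetric] ennreal_plus[OF n0(4,4), symmetric]
            ennreal_plus[OF n0(3) add_nonneg_nonneg[OF n0(4,4)], symmetric])
    qed
    finally show "norm (tr K b e v x) \<le> c * (1 + 2 * 4 ^ ?n) * lam"
      using c_pos lam by (subst (asm) ennreal_le_iff) auto
  qed
  have sub: "{x. \<not> max_truncation K f x \<le> ennreal (w11c * lam)} \<subseteq> G2 \<union> G3 \<union> G4 \<union> G5"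
  proof (rule subsetI, rule ccontr)
    fix x assume x: "x \<in> {x. \<not> max_truncation K f x \<le> ennreal (w11c * lam)}" "x \<notin> G2 \<union> G3 \<union> G4 \<union> G5"
    have "max_truncation K f x \<le> max_truncation K g x + max_truncation K b x"
      unfolding fgb by (intro max_truncation_add integrable_imp_loc_int gi bi)
    also have "\<dots> \<le> ennreal (2 * cotc * 2 ^ ?n * lam) + ennreal (c * (1 + 2 * 4 ^ ?n) * lam)"
      using x(2) G2(2) bad[of x] by (intro add_mono) auto
    also have "\<dots> = ennreal (2 * cotc * 2 ^ ?n * lam + c * (1 + 2 * 4 ^ ?n) * lam)"
      using cotc_nonneg lam c_pos by (intro ennreal_plus[symmetric]) auto
    also have "2 * cotc * 2 ^ ?n * lam + c * (1 + 2 * 4 ^ ?n) * lam = w11c * lam"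
      by (simp add: w11c_def distrib_right)
    finally show False using x(1) by simp
  qed
  have p: "0 \<le> 10 ^ ?n * (1 + B\<^sup>2) * ?L * M / lam" "0 \<le> 2 * 10 ^ ?n * M / lam" "0 \<le> (8 * real ?n) ^ ?n * (10 ^ ?n + 2) * M / lam"
     "0 \<le> 2 * (tailc ?n \<delta> * 2 ^ ?n) * M / lam"
    using lam M tailc_pos[OF \<delta>_pos, of ?n] by (auto intro!: divide_nonneg_pos mult_nonneg_nonneg)
  have "emeasure lebesgue (G2 \<union> G3 \<union> G4 \<union> G5) \<le> ennreal (10 ^ ?n * (1 + B\<^sup>2) * ?L * M / lam + 2 * 10 ^ ?n * M / lam + (8 * real ?n) ^ ?n * (10 ^ ?n + 2) * M / lam + 2 * (tailc ?n \<delta> * 2 ^ ?n) * M / lam)"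
    by (intro emeasure_le_add sets.Un G2 G3 G4 G5 G2m G3m G4m G5m p add_nonneg_nonneg)
  also have "10 ^ ?n * (1 + B\<^sup>2) * ?L * M / lam + 2 * 10 ^ ?n * M / lam + (8 * real ?n) ^ ?n * (10 ^ ?n + 2) * M / lam + 2 * (tailc ?n \<delta> * 2 ^ ?n) * M / lam = w11k * M / lam"
    by (simp only: w11k_def distrib_right add_divide_distrib)
  finally show ?thesis using sub G2 G3 G4 G5 by (intro bexI[of _ "G2 \<union> G3 \<union> G4 \<union> G5"]) auto
qed

end

subsection \<open>Sparse domination\<close>

definition tavg :: "(real ^ 'n \<Rightarrow> complex) \<Rightarrow> 'n::finite dyad \<Rightarrow> real" where
  "tavg f q = enn2real (\<integral>\<^sup>+y\<in>tri q. modulus f y \<partial>lebesgue) / (3 * side q) ^ CARD('n)"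

definition tres :: "(real ^ 'n \<Rightarrow> complex) \<Rightarrow> 'n::finite dyad \<Rightarrow> real ^ 'n \<Rightarrow> complex" where
  "tres f q = (\<lambda>y. indicator (tri q) y * f y)"

text \<open>An index set is used instead of a set of cubes so that an index can record the stage at
  which a cube was chosen. The disjoint sets \<open>E i\<close> witness sparseness with constant one
  half.\<close>

definition sparse_family :: "'i set \<Rightarrow> ('i \<Rightarrow> 'n::finite dyad) \<Rightarrow> ('i \<Rightarrow> (real ^ 'n) set) \<Rightarrow> bool" where
  "sparse_family I Q E \<longleftrightarrow> countable I \<and>
     (\<forall>i\<in>I. E i \<in> sets lebesgue \<and> E i \<subseteq> dset (Q i) \<and> emeasure lebesgue (dset (Q i)) \<le> 2 * emeasure lebesgue (E i)) \<and>
     (\<forall>i\<in>I. \<forall>j\<in>I. i \<noteq> j \<longrightarrow> E i \<inter> E j = {})"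

lemma tavg_nonneg [simp]: "0 \<le> tavg f q"
  by (simp add: tavg_def)

lemma loc_int_set:
  fixes f :: "real ^ 'n \<Rightarrow> complex"
  assumes "loc_int f" "S \<in> sets lebesgue" "bounded S"
  shows "set_integrable lebesgue S f"
proof -
  obtain r where "S \<subseteq> ball 0 r"
    using bounded_subset_ballD[OF assms(3)] by blast
  moreover have "set_integrable lebesgue (ball 0 r) f" using assms(1) by (simp add: loc_int_def)
  ultimately show ?thesis using assms(2) by (metis set_integrable_subset)
qed

lemma loc_int_nn_finite:
  fixes f :: "real ^ 'n \<Rightarrow> complex"
  assumes "loc_int f" "S \<in> sets lebesgue" "bounded S"
  shows "(\<integral>\<^sup>+y\<in>S. modulus f y \<partial>lebesgue) < \<infinity>"
proof -
  have "integrable lebesgue (\<lambda>y. indicat_real S y *\<^sub>R f y)"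
    using loc_int_set[OF assms] by (simp add: set_integrable_def)
  then have "(\<integral>\<^sup>+y. ennreal (norm (indicat_real S y *\<^sub>R f y)) \<partial>lebesgue) < \<infinity>"
    by (simp add: integrable_iff_bounded)
  also have "(\<integral>\<^sup>+y. ennreal (norm (indicat_real S y *\<^sub>R f y)) \<partial>lebesgue) = (\<integral>\<^sup>+y\<in>S. modulus f y \<partial>lebesgue)"
    by (intro nn_integral_cong) (auto simp: modulus_def split: split_indicator)
  finally show ?thesis .
qed

lemma tavg_integral:
  fixes f :: "real ^ 'n \<Rightarrow> complex"
  assumes "loc_int f"
  shows "(\<integral>\<^sup>+y\<in>tri q. modulus f y \<partial>lebesgue) = ennreal (tavg f q * (3 * side q) ^ CARD('n))"
  using loc_int_nn_finite[OF assms, of "tri q"] compact_imp_bounded[OF compact_tri[of q]]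
  by (simp add: tavg_def)

lemma tres_integrable:
  fixes f :: "real ^ 'n \<Rightarrow> complex"
  assumes "loc_int f"
  shows "integrable lebesgue (tres f q)"
proof -
  have "set_integrable lebesgue (tri q) f"
    using compact_imp_bounded[OF compact_tri[of q]] by (intro loc_int_set assms) auto
  then show ?thesis unfolding set_integrable_def tres_def
    by (rule Bochner_Integration.integrable_cong[THEN iffD1, OF refl, rotated]) (auto split: split_indicator)
qed

lemma tres_modulus_integral:
  "(\<integral>\<^sup>+y. modulus (tres f q) y \<partial>lebesgue) = (\<integral>\<^sup>+y\<in>tri q. modulus f y \<partial>lebesgue)"
  by (intro nn_integral_cong) (auto simp: modulus_def tres_def split: split_indicator)

text \<open>Exact inclusion of the triples lets \<open>tres f q\<close> split into
  \<open>tres f p\<close> and a remainder vanishing on \<open>tri p\<close>; this is what makes the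
  stopping argument iterate.\<close>

lemma tri_mono:
  fixes p q :: "'n::finite dyad"
  assumes "dset p \<subseteq> dset q"
  shows "tri p \<subseteq> tri q"
proof -
  have lo: "corner q $ i \<le> corner p $ i" for i
    using subsetD[OF assms corner_in_dset] by (simp add: dset_eq_corner)
  have hi: "corner p $ i + side p \<le> corner q $ i + side q" for i
  \<comment> \<open>The upper endpoint is not attained in a half-open cube; it is approached by
    points that differ from the corner in the coordinate \<open>i\<close> alone.\<close>
  proof (rule dense_le)
    fix u assume u: "u < corner p $ i + side p"
    define y where "y = (\<chi> j. if j = i then max u (corner p $ i) else corner p $ j)"
    have "y \<in> dset p" using u by (auto simp: y_def dset_eq_corner)
    then have "y \<in> dset q" using assms by blast
    then have "y $ i < corner q $ i + side q" by (simp add: dset_eq_corner)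
    then show "u \<le> corner q $ i + side q" by (simp add: y_def)
  qed
  have s: "side p \<le> side q" using lo[of undefined] hi[of undefined] by linarith
  show ?thesis
  proof
    fix y assume "y \<in> tri p"
    then have y: "corner p $ i - side p \<le> y $ i" "y $ i \<le> corner p $ i - side p + 3 * side p" for i
      by (simp_all add: tri_def mem_box_cart)
    have "corner q $ i - side q \<le> y $ i \<and> y $ i \<le> corner q $ i - side q + 3 * side q" for i
      using y[of i] lo[of i] hi[of i] s by linarith
    then show "y \<in> tri q" by (simp add: tri_def mem_box_cart)
  qed
qed

context std_kernel
begin

lemma tr_cong:
  assumes "\<And>y. y \<in> ann x e v \<Longrightarrow> f y = g y"
  shows "tr K f e v x = tr K g e v x"
  unfolding tr_def set_lebesgue_integral_def
  by (intro Bochner_Integration.integral_cong) (auto simp: assms split: split_indicator)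

lemma tr_zero_AE:
  assumes "AE y in lebesgue. f y = 0"
  shows "tr K f e v x = 0"
  unfolding tr_def set_lebesgue_integral_def
  by (rule integral_eq_zero_AE) (use assms in eventually_elim, simp)

text \<open>The first term is the size condition between the distances \<open>side p\<close> and
  \<open>12 * CARD('n) * side p\<close>, estimated in a ball of radius
  \<open>18 * CARD('n) * side p\<close> around \<open>z\<close>. The others are the cost of moving
  the centre to \<open>z\<close> and the bound for the truncation there.\<close>

definition farc :: "real \<Rightarrow> real" where
  "farc w = c * (18 * real CARD('n)) ^ CARD('n) + shiftc + w"

text \<open>On a whole cube \<open>p\<close> the part of \<open>F\<close> outside
  \<open>tri p\<close> is controlled by one good point \<open>z\<close> near \<open>p\<close>.
  Distant annuli are recentred at \<open>z\<close>; the remaining region is at distance comparable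
  to \<open>side p\<close>, so the size of the kernel is enough.\<close>

lemma max_truncation_far:
  assumes F: "loc_int F" and x: "x \<in> dset p" and z: "norm (x - z) \<le> 2 * CARD('n) * side p"
    and gr: "growth (modulus F) z lam" and mt: "max_truncation K F z \<le> ennreal (w * lam)"
    and lam: "0 \<le> lam" and w: "0 \<le> w"
  shows "max_truncation K (\<lambda>y. indicator (- tri p) y * F y) x \<le> ennreal (farc w * lam)"
proof (rule max_truncation_leI)
  fix e v :: real assume ev: "0 < e" "e < v"
  let ?F = "\<lambda>y. indicator (- tri p) y * F y"
  note Fm [measurable] = loc_int_measurable[OF F]
  have F': "loc_int ?F" by (rule loc_int_indicator[OF F]) (simp add: Compl_eq_Diff_UNIV sets.Diff)
  have n1: "1 \<le> real CARD('n)" using zero_less_card_finite[where 'a='n] by linarith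
  define s where "s = 3 * real CARD('n) * side p"
  have s0: "0 < s" using n1 by (simp add: s_def)
  have xz: "norm (x - z) \<le> s"
  proof -
    have "2 * real CARD('n) * side p \<le> s" unfolding s_def by (intro mult_right_mono) auto
    then show ?thesis using z by linarith
  qed
  have tri_near: "norm (x - y) \<le> s" if "y \<in> tri p" for y
    using tri_diam[OF subsetD[OF dset_subset_tri x] that] by (simp add: s_def mult_ac)
  \<comment> \<open>Such an annulus misses \<open>tri p\<close>, which lies within \<open>s\<close>
    of \<open>x\<close>, so \<open>F\<close> itself is truncated there and the centre can be moved
    to \<open>z\<close>.\<close>
  have far: "norm (tr K ?F E v x) \<le> (shiftc + w) * lam" if E: "4 * s \<le> E" for E
  proof (cases "E < v")
    case True
    have "tr K ?F E v x = tr K F E v x"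
    proof (rule tr_cong)
      fix y assume "y \<in> ann x E v"
      then have "y \<notin> tri p" using tri_near[of y] E s0 by (auto simp: ann_def)
      then show "?F y = F y" by simp
    qed
    moreover have "norm (tr K F E v x - tr K F E v z) \<le> shiftc * lam"
      by (rule tr_shift[OF F xz s0 E True gr lam])
    moreover have "norm (tr K F E v z) \<le> w * lam"
      using E s0 True lam w by (intro tr_le_of_max_truncation[OF _ _ mt]) auto
    moreover have "norm (tr K F E v x) \<le> norm (tr K F E v x - tr K F E v z) + norm (tr K F E v z)"
      using norm_triangle_ineq[of "tr K F E v x - tr K F E v z" "tr K F E v z"] by simp
    ultimately show ?thesis by (simp add: distrib_right)
  next
    case False
    then have "ann x E v = {}" by (auto simp: ann_def)
    then show ?thesis using lam w shiftc_pos by (simp add: tr_def set_lebesgue_integral_def)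
  qed
  have sp: "side p < norm (x - y)" if "y \<notin> tri p" for y
    using near_dset_in_tri[OF x] that by (meson not_le)
  have near: "norm (LINT y:ann x e v \<inter> cball x (4 * s)|lebesgue. K x y * ?F y) \<le> c * (18 * real CARD('n)) ^ CARD('n) * lam"
  proof (rule norm_set_integral_le)
    have "(\<integral>\<^sup>+y\<in>ann x e v \<inter> cball x (4 * s). ennreal (norm (K x y * ?F y)) \<partial>lebesgue)
      \<le> (\<integral>\<^sup>+y. ennreal (c / side p ^ CARD('n)) * (modulus F y * indicator (ball z (6 * s)) y) \<partial>lebesgue)"
    proof (rule nn_integral_mono)
      fix y
      show "ennreal (norm (K x y * ?F y)) * indicator (ann x e v \<inter> cball x (4 * s)) y \<le> ennreal (c / side p ^ CARD('n)) * (modulus F y * indicator (ball z (6 * s)) y)"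
      proof (cases "y \<notin> tri p \<and> norm (x - y) \<le> 4 * s")
        case True
        then have "norm (K x y) \<le> c / side p ^ CARD('n)" using sp[of y] by (intro size_ge) auto
        then have "ennreal (norm (K x y)) \<le> ennreal (c / side p ^ CARD('n))" by (rule ennreal_leI)
        moreover have "norm (z - y) < 6 * s"
          using True xz s0 norm_triangle_ineq[of "z - x" "x - y"] by (simp add: norm_minus_commute)
        ultimately show ?thesis using True
          by (auto simp: dist_norm norm_mult modulus_def ennreal_mult mult_right_mono split: split_indicator)
      next
        case False
        then show ?thesis by (auto simp: dist_norm split: split_indicator)
      qed
    qed
    also have "\<dots> = ennreal (c / side p ^ CARD('n)) * (\<integral>\<^sup>+y\<in>ball z (6 * s). modulus F y \<partial>lebesgue)"
      by (rule nn_integral_cmult) measurable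
    also have "\<dots> \<le> ennreal (c / side p ^ CARD('n)) * ennreal (lam * (6 * s) ^ CARD('n))"
      using s0 by (intro mult_left_mono growthD gr) auto
    also have "\<dots> = ennreal (c / side p ^ CARD('n) * (lam * (6 * s) ^ CARD('n)))"
      using c_pos by (intro ennreal_mult'[symmetric]) simp
    also have "c / side p ^ CARD('n) * (lam * (6 * s) ^ CARD('n)) = c * (18 * real CARD('n)) ^ CARD('n) * lam"
    proof -
      have "(6 * s) ^ CARD('n) = (18 * real CARD('n)) ^ CARD('n) * side p ^ CARD('n)"
      proof -
        have "6 * s = (18 * real CARD('n)) * side p" by (simp add: s_def)
        then show ?thesis by (simp only: power_mult_distrib)
      qed
      then show ?thesis by simp
    qed
    finally show "(\<integral>\<^sup>+y\<in>ann x e v \<inter> cball x (4 * s). ennreal (norm (K x y * ?F y)) \<partial>lebesgue) \<le> ennreal (c * (18 * real CARD('n)) ^ CARD('n) * lam)" .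
  qed (use c_pos lam in simp)
  \<comment> \<open>The truncation is cut at distance \<open>4 * s\<close>, the least inner radius
    for which moving the centre by \<open>s\<close> is permitted.\<close>
  have split: "ann x e v = (ann x e v \<inter> cball x (4 * s)) \<union> ann x (max e (4 * s)) v"
    "(ann x e v \<inter> cball x (4 * s)) \<inter> ann x (max e (4 * s)) v = {}"
    by (auto simp: ann_def dist_norm)
  have "tr K ?F e v x = (LINT y:ann x e v \<inter> cball x (4 * s)|lebesgue. K x y * ?F y) + tr K ?F (max e (4 * s)) v x"
  proof -
    have i: "set_integrable lebesgue (ann x e v \<inter> cball x (4 * s)) (\<lambda>y. K x y * ?F y)"
      by (rule set_integrable_subset[OF tr_integrable[OF F' ev(1), of x v]]) auto
    have j: "set_integrable lebesgue (ann x (max e (4 * s)) v) (\<lambda>y. K x y * ?F y)"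
      using ev by (intro tr_integrable F') auto
    show ?thesis unfolding tr_def by (subst split(1)) (rule set_integral_Un[OF split(2) i j])
  qed
  then have "norm (tr K ?F e v x) \<le> norm (LINT y:ann x e v \<inter> cball x (4 * s)|lebesgue. K x y * ?F y) + norm (tr K ?F (max e (4 * s)) v x)"
    by (simp only: norm_triangle_ineq)
  also have "\<dots> \<le> c * (18 * real CARD('n)) ^ CARD('n) * lam + (shiftc + w) * lam"
    by (intro add_mono near far) simp
  also have "\<dots> = farc w * lam" by (simp add: farc_def distrib_right)
  finally show "norm (tr K ?F e v x) \<le> farc w * lam" .
qed

end

context cz
begin

text \<open>Chosen so that at the level \<open>stopc * tavg f q\<close> the two exceptional sets
  have total measure at most a quarter of the cube; \<open>3 ^ CARD('n)\<close> passes from the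
  triple to the cube. The open enlargement takes another quarter.\<close>

definition stopc :: real where
  "stopc = 4 * (w11k + 10 ^ CARD('n)) * 3 ^ CARD('n)"

definition domc :: real where
  "domc = farc w11c * stopc"

lemma stopc_pos: "0 < stopc"
  using w11k_pos by (auto simp: stopc_def intro!: mult_pos_pos add_pos_pos)

lemma farc_pos: "0 \<le> w \<Longrightarrow> 0 < farc w" and farc_ge: "w \<le> farc w"
proof -
  have "0 \<le> c * (18 * real CARD('n)) ^ CARD('n)" using c_pos by simp
  then have "w < farc w" for w using shiftc_pos unfolding farc_def by linarith
  then show "0 \<le> w \<Longrightarrow> 0 < farc w" and "w \<le> farc w" by (meson order_le_less_trans less_imp_le)+
qed

lemma domc_pos: "0 < domc"
  unfolding domc_def using farc_pos[of w11c] w11c_pos stopc_pos by simp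

text \<open>One step of the stopping-time recursion. The last clause has the same quantity on its
  right side, for the child instead of the cube, and so can be applied repeatedly.\<close>

definition stop_children :: "(real ^ 'n \<Rightarrow> complex) \<Rightarrow> 'n dyad \<Rightarrow> 'n dyad set \<Rightarrow> bool" where
  "stop_children f q C \<longleftrightarrow>
     (\<forall>p\<in>C. dset p \<subseteq> dset q) \<and>
     (\<forall>p\<in>C. \<forall>p'\<in>C. p \<noteq> p' \<longrightarrow> dset p \<inter> dset p' = {}) \<and>
     emeasure lebesgue (\<Union>p\<in>C. dset p) \<le> ennreal (side q ^ CARD('n) / 2) \<and>
     (\<forall>x\<in>dset q. x \<notin> (\<Union>p\<in>C. dset p) \<longrightarrow> max_truncation K (tres f q) x \<le> ennreal (domc * tavg f q)) \<and>
     (\<forall>p\<in>C. \<forall>x\<in>dset p. max_truncation K (tres f q) x \<le> ennreal (domc * tavg f q) + max_truncation K (tres f p) x)"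

text \<open>The children are the maximal cubes inside \<open>q\<close> of an open set
  \<open>U\<close> that contains all points where the truncation or the growth of
  \<open>tres f q\<close> is too large. Near every child there is a point outside \<open>U\<close>,
  good in both respects, from which the contribution off the triple of the child is
  controlled.\<close>

lemma stop_children_exist:
  assumes f: "loc_int f"
  shows "\<exists>C. stop_children f q C"
proof (cases "tavg f q = 0")
  \<comment> \<open>For average 0 there is no positive stopping level, but then the function
    vanishes almost everywhere on the triple and so do all its truncations.\<close>
  case True
  note [measurable] = loc_int_measurable[OF f]
  have [measurable]: "tres f q \<in> borel_measurable lebesgue" using tres_integrable[OF f] by (rule borel_measurable_integrable)
  have "(\<integral>\<^sup>+y. modulus (tres f q) y \<partial>lebesgue) = 0"
    unfolding tres_modulus_integral tavg_integral[OF f] True by simp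
  then have "AE y in lebesgue. modulus (tres f q) y = 0"
    by (subst (asm) nn_integral_0_iff_AE) auto
  then have "AE y in lebesgue. tres f q y = 0" by eventually_elim (simp add: modulus_def)
  then have "max_truncation K (tres f q) x \<le> ennreal 0" for x
    by (intro max_truncation_leI) (simp add: tr_zero_AE)
  then have "stop_children f q {}" by (simp add: stop_children_def True)
  then show ?thesis by blast
next
  case False
  let ?n = "CARD('n)"
  define A where "A = tavg f q"
  have A: "0 < A" unfolding A_def using False tavg_nonneg[of f q] by (metis order_le_imp_less_or_eq)
  define lam where "lam = stopc * A"
  have lam: "0 < lam" using A stopc_pos by (simp add: lam_def)
  define M where "M = A * (3 * side q) ^ ?n"
  have M: "0 < M" using A by (simp add: M_def)
  let ?F = "tres f q"
  have Fi: "integrable lebesgue ?F" by (rule tres_integrable[OF f])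
  note Fm [measurable] = borel_measurable_integrable[OF Fi]
  have FM: "(\<integral>\<^sup>+y. modulus ?F y \<partial>lebesgue) \<le> ennreal M"
    unfolding tres_modulus_integral tavg_integral[OF f] M_def A_def by simp
  obtain G1 where G1: "G1 \<in> sets lebesgue" "{x. \<not> max_truncation K ?F x \<le> ennreal (w11c * lam)} \<subseteq> G1"
      "emeasure lebesgue G1 \<le> ennreal (w11k * M / lam)"
    using max_truncation_weak11[OF Fi lam M FM] by blast
  obtain G2 where G2: "G2 \<in> sets lebesgue" "{x. \<not> growth (modulus ?F) x lam} \<subseteq> G2"
      "emeasure lebesgue G2 \<le> ennreal (10 ^ ?n / lam) * (\<integral>\<^sup>+x. modulus ?F x \<partial>lebesgue)"
    using growth_weak_type[of "modulus ?F" lam] lam by auto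
  have G2m: "emeasure lebesgue G2 \<le> ennreal (10 ^ ?n * M / lam)"
  proof -
    have "ennreal (10 ^ ?n / lam) * (\<integral>\<^sup>+x. modulus ?F x \<partial>lebesgue) \<le> ennreal (10 ^ ?n / lam) * ennreal M"
      by (intro mult_left_mono FM) simp
    also have "\<dots> = ennreal (10 ^ ?n / lam * M)" using lam by (intro ennreal_mult'[symmetric]) simp
    finally show ?thesis using G2(3) by simp
  qed
  have Ml: "w11k * M / lam + 10 ^ ?n * M / lam = side q ^ ?n / 4"
  proof -
    have d: "w11k + 10 ^ ?n > 0" using w11k_pos by (intro add_pos_pos) auto
    have "w11k * M / lam + 10 ^ ?n * M / lam = (w11k + 10 ^ ?n) * M / lam" by (simp add: distrib_right add_divide_distrib)
    also have "\<dots> = side q ^ ?n / 4"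
      using A d unfolding M_def lam_def stopc_def power_mult_distrib by (simp add: divide_simps)
    finally show ?thesis .
  qed
  have "emeasure lebesgue (G1 \<union> G2) \<le> ennreal (w11k * M / lam + 10 ^ ?n * M / lam)"
    using G1 G2 G2m lam M w11k_pos by (intro emeasure_le_add) auto
  then have Gm: "emeasure lebesgue (G1 \<union> G2) \<le> ennreal (side q ^ ?n / 4)" unfolding Ml .
  obtain U where U: "open U" "G1 \<union> G2 \<subseteq> U" "emeasure lebesgue U \<le> ennreal (side q ^ ?n / 4 + side q ^ ?n / 4)"
    by (rule outer_open[OF sets.Un[OF G1(1) G2(1)] Gm, of "side q ^ ?n / 4"]) auto
  then have Um: "emeasure lebesgue U \<le> ennreal (side q ^ ?n / 2)" by simp
  have Ufin: "emeasure lebesgue U < \<infinity>" using order_le_less_trans[OF Um ennreal_less_top] by simp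
  have Us: "U \<in> sets lebesgue" using U(1) by (metis borel_open sets_completionI_sets sets_lborel)
  \<comment> \<open>\<open>U\<close> has at most half the measure of the cube. Hence a maximal cube
    of \<open>U\<close> meeting \<open>q\<close> cannot contain \<open>q\<close> and must lie inside
    it, so the children cover \<open>U\<close> within \<open>q\<close>.\<close>
  have qU: "\<not> dset q \<subseteq> U"
  proof
    assume "dset q \<subseteq> U"
    then have "emeasure lebesgue (dset q) \<le> ennreal (side q ^ ?n / 2)"
      using emeasure_mono[OF _ Us] Um by (meson order_trans)
    then have "side q ^ ?n \<le> side q ^ ?n / 2" by (simp add: emeasure_dset)
    moreover have "0 < side q ^ ?n" by simp
    ultimately show False by linarith
  qed
  define C where "C = {p \<in> whitney U. dset p \<subseteq> dset q}"
  have good: "max_truncation K ?F z \<le> ennreal (w11c * lam)" "growth (modulus ?F) z lam" if "z \<notin> U" for z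
    using that U(2) G1(2) G2(2) by auto
  have dl: "farc w11c * lam = domc * tavg f q" by (simp add: domc_def lam_def A_def)
  have wl: "w11c * lam \<le> domc * tavg f q"
    unfolding dl[symmetric] using farc_ge lam by (intro mult_right_mono) auto
  have "stop_children f q C"
    unfolding stop_children_def
  proof (intro conjI ballI impI)
    show "dset p \<subseteq> dset q" if "p \<in> C" for p using that by (simp add: C_def)
    show "dset p \<inter> dset p' = {}" if "p \<in> C" "p' \<in> C" "p \<noteq> p'" for p p'
      using that whitney_disjoint[of p U p'] by (simp add: C_def)
    have "(\<Union>p\<in>C. dset p) \<subseteq> U" using whitney_subset by (fastforce simp: C_def)
    then show "emeasure lebesgue (\<Union>p\<in>C. dset p) \<le> ennreal (side q ^ ?n / 2)"
      using emeasure_mono[OF _ Us] Um by (meson order_trans)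
  next
    fix x assume x: "x \<in> dset q" "x \<notin> (\<Union>p\<in>C. dset p)"
    have "x \<notin> U"
    proof
      assume "x \<in> U"
      then obtain p where p: "p \<in> whitney U" "x \<in> dset p" by (rule whitney_cover[OF U(1) Ufin])
      have "dset p \<subseteq> dset q"
      proof (cases "fst p \<le> fst q")
        case True
        then show ?thesis using dset_nested[OF True] p(2) x(1) by blast
      next
        case False
        then have "dset q \<subseteq> dset p" using dset_nested[of q p] p(2) x(1) by fastforce
        then show ?thesis using whitney_subset[OF p(1)] qU by blast
      qed
      then have "p \<in> C" using p(1) by (simp add: C_def)
      then show False using p(2) x(2) by blast
    qed
    from good(1)[OF this] have "max_truncation K ?F x \<le> ennreal (w11c * lam)" .
    also have "\<dots> \<le> ennreal (domc * tavg f q)" using wl by (rule ennreal_leI)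
    finally show "max_truncation K ?F x \<le> ennreal (domc * tavg f q)" .
  next
    fix p x assume p: "p \<in> C" and x: "x \<in> dset p"
    have pw: "p \<in> whitney U" "dset p \<subseteq> dset q" using p by (auto simp: C_def)
    obtain z where z: "z \<notin> U" "\<And>x. x \<in> dset p \<Longrightarrow> norm (x - z) \<le> 2 * ?n * side p"
      using whitney_near[OF pw(1)] by blast
    have "?F = (\<lambda>y. tres f p y + indicator (- tri p) y * ?F y)"
      using tri_mono[OF pw(2)] by (intro ext) (auto simp: tres_def split: split_indicator)
    then have "max_truncation K ?F x = max_truncation K (\<lambda>y. tres f p y + indicator (- tri p) y * ?F y) x" by (rule arg_cong)
    also have "\<dots> \<le> max_truncation K (tres f p) x + max_truncation K (\<lambda>y. indicator (- tri p) y * ?F y) x"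
      by (intro max_truncation_add integrable_imp_loc_int tres_integrable[OF f] loc_int_indicator[OF integrable_imp_loc_int[OF Fi]])
         (simp add: Compl_eq_Diff_UNIV sets.Diff)
    also have "\<dots> \<le> max_truncation K (tres f p) x + ennreal (farc w11c * lam)"
      using lam w11c_pos by (intro add_left_mono max_truncation_far[OF integrable_imp_loc_int[OF Fi] x z(2)[OF x]] good z(1)) auto
    finally show "max_truncation K ?F x \<le> ennreal (domc * tavg f q) + max_truncation K (tres f p) x"
      unfolding dl by (simp add: add.commute)
  qed
  then show ?thesis by blast
qed

text \<open>The recursion starts from all cubes of generation \<open>k0\<close>, on which
  truncations up to radius \<open>2 powi k0\<close> see only the triple. Almost every point leaves
  the stopping cubes after finitely many stages, so the domination is a finite sum at each such
  point and no limit of remainders occurs.\<close>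

lemma sparse_domination:
  assumes f: "loc_int f"
  shows "\<exists>(I :: (nat \<times> 'n dyad) set) E. sparse_family I snd E \<and>
    (AE x in lebesgue. \<forall>e v. 0 < e \<and> e < v \<and> v \<le> 2 powi k0 \<longrightarrow>
       ennreal (norm (tr K f e v x)) \<le>
         ennreal domc * (\<integral>\<^sup>+i. ennreal (tavg f (snd i)) * indicator (dset (snd i)) x \<partial>count_space I))"
proof -
  obtain ch where ch: "\<And>q. stop_children f q (ch q)" using stop_children_exist[OF f] by metis
  have ch_sub: "p \<in> ch q \<Longrightarrow> dset p \<subseteq> dset q" for p q
    using ch[of q] by (simp add: stop_children_def)
  have ch_disj: "p \<in> ch q \<Longrightarrow> p' \<in> ch q \<Longrightarrow> p \<noteq> p' \<Longrightarrow> dset p \<inter> dset p' = {}" for p p' q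
    using ch[of q] by (simp add: stop_children_def)
  have ch_meas: "emeasure lebesgue (\<Union>p\<in>ch q. dset p) \<le> ennreal (side q ^ CARD('n) / 2)" for q
    using ch[of q] by (simp add: stop_children_def)
  have ch_out: "max_truncation K (tres f q) x \<le> ennreal (domc * tavg f q)" if "x \<in> dset q" "x \<notin> (\<Union>p\<in>ch q. dset p)" for x q
    using ch[of q] that unfolding stop_children_def by blast
  have ch_in: "max_truncation K (tres f q) x \<le> ennreal (domc * tavg f q) + max_truncation K (tres f p) x" if "p \<in> ch q" "x \<in> dset p" for x p q
    using ch[of q] that unfolding stop_children_def by blast
  define S where "S = rec_nat {q :: 'n dyad. fst q = k0} (\<lambda>_ A. \<Union>q\<in>A. ch q)"
  have S0: "S 0 = {q. fst q = k0}" and SS: "S (Suc m) = (\<Union>q\<in>S m. ch q)" for m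
    by (simp_all add: S_def)
  have S_disj: "q \<in> S m \<Longrightarrow> q' \<in> S m \<Longrightarrow> q \<noteq> q' \<Longrightarrow> dset q \<inter> dset q' = {}" for q q' m
  proof (induction m arbitrary: q q')
    case 0
    then have "fst q = fst q'" by (simp add: S0)
    then show ?case using 0(3) dset_same_gen[of q q'] by blast
  next
    case (Suc m)
    obtain r r' where r: "r \<in> S m" "q \<in> ch r" "r' \<in> S m" "q' \<in> ch r'" using Suc.prems by (auto simp: SS)
    show ?case
    proof (cases "r = r'")
      case True
      then show ?thesis using ch_disj[of q r q'] r Suc.prems(3) by blast
    next
      case False
      then have "dset r \<inter> dset r' = {}" using Suc.IH r by blast
      then show ?thesis using ch_sub[OF r(2)] ch_sub[OF r(4)] by blast
    qed
  qed
  have anc: "q' \<in> S m' \<Longrightarrow> m < m' \<Longrightarrow> \<exists>r\<in>S m. \<exists>p\<in>ch r. dset q' \<subseteq> dset p" for q' m m'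
  proof (induction m' arbitrary: q')
    case (Suc m')
    obtain r where r: "r \<in> S m'" "q' \<in> ch r" using Suc.prems by (auto simp: SS)
    show ?case
    proof (cases "m = m'")
      case True
      then show ?thesis using r by blast
    next
      case False
      then obtain r2 p where "r2 \<in> S m" "p \<in> ch r2" "dset r \<subseteq> dset p" using Suc.IH[OF r(1)] Suc.prems by auto
      then show ?thesis using ch_sub[OF r(2)] by (intro bexI[of _ r2] bexI[of _ p]) auto
    qed
  qed simp
  define UC where "UC q = (\<Union>p\<in>ch q. dset p)" for q
  have cc: "countable (X :: 'n dyad set)" for X by (rule countableI_type)
  have UC_sets [measurable]: "UC q \<in> sets lebesgue" for q
    unfolding UC_def by (intro sets.countable_UN' cc) auto
  have UC_sub: "UC q \<subseteq> dset q" for q unfolding UC_def by (intro UN_least ch_sub)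
  \<comment> \<open>The stage is part of the index, so disjointness of the sets \<open>E i\<close>
    is checked separately for equal and for different stages.\<close>
  define I where "I = (SIGMA m:UNIV. S m)"
  define E where "E i = dset (snd i) - UC (snd i)" for i :: "nat \<times> 'n dyad"
  have sp: "sparse_family I snd E"
    unfolding sparse_family_def
  proof (intro conjI ballI impI)
    show "countable I" by (rule countableI_type)
    fix i assume i: "i \<in> I"
    show "E i \<in> sets lebesgue" by (simp add: E_def)
    show "E i \<subseteq> dset (snd i)" by (auto simp: E_def)
    let ?q = "snd i"
    have "emeasure lebesgue (dset ?q) = emeasure lebesgue (E i) + emeasure lebesgue (UC ?q)"
    proof -
      have "E i \<union> UC ?q = dset ?q" "E i \<inter> UC ?q = {}" using UC_sub[of ?q] by (auto simp: E_def)
      then show ?thesis using plus_emeasure[of "E i" lebesgue "UC ?q"] by (simp add: E_def)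
    qed
    also have "\<dots> \<le> emeasure lebesgue (E i) + ennreal (side ?q ^ CARD('n) / 2)"
      unfolding UC_def by (intro add_left_mono ch_meas)
    finally have le: "ennreal (side ?q ^ CARD('n)) \<le> emeasure lebesgue (E i) + ennreal (side ?q ^ CARD('n) / 2)"
      by (simp add: emeasure_dset)
    show "emeasure lebesgue (dset ?q) \<le> 2 * emeasure lebesgue (E i)"
    proof (cases "emeasure lebesgue (E i)")
      case (real a)
      have "ennreal (side ?q ^ CARD('n)) \<le> ennreal (a + side ?q ^ CARD('n) / 2)"
        using le real by simp
      then have "side ?q ^ CARD('n) \<le> a + side ?q ^ CARD('n) / 2" using real by (subst (asm) ennreal_le_iff) auto
      then have "side ?q ^ CARD('n) \<le> 2 * a" by linarith
      then have "ennreal (side ?q ^ CARD('n)) \<le> ennreal (2 * a)" by (rule ennreal_leI)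
      then show ?thesis using real by (simp add: emeasure_dset ennreal_mult)
    next
      case top
      then show ?thesis by (simp add: ennreal_mult_top)
    qed
  next
    have lt: "E i \<inter> E j = {}" if ij: "i \<in> I" "j \<in> I" "fst i < fst j" for i j
    proof -
      have "snd i \<in> S (fst i)" "snd j \<in> S (fst j)" using ij by (auto simp: I_def)
      then obtain r p where r: "r \<in> S (fst i)" "p \<in> ch r" "dset (snd j) \<subseteq> dset p" using anc ij(3) by blast
      show ?thesis
      proof (cases "r = snd i")
        case True
        then have "dset (snd j) \<subseteq> UC (snd i)" using r by (auto simp: UC_def)
        then show ?thesis by (auto simp: E_def)
      next
        case False
        then have "dset r \<inter> dset (snd i) = {}" using S_disj r(1) \<open>snd i \<in> S (fst i)\<close> by blast
        then show ?thesis using ch_sub[OF r(2)] r(3) by (auto simp: E_def)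
      qed
    qed
    fix i j assume ij: "i \<in> I" "j \<in> I" "i \<noteq> j"
    consider "fst i < fst j" | "fst j < fst i" | "fst i = fst j" "snd i \<noteq> snd j" using ij(3) by (metis linorder_neqE_nat prod_eqI)
    then show "E i \<inter> E j = {}"
    proof cases
      case 1
      then show ?thesis using lt ij by blast
    next
      case 2
      then show ?thesis using lt ij by blast
    next
      case 3
      have "snd i \<in> S (fst i)" "snd j \<in> S (fst i)" using ij 3 by (auto simp: I_def)
      then have "dset (snd i) \<inter> dset (snd j) = {}" using S_disj 3 by blast
      then show ?thesis by (auto simp: E_def)
    qed
  qed

  \<comment> \<open>The points that never leave the stopping cubes.\<close>
  define Z where "Z = (\<Inter>m. \<Union>q\<in>S m. dset q)"
  have Zs [measurable]: "Z \<in> sets lebesgue"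
    unfolding Z_def by (intro sets.countable_INT'' sets.countable_UN' cc) auto
  \<comment> \<open>Within a cube of any stage such points lie in its children, whose total measure
    is at most half; induction on \<open>j\<close> repeats this.\<close>
  have Zq: "emeasure lebesgue (Z \<inter> dset q) \<le> ennreal ((1 / 2) ^ j * side q ^ CARD('n))" if "q \<in> S m" for q m j
    using that
  proof (induction j arbitrary: q m)
    case 0
    have "emeasure lebesgue (Z \<inter> dset q) \<le> emeasure lebesgue (dset q)" by (intro emeasure_mono) auto
    then show ?case by (simp add: emeasure_dset)
  next
    case (Suc j)
    have "Z \<inter> dset q \<subseteq> (\<Union>p\<in>ch q. Z \<inter> dset p)"
    proof
      fix x assume x: "x \<in> Z \<inter> dset q"
      then have "x \<in> (\<Union>q\<in>S (Suc m). dset q)" by (auto simp: Z_def)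
      then obtain r p where r: "r \<in> S m" "p \<in> ch r" "x \<in> dset p" by (auto simp: SS)
      have "r = q"
      proof (rule ccontr)
        assume "r \<noteq> q"
        then have "dset r \<inter> dset q = {}" using S_disj r(1) Suc.prems by blast
        then show False using ch_sub[OF r(2)] r(3) x by blast
      qed
      then show "x \<in> (\<Union>p\<in>ch q. Z \<inter> dset p)" using r x by blast
    qed
    moreover have "(\<Union>p\<in>ch q. Z \<inter> dset p) \<in> sets lebesgue" by (intro sets.countable_UN' cc) auto
    ultimately have "emeasure lebesgue (Z \<inter> dset q) \<le> emeasure lebesgue (\<Union>p\<in>ch q. Z \<inter> dset p)"
      by (intro emeasure_mono)
    also have "\<dots> \<le> (\<integral>\<^sup>+p. emeasure lebesgue (Z \<inter> dset p) \<partial>count_space (ch q))"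
      by (intro emeasure_UN_le_count cc) auto
    also have "\<dots> \<le> (\<integral>\<^sup>+p. ennreal ((1 / 2) ^ j) * (\<integral>\<^sup>+x. 1 * indicator (dset p) x \<partial>lebesgue) \<partial>count_space (ch q))"
    proof (rule nn_integral_mono)
      fix p assume "p \<in> space (count_space (ch q))"
      then have "p \<in> S (Suc m)" using Suc.prems by (auto simp: SS)
      from Suc.IH[OF this] show "emeasure lebesgue (Z \<inter> dset p) \<le> ennreal ((1 / 2) ^ j) * (\<integral>\<^sup>+x. 1 * indicator (dset p) x \<partial>lebesgue)"
        by (simp add: emeasure_dset ennreal_mult)
    qed
    also have "\<dots> = ennreal ((1 / 2) ^ j) * (\<integral>\<^sup>+p. (\<integral>\<^sup>+x. 1 * indicator (dset p) x \<partial>lebesgue) \<partial>count_space (ch q))"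
      by (rule nn_integral_cmult) simp
    also have "(\<integral>\<^sup>+p. (\<integral>\<^sup>+x. 1 * indicator (dset p) x \<partial>lebesgue) \<partial>count_space (ch q)) = (\<integral>\<^sup>+x. 1 * indicator (UC q) x \<partial>lebesgue)"
      unfolding UC_def by (rule nn_integral_disjoint_le[OF cc]) (use ch_disj in auto)
    also have "\<dots> = emeasure lebesgue (UC q)" by simp
    also have "ennreal ((1 / 2) ^ j) * emeasure lebesgue (UC q) \<le> ennreal ((1 / 2) ^ j) * ennreal (side q ^ CARD('n) / 2)"
      unfolding UC_def by (intro mult_left_mono ch_meas) simp
    also have "\<dots> = ennreal ((1 / 2) ^ Suc j * side q ^ CARD('n))"
      by (subst ennreal_mult[symmetric]) auto
    finally show ?case .
  qed
  have Zq0: "emeasure lebesgue (Z \<inter> dset q) = 0" if "q \<in> S 0" for q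
  proof -
    have "(\<lambda>j. ennreal ((1 / 2) ^ j * side q ^ CARD('n))) \<longlonglongrightarrow> ennreal (0 * side q ^ CARD('n))"
      by (intro tendsto_ennrealI tendsto_mult tendsto_const LIMSEQ_power_zero) auto
    then have "emeasure lebesgue (Z \<inter> dset q) \<le> ennreal (0 * side q ^ CARD('n))"
      by (rule LIMSEQ_le_const) (use Zq[OF that] in auto)
    then show ?thesis by simp
  qed
  have Z0: "AE x in lebesgue. x \<notin> Z"
  proof -
    have "emeasure lebesgue (\<Union>q\<in>S 0. Z \<inter> dset q) \<le> (\<integral>\<^sup>+q. emeasure lebesgue (Z \<inter> dset q) \<partial>count_space (S 0))"
      by (intro emeasure_UN_le_count cc) auto
    also have "\<dots> = (\<integral>\<^sup>+q. 0 \<partial>count_space (S 0))" by (intro nn_integral_cong) (simp only: space_count_space Zq0)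
    finally have "emeasure lebesgue (\<Union>q\<in>S 0. Z \<inter> dset q) = 0" by simp
    moreover have "(\<Union>q\<in>S 0. Z \<inter> dset q) = Z" by (auto simp: Z_def)
    ultimately have "Z \<in> null_sets lebesgue" using Zs by (simp add: null_sets_def)
    then show ?thesis by (rule AE_not_in)
  qed

  let ?SF = "\<lambda>x. \<integral>\<^sup>+i. ennreal (tavg f (snd i)) * indicator (dset (snd i)) x \<partial>count_space I"
  have main: "ennreal (norm (tr K f e v x)) \<le> ennreal domc * ?SF x"
    if x: "x \<notin> Z" and ev: "0 < e" "e < v" "v \<le> 2 powi k0" for x e v
  proof -
    define q0 where "q0 = dyad_at k0 x"
    have q0: "q0 \<in> S 0" "x \<in> dset q0" by (simp_all add: q0_def S0)
    have "tr K f e v x = tr K (tres f q0) e v x"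
    proof (rule tr_cong)
      fix y assume "y \<in> ann x e v"
      then have "y \<in> tri q0" using ev by (intro near_dset_in_tri[OF q0(2)]) (auto simp: ann_def q0_def)
      then show "f y = tres f q0 y" by (simp add: tres_def)
    qed
    then have le1: "ennreal (norm (tr K f e v x)) \<le> max_truncation K (tres f q0) x"
      using tr_le_max_truncation[OF ev(1,2), of K "tres f q0" x] by simp
    define P where "P m Q \<longleftrightarrow> finite Q \<and> Q \<subseteq> I \<and> (\<forall>i\<in>Q. fst i < m) \<and> (\<forall>i\<in>Q. x \<in> dset (snd i))" for m :: nat and Q
    \<comment> \<open>Invariant after \<open>m\<close> stages: either the recursion has already
      stopped with a finite sum, or \<open>x\<close> lies in a cube of stage \<open>m\<close> and
      the truncation localised there is still to be paid.\<close>
    have chain: "(\<exists>Q. P m Q \<and> max_truncation K (tres f q0) x \<le> (\<Sum>i\<in>Q. ennreal (domc * tavg f (snd i))))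
        \<or> (\<exists>q\<in>S m. x \<in> dset q \<and> (\<exists>Q. P m Q \<and> max_truncation K (tres f q0) x \<le> (\<Sum>i\<in>Q. ennreal (domc * tavg f (snd i))) + max_truncation K (tres f q) x))" for m
    proof (induction m)
      case 0
      have "P 0 {}" by (simp add: P_def)
      then show ?case using q0 by (intro disjI2 bexI[of _ q0] conjI exI[of _ "{}"]) auto
    next
      case (Suc m)
      then show ?case
      proof (elim disjE exE bexE conjE)
        fix Q assume Q: "P m Q" "max_truncation K (tres f q0) x \<le> (\<Sum>i\<in>Q. ennreal (domc * tavg f (snd i)))"
        then have "P (Suc m) Q" by (auto simp: P_def)
        then show ?thesis using Q by blast
      next
        fix q Q assume q: "q \<in> S m" "x \<in> dset q" and Q: "P m Q"
          "max_truncation K (tres f q0) x \<le> (\<Sum>i\<in>Q. ennreal (domc * tavg f (snd i))) + max_truncation K (tres f q) x"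
        let ?Q = "insert (m, q) Q"
        have PQ: "P (Suc m) ?Q" using Q(1) q by (auto simp: P_def I_def)
        have new: "(m, q) \<notin> Q" "finite Q" using Q(1) by (auto simp: P_def)
        have sumQ: "(\<Sum>i\<in>?Q. ennreal (domc * tavg f (snd i))) = (\<Sum>i\<in>Q. ennreal (domc * tavg f (snd i))) + ennreal (domc * tavg f q)"
          using new by (simp add: add.commute)
        show ?thesis
        proof (cases "x \<in> (\<Union>p\<in>ch q. dset p)")
          case True
          then obtain p where p: "p \<in> ch q" "x \<in> dset p" by blast
          have "max_truncation K (tres f q0) x \<le> (\<Sum>i\<in>Q. ennreal (domc * tavg f (snd i))) + (ennreal (domc * tavg f q) + max_truncation K (tres f p) x)"
            using Q(2) add_left_mono[OF ch_in[OF p]] by (rule order_trans)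
          then have "max_truncation K (tres f q0) x \<le> (\<Sum>i\<in>?Q. ennreal (domc * tavg f (snd i))) + max_truncation K (tres f p) x"
            unfolding sumQ by (simp only: add.assoc)
          moreover have "p \<in> S (Suc m)" using p q by (auto simp: SS)
          ultimately show ?thesis using PQ p(2) by blast
        next
          case False
          have "max_truncation K (tres f q0) x \<le> (\<Sum>i\<in>?Q. ennreal (domc * tavg f (snd i)))"
            unfolding sumQ using Q(2) add_left_mono[OF ch_out[OF q(2) False]] by (rule order_trans)
          then show ?thesis using PQ by blast
        qed
      qed
    qed
    \<comment> \<open>At a stage whose cubes miss \<open>x\<close> the second alternative is
      impossible.\<close>
    obtain m where "x \<notin> (\<Union>q\<in>S m. dset q)" using x by (auto simp: Z_def)
    with chain[of m] obtain Q where Q: "P m Q" "max_truncation K (tres f q0) x \<le> (\<Sum>i\<in>Q. ennreal (domc * tavg f (snd i)))"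
      by blast
    have "(\<Sum>i\<in>Q. ennreal (domc * tavg f (snd i))) = ennreal domc * (\<Sum>i\<in>Q. ennreal (tavg f (snd i)))"
      using domc_pos by (simp add: sum_distrib_left ennreal_mult del: sum_ennreal)
    also have "(\<Sum>i\<in>Q. ennreal (tavg f (snd i))) = (\<integral>\<^sup>+i. ennreal (tavg f (snd i)) * indicator Q i \<partial>count_space I)"
      using Q(1) by (subst nn_integral_count_space'[of Q]) (auto simp: P_def)
    also have "\<dots> \<le> ?SF x"
      using Q(1) by (intro nn_integral_mono) (auto simp: P_def split: split_indicator)
    finally have "(\<Sum>i\<in>Q. ennreal (domc * tavg f (snd i))) \<le> ennreal domc * ?SF x" by (simp add: mult_left_mono)
    then show ?thesis using le1 Q(2) by (meson order_trans)
  qed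
  have "AE x in lebesgue. \<forall>e v. 0 < e \<and> e < v \<and> v \<le> 2 powi k0 \<longrightarrow> ennreal (norm (tr K f e v x)) \<le> ennreal domc * ?SF x"
    using Z0 by eventually_elim (use main in blast)
  then show ?thesis using sp by blast
qed

end

subsection \<open>Sums over sparse families\<close>

lemma sigma_finite_lebesgue: "sigma_finite_measure (lebesgue :: 'a::euclidean_space measure)"
proof
  have "(\<Union>m::nat. ball (0::'a) (real m)) = UNIV"
    using reals_Archimedean2 by (auto simp: dist_norm)
  moreover have "emeasure lebesgue (ball (0::'a) r) \<noteq> \<infinity>" for r
    using emeasure_lborel_ball_finite[of "0::'a" r] by simp
  ultimately show "\<exists>A. countable A \<and> A \<subseteq> sets (lebesgue :: 'a measure) \<and> \<Union> A = space lebesgue \<and> (\<forall>a\<in>A. emeasure lebesgue a \<noteq> \<infinity>)"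
    by (intro exI[of _ "range (\<lambda>m::nat. ball (0::'a) (real m))"]) auto
qed

lemma powr_layer_cake:
  fixes a q :: real
  assumes a: "0 \<le> a" and q: "0 < q"
  shows "(\<integral>\<^sup>+t. ennreal (t powr (q - 1)) * indicator {0<..<a} t \<partial>lborel) = ennreal (a powr q / q)"
proof -
  have "((\<lambda>t. t powr (q - 1)) has_integral (a powr (q - 1 + 1) / (q - 1 + 1))) {0..a}"
    using a q by (intro has_integral_powr_from_0) auto
  then have "(\<integral>\<^sup>+t. ennreal (t powr (q - 1)) * indicator {0..a} t \<partial>lborel) = ennreal (a powr q / q)"
    by (subst nn_integral_has_integral_lebesgue') auto
  moreover have "(\<integral>\<^sup>+t. ennreal (t powr (q - 1)) * indicator {0<..<a} t \<partial>lborel) = (\<integral>\<^sup>+t. ennreal (t powr (q - 1)) * indicator {0..a} t \<partial>lborel)"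
  proof (rule nn_integral_cong_AE)
    show "AE t in lborel. ennreal (t powr (q - 1)) * indicator {0<..<a} t = ennreal (t powr (q - 1)) * indicator {0..a} t"
      using AE_lborel_singleton[of 0] AE_lborel_singleton[of a]
      by eventually_elim (auto split: split_indicator)
  qed
  ultimately show ?thesis by simp
qed

text \<open>The hypothesis is a weak-type bound in which only the part of \<open>g\<close> above
  \<open>t\<close> counts. In the layer-cake formula it is integrated against
  \<open>q * t powr (q - 1)\<close>; by Fubini \<open>t\<close> runs up to \<open>g x\<close>, and
  the remaining power \<open>t powr (q - 2)\<close> produces the factor \<open>q / (q - 1)\<close>.
  The factor \<open>2 powr q\<close> pays for the level \<open>2 * t\<close>. All occurrences of
  \<open>p\<close> and \<open>p'\<close> outside exponents originate here.\<close>

lemma finite_marcinkiewicz: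
  fixes h \<nu> :: "'i \<Rightarrow> real" and g :: "'a::euclidean_space \<Rightarrow> real" and u :: "'a \<Rightarrow> ennreal" and C q :: real
  assumes fin: "finite I" and \<nu>: "\<And>i. i \<in> I \<Longrightarrow> 0 \<le> \<nu> i" and h: "\<And>i. i \<in> I \<Longrightarrow> 0 \<le> h i"
    and g [measurable]: "g \<in> borel_measurable lebesgue" and g0: "\<And>x. 0 \<le> g x"
    and u [measurable]: "u \<in> borel_measurable lebesgue" and q: "1 < q" and C: "0 \<le> C"
    and weak: "\<And>t. 0 < t \<Longrightarrow> ennreal (\<Sum>i\<in>{i \<in> I. 2 * t < h i}. \<nu> i)
       \<le> ennreal (C / t) * (\<integral>\<^sup>+x. ennreal (g x) * indicator {x. t < g x} x * u x \<partial>lebesgue)"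
  shows "ennreal (\<Sum>i\<in>I. \<nu> i * h i powr q) \<le> ennreal (2 powr q * C * (q / (q - 1))) * (\<integral>\<^sup>+x. ennreal (g x powr q) * u x \<partial>lebesgue)"
proof -
  interpret L: sigma_finite_measure "lebesgue :: 'a measure" by (rule sigma_finite_lebesgue)
  interpret P: pair_sigma_finite "lebesgue :: 'a measure" "lborel :: real measure" ..
  have q0: "0 < q" using q by simp
  have "ennreal (\<Sum>i\<in>I. \<nu> i * (h i / 2) powr q) = (\<Sum>i\<in>I. ennreal (\<nu> i * q) * ennreal ((h i / 2) powr q / q))"
    using \<nu> h q by (subst sum_ennreal[symmetric]) (auto intro!: sum.cong simp: ennreal_mult[symmetric])
  also have "\<dots> = (\<Sum>i\<in>I. ennreal (\<nu> i * q) * (\<integral>\<^sup>+t. ennreal (t powr (q - 1)) * indicator {0<..<h i / 2} t \<partial>lborel))"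
    using h q by (intro sum.cong refl) (simp add: powr_layer_cake)
  also have "\<dots> = (\<integral>\<^sup>+t. (\<Sum>i\<in>I. ennreal (\<nu> i * q) * (ennreal (t powr (q - 1)) * indicator {0<..<h i / 2} t)) \<partial>lborel)"
    by (subst nn_integral_sum) (auto simp: nn_integral_cmult)
  also have "\<dots> \<le> (\<integral>\<^sup>+t. (\<integral>\<^sup>+x. ennreal (q * C * t powr (q - 1 - 1)) * indicator {0<..} t * (ennreal (g x) * indicator {x. t < g x} x * u x) \<partial>lebesgue) \<partial>lborel)"
  proof (rule nn_integral_mono)
    fix t :: real
    show "(\<Sum>i\<in>I. ennreal (\<nu> i * q) * (ennreal (t powr (q - 1)) * indicator {0<..<h i / 2} t))
      \<le> (\<integral>\<^sup>+x. ennreal (q * C * t powr (q - 1 - 1)) * indicator {0<..} t * (ennreal (g x) * indicator {x. t < g x} x * u x) \<partial>lebesgue)"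
    proof (cases "0 < t")
      case True
      let ?J = "{i \<in> I. 2 * t < h i}"
      have "(\<Sum>i\<in>I. ennreal (\<nu> i * q) * (ennreal (t powr (q - 1)) * indicator {0<..<h i / 2} t))
         = (\<Sum>i\<in>?J. ennreal (\<nu> i * q) * (ennreal (t powr (q - 1)) * indicator {0<..<h i / 2} t))"
        using fin by (intro sum.mono_neutral_right) (auto split: split_indicator)
      also have "\<dots> = (\<Sum>i\<in>?J. ennreal (\<nu> i) * ennreal (q * t powr (q - 1)))"
        using True \<nu> q by (intro sum.cong refl) (auto simp: ennreal_mult[symmetric] mult_ac)
      also have "\<dots> = ennreal (q * t powr (q - 1)) * ennreal (\<Sum>i\<in>?J. \<nu> i)"
        using \<nu> by (subst sum_ennreal[symmetric]) (auto simp: sum_distrib_left mult.commute)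
      also have "\<dots> \<le> ennreal (q * t powr (q - 1)) * (ennreal (C / t) * (\<integral>\<^sup>+x. ennreal (g x) * indicator {x. t < g x} x * u x \<partial>lebesgue))"
        by (intro mult_left_mono weak True) simp
      also have "\<dots> = ennreal (q * C * t powr (q - 1 - 1)) * (\<integral>\<^sup>+x. ennreal (g x) * indicator {x. t < g x} x * u x \<partial>lebesgue)"
      proof -
        have "q * t powr (q - 1) * (C / t) = q * C * t powr (q - 1 - 1)"
          using True powr_diff[of t "q - 1" 1] by simp
        note eq = this
        have n: "0 \<le> q * t powr (q - 1)" "0 \<le> C / t" using True q C by auto
        show ?thesis by (subst eq[symmetric], subst ennreal_mult[OF n], rule mult.assoc[symmetric])
      qed
      also have "\<dots> = (\<integral>\<^sup>+x. ennreal (q * C * t powr (q - 1 - 1)) * indicator {0<..} t * (ennreal (g x) * indicator {x. t < g x} x * u x) \<partial>lebesgue)"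
        using True by (subst nn_integral_cmult) auto
      finally show ?thesis .
    next
      case False
      then have "(\<Sum>i\<in>I. ennreal (\<nu> i * q) * (ennreal (t powr (q - 1)) * indicator {0<..<h i / 2} t)) = 0"
        by (intro sum.neutral) auto
      then show ?thesis by simp
    qed
  qed
  also have "\<dots> = (\<integral>\<^sup>+x. (\<integral>\<^sup>+t. ennreal (q * C * t powr (q - 1 - 1)) * indicator {0<..} t * (ennreal (g x) * indicator {x. t < g x} x * u x) \<partial>lborel) \<partial>lebesgue)"
  proof (rule P.Fubini')
    have "(\<lambda>z :: 'a \<times> real. indicator {x. snd z < g x} (fst z) :: ennreal) = (\<lambda>z. indicator {z. snd z < g (fst z)} z)"
      by (auto split: split_indicator)
    moreover have "(\<lambda>z :: 'a \<times> real. indicator {z. snd z < g (fst z)} z :: ennreal) \<in> borel_measurable (lebesgue \<Otimes>\<^sub>M lborel)"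
    proof (rule borel_measurable_indicator)
      have "{z \<in> space (lebesgue \<Otimes>\<^sub>M lborel). snd z < g (fst z)} \<in> sets (lebesgue \<Otimes>\<^sub>M lborel)" by measurable
      then show "{z. snd z < g (fst z)} \<in> sets (lebesgue \<Otimes>\<^sub>M lborel)" by (simp add: space_pair_measure)
    qed
    ultimately have [measurable]: "(\<lambda>z :: 'a \<times> real. indicator {x. snd z < g x} (fst z) :: ennreal) \<in> borel_measurable (lebesgue \<Otimes>\<^sub>M lborel)"
      by simp
    show "(\<lambda>(x, t). ennreal (q * C * t powr (q - 1 - 1)) * indicator {0<..} t * (ennreal (g x) * indicator {x. t < g x} x * u x)) \<in> borel_measurable (lebesgue \<Otimes>\<^sub>M lborel)"
      unfolding case_prod_beta by measurable
  qed
  also have "\<dots> = (\<integral>\<^sup>+x. ennreal (C * (q / (q - 1))) * (ennreal (g x powr q) * u x) \<partial>lebesgue)"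
  proof (rule nn_integral_cong)
    fix x
    have "(\<integral>\<^sup>+t. ennreal (q * C * t powr (q - 1 - 1)) * indicator {0<..} t * (ennreal (g x) * indicator {x. t < g x} x * u x) \<partial>lborel)
      = (\<integral>\<^sup>+t. (ennreal (q * C) * (ennreal (g x) * u x)) * (ennreal (t powr (q - 1 - 1)) * indicator {0<..<g x} t) \<partial>lborel)"
      using q C by (intro nn_integral_cong) (auto simp: ennreal_mult mult_ac split: split_indicator)
    also have "\<dots> = (ennreal (q * C) * (ennreal (g x) * u x)) * ennreal (g x powr (q - 1) / (q - 1))"
      using powr_layer_cake[of "g x" "q - 1"] q g0[of x] by (subst nn_integral_cmult) simp_all
    also have "\<dots> = ennreal (q * C * g x * (g x powr (q - 1) / (q - 1))) * u x"
    proof -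
      have n: "0 \<le> q * C" "0 \<le> g x" "0 \<le> g x powr (q - 1) / (q - 1)" using q C g0[of x] by auto
      show ?thesis
        unfolding ennreal_mult[OF mult_nonneg_nonneg[OF n(1,2)] n(3)] ennreal_mult[OF n(1,2)] by (simp only: mult_ac)
    qed
    also have "q * C * g x * (g x powr (q - 1) / (q - 1)) = C * (q / (q - 1)) * g x powr q"
    proof (cases "g x = 0")
      case False
      then have "g x * g x powr (q - 1) = g x powr q" using g0[of x] powr_mult_base[of "g x" "q - 1"] by simp
      then show ?thesis by (simp add: field_simps)
    qed simp
    also have "ennreal (C * (q / (q - 1)) * g x powr q) * u x = ennreal (C * (q / (q - 1))) * (ennreal (g x powr q) * u x)"
    proof -
      have n: "0 \<le> C * (q / (q - 1))" "0 \<le> g x powr q" using q C by auto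
      show ?thesis by (subst ennreal_mult[OF n]) (rule mult.assoc)
    qed
    finally show "(\<integral>\<^sup>+t. ennreal (q * C * t powr (q - 1 - 1)) * indicator {0<..} t * (ennreal (g x) * indicator {x. t < g x} x * u x) \<partial>lborel) = \<dots>" .
  qed
  also have "\<dots> = ennreal (C * (q / (q - 1))) * (\<integral>\<^sup>+x. ennreal (g x powr q) * u x \<partial>lebesgue)"
    by (rule nn_integral_cmult) measurable
  finally have le: "ennreal (\<Sum>i\<in>I. \<nu> i * (h i / 2) powr q) \<le> ennreal (C * (q / (q - 1))) * (\<integral>\<^sup>+x. ennreal (g x powr q) * u x \<partial>lebesgue)" .
  have "(\<Sum>i\<in>I. \<nu> i * h i powr q) = 2 powr q * (\<Sum>i\<in>I. \<nu> i * (h i / 2) powr q)"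
    using h by (simp add: sum_distrib_left powr_divide)
  then have "ennreal (\<Sum>i\<in>I. \<nu> i * h i powr q) = ennreal (2 powr q) * ennreal (\<Sum>i\<in>I. \<nu> i * (h i / 2) powr q)"
    using \<nu> by (simp add: ennreal_mult sum_nonneg)
  also have "\<dots> \<le> ennreal (2 powr q) * (ennreal (C * (q / (q - 1))) * (\<integral>\<^sup>+x. ennreal (g x powr q) * u x \<partial>lebesgue))"
    by (intro mult_left_mono le) simp
  also have "\<dots> = ennreal (2 powr q * C * (q / (q - 1))) * (\<integral>\<^sup>+x. ennreal (g x powr q) * u x \<partial>lebesgue)"
  proof -
    have n: "0 \<le> 2 powr q" "0 \<le> C * (q / (q - 1))" using q C by auto
    show ?thesis unfolding mult.assoc[of "2 powr q" C]
      by (subst ennreal_mult[OF n]) (rule mult.assoc[symmetric])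
  qed
  finally show ?thesis .
qed

text \<open>The Vitali constant times the ratio of scales when a cube of side \<open>3 * l\<close>
  is placed in a ball of radius \<open>4 * n * l\<close>.\<close>

definition maxc :: "nat \<Rightarrow> real" where
  "maxc n = 10 ^ n * (4 * real n / 3) ^ n"

text \<open>The maximal inequality is applied to \<open>g\<close> restricted to the union of the
  triples, so that only the integral over this union appears on the right. This localisation is what
  permits the summation by parts below.\<close>

lemma tri_cover_weak:
  fixes g :: "real ^ 'n \<Rightarrow> ennreal" and t :: real and J :: "'n::finite dyad set"
  assumes g [measurable]: "g \<in> borel_measurable lebesgue" and t: "0 < t" and fin: "finite J"
    and big: "\<And>q. q \<in> J \<Longrightarrow> ennreal (t * (3 * side q) ^ CARD('n)) < (\<integral>\<^sup>+y\<in>tri q. g y \<partial>lebesgue)"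
  shows "emeasure lebesgue (\<Union>q\<in>J. tri q) \<le> ennreal (maxc CARD('n) / t) * (\<integral>\<^sup>+y\<in>(\<Union>q\<in>J. tri q). g y \<partial>lebesgue)"
proof -
  let ?n = "CARD('n)"
  let ?U = "\<Union>q\<in>J. tri q"
  have n1: "1 \<le> real ?n" using zero_less_card_finite[where 'a='n] by linarith
  have U [measurable]: "?U \<in> sets lebesgue" using fin by (intro sets.finite_UN) auto
  define A where "A = t * (3 / (4 * real ?n)) ^ ?n"
  have A: "0 < A" using t n1 by (simp add: A_def)
  let ?g = "\<lambda>y. g y * indicator ?U y"
  obtain G where G: "G \<in> sets lebesgue" "{x. \<not> growth ?g x A} \<subseteq> G"
      "emeasure lebesgue G \<le> ennreal (10 ^ ?n / A) * (\<integral>\<^sup>+x. ?g x \<partial>lebesgue)"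
    using growth_weak_type[of ?g A] A by auto
  have "?U \<subseteq> G"
  proof
    fix x assume "x \<in> ?U"
    then obtain q where q: "q \<in> J" "x \<in> tri q" by blast
    let ?r = "4 * real ?n * side q"
    have sub: "tri q \<subseteq> ball x ?r"
    proof
      fix y assume "y \<in> tri q"
      then have "norm (x - y) \<le> real ?n * (3 * side q)" using tri_diam[OF q(2)] by blast
      also have "\<dots> < ?r" using n1 by simp
      finally show "y \<in> ball x ?r" by (simp add: dist_norm)
    qed
    have "A * ?r ^ ?n = t * ((3 / (4 * real ?n)) * ?r) ^ ?n" by (simp only: A_def power_mult_distrib mult.assoc)
    also have "(3 / (4 * real ?n)) * ?r = 3 * side q" using n1 by simp
    finally have Ar: "A * ?r ^ ?n = t * (3 * side q) ^ ?n" .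
    have "(\<integral>\<^sup>+y\<in>tri q. g y \<partial>lebesgue) \<le> (\<integral>\<^sup>+y\<in>ball x ?r. ?g y \<partial>lebesgue)"
      using sub q(1) by (intro nn_integral_mono) (auto split: split_indicator)
    with big[OF q(1)] have "\<not> (\<integral>\<^sup>+y\<in>ball x ?r. ?g y \<partial>lebesgue) \<le> ennreal (A * ?r ^ ?n)"
      unfolding Ar by (meson leD order_trans)
    moreover have "0 < ?r" using n1 by simp
    ultimately have "\<not> growth ?g x A" using growthD by blast
    then show "x \<in> G" using G(2) by blast
  qed
  then have "emeasure lebesgue ?U \<le> emeasure lebesgue G" using G(1) by (intro emeasure_mono)
  also note G(3)
  also have "10 ^ ?n / A = maxc ?n / t"
    using n1 t by (simp add: A_def maxc_def power_divide power_mult_distrib)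
  finally show ?thesis .
qed

lemma maxc_pos: "0 < n \<Longrightarrow> 0 < maxc n"
  by (simp add: maxc_def)

lemma sparse_subfamily: "sparse_family I Q E \<Longrightarrow> J \<subseteq> I \<Longrightarrow> sparse_family J Q E"
  unfolding sparse_family_def by (meson countable_subset subsetD)

lemma sparse_measure:
  fixes Q :: "'i \<Rightarrow> 'n::finite dyad"
  assumes "sparse_family I Q E" "i \<in> I"
  shows "emeasure lebesgue (E i) = ennreal (measure lebesgue (E i))"
    and "side (Q i) ^ CARD('n) \<le> 2 * measure lebesgue (E i)"
    and "E i \<in> sets lebesgue" and "E i \<subseteq> dset (Q i)"
proof -
  show E: "E i \<in> sets lebesgue" "E i \<subseteq> dset (Q i)" using assms by (auto simp: sparse_family_def)
  have "emeasure lebesgue (E i) \<le> emeasure lebesgue (dset (Q i))" using E by (intro emeasure_mono) auto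
  then have "emeasure lebesgue (E i) < \<infinity>" by (auto simp: emeasure_dset intro: le_less_trans)
  then show em: "emeasure lebesgue (E i) = ennreal (measure lebesgue (E i))"
    by (intro emeasure_eq_ennreal_measure) auto
  have "emeasure lebesgue (dset (Q i)) \<le> 2 * emeasure lebesgue (E i)" using assms by (auto simp: sparse_family_def)
  then have "ennreal (side (Q i) ^ CARD('n)) \<le> ennreal (2 * measure lebesgue (E i))"
    unfolding em by (simp add: emeasure_dset ennreal_mult)
  then show "side (Q i) ^ CARD('n) \<le> 2 * measure lebesgue (E i)" by simp
qed

lemma sparse_sum_le:
  fixes Q :: "'i \<Rightarrow> 'n::finite dyad"
  assumes sp: "sparse_family I Q E" and fin: "finite I"
  shows "ennreal (\<Sum>i\<in>I. measure lebesgue (E i)) \<le> emeasure lebesgue (\<Union>q\<in>Q ` I. tri q)"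
proof -
  have "ennreal (\<Sum>i\<in>I. measure lebesgue (E i)) = (\<Sum>i\<in>I. emeasure lebesgue (E i))"
    using sparse_measure(1)[OF sp] by (subst sum_ennreal[symmetric]) auto
  also have "\<dots> = emeasure lebesgue (\<Union>i\<in>I. E i)"
    using sp fin by (intro sum_emeasure) (auto simp: sparse_family_def disjoint_family_on_def)
  also have "\<dots> \<le> emeasure lebesgue (\<Union>q\<in>Q ` I. tri q)"
  proof (rule emeasure_mono)
    show "(\<Union>i\<in>I. E i) \<subseteq> (\<Union>q\<in>Q ` I. tri q)"
      using sparse_measure(4)[OF sp] dset_subset_tri by fast
    show "(\<Union>q\<in>Q ` I. tri q) \<in> sets lebesgue" using fin by (intro sets.finite_UN) auto
  qed
  finally show ?thesis .
qed

text \<open>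
  Induction on the number of distinct values of \<open>m\<close> (summation by parts): subtracting the least
  value from all of them leaves a smaller family.
\<close>

lemma sparse_weighted_sum:
  fixes f :: "real ^ 'n \<Rightarrow> complex" and Q :: "'i \<Rightarrow> 'n::finite dyad" and m :: "'i \<Rightarrow> real" and lam :: real
  assumes f: "loc_int f" and lam: "0 < lam" and fin: "finite I" and sp: "sparse_family I Q E"
    and big: "\<And>i. i \<in> I \<Longrightarrow> lam < tavg f (Q i)" and m0: "\<And>i. i \<in> I \<Longrightarrow> 0 \<le> m i"
    and \<phi>: "\<phi> \<in> borel_measurable lebesgue" and m\<phi>: "AE x in lebesgue. \<forall>i\<in>I. x \<in> tri (Q i) \<longrightarrow> ennreal (m i) \<le> \<phi> x"
  shows "ennreal (lam * (\<Sum>i\<in>I. m i * measure lebesgue (E i))) \<le> ennreal (maxc CARD('n)) * (\<integral>\<^sup>+x. modulus f x * \<phi> x \<partial>lebesgue)"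
  using fin sp big m0 \<phi> m\<phi>
proof (induction "card I" arbitrary: I m \<phi> rule: less_induct)
  case less
  note [measurable] = loc_int_measurable[OF f] less.prems(5)
  let ?e = "\<lambda>i. measure lebesgue (E i)"
  show ?case
  proof (cases "I = {}")
    case False
    define \<mu> where "\<mu> = Min (m ` I)"
    have \<mu>le: "\<mu> \<le> m i" if "i \<in> I" for i unfolding \<mu>_def using less.prems(1) that by (intro Min_le) auto
    have "\<mu> \<in> m ` I" unfolding \<mu>_def using less.prems(1) False by (intro Min_in) auto
    then obtain i0 where i0: "i0 \<in> I" "m i0 = \<mu>" by (metis imageE)
    have \<mu>0: "0 \<le> \<mu>" using less.prems(4)[OF i0(1)] i0 by simp
    define J where "J = I - {i0}"
    let ?U = "\<Union>q\<in>Q ` I. tri q"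
    have U [measurable]: "?U \<in> sets lebesgue" using less.prems(1) by (intro sets.finite_UN) auto
    \<comment> \<open>Subtraction on \<open>ennreal\<close> is truncated, but \<mu> is almost
      everywhere at most \<phi> on the union, so adding \<mu> back recovers \<phi>; \<psi> then
      dominates the reduced values.\<close>
    define \<psi> where "\<psi> x = \<phi> x - ennreal \<mu> * indicator ?U x" for x
    have \<psi>m [measurable]: "\<psi> \<in> borel_measurable lebesgue" unfolding \<psi>_def by measurable
    have ae: "AE x in lebesgue. ennreal \<mu> * indicator ?U x + \<psi> x = \<phi> x \<and> (\<forall>i\<in>J. x \<in> tri (Q i) \<longrightarrow> ennreal (m i - \<mu>) \<le> \<psi> x)"
      using less.prems(6)
    proof eventually_elim
      case (elim x)
      show ?case
      proof (cases "x \<in> ?U")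
        case True
        then obtain i where i: "i \<in> I" "x \<in> tri (Q i)" by blast
        have "ennreal \<mu> \<le> ennreal (m i)" using \<mu>le[OF i(1)] by (rule ennreal_leI)
        then have le: "ennreal \<mu> \<le> \<phi> x" using elim i by (meson order_trans)
        have "ennreal (m j - \<mu>) \<le> \<psi> x" if "j \<in> J" "x \<in> tri (Q j)" for j
        proof -
          have "ennreal (m j) \<le> \<phi> x" using elim that by (auto simp: J_def)
          then have "ennreal (m j) - ennreal \<mu> \<le> \<phi> x - ennreal \<mu>" by (rule ennreal_minus_mono) simp
          then show ?thesis using True \<mu>0 by (simp add: \<psi>_def ennreal_minus)
        qed
        moreover have "ennreal \<mu> + (\<phi> x - ennreal \<mu>) = \<phi> x"
          using le by (metis add_diff_inverse_ennreal)
        ultimately show ?thesis using True by (simp add: \<psi>_def)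
      next
        case False
        then show ?thesis by (auto simp: \<psi>_def J_def)
      qed
    qed
    have "(\<Sum>i\<in>I. m i * ?e i) = (\<Sum>i\<in>I. \<mu> * ?e i) + (\<Sum>i\<in>I. (m i - \<mu>) * ?e i)"
      by (simp add: sum.distrib[symmetric] algebra_simps)
    also have "(\<Sum>i\<in>I. (m i - \<mu>) * ?e i) = (\<Sum>i\<in>J. (m i - \<mu>) * ?e i)"
      using less.prems(1) i0 by (intro sum.mono_neutral_right) (auto simp: J_def)
    finally have "lam * (\<Sum>i\<in>I. m i * ?e i) = \<mu> * (lam * (\<Sum>i\<in>I. ?e i)) + lam * (\<Sum>i\<in>J. (m i - \<mu>) * ?e i)"
      by (simp add: distrib_left sum_distrib_left mult_ac)
    moreover have "0 \<le> (\<Sum>i\<in>J. (m i - \<mu>) * ?e i)" using \<mu>le by (intro sum_nonneg mult_nonneg_nonneg) (auto simp: J_def)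
    ultimately have "ennreal (lam * (\<Sum>i\<in>I. m i * ?e i)) = ennreal \<mu> * ennreal (lam * (\<Sum>i\<in>I. ?e i)) + ennreal (lam * (\<Sum>i\<in>J. (m i - \<mu>) * ?e i))"
      using \<mu>0 lam by (simp add: ennreal_mult sum_nonneg)
    also have "\<dots> \<le> ennreal \<mu> * (ennreal (maxc CARD('n)) * (\<integral>\<^sup>+x\<in>?U. modulus f x \<partial>lebesgue)) + ennreal (maxc CARD('n)) * (\<integral>\<^sup>+x. modulus f x * \<psi> x \<partial>lebesgue)"
    proof (intro add_mono mult_left_mono)
      have "ennreal (\<Sum>i\<in>I. ?e i) \<le> emeasure lebesgue ?U"
        by (rule sparse_sum_le[OF less.prems(2,1)])
      also have "\<dots> \<le> ennreal (maxc CARD('n) / lam) * (\<integral>\<^sup>+x\<in>?U. modulus f x \<partial>lebesgue)"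
      proof (rule tri_cover_weak[OF _ lam])
        fix q assume "q \<in> Q ` I"
        then have "lam < tavg f q" using less.prems(3) by blast
        then have "lam * (3 * side q) ^ CARD('n) < tavg f q * (3 * side q) ^ CARD('n)" by simp
        then show "ennreal (lam * (3 * side q) ^ CARD('n)) < (\<integral>\<^sup>+y\<in>tri q. modulus f y \<partial>lebesgue)"
          unfolding tavg_integral[OF f] using lam by (intro ennreal_lessI) (auto intro: le_less_trans[rotated])
      qed (use less.prems(1) in auto)
      finally have "ennreal lam * ennreal (\<Sum>i\<in>I. ?e i) \<le> ennreal lam * (ennreal (maxc CARD('n) / lam) * (\<integral>\<^sup>+x\<in>?U. modulus f x \<partial>lebesgue))"
        by (rule mult_left_mono) simp
      also have "\<dots> = ennreal (maxc CARD('n)) * (\<integral>\<^sup>+x\<in>?U. modulus f x \<partial>lebesgue)"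
        using lam maxc_pos[of "CARD('n)"] by (simp add: mult.assoc[symmetric] ennreal_mult[symmetric])
      finally show "ennreal (lam * (\<Sum>i\<in>I. ?e i)) \<le> ennreal (maxc CARD('n)) * (\<integral>\<^sup>+x\<in>?U. modulus f x \<partial>lebesgue)"
        using lam by (simp add: ennreal_mult sum_nonneg)
      show "ennreal (lam * (\<Sum>i\<in>J. (m i - \<mu>) * ?e i)) \<le> ennreal (maxc CARD('n)) * (\<integral>\<^sup>+x. modulus f x * \<psi> x \<partial>lebesgue)"
      proof (rule less.hyps)
        show "card J < card I" unfolding J_def using less.prems(1) i0(1) by (rule card_Diff1_less)
        show "sparse_family J Q E" by (rule sparse_subfamily[OF less.prems(2)]) (auto simp: J_def)
        show "AE x in lebesgue. \<forall>i\<in>J. x \<in> tri (Q i) \<longrightarrow> ennreal (m i - \<mu>) \<le> \<psi> x"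
          using ae by eventually_elim blast
      qed (use less.prems \<mu>le \<psi>m in \<open>auto simp: J_def\<close>)
    qed simp
    also have "\<dots> = ennreal (maxc CARD('n)) * ((\<integral>\<^sup>+x. ennreal \<mu> * (modulus f x * indicator ?U x) \<partial>lebesgue) + (\<integral>\<^sup>+x. modulus f x * \<psi> x \<partial>lebesgue))"
    proof -
      have "(\<integral>\<^sup>+x. ennreal \<mu> * (modulus f x * indicator ?U x) \<partial>lebesgue) = ennreal \<mu> * (\<integral>\<^sup>+x\<in>?U. modulus f x \<partial>lebesgue)"
        by (rule nn_integral_cmult) measurable
      then show ?thesis by (simp only: distrib_left mult.left_commute)
    qed
    also have "(\<integral>\<^sup>+x. ennreal \<mu> * (modulus f x * indicator ?U x) \<partial>lebesgue) + (\<integral>\<^sup>+x. modulus f x * \<psi> x \<partial>lebesgue)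
      = (\<integral>\<^sup>+x. (ennreal \<mu> * (modulus f x * indicator ?U x) + modulus f x * \<psi> x) \<partial>lebesgue)"
      by (rule nn_integral_add[symmetric]) measurable
    also have "\<dots> = (\<integral>\<^sup>+x. modulus f x * \<phi> x \<partial>lebesgue)"
    proof (rule nn_integral_cong_AE)
      show "AE x in lebesgue. ennreal \<mu> * (modulus f x * indicator ?U x) + modulus f x * \<psi> x = modulus f x * \<phi> x"
        using ae
      proof eventually_elim
        case (elim x)
        show ?case by (simp only: elim[THEN conjunct1, symmetric] distrib_left mult.left_commute)
      qed
    qed
    finally show ?thesis .
  qed simp
qed

subsection \<open>Weighted bounds for finite sparse families\<close>

text \<open>\<open>V\<close> and \<open>W\<close> stand for \<open>A1_const w\<close> and
  \<open>Ainf_const w\<close>, kept as separate parameters. Positivity on cubes excludes the weights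
  that vanish almost everywhere.\<close>

locale a1_setting =
  fixes w :: "real ^ 'n::finite \<Rightarrow> real" and V W :: real
  assumes w0: "\<And>x. 0 \<le> w x" and wm [measurable]: "w \<in> borel_measurable lebesgue"
    and wfin: "\<And>S. compact S \<Longrightarrow> weight_of w S < \<infinity>"
    and V0: "0 \<le> V" and hlV: "AE x in lebesgue. HL_maximal w x \<le> ennreal (V * w x)"
    and hlW: "\<And>S. S \<in> cubes \<Longrightarrow> (\<integral>\<^sup>+x\<in>S. HL_maximal (\<lambda>y. indicator S y * w y) x \<partial>lebesgue) \<le> ennreal W * weight_of w S"
    and W1: "1 \<le> W" and wpos: "\<And>S. S \<in> cubes \<Longrightarrow> 0 < weight_of w S"
begin

definition wr :: "'n dyad \<Rightarrow> real" where
  "wr q = enn2real (weight_of w (dset q))"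

text \<open>The average of the weight over the triple, the same cube over which \<open>tavg\<close>
  averages; so its bound by \<open>V * w\<close> can be inserted under the integral of
  \<open>modulus f\<close>.\<close>

definition mt :: "'n dyad \<Rightarrow> real" where
  "mt q = enn2real (weight_of w (tri q)) / (3 * side q) ^ CARD('n)"

lemma weight_of_mono: "S \<subseteq> S' \<Longrightarrow> weight_of w S \<le> weight_of w S'"
  unfolding weight_of_def by (intro nn_integral_mono) (auto split: split_indicator)

lemma weight_of_density: "S \<in> sets lebesgue \<Longrightarrow> weight_of w S = emeasure (density lebesgue (\<lambda>x. ennreal (w x))) S"
  unfolding weight_of_def by (subst emeasure_density) auto

lemma weight_ccube: "weight_of w (ccube q) = weight_of w (dset q)"
  unfolding weight_of_def
proof (rule nn_integral_cong_AE)
  show "AE x in lebesgue. ennreal (w x) * indicator (ccube q) x = ennreal (w x) * indicator (dset q) x"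
  proof -
    have "AE x in lebesgue. indicator (ccube q) x = (indicator (dset q) x :: ennreal)" by (rule AE_indicator_ccube)
    then show ?thesis by eventually_elim simp
  qed
qed

lemma weight_dset: "weight_of w (dset q) = ennreal (wr q)"
  using wfin[OF compact_ccube[of q]] by (simp add: wr_def weight_ccube)

lemma wr_pos: "0 < wr q"
  using wpos[OF ccube_in_cubes[of q]] unfolding weight_ccube weight_dset by simp

lemma weight_tri: "weight_of w (tri q) = ennreal (mt q * (3 * side q) ^ CARD('n))"
  using wfin[OF compact_tri[of q]] by (simp add: mt_def)

lemma mt_nonneg [simp]: "0 \<le> mt q"
  by (simp add: mt_def)

lemma wr_le_mt: "wr q \<le> 3 ^ CARD('n) * mt q * side q ^ CARD('n)"
proof -
  have "ennreal (wr q) \<le> ennreal (mt q * (3 * side q) ^ CARD('n))"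
    unfolding weight_dset[symmetric] weight_tri[symmetric] by (intro weight_of_mono dset_subset_tri)
  then show ?thesis by (simp add: power_mult_distrib mult_ac)
qed

lemma HL_ge:
  assumes "S \<in> cubes" "x \<in> S"
  shows "(\<integral>\<^sup>+y\<in>S. modulus g y \<partial>lebesgue) / emeasure lebesgue S \<le> HL_maximal g x"
  unfolding HL_maximal_def by (rule SUP_upper) (use assms in simp)

lemma mt_AE: "AE x in lebesgue. \<forall>q. x \<in> tri q \<longrightarrow> ennreal (mt q) \<le> ennreal (V * w x)"
  using hlV
proof eventually_elim
  case (elim x)
  show ?case
  proof (intro allI impI)
    fix q assume x: "x \<in> tri q"
    have "(\<integral>\<^sup>+y\<in>tri q. modulus w y \<partial>lebesgue) = weight_of w (tri q)"
      unfolding weight_of_def modulus_def using w0 by simp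
    then have "(\<integral>\<^sup>+y\<in>tri q. modulus w y \<partial>lebesgue) / emeasure lebesgue (tri q) = ennreal (mt q)"
      by (simp add: weight_tri emeasure_tri divide_ennreal)
    then show "ennreal (mt q) \<le> ennreal (V * w x)"
      using HL_ge[OF tri_in_cubes x, of w] elim by (metis order_trans)
  qed
qed

lemma wr_le_sparse:
  assumes "sparse_family I Q E" "i \<in> I"
  shows "wr (Q i) \<le> 2 * 3 ^ CARD('n) * (mt (Q i) * measure lebesgue (E i))"
proof -
  have "wr (Q i) \<le> 3 ^ CARD('n) * mt (Q i) * side (Q i) ^ CARD('n)" by (rule wr_le_mt)
  also have "\<dots> \<le> 3 ^ CARD('n) * mt (Q i) * (2 * measure lebesgue (E i))"
    using sparse_measure(2)[OF assms] by (intro mult_left_mono) auto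
  finally show ?thesis by (simp add: mult_ac)
qed

text \<open>On \<open>E j\<close> the maximal function of the weight restricted to \<open>R\<close>
  is at least the average of the weight over \<open>Q j\<close>, and \<open>E j\<close> has at least
  half the measure of \<open>Q j\<close>. Since the sets \<open>E j\<close> are disjoint, the sum is
  at most twice the integral in the definition of the characteristic. Closed cubes enter only
  because \<open>cubes\<close> consists of them; the difference is a null set.\<close>

lemma carleson:
  assumes sp: "sparse_family I Q E" and fin: "finite I"
  shows "(\<Sum>j\<in>{j \<in> I. dset (Q j) \<subseteq> dset R}. wr (Q j)) \<le> 2 * W * wr R"
proof -
  let ?J = "{j \<in> I. dset (Q j) \<subseteq> dset R}"
  let ?e = "\<lambda>j. measure lebesgue (E j)"
  let ?H = "\<lambda>x. \<Sum>j\<in>?J. ennreal (wr (Q j) / side (Q j) ^ CARD('n)) * indicator (E j) x"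
  have wr0: "0 \<le> wr q" for q using wr_pos[of q] by simp
  have Es: "E j \<in> sets lebesgue" if "j \<in> I" for j using sparse_measure(3)[OF sp that] .
  have pt: "?H x \<le> HL_maximal (\<lambda>y. indicator (ccube R) y * w y) x * indicator (ccube R) x" for x
  proof (cases "\<exists>j\<in>?J. x \<in> E j")
    case True
    then obtain j where j: "j \<in> I" "dset (Q j) \<subseteq> dset R" "x \<in> E j" by blast
    have "?H x = (\<Sum>i\<in>{j}. ennreal (wr (Q i) / side (Q i) ^ CARD('n)) * indicator (E i) x)"
    proof (rule sum.mono_neutral_right)
      show "\<forall>i\<in>?J - {j}. ennreal (wr (Q i) / side (Q i) ^ CARD('n)) * indicator (E i) x = 0"
      proof
        fix i assume "i \<in> ?J - {j}"
        then have "E i \<inter> E j = {}" using sp j(1) unfolding sparse_family_def by blast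
        then have "x \<notin> E i" using j(3) by blast
        then show "ennreal (wr (Q i) / side (Q i) ^ CARD('n)) * indicator (E i) x = 0" by simp
      qed
    qed (use fin j in auto)
    also have "\<dots> = ennreal (wr (Q j) / side (Q j) ^ CARD('n))" using j(3) by simp
    also have "\<dots> = weight_of w (dset (Q j)) / emeasure lebesgue (ccube (Q j))"
      unfolding weight_dset emeasure_ccube using wr0 by (subst divide_ennreal) auto
    also have "\<dots> \<le> (\<integral>\<^sup>+y\<in>ccube (Q j). modulus (\<lambda>y. indicator (ccube R) y * w y) y \<partial>lebesgue) / emeasure lebesgue (ccube (Q j))"
    proof (rule divide_right_mono_ennreal)
      have "dset (Q j) \<subseteq> ccube R" using j(2) dset_subset_ccube by blast
      then show "weight_of w (dset (Q j)) \<le> (\<integral>\<^sup>+y\<in>ccube (Q j). modulus (\<lambda>y. indicator (ccube R) y * w y) y \<partial>lebesgue)"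
        unfolding weight_of_def modulus_def using w0 dset_subset_ccube[of "Q j"]
        by (intro nn_integral_mono) (auto split: split_indicator)
    qed
    also have "\<dots> \<le> HL_maximal (\<lambda>y. indicator (ccube R) y * w y) x"
      using sparse_measure(4)[OF sp j(1)] j(3) dset_subset_ccube by (intro HL_ge ccube_in_cubes) blast
    finally have "?H x \<le> HL_maximal (\<lambda>y. indicator (ccube R) y * w y) x" .
    moreover have "x \<in> ccube R" using sparse_measure(4)[OF sp j(1)] j(2,3) dset_subset_ccube by blast
    ultimately show ?thesis by simp
  next
    case False
    then have "?H x = 0" by (intro sum.neutral) auto
    then show ?thesis by simp
  qed
  have "ennreal (\<Sum>j\<in>?J. wr (Q j) / side (Q j) ^ CARD('n) * ?e j) = (\<Sum>j\<in>?J. ennreal (wr (Q j) / side (Q j) ^ CARD('n)) * emeasure lebesgue (E j))"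
  proof -
    have "ennreal (wr (Q j) / side (Q j) ^ CARD('n) * ?e j) = ennreal (wr (Q j) / side (Q j) ^ CARD('n)) * emeasure lebesgue (E j)"
      if "j \<in> ?J" for j
    proof -
      have "j \<in> I" using that by simp
      then show ?thesis unfolding sparse_measure(1)[OF sp \<open>j \<in> I\<close>] using wr0 by (intro ennreal_mult) auto
    qed
    moreover have "ennreal (\<Sum>j\<in>?J. wr (Q j) / side (Q j) ^ CARD('n) * ?e j) = (\<Sum>j\<in>?J. ennreal (wr (Q j) / side (Q j) ^ CARD('n) * ?e j))"
      by (rule sum_ennreal[symmetric]) (simp add: wr0)
    moreover have "(\<Sum>j\<in>?J. ennreal (wr (Q j) / side (Q j) ^ CARD('n) * ?e j)) = (\<Sum>j\<in>?J. ennreal (wr (Q j) / side (Q j) ^ CARD('n)) * emeasure lebesgue (E j))"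
      by (rule sum.cong[OF refl]) (rule calculation(1))
    ultimately show ?thesis by (metis (no_types))
  qed
  also have "\<dots> = (\<integral>\<^sup>+x. ?H x \<partial>lebesgue)"
    using Es by (subst nn_integral_sum) (auto simp: nn_integral_cmult)
  also have "\<dots> \<le> (\<integral>\<^sup>+x\<in>ccube R. HL_maximal (\<lambda>y. indicator (ccube R) y * w y) x \<partial>lebesgue)"
    by (intro nn_integral_mono pt)
  also have "\<dots> \<le> ennreal W * weight_of w (ccube R)" by (intro hlW ccube_in_cubes)
  also have "\<dots> = ennreal (W * wr R)" unfolding weight_ccube weight_dset using W1 by (intro ennreal_mult'[symmetric]) simp
  finally have le: "(\<Sum>j\<in>?J. wr (Q j) / side (Q j) ^ CARD('n) * ?e j) \<le> W * wr R"
    using W1 wr0[of R] by (subst (asm) ennreal_le_iff) auto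
  have "(\<Sum>j\<in>?J. wr (Q j)) \<le> (\<Sum>j\<in>?J. 2 * (wr (Q j) / side (Q j) ^ CARD('n) * ?e j))"
  proof (rule sum_mono)
    fix j assume "j \<in> ?J"
    then have "side (Q j) ^ CARD('n) \<le> 2 * ?e j" using sparse_measure(2)[OF sp] by blast
    then have "wr (Q j) * side (Q j) ^ CARD('n) \<le> wr (Q j) * (2 * ?e j)" using wr0 by (intro mult_left_mono)
    moreover have "0 < side (Q j) ^ CARD('n)" by simp
    ultimately show "wr (Q j) \<le> 2 * (wr (Q j) / side (Q j) ^ CARD('n) * ?e j)"
      by (simp add: pos_le_divide_eq mult_ac)
  qed
  also have "\<dots> = 2 * (\<Sum>j\<in>?J. wr (Q j) / side (Q j) ^ CARD('n) * ?e j)" by (simp add: sum_distrib_left)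
  also have "\<dots> \<le> 2 * (W * wr R)" using le by simp
  finally show ?thesis by (simp add: mult_ac)
qed

text \<open>The weight of a cube is at most a multiple of \<open>mt\<close> times the measure of
  \<open>E\<close>. With \<open>mt\<close> as weights and \<open>V * w\<close> as their common
  majorant, the summation by parts yields a single factor \<open>V\<close> for the whole
  family.\<close>

lemma weight_level:
  assumes f: "loc_int f" and lam: "0 < lam" and fin: "finite I" and sp: "sparse_family I Q E"
    and big: "\<And>i. i \<in> I \<Longrightarrow> lam < tavg f (Q i)"
  shows "ennreal (lam * (\<Sum>i\<in>I. wr (Q i))) \<le> ennreal (2 * 3 ^ CARD('n) * maxc CARD('n) * V) * (\<integral>\<^sup>+x. modulus f x * ennreal (w x) \<partial>lebesgue)"
proof -
  note [measurable] = loc_int_measurable[OF f]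
  have mc: "0 < maxc CARD('n)" by (simp add: maxc_pos)
  have mtI: "AE x in lebesgue. \<forall>i\<in>I. x \<in> tri (Q i) \<longrightarrow> ennreal (mt (Q i)) \<le> ennreal (V * w x)"
    using mt_AE by eventually_elim blast
  have "(\<Sum>i\<in>I. wr (Q i)) \<le> (\<Sum>i\<in>I. 2 * 3 ^ CARD('n) * (mt (Q i) * measure lebesgue (E i)))"
    by (intro sum_mono wr_le_sparse[OF sp])
  also have "\<dots> = 2 * 3 ^ CARD('n) * (\<Sum>i\<in>I. mt (Q i) * measure lebesgue (E i))" by (simp add: sum_distrib_left)
  finally have "lam * (\<Sum>i\<in>I. wr (Q i)) \<le> lam * (2 * 3 ^ CARD('n) * (\<Sum>i\<in>I. mt (Q i) * measure lebesgue (E i)))"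
    using lam by (intro mult_left_mono) auto
  then have "ennreal (lam * (\<Sum>i\<in>I. wr (Q i))) \<le> ennreal (2 * 3 ^ CARD('n) * (lam * (\<Sum>i\<in>I. mt (Q i) * measure lebesgue (E i))))"
    by (intro ennreal_leI) (simp add: mult_ac)
  also have "\<dots> = ennreal (2 * 3 ^ CARD('n)) * ennreal (lam * (\<Sum>i\<in>I. mt (Q i) * measure lebesgue (E i)))"
    by (intro ennreal_mult') simp
  also have "\<dots> \<le> ennreal (2 * 3 ^ CARD('n)) * (ennreal (maxc CARD('n)) * (\<integral>\<^sup>+x. modulus f x * ennreal (V * w x) \<partial>lebesgue))"
    by (intro mult_left_mono sparse_weighted_sum[OF f lam fin sp big])
       (use mtI in auto)
  also have "(\<integral>\<^sup>+x. modulus f x * ennreal (V * w x) \<partial>lebesgue) = ennreal V * (\<integral>\<^sup>+x. modulus f x * ennreal (w x) \<partial>lebesgue)"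
    using V0 w0 by (subst nn_integral_cmult[symmetric]) (auto simp: ennreal_mult mult_ac)
  also have "ennreal (2 * 3 ^ CARD('n)) * (ennreal (maxc CARD('n)) * (ennreal V * (\<integral>\<^sup>+x. modulus f x * ennreal (w x) \<partial>lebesgue)))
     = ennreal (2 * 3 ^ CARD('n) * maxc CARD('n) * V) * (\<integral>\<^sup>+x. modulus f x * ennreal (w x) \<partial>lebesgue)"
    using mc V0 by (simp add: ennreal_mult mult.assoc)
  finally show ?thesis .
qed

text \<open>The power \<open>1 / p\<close> of \<open>mt\<close> is moved into the average of
  \<open>modulus f\<close>, where it is at most the same power of \<open>V * w\<close>. What remains
  is the unweighted maximal theorem for \<open>F\<close>, with the measures of the disjoint sets
  \<open>E i\<close>, and the integral of \<open>F powr p\<close> contains \<open>V\<close> exactly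
  once.\<close>

lemma strong_first:
  assumes f: "loc_int f" and p: "1 < p" and fin: "finite I" and sp: "sparse_family I Q E"
    and Nf: "(\<integral>\<^sup>+x. ennreal (norm (f x) powr p) * ennreal (w x) \<partial>lebesgue) < \<infinity>"
  shows "ennreal (\<Sum>i\<in>I. wr (Q i) * tavg f (Q i) powr p)
    \<le> ennreal (2 * 3 ^ CARD('n) * (2 powr p * maxc CARD('n) * (p / (p - 1))) * V) * (\<integral>\<^sup>+x. ennreal (norm (f x) powr p) * ennreal (w x) \<partial>lebesgue)"
proof -
  note [measurable] = loc_int_measurable[OF f]
  have mc: "0 < maxc CARD('n)" by (simp add: maxc_pos)
  let ?e = "\<lambda>j. measure lebesgue (E j)"
  define F where "F x = norm (f x) * (V * w x) powr (1 / p)" for x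
  have Fm [measurable]: "F \<in> borel_measurable lebesgue" unfolding F_def by measurable
  have F0: "0 \<le> F x" for x by (simp add: F_def)
  have Fp: "F x powr p = norm (f x) powr p * (V * w x)" for x
    using p V0 w0[of x] by (simp add: F_def powr_mult powr_powr)
  have FpI: "(\<integral>\<^sup>+x. ennreal (F x powr p) * 1 \<partial>lebesgue) = ennreal V * (\<integral>\<^sup>+x. ennreal (norm (f x) powr p) * ennreal (w x) \<partial>lebesgue)"
    using V0 w0 by (subst nn_integral_cmult[symmetric]) (auto simp: Fp ennreal_mult mult_ac)
  have Ffin: "(\<integral>\<^sup>+x\<in>tri q. ennreal (F x) \<partial>lebesgue) < \<infinity>" for q
  proof -
    have "F x \<le> 1 + F x powr p" for x
    proof (cases "F x \<le> 1")
      case True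
      then show ?thesis by (simp add: add_increasing2)
    next
      case False
      then have "F x powr 1 \<le> F x powr p" using p by (intro powr_mono) auto
      then show ?thesis using False by simp
    qed
    then have "ennreal (F x) \<le> ennreal (1 + F x powr p)" for x by (rule ennreal_leI)
    then have "(\<integral>\<^sup>+x\<in>tri q. ennreal (F x) \<partial>lebesgue) \<le> (\<integral>\<^sup>+x. (indicator (tri q) x + ennreal (F x powr p) * 1) \<partial>lebesgue)"
      by (intro nn_integral_mono) (auto split: split_indicator)
    also have "\<dots> = emeasure lebesgue (tri q) + (\<integral>\<^sup>+x. ennreal (F x powr p) * 1 \<partial>lebesgue)"
      by (subst nn_integral_add) auto
    also have "\<dots> < \<infinity>" unfolding FpI using Nf by (auto simp: emeasure_tri ennreal_mult_less_top)
    finally show ?thesis .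
  qed
  define h where "h i = enn2real (\<integral>\<^sup>+x\<in>tri (Q i). ennreal (F x) \<partial>lebesgue) / (3 * side (Q i)) ^ CARD('n)" for i
  have h0: "0 \<le> h i" for i by (simp add: h_def)
  have hI: "(\<integral>\<^sup>+x\<in>tri (Q i). ennreal (F x) \<partial>lebesgue) = ennreal (h i * (3 * side (Q i)) ^ CARD('n))" for i
    using Ffin[of "Q i"] by (simp add: h_def)
  have th: "tavg f (Q i) * mt (Q i) powr (1 / p) \<le> h i" for i
  proof -
    let ?m = "mt (Q i) powr (1 / p)"
    have "ennreal (tavg f (Q i) * ?m * (3 * side (Q i)) ^ CARD('n)) = ennreal ?m * (\<integral>\<^sup>+y\<in>tri (Q i). modulus f y \<partial>lebesgue)"
      unfolding tavg_integral[OF f] by (subst ennreal_mult[symmetric]) (auto simp: mult_ac)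
    also have "\<dots> = (\<integral>\<^sup>+y. ennreal ?m * (modulus f y * indicator (tri (Q i)) y) \<partial>lebesgue)"
      by (rule nn_integral_cmult[symmetric]) measurable
    also have "\<dots> \<le> (\<integral>\<^sup>+x\<in>tri (Q i). ennreal (F x) \<partial>lebesgue)"
    proof (rule nn_integral_mono_AE)
      show "AE y in lebesgue. ennreal ?m * (modulus f y * indicator (tri (Q i)) y) \<le> ennreal (F y) * indicator (tri (Q i)) y"
        using mt_AE
      proof eventually_elim
        case (elim y)
        show ?case
        proof (cases "y \<in> tri (Q i)")
          case True
          then have "ennreal (mt (Q i)) \<le> ennreal (V * w y)" using elim by blast
          then have "mt (Q i) \<le> V * w y" using V0 w0[of y] by simp
          then have "?m \<le> (V * w y) powr (1 / p)" using p by (intro powr_mono2) auto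
          then have "norm (f y) * ?m \<le> F y" unfolding F_def by (intro mult_left_mono) auto
          then have "ennreal (norm (f y) * ?m) \<le> ennreal (F y)" by (rule ennreal_leI)
          then show ?thesis using True by (simp add: modulus_def ennreal_mult mult.commute)
        qed simp
      qed
    qed
    also note hI[of i]
    finally show ?thesis using h0[of i] by (simp add: mult_le_cancel_right)
  qed
  have "ennreal (\<Sum>i\<in>I. ?e i * h i powr p) \<le> ennreal (2 powr p * maxc CARD('n) * (p / (p - 1))) * (\<integral>\<^sup>+x. ennreal (F x powr p) * 1 \<partial>lebesgue)"
  proof (rule finite_marcinkiewicz[OF fin _ h0 Fm F0 _ p])
    fix t :: real assume t: "0 < t"
    let ?J = "{i \<in> I. 2 * t < h i}"
    let ?g = "\<lambda>x. ennreal (F x) * indicator {x. t < F x} x"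
    have gm [measurable]: "?g \<in> borel_measurable lebesgue"
    proof -
      have "{x \<in> space lebesgue. t < F x} \<in> sets lebesgue" by measurable
      then have "{x. t < F x} \<in> sets lebesgue" by simp
      then show ?thesis by measurable
    qed
    have "ennreal (\<Sum>i\<in>?J. ?e i) \<le> emeasure lebesgue (\<Union>q\<in>Q ` ?J. tri q)"
      using fin by (intro sparse_sum_le[OF sparse_subfamily[OF sp]]) auto
    also have "\<dots> \<le> ennreal (maxc CARD('n) / t) * (\<integral>\<^sup>+y\<in>(\<Union>q\<in>Q ` ?J. tri q). ?g y \<partial>lebesgue)"
    proof (rule tri_cover_weak[OF gm t])
      fix q assume "q \<in> Q ` ?J"
      then obtain i where i: "i \<in> I" "2 * t < h i" "q = Q i" by blast
      let ?s = "(3 * side q) ^ CARD('n)"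
      have s0: "0 < ?s" by simp
      have "ennreal (h i * ?s) = (\<integral>\<^sup>+x\<in>tri q. ennreal (F x) \<partial>lebesgue)" using hI[of i] i(3) by simp
      \<comment> \<open>The part of \<open>F\<close> not exceeding \<open>t\<close> contributes at
        most \<open>t\<close> to the average. Since the average is above \<open>2 * t\<close>, the
        part above \<open>t\<close> still exceeds \<open>t\<close> on average.\<close>
      also have "\<dots> \<le> (\<integral>\<^sup>+x. (?g x * indicator (tri q) x + ennreal t * indicator (tri q) x) \<partial>lebesgue)"
        by (intro nn_integral_mono) (auto split: split_indicator simp: ennreal_leI not_less)
      also have "\<dots> = (\<integral>\<^sup>+x\<in>tri q. ?g x \<partial>lebesgue) + ennreal (t * ?s)"
        using t by (subst nn_integral_add) (auto simp: nn_integral_cmult emeasure_tri ennreal_mult)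
      finally have le: "ennreal (h i * ?s) \<le> (\<integral>\<^sup>+x\<in>tri q. ?g x \<partial>lebesgue) + ennreal (t * ?s)" .
      show "ennreal (t * ?s) < (\<integral>\<^sup>+x\<in>tri q. ?g x \<partial>lebesgue)"
      proof (rule ccontr)
        assume "\<not> ?thesis"
        then have "ennreal (h i * ?s) \<le> ennreal (t * ?s) + ennreal (t * ?s)"
          using le by (meson add_right_mono not_less order_trans)
        then have "h i * ?s \<le> t * ?s + t * ?s" using t s0 by (simp flip: ennreal_plus)
        then have "h i * ?s \<le> (2 * t) * ?s" by simp
        then show False using i(2) s0 by (simp add: mult_le_cancel_right)
      qed
    qed (use fin in simp)
    also have "\<dots> \<le> ennreal (maxc CARD('n) / t) * (\<integral>\<^sup>+x. ?g x * 1 \<partial>lebesgue)"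
      by (intro mult_left_mono nn_integral_mono) (auto split: split_indicator)
    finally show "ennreal (\<Sum>i\<in>?J. ?e i) \<le> ennreal (maxc CARD('n) / t) * (\<integral>\<^sup>+x. ?g x * 1 \<partial>lebesgue)" .
  qed (use mc in auto)
  note marc = this[unfolded FpI]
  have "(\<Sum>i\<in>I. wr (Q i) * tavg f (Q i) powr p) \<le> (\<Sum>i\<in>I. 2 * 3 ^ CARD('n) * (?e i * h i powr p))"
  proof (rule sum_mono)
    fix i assume i: "i \<in> I"
    have "wr (Q i) * tavg f (Q i) powr p \<le> 2 * 3 ^ CARD('n) * (mt (Q i) * ?e i) * tavg f (Q i) powr p"
      by (intro mult_right_mono wr_le_sparse[OF sp i]) simp
    also have "\<dots> = 2 * 3 ^ CARD('n) * (?e i * (tavg f (Q i) * mt (Q i) powr (1 / p)) powr p)"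
      using p by (simp add: powr_mult powr_powr mult_ac)
    also have "\<dots> \<le> 2 * 3 ^ CARD('n) * (?e i * h i powr p)"
      using p th[of i] by (intro mult_left_mono powr_mono2) auto
    finally show "wr (Q i) * tavg f (Q i) powr p \<le> 2 * 3 ^ CARD('n) * (?e i * h i powr p)" .
  qed
  also have "\<dots> = 2 * 3 ^ CARD('n) * (\<Sum>i\<in>I. ?e i * h i powr p)" by (simp add: sum_distrib_left)
  finally have "ennreal (\<Sum>i\<in>I. wr (Q i) * tavg f (Q i) powr p) \<le> ennreal (2 * 3 ^ CARD('n)) * ennreal (\<Sum>i\<in>I. ?e i * h i powr p)"
    by (subst ennreal_mult'[symmetric]) (auto intro: ennreal_leI)
  also have "\<dots> \<le> ennreal (2 * 3 ^ CARD('n)) * (ennreal (2 powr p * maxc CARD('n) * (p / (p - 1))) * (ennreal V * (\<integral>\<^sup>+x. ennreal (norm (f x) powr p) * ennreal (w x) \<partial>lebesgue)))"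
    by (intro mult_left_mono marc) simp
  also have "\<dots> = ennreal (2 * 3 ^ CARD('n) * (2 powr p * maxc CARD('n) * (p / (p - 1))) * V) * (\<integral>\<^sup>+x. ennreal (norm (f x) powr p) * ennreal (w x) \<partial>lebesgue)"
  proof -
    have n: "0 \<le> (2::real) * 3 ^ CARD('n)" "0 \<le> 2 powr p * maxc CARD('n) * (p / (p - 1))" using mc p by auto
    show ?thesis
      by (subst ennreal_mult[OF mult_nonneg_nonneg[OF n] V0], subst ennreal_mult[OF n]) (simp only: mult.assoc)
  qed
  finally show ?thesis .
qed

text \<open>In a finite set of dyadic cubes the maximal ones under inclusion cover the rest, and two
  different ones are disjoint, since meeting dyadic cubes are nested.\<close>

lemma maximal_dyads:
  assumes "finite (X :: 'n dyad set)"
  shows "\<exists>R\<subseteq>X. (\<forall>q\<in>X. \<exists>r\<in>R. dset q \<subseteq> dset r) \<and> (\<forall>r\<in>R. \<forall>r'\<in>R. r \<noteq> r' \<longrightarrow> dset r \<inter> dset r' = {})"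
proof -
  define R where "R = {r \<in> X. \<forall>s\<in>X. dset r \<subseteq> dset s \<longrightarrow> s = r}"
  have "\<exists>r\<in>R. dset q \<subseteq> dset r" if q: "q \<in> X" for q
  proof -
    let ?Y = "{s \<in> X. dset q \<subseteq> dset s}"
    have Y: "finite ?Y" "?Y \<noteq> {}" using assms q by (simp, blast)
    have "Max (fst ` ?Y) \<in> fst ` ?Y" using Y by (intro Max_in) auto
    then obtain r where r: "r \<in> X" "dset q \<subseteq> dset r" "fst r = Max (fst ` ?Y)" by auto
    have "s = r" if s: "s \<in> X" "dset r \<subseteq> dset s" for s
    proof -
      have "s \<in> ?Y" using s r(2) by auto
      then have "fst s \<le> fst r" unfolding r(3) using Y by (intro Max_ge) auto
      moreover have "emeasure lebesgue (dset r) \<le> emeasure lebesgue (dset s)" using s by (intro emeasure_mono) auto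
      then have "side r \<le> side s" by (simp add: emeasure_dset power_mono_iff)
      then have "fst r \<le> fst s"
        using power_int_strict_increasing[of "fst s" "fst r" "2 :: real"] by (fastforce simp: side_def not_le)
      ultimately have "fst s = fst r" by simp
      then show ?thesis using dset_same_gen[of s r "corner r"] s(2) corner_in_dset[of r] by blast
    qed
    then have "r \<in> R" using r by (simp add: R_def)
    then show ?thesis using r by blast
  qed
  moreover have "dset r \<inter> dset r' = {}" if r: "r \<in> R" "r' \<in> R" "r \<noteq> r'" for r r'
  proof (rule ccontr)
    assume "dset r \<inter> dset r' \<noteq> {}"
    then have "dset r \<subseteq> dset r' \<or> dset r' \<subseteq> dset r"
      using dset_nested[of r r'] dset_nested[of r' r] by (metis inf_commute linear)
    then show False using r by (auto simp: R_def)
  qed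
  moreover have "R \<subseteq> X" unfolding R_def by blast
  ultimately show ?thesis by (intro exI[of _ R] conjI ballI impI) simp_all
qed

text \<open>The Carleson embedding for averages in the measure given by \<open>w\<close>. The cubes
  with large average are grouped under disjoint maximal ones; the Carleson condition bounds each
  group by \<open>2 * W\<close> times the weight of its top cube, and the weight of that cube by the
  part of \<open>g\<close> above \<open>t\<close>. Boundedness of \<open>g\<close> keeps the
  averages finite.\<close>

lemma strong_second:
  assumes g [measurable]: "g \<in> borel_measurable lebesgue" and g0: "\<And>x. 0 \<le> g x" and gb: "\<And>x. g x \<le> G"
    and q: "1 < q" and fin: "finite I" and sp: "sparse_family I Q E"
  defines "h i \<equiv> enn2real (\<integral>\<^sup>+x\<in>dset (Q i). ennreal (g x) * ennreal (w x) \<partial>lebesgue) / wr (Q i)"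
  shows "ennreal (\<Sum>i\<in>I. wr (Q i) * h i powr q) \<le> ennreal (2 powr q * (2 * W) * (q / (q - 1))) * (\<integral>\<^sup>+x. ennreal (g x powr q) * ennreal (w x) \<partial>lebesgue)"
    and "\<And>i. (\<integral>\<^sup>+x\<in>dset (Q i). ennreal (g x) * ennreal (w x) \<partial>lebesgue) = ennreal (h i * wr (Q i))"
    and "\<And>i. 0 \<le> h i"
proof -
  have wr0: "0 \<le> wr q" for q using wr_pos[of q] by simp
  have gfin: "(\<integral>\<^sup>+x\<in>dset r. ennreal (g x) * ennreal (w x) \<partial>lebesgue) < \<infinity>" for r
  proof -
    have "(\<integral>\<^sup>+x\<in>dset r. ennreal (g x) * ennreal (w x) \<partial>lebesgue) \<le> (\<integral>\<^sup>+x. ennreal G * (ennreal (w x) * indicator (dset r) x) \<partial>lebesgue)"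
      using gb by (intro nn_integral_mono) (auto split: split_indicator intro!: mult_right_mono ennreal_leI)
    also have "\<dots> = ennreal G * weight_of w (dset r)" unfolding weight_of_def by (rule nn_integral_cmult) measurable
    also have "\<dots> < \<infinity>" by (simp add: weight_dset ennreal_mult_less_top)
    finally show ?thesis .
  qed
  show hI: "(\<integral>\<^sup>+x\<in>dset (Q i). ennreal (g x) * ennreal (w x) \<partial>lebesgue) = ennreal (h i * wr (Q i))" for i
    using gfin[of "Q i"] wr_pos[of "Q i"] by (simp add: h_def)
  show h0: "0 \<le> h i" for i using wr0 by (simp add: h_def)
  show "ennreal (\<Sum>i\<in>I. wr (Q i) * h i powr q) \<le> ennreal (2 powr q * (2 * W) * (q / (q - 1))) * (\<integral>\<^sup>+x. ennreal (g x powr q) * ennreal (w x) \<partial>lebesgue)"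
  proof (rule finite_marcinkiewicz[OF fin wr0 h0 g g0 _ q])
    fix t :: real assume t: "0 < t"
    let ?J = "{i \<in> I. 2 * t < h i}"
    let ?g = "\<lambda>x. ennreal (g x) * indicator {x. t < g x} x * ennreal (w x)"
    have gm [measurable]: "?g \<in> borel_measurable lebesgue"
    proof -
      have "{x \<in> space lebesgue. t < g x} \<in> sets lebesgue" by measurable
      then have "{x. t < g x} \<in> sets lebesgue" by simp
      then show ?thesis by measurable
    qed
    have fX: "finite (Q ` ?J)" using fin by simp
    obtain R where R: "R \<subseteq> Q ` ?J" "\<forall>q\<in>Q ` ?J. \<exists>r\<in>R. dset q \<subseteq> dset r"
      "\<forall>r\<in>R. \<forall>r'\<in>R. r \<noteq> r' \<longrightarrow> dset r \<inter> dset r' = {}"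
      using maximal_dyads[OF fX] by (elim exE conjE)
    have finR: "finite R" by (rule finite_subset[OF R(1) fX])
    have each: "ennreal (wr r) \<le> ennreal (1 / t) * (\<integral>\<^sup>+x\<in>dset r. ?g x \<partial>lebesgue)" if r: "r \<in> R" for r
    proof -
      obtain i where i: "i \<in> I" "2 * t < h i" "r = Q i" using r R(1) by blast
      have "ennreal (h i * wr r) \<le> (\<integral>\<^sup>+x. (?g x * indicator (dset r) x + ennreal t * (ennreal (w x) * indicator (dset r) x)) \<partial>lebesgue)"
        unfolding i(3) hI[of i, symmetric]
        by (intro nn_integral_mono) (auto split: split_indicator simp: not_less intro!: mult_right_mono ennreal_leI)
      also have "\<dots> = (\<integral>\<^sup>+x\<in>dset r. ?g x \<partial>lebesgue) + ennreal t * weight_of w (dset r)"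
        unfolding weight_of_def by (subst nn_integral_add) (auto simp: nn_integral_cmult)
      also have "\<dots> = (\<integral>\<^sup>+x\<in>dset r. ?g x \<partial>lebesgue) + ennreal (t * wr r)"
        using t wr0[of r] by (simp add: weight_dset ennreal_mult)
      finally have le: "ennreal (h i * wr r) \<le> (\<integral>\<^sup>+x\<in>dset r. ?g x \<partial>lebesgue) + ennreal (t * wr r)" .
      have "ennreal (t * wr r) \<le> (\<integral>\<^sup>+x\<in>dset r. ?g x \<partial>lebesgue)"
      proof (rule ccontr)
        assume "\<not> ?thesis"
        then have "(\<integral>\<^sup>+x\<in>dset r. ?g x \<partial>lebesgue) \<le> ennreal (t * wr r)" by simp
        then have "ennreal (h i * wr r) \<le> ennreal (t * wr r) + ennreal (t * wr r)"
          using le by (meson add_right_mono order_trans)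
        then have "h i * wr r \<le> t * wr r + t * wr r" using t wr0[of r] by (simp flip: ennreal_plus)
        then have "h i * wr r \<le> (2 * t) * wr r" by simp
        then show False using i(2) wr_pos[of r] by (simp add: mult_le_cancel_right)
      qed
      then have "ennreal (1 / t) * ennreal (t * wr r) \<le> ennreal (1 / t) * (\<integral>\<^sup>+x\<in>dset r. ?g x \<partial>lebesgue)" by (rule mult_left_mono) simp
      then show ?thesis using t wr0[of r] by (simp flip: ennreal_mult')
    qed
    \<comment> \<open>Every selected cube lies under some maximal one, so its weight is counted at
      least once in the sums on the right.\<close>
    have "(\<Sum>i\<in>?J. wr (Q i)) \<le> (\<Sum>r\<in>R. \<Sum>i\<in>{i \<in> I. dset (Q i) \<subseteq> dset r}. wr (Q i))"
    proof -
      let ?c = "\<lambda>i r. if dset (Q i) \<subseteq> dset r then wr (Q i) else 0"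
      have "(\<Sum>i\<in>?J. wr (Q i)) \<le> (\<Sum>i\<in>?J. \<Sum>r\<in>R. ?c i r)"
      proof (rule sum_mono)
        fix i assume "i \<in> ?J"
        then obtain r where r: "r \<in> R" "dset (Q i) \<subseteq> dset r" using R(2) by blast
        have "?c i r \<le> (\<Sum>r\<in>R. ?c i r)" using r(1) wr0 finR by (intro member_le_sum) auto
        then show "wr (Q i) \<le> (\<Sum>r\<in>R. ?c i r)" using r(2) by simp
      qed
      also have "\<dots> \<le> (\<Sum>i\<in>I. \<Sum>r\<in>R. ?c i r)"
        using fin wr0 by (intro sum_mono2 sum_nonneg) auto
      also have "\<dots> = (\<Sum>r\<in>R. \<Sum>i\<in>I. ?c i r)" by (rule sum.swap)
      also have "\<dots> = (\<Sum>r\<in>R. \<Sum>i\<in>{i \<in> I. dset (Q i) \<subseteq> dset r}. wr (Q i))"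
        using fin by (simp add: sum.inter_filter)
      finally show ?thesis .
    qed
    also have "\<dots> \<le> (\<Sum>r\<in>R. 2 * W * wr r)" by (intro sum_mono carleson[OF sp fin])
    finally have "ennreal (\<Sum>i\<in>?J. wr (Q i)) \<le> ennreal (\<Sum>r\<in>R. 2 * W * wr r)" by (rule ennreal_leI)
    also have "\<dots> = ennreal (2 * W) * (\<Sum>r\<in>R. ennreal (wr r))"
      using W1 wr0 by (simp add: sum_distrib_left[symmetric] ennreal_mult sum_nonneg)
    also have "\<dots> \<le> ennreal (2 * W) * (\<Sum>r\<in>R. ennreal (1 / t) * (\<integral>\<^sup>+x\<in>dset r. ?g x \<partial>lebesgue))"
      by (intro mult_left_mono sum_mono each) auto
    also have "\<dots> = ennreal (2 * W) * (ennreal (1 / t) * (\<Sum>r\<in>R. \<integral>\<^sup>+x\<in>dset r. ?g x \<partial>lebesgue))"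
      by (simp add: sum_distrib_left)
    also have "(\<Sum>r\<in>R. \<integral>\<^sup>+x\<in>dset r. ?g x \<partial>lebesgue) = (\<integral>\<^sup>+r. (\<integral>\<^sup>+x. ?g x * indicator (dset r) x \<partial>lebesgue) \<partial>count_space R)"
      using finR by (simp add: nn_integral_count_space_finite)
    also have "\<dots> = (\<integral>\<^sup>+x. ?g x * indicator (\<Union>r\<in>R. dset r) x \<partial>lebesgue)"
      using R(3) by (intro nn_integral_disjoint_le countable_finite finR gm) auto
    also have "ennreal (2 * W) * (ennreal (1 / t) * (\<integral>\<^sup>+x. ?g x * indicator (\<Union>r\<in>R. dset r) x \<partial>lebesgue)) \<le> ennreal (2 * W) * (ennreal (1 / t) * (\<integral>\<^sup>+x. ?g x \<partial>lebesgue))"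
      by (intro mult_left_mono nn_integral_mono) (auto split: split_indicator)
    also have "\<dots> = ennreal (2 * W / t) * (\<integral>\<^sup>+x. ?g x \<partial>lebesgue)"
    proof -
      have n: "0 \<le> 2 * W" "0 \<le> 1 / t" using W1 t by auto
      have "2 * W / t = 2 * W * (1 / t)" by simp
      then show ?thesis by (simp only:) (subst ennreal_mult[OF n], rule mult.assoc[symmetric])
    qed
    finally show "ennreal (\<Sum>i\<in>?J. wr (Q i)) \<le> ennreal (2 * W / t) * (\<integral>\<^sup>+x. ?g x \<partial>lebesgue)" .
  qed (use W1 in auto)
qed

end

section \<open>Strong type for finite sparse sums\<close>

definition avgop :: "(real ^ 'n \<Rightarrow> complex) \<Rightarrow> 'i set \<Rightarrow> ('i \<Rightarrow> 'n::finite dyad) \<Rightarrow> real ^ 'n \<Rightarrow> real" where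
  "avgop f I Q x = (\<Sum>i\<in>I. tavg f (Q i) * indicator (dset (Q i)) x)"

lemma avgop_nonneg [simp]: "0 \<le> avgop f I Q x"
  by (simp add: avgop_def sum_nonneg)

lemma avgop_measurable [measurable]: "avgop f I Q \<in> borel_measurable lebesgue"
  unfolding avgop_def[abs_def] by measurable

definition strc :: "nat \<Rightarrow> real" where
  "strc n = 8 * (2 * 3 ^ n * maxc n)"

lemma maxc_ge1: "0 < n \<Longrightarrow> 1 \<le> maxc n"
proof -
  assume n: "0 < n"
  have "1 \<le> (10::real) ^ n" by (rule one_le_power) simp
  moreover have "1 \<le> (4 * real n / 3) ^ n" using n by (intro one_le_power) simp
  ultimately have "1 * 1 \<le> maxc n" unfolding maxc_def by (intro mult_mono) auto
  then show ?thesis by simp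
qed

text \<open>The bound must become a product of \<open>p\<close>-th powers, so that the
  \<open>p\<close>-th root is linear in \<open>p * p'\<close>. For this \<open>p'\<close> and
  \<open>c0\<close> are raised to the power \<open>p\<close> and \<open>p powr (p - 1)\<close> is
  enlarged. The three powers of 2, from the two interpolations and from the constant
  \<open>2 * W\<close>, merge into \<open>8 powr p\<close>.\<close>

lemma strong_constant_bound:
  fixes c0 p p' V W :: real
  assumes p: "1 < p" and p': "p' = p / (p - 1)" and c0: "1 \<le> c0" and V: "0 \<le> V" and W: "1 \<le> W"
  shows "c0 * (2 powr p * p') * V * (2 powr p' * (2 * W) * p) powr (p - 1) \<le> (8 * c0 * p * p') powr p * V * W powr (p - 1)"
proof -
  have p'1: "1 < p'" unfolding p' using p by (simp add: less_divide_eq)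
  have pp: "p' * (p - 1) = p" using p p' by simp
  have "(2 powr p' * (2 * W) * p) powr (p - 1) = 2 powr p * (2 powr (p - 1) * W powr (p - 1)) * p powr (p - 1)"
    using p W by (simp add: powr_mult powr_powr pp)
  also have "\<dots> \<le> 2 powr p * (2 powr p * W powr (p - 1)) * p powr p"
    using p W by (intro mult_mono mult_left_mono mult_right_mono powr_mono) auto
  finally have 1: "(2 powr p' * (2 * W) * p) powr (p - 1) \<le> 2 powr p * (2 powr p * W powr (p - 1)) * p powr p" .
  have 2: "c0 \<le> c0 powr p" using powr_mono[of 1 p c0] c0 p by simp
  have 3: "p' \<le> p' powr p" using powr_mono[of 1 p p'] p'1 p by simp
  have "c0 * (2 powr p * p') * V * (2 powr p' * (2 * W) * p) powr (p - 1)
      \<le> c0 powr p * (2 powr p * p' powr p) * V * (2 powr p * (2 powr p * W powr (p - 1)) * p powr p)"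
    using 1 2 3 c0 p'1 V by (intro mult_mono mult_left_mono mult_nonneg_nonneg) auto
  also have "\<dots> = (2 powr p * 2 powr p * 2 powr p) * c0 powr p * p powr p * p' powr p * V * W powr (p - 1)"
    by (simp only: mult_ac)
  also have "2 powr p * 2 powr p * 2 powr p = 8 powr p"
  proof -
    have "(2 * 2 * 2) powr p = 2 powr p * 2 powr p * 2 powr p" by (simp only: powr_mult)
    then show ?thesis by simp
  qed
  also have "8 powr p * c0 powr p * p powr p * p' powr p * V * W powr (p - 1) = (8 * c0 * p * p') powr p * V * W powr (p - 1)"
    by (simp only: powr_mult)
  finally show ?thesis .
qed

lemma AE_lebesgue_ex:
  assumes "AE x :: 'a::euclidean_space in lebesgue. P x"
  obtains x where "P x"
proof -
  have "\<exists>x. P x"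
  proof (rule ccontr)
    assume "\<not> (\<exists>x. P x)"
    then have "AE x :: 'a in lebesgue. False" using assms by simp
    then have "emeasure (lebesgue :: 'a measure) (space lebesgue) = 0"
      by (simp only: eventually_False ae_filter_eq_bot_iff)
    then show False by simp
  qed
  then show ?thesis using that by blast
qed

lemma ennreal_pos_times_top: "0 < c \<Longrightarrow> ennreal c * \<infinity> = \<infinity>"
  by (simp add: ennreal_mult_top ennreal_eq_0_iff)

lemma ennreal_less_topE:
  assumes "x < (\<infinity> :: ennreal)"
  obtains r where "x = ennreal r" "0 \<le> r"
  using assms by (cases x) auto

text \<open>With \<tau> equal to \<open>K2 powr (1 / p')\<close> the dual term contributes exactly
  \<open>X / p'\<close>, which is absorbed on the left; this is possible because \<open>X\<close> is
  a finite real. The factor \<open>1 / p\<close> left over cancels the one in the first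
  term.\<close>

lemma young_absorb:
  fixes S1 S2 X K1 K2 p p' :: real
  assumes p: "1 < p" and p': "p' = p / (p - 1)" and K2: "0 < K2"
    and S1: "S1 \<le> K1" and S2: "S2 \<le> K2 * X"
    and yg: "\<And>\<tau>. 0 < \<tau> \<Longrightarrow> X \<le> \<tau> powr p * S1 / p + \<tau> powr (- p') * S2 / p'"
  shows "X \<le> K1 * K2 powr (p - 1)"
proof -
  have p'1: "1 < p'" unfolding p' using p by (simp add: less_divide_eq)
  have conj: "1 - 1 / p' = 1 / p" unfolding p' using p by (simp add: field_simps)
  define \<tau> where "\<tau> = K2 powr (1 / p')"
  have \<tau>: "0 < \<tau>" using K2 by (simp add: \<tau>_def)
  have t1: "\<tau> powr p = K2 powr (p - 1)"
  proof -
    have "1 / p' * p = p - 1" unfolding p' using p by simp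
    then show ?thesis by (simp add: \<tau>_def powr_powr)
  qed
  have t2: "\<tau> powr (- p') * K2 = 1"
  proof -
    have "\<tau> powr (- p') = K2 powr (-1)" using p'1 by (simp add: \<tau>_def powr_powr)
    then show ?thesis using K2 by (simp add: powr_minus)
  qed
  have "X \<le> \<tau> powr p * S1 / p + \<tau> powr (- p') * S2 / p'" by (rule yg[OF \<tau>])
  also have "\<dots> \<le> \<tau> powr p * K1 / p + \<tau> powr (- p') * (K2 * X) / p'"
    using S1 S2 p p'1 by (intro add_mono divide_right_mono mult_left_mono) auto
  also have "\<tau> powr (- p') * (K2 * X) = X" using t2 by (simp add: mult.assoc[symmetric])
  finally have "X * (1 - 1 / p') \<le> \<tau> powr p * K1 / p" by (simp add: right_diff_distrib)
  then have "X * (1 / p) \<le> \<tau> powr p * K1 / p" by (simp only: conj)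
  then have "X \<le> \<tau> powr p * K1" using p by (simp add: divide_le_cancel)
  then show ?thesis by (simp add: t1 mult.commute)
qed

context a1_setting
begin

text \<open>Strict positivity matters when \<open>f\<close> has infinite norm: the right-hand side
  is then infinite only if its constant does not vanish.\<close>

lemma V_pos: "0 < V"
proof (rule ccontr)
  assume "\<not> 0 < V"
  then have "V = 0" using V0 by simp
  then have "AE x in lebesgue. HL_maximal w x \<le> 0" using hlV by simp
  then have "AE x in lebesgue. \<forall>q. x \<in> tri q \<longrightarrow> ennreal (mt q) \<le> 0" using mt_AE \<open>V = 0\<close> by simp
  then obtain x where x: "\<forall>q. x \<in> tri q \<longrightarrow> ennreal (mt q) \<le> 0"
    by (rule AE_lebesgue_ex)
  let ?q = "dyad_at 0 x"
  have "x \<in> tri ?q" using dset_subset_tri[of ?q] mem_dset_dyad_at[of x 0] by blast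
  then have "ennreal (mt ?q) \<le> 0" using x by blast
  then have "mt ?q = 0" using mt_nonneg[of ?q] by (simp add: ennreal_eq_0_iff)
  then have "weight_of w (tri ?q) = 0" unfolding weight_tri by simp
  then show False using wpos[OF tri_in_cubes[of ?q]] by simp
qed

text \<open>The integral of the \<open>p\<close>-th power is the pairing of the sparse sum with its
  power \<open>p - 1\<close>, called \<open>g\<close>. It equals the sum of the averages of
  \<open>modulus f\<close> times the weighted averages of \<open>g\<close> times the weights of the
  cubes, to which Young's inequality applies. The dual sum returns the original integral, because
  \<open>g powr p'\<close> is again the \<open>p\<close>-th power.\<close>

lemma strong_finite:
  assumes f: "loc_int f" and p: "1 < p" and p': "p' = p / (p - 1)" and fin: "finite I" and sp: "sparse_family I Q E"
  shows "(\<integral>\<^sup>+x. ennreal (avgop f I Q x powr p) * ennreal (w x) \<partial>lebesgue)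
    \<le> ennreal ((strc CARD('n) * p * p') powr p * V * W powr (p - 1)) * (\<integral>\<^sup>+x. ennreal (norm (f x) powr p) * ennreal (w x) \<partial>lebesgue)"
proof (cases "(\<integral>\<^sup>+x. ennreal (norm (f x) powr p) * ennreal (w x) \<partial>lebesgue) < \<infinity>")
  case True
  let ?A = "avgop f I Q"
  let ?t = "\<lambda>i. tavg f (Q i)"
  note [measurable] = loc_int_measurable[OF f]
  have wr0: "0 \<le> wr q" for q using wr_pos[of q] by simp
  have p'1: "1 < p'" unfolding p' using p by (simp add: less_divide_eq)
  have pm: "(p - 1) * p' = p" "p' / (p' - 1) = p"
  proof -
    show "(p - 1) * p' = p" unfolding p' using p by simp
    have "p' - 1 = 1 / (p - 1)" unfolding p' using p by (simp add: field_simps)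
    then show "p' / (p' - 1) = p" unfolding p' using p by simp
  qed
  obtain N where N: "(\<integral>\<^sup>+x. ennreal (norm (f x) powr p) * ennreal (w x) \<partial>lebesgue) = ennreal N" "0 \<le> N"
    by (rule ennreal_less_topE[OF True])
  \<comment> \<open>A finite sparse sum is bounded by the sum of its coefficients; hence
    \<open>g\<close> is bounded and the integral to be absorbed is finite.\<close>
  define G where "G = (\<Sum>i\<in>I. ?t i)"
  have AG: "?A x \<le> G" for x
    unfolding avgop_def G_def by (intro sum_mono) (simp add: indicator_def)
  have G0: "0 \<le> G" by (simp add: G_def sum_nonneg)
  define g where "g x = ?A x powr (p - 1)" for x
  have gm: "g \<in> borel_measurable lebesgue" unfolding g_def by measurable
  note [measurable] = gm
  have g0: "0 \<le> g x" for x by (simp add: g_def)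
  have gG: "g x \<le> G powr (p - 1)" for x unfolding g_def using AG p by (intro powr_mono2) auto
  have gp: "g x powr p' = ?A x powr p" for x by (simp add: g_def powr_powr pm)
  have Ag: "?A x powr p = ?A x * g x" for x
    using powr_mult_base[of "?A x" "p - 1"] by (cases "?A x = 0") (simp_all add: g_def)
  define h where "h i = enn2real (\<integral>\<^sup>+x\<in>dset (Q i). ennreal (g x) * ennreal (w x) \<partial>lebesgue) / wr (Q i)" for i
  note ss = strong_second[OF gm g0 gG p'1 fin sp, folded h_def]
  define X where "X = (\<Sum>i\<in>I. ?t i * (h i * wr (Q i)))"
  have X0: "0 \<le> X" unfolding X_def using ss(3) wr0 by (intro sum_nonneg mult_nonneg_nonneg) auto
  have XI: "(\<integral>\<^sup>+x. ennreal (?A x powr p) * ennreal (w x) \<partial>lebesgue) = ennreal X"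
  proof -
    have "(\<integral>\<^sup>+x. ennreal (?A x powr p) * ennreal (w x) \<partial>lebesgue)
      = (\<integral>\<^sup>+x. (\<Sum>i\<in>I. ennreal (?t i) * (ennreal (g x) * ennreal (w x) * indicator (dset (Q i)) x)) \<partial>lebesgue)"
    proof (rule nn_integral_cong)
      fix x
      have "ennreal (?A x powr p) = ennreal (?A x) * ennreal (g x)" unfolding Ag using g0[of x] by (intro ennreal_mult) auto
      also have "ennreal (?A x) = (\<Sum>i\<in>I. ennreal (?t i * indicator (dset (Q i)) x))"
        unfolding avgop_def by (rule sum_ennreal[symmetric]) simp
      finally show "ennreal (?A x powr p) * ennreal (w x) = (\<Sum>i\<in>I. ennreal (?t i) * (ennreal (g x) * ennreal (w x) * indicator (dset (Q i)) x))"
        by (simp add: sum_distrib_right del: sum_ennreal) (intro sum.cong refl, simp add: indicator_def mult.assoc)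
    qed
    also have "\<dots> = (\<Sum>i\<in>I. ennreal (?t i) * ennreal (h i * wr (Q i)))"
      by (subst nn_integral_sum) (auto simp: nn_integral_cmult ss(2))
    also have "\<dots> = (\<Sum>i\<in>I. ennreal (?t i * (h i * wr (Q i))))"
      using ss(3) wr0 by (intro sum.cong refl ennreal_mult[symmetric]) auto
    also have "\<dots> = ennreal X" unfolding X_def using ss(3) wr0 by (intro sum_ennreal mult_nonneg_nonneg) auto
    finally show ?thesis .
  qed
  define S1 where "S1 = (\<Sum>i\<in>I. wr (Q i) * ?t i powr p)"
  define S2 where "S2 = (\<Sum>i\<in>I. wr (Q i) * h i powr p')"
  define c0 where "c0 = 2 * 3 ^ CARD('n) * maxc CARD('n)"
  have mc: "1 \<le> maxc CARD('n)" by (simp add: maxc_ge1)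
  have c01: "1 \<le> c0"
  proof -
    have "1 \<le> (3::real) ^ CARD('n)" by (rule one_le_power) simp
    then have "1 \<le> 2 * (3::real) ^ CARD('n)" by linarith
    then have "1 * 1 \<le> (2 * 3 ^ CARD('n)) * maxc CARD('n)"
      using mc by (intro mult_mono) auto
    then show ?thesis by (simp add: c0_def)
  qed
  define K1 where "K1 = c0 * (2 powr p * p') * V"
  define K2 where "K2 = 2 powr p' * (2 * W) * p"
  have K20: "0 < K2" unfolding K2_def using W1 p by simp
  have K10: "0 \<le> K1" unfolding K1_def using c01 p'1 V0 by simp
  have S1K: "S1 \<le> K1 * N"
  proof -
    have "ennreal S1 \<le> ennreal (2 * 3 ^ CARD('n) * (2 powr p * maxc CARD('n) * (p / (p - 1))) * V) * ennreal N"
      using strong_first[OF f p fin sp True] unfolding S1_def N(1) .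
    also have "2 * 3 ^ CARD('n) * (2 powr p * maxc CARD('n) * (p / (p - 1))) * V = K1"
      by (simp add: K1_def c0_def p' mult_ac)
    finally have "ennreal S1 \<le> ennreal (K1 * N)" using K10 by (simp add: ennreal_mult')
    then show ?thesis using K10 N(2) by (subst (asm) ennreal_le_iff) auto
  qed
  have S2K: "S2 \<le> K2 * X"
  proof -
    have "ennreal S2 \<le> ennreal (2 powr p' * (2 * W) * (p' / (p' - 1))) * (\<integral>\<^sup>+x. ennreal (g x powr p') * ennreal (w x) \<partial>lebesgue)"
      using ss(1) unfolding S2_def .
    then have "ennreal S2 \<le> ennreal K2 * ennreal X" unfolding gp XI pm K2_def .
    then have "ennreal S2 \<le> ennreal (K2 * X)" using K20 by (simp add: ennreal_mult')
    then show ?thesis using K20 X0 by (subst (asm) ennreal_le_iff) auto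
  qed
  have "X \<le> K1 * N * K2 powr (p - 1)"
  proof (rule young_absorb[OF p p' K20 S1K S2K])
    fix \<tau> :: real assume \<tau>: "0 < \<tau>"
    have "X \<le> (\<Sum>i\<in>I. \<tau> powr p / p * (wr (Q i) * ?t i powr p) + \<tau> powr (- p') / p' * (wr (Q i) * h i powr p'))"
      unfolding X_def
    proof (rule sum_mono)
      fix i
      have "(\<tau> * ?t i) * (h i / \<tau>) \<le> (\<tau> * ?t i) powr p / p + (h i / \<tau>) powr p' / p'"
      proof (rule Youngs_inequality[OF p p'1])
        show "1 / p + 1 / p' = 1" unfolding p' using p by (simp add: field_simps)
      qed (use \<tau> ss(3)[of i] in auto)
      also have "(\<tau> * ?t i) * (h i / \<tau>) = ?t i * h i" using \<tau> by simp
      also have "(\<tau> * ?t i) powr p = \<tau> powr p * ?t i powr p" by (rule powr_mult)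
      also have "(h i / \<tau>) powr p' = \<tau> powr (- p') * h i powr p'"
        using \<tau> ss(3)[of i] by (simp add: powr_divide powr_minus_divide)
      finally have "?t i * h i * wr (Q i) \<le> (\<tau> powr p * ?t i powr p / p + \<tau> powr (- p') * h i powr p' / p') * wr (Q i)"
        using wr0 by (intro mult_right_mono)
      then show "?t i * (h i * wr (Q i)) \<le> \<tau> powr p / p * (wr (Q i) * ?t i powr p) + \<tau> powr (- p') / p' * (wr (Q i) * h i powr p')"
        by (simp add: distrib_left distrib_right mult_ac)
    qed
    also have "\<dots> = \<tau> powr p / p * S1 + \<tau> powr (- p') / p' * S2"
      by (simp add: sum.distrib sum_distrib_left S1_def S2_def)
    finally show "X \<le> \<tau> powr p * S1 / p + \<tau> powr (- p') * S2 / p'" by simp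
  qed
  also have "\<dots> = K1 * K2 powr (p - 1) * N" by (simp add: mult_ac)
  also have "\<dots> \<le> (8 * c0 * p * p') powr p * V * W powr (p - 1) * N"
    unfolding K1_def K2_def by (intro mult_right_mono strong_constant_bound[OF p p' c01 V0 W1] N(2))
  also have "8 * c0 = strc CARD('n)" by (simp add: c0_def strc_def)
  finally have "ennreal X \<le> ennreal ((strc CARD('n) * p * p') powr p * V * W powr (p - 1) * N)" by (rule ennreal_leI)
  also have "\<dots> = ennreal ((strc CARD('n) * p * p') powr p * V * W powr (p - 1)) * ennreal N"
    using V0 by (intro ennreal_mult') (auto intro!: mult_nonneg_nonneg simp: N(2))
  finally show ?thesis unfolding XI N(1) .
next
  case False
  then have top: "(\<integral>\<^sup>+x. ennreal (norm (f x) powr p) * ennreal (w x) \<partial>lebesgue) = \<infinity>" using False by (simp flip: less_top)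
  have "0 < strc CARD('n) * p * p'" using p p' by (simp add: strc_def maxc_pos)
  then have "0 < (strc CARD('n) * p * p') powr p" unfolding powr_gt_zero by (metis less_irrefl)
  then have pos: "0 < (strc CARD('n) * p * p') powr p * V * W powr (p - 1)"
    using V_pos W1 by (intro mult_pos_pos) simp_all
  show ?thesis unfolding top ennreal_pos_times_top[OF pos] by simp
qed

end

text \<open>
  \<open>4613 = 9 * 512 + 1 + 4\<close>: the geometric tail of ratio \<open>8/9\<close>, the averages larger than \<open>\<alpha>\<close>, and
  the rounding of the number of levels, which is about \<open>log W / log (9/8)\<close>.
\<close>

definition wkc :: "nat \<Rightarrow> real" where
  "wkc n = 2 * 3 ^ n * maxc n * (4613 / ln 2 + 4 / ln (9 / 8))"

section \<open>Weak type for finite sparse sums\<close>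

lemma geometric_tail_le:
  fixes r :: real
  assumes "0 < r" "r < 1"
  shows "(\<Sum>k\<in>{a..<b}. r ^ k) \<le> r ^ a / (1 - r)"
proof (cases "a \<le> b")
  case True
  have "(1 - r) * (\<Sum>k\<in>{a..<b}. r ^ k) = r ^ a - r ^ b"
    using True
  proof (induction b rule: dec_induct)
    case (step m)
    then show ?case by (simp add: distrib_left) (simp add: left_diff_distrib)
  qed simp
  then have "(1 - r) * (\<Sum>k\<in>{a..<b}. r ^ k) \<le> r ^ a" using assms by simp
  then show ?thesis using assms by (simp add: pos_le_divide_eq mult.commute)
qed (use assms in simp)

context a1_setting
begin

lemma weight_markov:
  assumes [measurable]: "h \<in> borel_measurable lebesgue" and c: "0 < c"
  shows "weight_of w {x. ennreal c < h x} \<le> ennreal (1 / c) * (\<integral>\<^sup>+x. h x * ennreal (w x) \<partial>lebesgue)"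
proof -
  have "weight_of w {x. ennreal c < h x} \<le> (\<integral>\<^sup>+x. ennreal (1 / c) * (h x * ennreal (w x)) \<partial>lebesgue)"
    unfolding weight_of_def
  proof (rule nn_integral_mono)
    fix x
    show "ennreal (w x) * indicator {x. ennreal c < h x} x \<le> ennreal (1 / c) * (h x * ennreal (w x))"
    proof (cases "ennreal c < h x")
      case True
      then have "ennreal (1 / c) * ennreal c \<le> ennreal (1 / c) * h x" by (intro mult_left_mono) auto
      then have "1 \<le> ennreal (1 / c) * h x" using c by (simp flip: ennreal_mult')
      then have "1 * ennreal (w x) \<le> ennreal (1 / c) * h x * ennreal (w x)" by (rule mult_right_mono) simp
      then show ?thesis using True by (simp add: mult.assoc)
    qed simp
  qed
  also have "\<dots> = ennreal (1 / c) * (\<integral>\<^sup>+x. h x * ennreal (w x) \<partial>lebesgue)" by (rule nn_integral_cmult) measurable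
  finally show ?thesis .
qed

lemma weight_Un:
  assumes "S \<in> sets lebesgue" "S' \<in> sets lebesgue" "weight_of w S \<le> ennreal a" "weight_of w S' \<le> ennreal b" "0 \<le> a" "0 \<le> b"
  shows "weight_of w (S \<union> S') \<le> ennreal (a + b)"
  using emeasure_le_add[of S "density lebesgue (\<lambda>x. ennreal (w x))" S' a b] assms
  by (simp add: weight_of_density)

lemma weight_UN:
  assumes "finite F" "\<And>k. k \<in> F \<Longrightarrow> S k \<in> sets lebesgue" "\<And>k. k \<in> F \<Longrightarrow> weight_of w (S k) \<le> ennreal (a k)" "\<And>k. k \<in> F \<Longrightarrow> 0 \<le> a k"
  shows "weight_of w (\<Union>k\<in>F. S k) \<le> ennreal (\<Sum>k\<in>F. a k)"
proof -
  have U: "(\<Union>k\<in>F. S k) \<in> sets lebesgue" using assms by (intro sets.finite_UN) auto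
  have "weight_of w (\<Union>k\<in>F. S k) \<le> (\<Sum>k\<in>F. weight_of w (S k))"
    unfolding weight_of_density[OF U] using assms(1,2)
    by (subst sum.cong[OF refl weight_of_density]) (auto intro!: emeasure_subadditive_finite)
  also have "\<dots> \<le> (\<Sum>k\<in>F. ennreal (a k))" by (intro sum_mono assms(3))
  also have "\<dots> = ennreal (\<Sum>k\<in>F. a k)" using assms(4) by (rule sum_ennreal)
  finally show ?thesis .
qed

text \<open>Expanding the square gives pairs of cubes, which are nested or disjoint, so each pair
  contributes at most the weight of the smaller cube. Grouping by the larger cube, the Carleson
  condition gives \<open>2 * W\<close> times the sum of the weights, once for each order of the
  pair.\<close>

lemma overlap_square:
  assumes fin: "finite I" and sp: "sparse_family I Q E"
  shows "(\<integral>\<^sup>+x. ennreal ((\<Sum>i\<in>I. indicator (dset (Q i)) x)\<^sup>2) * ennreal (w x) \<partial>lebesgue) \<le> ennreal (4 * W * (\<Sum>i\<in>I. wr (Q i)))"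
proof -
  have wr0: "0 \<le> wr q" for q using wr_pos[of q] by simp
  let ?a = "\<lambda>i j. if dset (Q j) \<subseteq> dset (Q i) then wr (Q j) else 0"
  have inter: "(\<integral>\<^sup>+x. indicator (dset (Q i)) x * indicator (dset (Q j)) x * ennreal (w x) \<partial>lebesgue) \<le> ennreal (?a i j + ?a j i)" for i j
  proof -
    consider "dset (Q j) \<subseteq> dset (Q i)" | "dset (Q i) \<subseteq> dset (Q j)" | "dset (Q i) \<inter> dset (Q j) = {}"
      using dset_nested[of "Q i" "Q j"] dset_nested[of "Q j" "Q i"] by (metis inf_commute linear)
    then show ?thesis
    proof cases
      case 1
      have "(\<integral>\<^sup>+x. indicator (dset (Q i)) x * indicator (dset (Q j)) x * ennreal (w x) \<partial>lebesgue) \<le> weight_of w (dset (Q j))"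
        unfolding weight_of_def by (intro nn_integral_mono) (auto split: split_indicator)
      also have "\<dots> \<le> ennreal (?a i j + ?a j i)" using 1 wr0 by (auto simp: weight_dset intro!: ennreal_leI)
      finally show ?thesis .
    next
      case 2
      have "(\<integral>\<^sup>+x. indicator (dset (Q i)) x * indicator (dset (Q j)) x * ennreal (w x) \<partial>lebesgue) \<le> weight_of w (dset (Q i))"
        unfolding weight_of_def by (intro nn_integral_mono) (auto split: split_indicator)
      also have "\<dots> \<le> ennreal (?a i j + ?a j i)" using 2 wr0 by (auto simp: weight_dset intro!: ennreal_leI)
      finally show ?thesis .
    next
      case 3
      then have "(\<integral>\<^sup>+x. indicator (dset (Q i)) x * indicator (dset (Q j)) x * ennreal (w x) \<partial>lebesgue) = (\<integral>\<^sup>+x. 0 \<partial>(lebesgue :: (real ^ 'n) measure))"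
        by (intro nn_integral_cong) (auto split: split_indicator)
      then show ?thesis by simp
    qed
  qed
  have "(\<integral>\<^sup>+x. ennreal ((\<Sum>i\<in>I. indicator (dset (Q i)) x)\<^sup>2) * ennreal (w x) \<partial>lebesgue)
    = (\<integral>\<^sup>+x. (\<Sum>i\<in>I. \<Sum>j\<in>I. indicator (dset (Q i)) x * indicator (dset (Q j)) x * ennreal (w x)) \<partial>lebesgue)"
  proof (rule nn_integral_cong)
    fix x
    let ?s = "\<lambda>i. indicator (dset (Q i)) x :: real"
    have "(\<Sum>i\<in>I. ?s i)\<^sup>2 = (\<Sum>i\<in>I. \<Sum>j\<in>I. ?s i * ?s j)" by (simp add: power2_eq_square sum_product)
    then have "ennreal ((\<Sum>i\<in>I. ?s i)\<^sup>2) = ennreal (\<Sum>i\<in>I. \<Sum>j\<in>I. ?s i * ?s j)" by (rule arg_cong)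
    also have "\<dots> = (\<Sum>i\<in>I. ennreal (\<Sum>j\<in>I. ?s i * ?s j))" by (rule sum_ennreal[symmetric]) (simp add: sum_nonneg)
    also have "\<dots> = (\<Sum>i\<in>I. \<Sum>j\<in>I. ennreal (?s i * ?s j))" by (intro sum.cong refl sum_ennreal[symmetric]) simp
    also have "\<dots> = (\<Sum>i\<in>I. \<Sum>j\<in>I. indicator (dset (Q i)) x * indicator (dset (Q j)) x)"
      by (intro sum.cong refl) (simp add: indicator_def)
    finally show "ennreal ((\<Sum>i\<in>I. ?s i)\<^sup>2) * ennreal (w x) = (\<Sum>i\<in>I. \<Sum>j\<in>I. indicator (dset (Q i)) x * indicator (dset (Q j)) x * ennreal (w x))"
      by (simp only: sum_distrib_right)
  qed
  also have "\<dots> = (\<Sum>i\<in>I. \<Sum>j\<in>I. \<integral>\<^sup>+x. indicator (dset (Q i)) x * indicator (dset (Q j)) x * ennreal (w x) \<partial>lebesgue)"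
    by (simp add: nn_integral_sum)
  also have "\<dots> \<le> (\<Sum>i\<in>I. \<Sum>j\<in>I. ennreal (?a i j + ?a j i))" by (intro sum_mono inter)
  also have "\<dots> = (\<Sum>i\<in>I. ennreal (\<Sum>j\<in>I. ?a i j + ?a j i))"
    by (intro sum.cong refl sum_ennreal) (simp add: wr0)
  also have "\<dots> = ennreal (\<Sum>i\<in>I. \<Sum>j\<in>I. ?a i j + ?a j i)"
    by (rule sum_ennreal) (simp add: sum_nonneg wr0)
  also have "\<dots> \<le> ennreal (4 * W * (\<Sum>i\<in>I. wr (Q i)))"
  proof (rule ennreal_leI)
    have c: "(\<Sum>j\<in>I. ?a i j) \<le> 2 * W * wr (Q i)" for i
      using carleson[OF sp fin, of "Q i"] fin by (simp add: sum.inter_filter)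
    have "(\<Sum>i\<in>I. \<Sum>j\<in>I. ?a i j + ?a j i) = (\<Sum>i\<in>I. \<Sum>j\<in>I. ?a i j) + (\<Sum>i\<in>I. \<Sum>j\<in>I. ?a j i)"
      by (simp only: sum.distrib)
    also have "(\<Sum>i\<in>I. \<Sum>j\<in>I. ?a j i) = (\<Sum>i\<in>I. \<Sum>j\<in>I. ?a i j)" by (rule sum.swap)
    also have "(\<Sum>i\<in>I. \<Sum>j\<in>I. ?a i j) \<le> (\<Sum>i\<in>I. 2 * W * wr (Q i))" by (intro sum_mono c)
    finally show "(\<Sum>i\<in>I. \<Sum>j\<in>I. ?a i j + ?a j i) \<le> 4 * W * (\<Sum>i\<in>I. wr (Q i))"
      by (simp add: sum_distrib_left mult.assoc)
  qed
  finally show ?thesis .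
qed

text \<open>
  The family is split by the size of the averages relative to \<open>\<alpha>\<close>. For the first
  \<open>O (log W)\<close> levels the \<open>L\<^sup>1\<close> estimate of each level suffices, beyond that the
  square function of the overlaps decays geometrically and beats the factor \<open>W\<close>.
\<close>

lemma weak_finite:
  assumes f: "loc_int f" and fin: "finite I" and sp: "sparse_family I Q E" and al: "0 < \<alpha>"
  shows "ennreal \<alpha> * weight_of w {x. \<alpha> < avgop f I Q x}
    \<le> ennreal (wkc CARD('n) * V * ln (1 + W)) * (\<integral>\<^sup>+x. modulus f x * ennreal (w x) \<partial>lebesgue)"
proof (cases "(\<integral>\<^sup>+x. modulus f x * ennreal (w x) \<partial>lebesgue) < \<infinity>")
  case True
  note [measurable] = loc_int_measurable[OF f]
  let ?t = "\<lambda>i. tavg f (Q i)"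
  have wr0: "0 \<le> wr q" for q using wr_pos[of q] by simp
  have mc: "0 < maxc CARD('n)" by (simp add: maxc_pos)
  obtain N where N: "(\<integral>\<^sup>+x. modulus f x * ennreal (w x) \<partial>lebesgue) = ennreal N" "0 \<le> N"
    by (rule ennreal_less_topE[OF True])
  \<comment> \<open>The total mass in the weak-type bound for averages: the cubes with average above
    \<open>lam\<close> have total weight at most \<open>D / lam\<close>.\<close>
  define D where "D = 2 * 3 ^ CARD('n) * maxc CARD('n) * V * N"
  have D0: "0 \<le> D" using mc V0 N(2) by (simp add: D_def)
  have lev: "(\<Sum>i\<in>J. wr (Q i)) \<le> D / lam" if J: "J \<subseteq> I" "\<And>i. i \<in> J \<Longrightarrow> lam < ?t i" and lam: "0 < lam" for J lam
  proof -
    have "ennreal (lam * (\<Sum>i\<in>J. wr (Q i))) \<le> ennreal (2 * 3 ^ CARD('n) * maxc CARD('n) * V) * ennreal N"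
      unfolding N(1)[symmetric]
      by (rule weight_level[OF f lam finite_subset[OF J(1) fin] sparse_subfamily[OF sp J(1)] J(2)])
    also have "\<dots> = ennreal D" unfolding D_def using mc V0 by (intro ennreal_mult'[symmetric]) simp
    finally have "lam * (\<Sum>i\<in>J. wr (Q i)) \<le> D" using D0 by (simp add: ennreal_le_iff)
    then show ?thesis using lam by (simp add: pos_le_divide_eq mult.commute)
  qed
  \<comment> \<open>The level \<open>k\<close> holds the averages comparable to \<alpha> divided by
    \<open>2 ^ k\<close>; averages above \<alpha> are treated apart.\<close>
  define S where "S k = {i \<in> I. \<alpha> / 2 ^ Suc k < ?t i \<and> ?t i \<le> \<alpha> / 2 ^ k}" for k :: nat
  have SI: "S k \<subseteq> I" for k by (auto simp: S_def)
  have Sfin: "finite (S k)" for k using SI fin by (rule finite_subset)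
  have Slev: "(\<Sum>i\<in>S k. wr (Q i)) \<le> D * 2 ^ Suc k / \<alpha>" for k
    using lev[OF SI, of k "\<alpha> / 2 ^ Suc k"] al by (simp add: S_def)
  let ?A = "\<lambda>k. avgop f (S k) Q"
  \<comment> \<open>The least number of levels with \<open>(9 / 8) ^ k1 \<ge> W\<close>; after them
    the decay of ratio \<open>8 / 9\<close> compensates the factor \<open>W\<close>.\<close>
  define k1 where "k1 = nat \<lceil>ln W / ln (9 / 8)\<rceil>"
  define Um where "Um = (\<Union>i\<in>{i \<in> I. \<alpha> < ?t i}. dset (Q i))"
  define Bm where "Bm = {x. \<alpha> / 2 < (\<Sum>k<k1. ?A k x)}"
  \<comment> \<open>These thresholds sum to at most \<alpha> / 2. The ratio \<open>3 / 4\<close>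
    must be below 1 for summability and above the inverse root of 2 for the weights of the sets to
    decay.\<close>
  define C where "C k = {x. \<alpha> * (3 / 4) ^ k / 8 < ?A k x}" for k
  have Um_m: "Um \<in> sets lebesgue" unfolding Um_def using fin by (intro sets.finite_UN) auto
  have Bm_m: "Bm \<in> sets lebesgue"
  proof -
    have "{x \<in> space lebesgue. \<alpha> / 2 < (\<Sum>k<k1. ?A k x)} \<in> sets lebesgue" by measurable
    then show ?thesis by (simp add: Bm_def)
  qed
  have C_m: "C k \<in> sets lebesgue" for k
  proof -
    have "{x \<in> space lebesgue. \<alpha> * (3 / 4) ^ k / 8 < ?A k x} \<in> sets lebesgue" by measurable
    then show ?thesis by (simp add: C_def)
  qed
  have Um_w: "weight_of w Um \<le> ennreal (D / \<alpha>)"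
  proof -
    have "weight_of w Um \<le> ennreal (\<Sum>i\<in>{i \<in> I. \<alpha> < ?t i}. wr (Q i))"
      unfolding Um_def using fin wr0 by (intro weight_UN) (auto simp: weight_dset)
    also have "\<dots> \<le> ennreal (D / \<alpha>)" by (intro ennreal_leI lev al) auto
    finally show ?thesis .
  qed
  have Aint: "(\<integral>\<^sup>+x. ennreal (?A k x) * ennreal (w x) \<partial>lebesgue) \<le> ennreal (2 * D)" for k
  proof -
    have "(\<integral>\<^sup>+x. ennreal (?A k x) * ennreal (w x) \<partial>lebesgue) = (\<integral>\<^sup>+x. (\<Sum>i\<in>S k. ennreal (?t i) * (ennreal (w x) * indicator (dset (Q i)) x)) \<partial>lebesgue)"
    proof (rule nn_integral_cong)
      fix x
      have "ennreal (?A k x) = (\<Sum>i\<in>S k. ennreal (?t i * indicator (dset (Q i)) x))"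
        unfolding avgop_def by (rule sum_ennreal[symmetric]) simp
      then show "ennreal (?A k x) * ennreal (w x) = (\<Sum>i\<in>S k. ennreal (?t i) * (ennreal (w x) * indicator (dset (Q i)) x))"
        by (simp add: sum_distrib_right del: sum_ennreal) (intro sum.cong refl, simp add: indicator_def)
    qed
    also have "\<dots> = (\<Sum>i\<in>S k. ennreal (?t i) * weight_of w (dset (Q i)))"
      unfolding weight_of_def by (subst nn_integral_sum) (auto simp: nn_integral_cmult)
    also have "\<dots> = ennreal (\<Sum>i\<in>S k. ?t i * wr (Q i))"
      using wr0 by (simp add: weight_dset ennreal_mult[symmetric])
    also have "\<dots> \<le> ennreal (2 * D)"
    proof (rule ennreal_leI)
      have "(\<Sum>i\<in>S k. ?t i * wr (Q i)) \<le> (\<Sum>i\<in>S k. \<alpha> / 2 ^ k * wr (Q i))"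
        by (intro sum_mono mult_right_mono wr0) (auto simp: S_def)
      also have "\<dots> = \<alpha> / 2 ^ k * (\<Sum>i\<in>S k. wr (Q i))" by (simp add: sum_distrib_left)
      also have "\<dots> \<le> \<alpha> / 2 ^ k * (D * 2 ^ Suc k / \<alpha>)" using al by (intro mult_left_mono Slev) auto
      also have "\<dots> = 2 * D" using al by simp
      finally show "(\<Sum>i\<in>S k. ?t i * wr (Q i)) \<le> 2 * D" .
    qed
    finally show ?thesis .
  qed
  have Bm_w: "weight_of w Bm \<le> ennreal (4 * real k1 * D / \<alpha>)"
  proof -
    have "Bm = {x. ennreal (\<alpha> / 2) < ennreal (\<Sum>k<k1. ?A k x)}"
      unfolding Bm_def using al by (auto simp: ennreal_less_iff)
    then have "weight_of w Bm \<le> ennreal (1 / (\<alpha> / 2)) * (\<integral>\<^sup>+x. ennreal (\<Sum>k<k1. ?A k x) * ennreal (w x) \<partial>lebesgue)"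
      using al by (simp only:) (rule weight_markov, measurable)
    also have "(\<integral>\<^sup>+x. ennreal (\<Sum>k<k1. ?A k x) * ennreal (w x) \<partial>lebesgue) = (\<integral>\<^sup>+x. (\<Sum>k<k1. ennreal (?A k x) * ennreal (w x)) \<partial>lebesgue)"
      by (intro nn_integral_cong) (simp add: sum_distrib_right[symmetric])
    also have "\<dots> = (\<Sum>k<k1. \<integral>\<^sup>+x. ennreal (?A k x) * ennreal (w x) \<partial>lebesgue)" by (rule nn_integral_sum) measurable
    also have "ennreal (1 / (\<alpha> / 2)) * \<dots> \<le> ennreal (1 / (\<alpha> / 2)) * (\<Sum>k<k1. ennreal (2 * D))"
      by (intro mult_left_mono sum_mono Aint) auto
    also have "(\<Sum>k<k1. ennreal (2 * D)) = ennreal (real k1 * (2 * D))"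
      using D0 by (subst sum_ennreal) auto
    also have "ennreal (1 / (\<alpha> / 2)) * \<dots> = ennreal (1 / (\<alpha> / 2) * (real k1 * (2 * D)))"
      using al by (intro ennreal_mult'[symmetric]) simp
    also have "1 / (\<alpha> / 2) * (real k1 * (2 * D)) = 4 * real k1 * D / \<alpha>" by simp
    finally show ?thesis .
  qed
  have C_w: "weight_of w (C k) \<le> ennreal (512 * W * D / \<alpha> * (8 / 9) ^ k)" for k
  proof -
    let ?n = "\<lambda>x. \<Sum>i\<in>S k. indicator (dset (Q i)) x :: real"
    have sub: "C k \<subseteq> {x. ennreal ((9 / 4) ^ k / 64) < ennreal ((?n x)\<^sup>2)}"
    proof
      fix x assume "x \<in> C k"
      then have "\<alpha> * (3 / 4) ^ k / 8 < ?A k x" by (simp add: C_def)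
      \<comment> \<open>On one level all averages are comparable, so a large sparse sum forces many
        overlaps: more than \<open>(3 / 2) ^ k / 8\<close>. Chebyshev for the square of the overlap
        gains \<open>(4 / 9) ^ k\<close> against the growth \<open>2 ^ k\<close> of the total weight
        of the level.\<close>
      also have "?A k x \<le> \<alpha> / 2 ^ k * ?n x"
        unfolding avgop_def sum_distrib_left by (intro sum_mono mult_right_mono) (auto simp: S_def)
      finally have "\<alpha> / 2 ^ k * ((3 / 2) ^ k / 8) < \<alpha> / 2 ^ k * ?n x"
        by (simp add: power_divide field_simps power_mult_distrib[symmetric])
      then have "(3 / 2) ^ k / 8 < ?n x" using al by (simp add: mult_less_cancel_left_pos del: times_divide_eq_right times_divide_eq_left)
      then have "((3 / 2) ^ k / 8)\<^sup>2 < (?n x)\<^sup>2" by (intro power_strict_mono) auto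
      also have "((3 / 2) ^ k / 8 :: real)\<^sup>2 = (9 / 4) ^ k / 64"
        by (simp add: power_divide power_mult[symmetric] mult.commute[of k 2]) (simp add: power_mult)
      finally show "x \<in> {x. ennreal ((9 / 4) ^ k / 64) < ennreal ((?n x)\<^sup>2)}" by (simp add: ennreal_less_iff)
    qed
    have "weight_of w (C k) \<le> ennreal (1 / ((9 / 4) ^ k / 64)) * (\<integral>\<^sup>+x. ennreal ((?n x)\<^sup>2) * ennreal (w x) \<partial>lebesgue)"
      by (rule order_trans[OF weight_of_mono[OF sub] weight_markov]) auto
    also have "\<dots> \<le> ennreal (1 / ((9 / 4) ^ k / 64)) * ennreal (4 * W * (\<Sum>i\<in>S k. wr (Q i)))"
      by (intro mult_left_mono overlap_square[OF Sfin sparse_subfamily[OF sp SI]]) auto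
    also have "\<dots> \<le> ennreal (1 / ((9 / 4) ^ k / 64)) * ennreal (4 * W * (D * 2 ^ Suc k / \<alpha>))"
      using W1 by (intro mult_left_mono ennreal_leI Slev) auto
    also have "\<dots> = ennreal (1 / ((9 / 4) ^ k / 64) * (4 * W * (D * 2 ^ Suc k / \<alpha>)))"
      by (intro ennreal_mult'[symmetric]) simp
    also have "1 / ((9 / 4) ^ k / 64) * (4 * W * (D * 2 ^ Suc k / \<alpha>)) = 512 * W * D / \<alpha> * (8 / 9) ^ k"
    proof -
      have "(8 / 9 :: real) ^ k = (4 / 9) ^ k * 2 ^ k" by (simp flip: power_mult_distrib)
      moreover have "1 / ((9 / 4 :: real) ^ k) = (4 / 9) ^ k" by (simp add: power_divide)
      ultimately show ?thesis by (simp add: power_divide mult_ac)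
    qed
    finally show ?thesis .
  qed
  \<comment> \<open>A finite family has a smallest positive average, so finitely many levels exhaust
    it; vanishing averages contribute nothing.\<close>
  obtain K0 where K0: "\<And>i. i \<in> I \<Longrightarrow> 0 < ?t i \<Longrightarrow> \<alpha> / 2 ^ K0 < ?t i"
  proof -
    have "\<exists>m::nat. \<alpha> / 2 ^ m < ?t i" if "0 < ?t i" for i
    proof -
      obtain m where "\<alpha> / ?t i < 2 ^ m" using real_arch_pow[of 2 "\<alpha> / ?t i"] by auto
      then show ?thesis using that by (intro exI[of _ m]) (simp add: field_simps)
    qed
    then obtain m where m: "\<And>i. 0 < ?t i \<Longrightarrow> \<alpha> / 2 ^ m i < ?t i" by metis
    show ?thesis
    proof (rule that[of "Max (insert 0 (m ` I))"])
      fix i assume i: "i \<in> I" "0 < ?t i"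
      have "m i \<le> Max (insert 0 (m ` I))" using i fin by (intro Max_ge) auto
      then have "(2::real) ^ m i \<le> 2 ^ Max (insert 0 (m ` I))" by (intro power_increasing) auto
      then have "\<alpha> / 2 ^ Max (insert 0 (m ` I)) \<le> \<alpha> / 2 ^ m i" using al by (intro divide_left_mono) auto
      then show "\<alpha> / 2 ^ Max (insert 0 (m ` I)) < ?t i" using m[OF i(2)] by linarith
    qed
  qed
  \<comment> \<open>Adding \<open>k1\<close> ensures that the first \<open>k1\<close> levels form an
    initial segment of all levels considered.\<close>
  define K where "K = K0 + k1"
  have KK: "\<alpha> / 2 ^ K < ?t i" if "i \<in> I" "0 < ?t i" for i
  proof -
    have "(2::real) ^ K0 \<le> 2 ^ K" unfolding K_def by (intro power_increasing) auto
    then have "\<alpha> / 2 ^ K \<le> \<alpha> / 2 ^ K0" using al by (intro divide_left_mono) auto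
    then show ?thesis using K0[OF that] by linarith
  qed
  have level: "\<exists>k<K. i \<in> S k" if i: "i \<in> I" "0 < ?t i" "?t i \<le> \<alpha>" for i
  proof -
    define l where "l = (LEAST l. \<alpha> / 2 ^ l < ?t i)"
    have l: "\<alpha> / 2 ^ l < ?t i" unfolding l_def by (rule LeastI[of _ K]) (rule KK[OF i(1,2)])
    have lK: "l \<le> K" unfolding l_def by (rule Least_le) (rule KK[OF i(1,2)])
    have "l \<noteq> 0"
    proof
      assume "l = 0"
      then show False using l i(3) by simp
    qed
    then obtain k where k: "l = Suc k" by (cases l) auto
    have "\<not> \<alpha> / 2 ^ k < ?t i" using k not_less_Least[of k "\<lambda>l. \<alpha> / 2 ^ l < ?t i"] l_def by simp
    then have "i \<in> S k" using i(1) l k by (simp add: S_def)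
    then show ?thesis using k lK by (intro exI[of _ k]) auto
  qed
  have sub: "{x. \<alpha> < avgop f I Q x} \<subseteq> Um \<union> Bm \<union> (\<Union>k\<in>{k1..<K}. C k)"
  proof (rule subsetI, rule ccontr)
    fix x assume x: "x \<in> {x. \<alpha> < avgop f I Q x}" "x \<notin> Um \<union> Bm \<union> (\<Union>k\<in>{k1..<K}. C k)"
    have "avgop f I Q x \<le> (\<Sum>k<K. ?A k x)"
    proof -
      have "avgop f I Q x \<le> (\<Sum>i\<in>I. \<Sum>k<K. if i \<in> S k then ?t i * indicator (dset (Q i)) x else 0)"
        unfolding avgop_def
      proof (rule sum_mono)
        fix i assume i: "i \<in> I"
        let ?c = "\<lambda>k. if i \<in> S k then ?t i * indicator (dset (Q i)) x else 0"
        show "?t i * indicator (dset (Q i)) x \<le> (\<Sum>k<K. ?c k)"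
        proof (cases "0 < ?t i \<and> x \<in> dset (Q i)")
          case True
          then have "?t i \<le> \<alpha>" using x(2) i by (auto simp: Um_def not_less)
          then obtain k where k: "k < K" "i \<in> S k" using level[OF i] True by blast
          have "?c k \<le> (\<Sum>k<K. ?c k)" using k by (intro member_le_sum) auto
          then show ?thesis using k by simp
        next
          case False
          then have "?t i * indicator (dset (Q i)) x = 0" using tavg_nonneg[of f "Q i"] by (auto simp: order_less_le)
          moreover have "0 \<le> (\<Sum>k<K. ?c k)" by (intro sum_nonneg) auto
          ultimately show ?thesis by linarith
        qed
      qed
      also have "\<dots> = (\<Sum>k<K. \<Sum>i\<in>I. if i \<in> S k then ?t i * indicator (dset (Q i)) x else 0)" by (rule sum.swap)
      also have "\<dots> = (\<Sum>k<K. ?A k x)"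
      proof (rule sum.cong[OF refl])
        fix k
        have "S k = {i \<in> I. i \<in> S k}" using SI by blast
        then show "(\<Sum>i\<in>I. if i \<in> S k then ?t i * indicator (dset (Q i)) x else 0) = ?A k x"
          unfolding avgop_def using sum.inter_filter[OF fin, of "\<lambda>i. ?t i * indicator (dset (Q i)) x" "\<lambda>i. i \<in> S k"] by simp
      qed
      finally show ?thesis .
    qed
    also have "(\<Sum>k<K. ?A k x) = (\<Sum>k<k1. ?A k x) + (\<Sum>k\<in>{k1..<K}. ?A k x)"
    proof -
      have "{..<K} = {..<k1} \<union> {k1..<K}" by (auto simp: K_def)
      then have "(\<Sum>k<K. ?A k x) = (\<Sum>k\<in>{..<k1} \<union> {k1..<K}. ?A k x)" by (rule sum.cong) simp
      also have "\<dots> = (\<Sum>k<k1. ?A k x) + (\<Sum>k\<in>{k1..<K}. ?A k x)"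
        by (rule sum.union_disjoint) auto
      finally show ?thesis .
    qed
    also have "\<dots> \<le> \<alpha> / 2 + \<alpha> / 2"
    proof (rule add_mono)
      show "(\<Sum>k<k1. ?A k x) \<le> \<alpha> / 2" using x(2) by (auto simp: Bm_def not_less)
      have "(\<Sum>k\<in>{k1..<K}. ?A k x) \<le> (\<Sum>k\<in>{k1..<K}. \<alpha> / 8 * (3 / 4) ^ k)"
        using x(2) by (intro sum_mono) (auto simp: C_def not_less)
      also have "\<dots> = \<alpha> / 8 * (\<Sum>k\<in>{k1..<K}. (3 / 4) ^ k)" by (rule sum_distrib_left[symmetric])
      also have "\<dots> \<le> \<alpha> / 8 * 4"
      proof (intro mult_left_mono)
        have "(\<Sum>k\<in>{k1..<K}. (3 / 4 :: real) ^ k) \<le> (3 / 4) ^ k1 / (1 - 3 / 4)" by (rule geometric_tail_le) auto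
        moreover have "(3 / 4 :: real) ^ k1 \<le> 1" by (rule power_le_one) auto
        ultimately show "(\<Sum>k\<in>{k1..<K}. (3 / 4 :: real) ^ k) \<le> 4" by simp
      qed (use al in simp)
      finally show "(\<Sum>k\<in>{k1..<K}. ?A k x) \<le> \<alpha> / 2" by simp
    qed
    finally show False using x(1) by simp
  qed
  have nn: "0 \<le> D / \<alpha>" "0 \<le> 4 * real k1 * D / \<alpha>" "0 \<le> 512 * W * D / \<alpha> * (8 / 9) ^ k" for k :: nat
    using D0 al W1 by auto
  have UnM: "Um \<union> Bm \<in> sets lebesgue" "(\<Union>k\<in>{k1..<K}. C k) \<in> sets lebesgue"
    using Um_m Bm_m C_m by auto
  have "weight_of w {x. \<alpha> < avgop f I Q x} \<le> weight_of w (Um \<union> Bm \<union> (\<Union>k\<in>{k1..<K}. C k))"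
    by (rule weight_of_mono[OF sub])
  also have "\<dots> \<le> ennreal (D / \<alpha> + 4 * real k1 * D / \<alpha> + (\<Sum>k\<in>{k1..<K}. 512 * W * D / \<alpha> * (8 / 9) ^ k))"
    by (rule weight_Un[OF UnM weight_Un[OF Um_m Bm_m Um_w Bm_w nn(1,2)] weight_UN[OF _ C_m C_w nn(3)] add_nonneg_nonneg[OF nn(1,2)] sum_nonneg[OF nn(3)]]) simp
  finally have le: "weight_of w {x. \<alpha> < avgop f I Q x} \<le> \<dots>" .
  have k1W: "W * (8 / 9) ^ k1 \<le> 1"
  proof -
    have "ln W / ln (9 / 8) \<le> real k1" unfolding k1_def by (rule real_nat_ceiling_ge)
    then have "ln W \<le> real k1 * ln (9 / 8)" by (simp add: pos_divide_le_eq)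
    also have "\<dots> = ln ((9 / 8) ^ k1)" by (simp add: ln_realpow)
    finally have "W \<le> (9 / 8) ^ k1" using W1 by (subst (asm) ln_le_cancel_iff) auto
    then have "W * (8 / 9) ^ k1 \<le> (9 / 8) ^ k1 * (8 / 9) ^ k1" by (intro mult_right_mono) auto
    also have "\<dots> = 1" by (simp flip: power_mult_distrib)
    finally show ?thesis .
  qed
  have "(\<Sum>k\<in>{k1..<K}. 512 * W * D / \<alpha> * (8 / 9) ^ k) = 512 * W * D / \<alpha> * (\<Sum>k\<in>{k1..<K}. (8 / 9) ^ k)"
    by (rule sum_distrib_left[symmetric])
  also have "\<dots> \<le> 512 * W * D / \<alpha> * ((8 / 9) ^ k1 / (1 - 8 / 9))"
    using D0 al W1 by (intro mult_left_mono geometric_tail_le) auto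
  also have "\<dots> = 4608 * (D / \<alpha>) * (W * (8 / 9) ^ k1)" by simp
  also have "\<dots> \<le> 4608 * (D / \<alpha>) * 1" using D0 al k1W by (intro mult_left_mono) auto
  finally have tail: "(\<Sum>k\<in>{k1..<K}. 512 * W * D / \<alpha> * (8 / 9) ^ k) \<le> 4608 * (D / \<alpha>)" by simp
  have k1b: "4609 + 4 * real k1 \<le> (4613 / ln 2 + 4 / ln (9 / 8)) * ln (1 + W)"
  proof -
    have "0 \<le> ln W / ln (9 / 8)" using W1 by simp
    then have "real k1 \<le> ln W / ln (9 / 8) + 1" unfolding k1_def by linarith
    moreover have "ln W / ln (9 / 8) \<le> ln (1 + W) / ln (9 / 8)" using W1 by (intro divide_right_mono) auto
    moreover have "1 \<le> ln (1 + W) / ln 2" using W1 by (simp add: le_divide_eq)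
    ultimately have "4609 + 4 * real k1 \<le> 4613 * (ln (1 + W) / ln 2) + 4 * (ln (1 + W) / ln (9 / 8))" by linarith
    then show ?thesis by (simp add: distrib_right)
  qed
  have "D / \<alpha> + 4 * real k1 * D / \<alpha> + (\<Sum>k\<in>{k1..<K}. 512 * W * D / \<alpha> * (8 / 9) ^ k) \<le> (4609 + 4 * real k1) * (D / \<alpha>)"
  proof -
    have "(4609 + 4 * real k1) * (D / \<alpha>) = D / \<alpha> + 4 * real k1 * D / \<alpha> + 4608 * (D / \<alpha>)"
      by (simp add: distrib_right add_divide_distrib)
    then show ?thesis using tail by linarith
  qed
  also have "\<dots> \<le> (4613 / ln 2 + 4 / ln (9 / 8)) * ln (1 + W) * (D / \<alpha>)"
    by (intro mult_right_mono k1b nn(1))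
  also have "\<dots> = wkc CARD('n) * V * ln (1 + W) * N / \<alpha>"
    by (simp add: wkc_def D_def mult_ac)
  finally have "weight_of w {x. \<alpha> < avgop f I Q x} \<le> ennreal (wkc CARD('n) * V * ln (1 + W) * N / \<alpha>)"
    by (rule order_trans[OF le ennreal_leI])
  then have "ennreal \<alpha> * weight_of w {x. \<alpha> < avgop f I Q x} \<le> ennreal \<alpha> * ennreal (wkc CARD('n) * V * ln (1 + W) * N / \<alpha>)"
    by (rule mult_left_mono) simp
  also have "\<dots> = ennreal (wkc CARD('n) * V * ln (1 + W) * N)"
    using al by (subst ennreal_mult'[symmetric]) auto
  also have "\<dots> = ennreal (wkc CARD('n) * V * ln (1 + W)) * ennreal N"
    using N(2) by (intro ennreal_mult'') simp
  finally show ?thesis unfolding N(1) .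
next
  case False
  then have top: "(\<integral>\<^sup>+x. modulus f x * ennreal (w x) \<partial>lebesgue) = \<infinity>" using False by (simp flip: less_top)
  have "0 < wkc CARD('n)" by (auto simp: wkc_def maxc_pos intro!: mult_pos_pos add_pos_pos divide_pos_pos)
  moreover have "0 < ln (1 + W)" using W1 by simp
  ultimately have pos: "0 < wkc CARD('n) * V * ln (1 + W)" using V_pos by simp
  show ?thesis unfolding top ennreal_pos_times_top[OF pos] by simp
qed

end

subsection \<open>Passage to the maximal truncation\<close>

lemma ennreal_powr_ennreal: "0 \<le> a \<Longrightarrow> ennreal_powr (ennreal a) b = ennreal (a powr b)"
  by (simp add: ennreal_powr_def)

lemma ennreal_powr_mono:
  assumes "x \<le> y" "0 \<le> a"
  shows "ennreal_powr x a \<le> ennreal_powr y a"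
proof (cases "y = \<infinity>")
  case False
  then have "x < \<infinity>" "y < \<infinity>" using assms(1) by (auto simp: top.not_eq_extremum intro: le_less_trans)
  then obtain r s where "x = ennreal r" "0 \<le> r" "y = ennreal s" "0 \<le> s" by (metis ennreal_less_topE)
  then show ?thesis using assms by (simp add: ennreal_powr_ennreal powr_mono2 ennreal_leI)
qed (simp add: ennreal_powr_def)

lemma ennreal_powr_inverse:
  assumes "0 < a"
  shows "ennreal_powr (ennreal_powr x a) (1 / a) = x" "ennreal_powr (ennreal_powr x (1 / a)) a = x"
  using assms by (cases x; simp add: ennreal_powr_ennreal powr_powr; simp add: ennreal_powr_def)+

lemma ennreal_powr_mult:
  assumes "0 < c" "0 < a"
  shows "ennreal_powr (ennreal c * x) a = ennreal (c powr a) * ennreal_powr x a"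
proof (cases x)
  case (real r)
  have "ennreal c * ennreal r = ennreal (c * r)" using real assms by (intro ennreal_mult[symmetric]) auto
  moreover have "ennreal_powr (ennreal (c * r)) a = ennreal (c powr a) * ennreal (r powr a)"
    using real assms by (subst ennreal_powr_ennreal) (auto simp: powr_mult ennreal_mult)
  ultimately show ?thesis unfolding real(2) ennreal_powr_ennreal[OF real(1)] by (rule ssubst)
next
  case top
  have "0 < c powr a" using assms by simp
  then show ?thesis using top assms ennreal_pos_times_top[of c] ennreal_pos_times_top[of "c powr a"]
    by (simp add: ennreal_powr_def)
qed

text \<open>Each term is bounded by the inverse power of the supremum of the powers, so monotonicity
  suffices and infinite values are included.\<close>

lemma ennreal_powr_SUP:
  assumes "0 < a"
  shows "ennreal_powr (SUP m::nat. X m) a \<le> (SUP m. ennreal_powr (X m) a)"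
proof -
  let ?S = "SUP m. ennreal_powr (X m) a"
  have "X m \<le> ennreal_powr ?S (1 / a)" for m
  proof -
    have "ennreal_powr (X m) a \<le> ?S" by (rule SUP_upper) simp
    then have "ennreal_powr (ennreal_powr (X m) a) (1 / a) \<le> ennreal_powr ?S (1 / a)"
      using assms by (intro ennreal_powr_mono) auto
    then show ?thesis using ennreal_powr_inverse[OF assms] by simp
  qed
  then have "(SUP m. X m) \<le> ennreal_powr ?S (1 / a)" by (intro SUP_least)
  then have "ennreal_powr (SUP m. X m) a \<le> ennreal_powr (ennreal_powr ?S (1 / a)) a"
    using assms by (intro ennreal_powr_mono) auto
  then show ?thesis using ennreal_powr_inverse[OF assms] by simp
qed

lemma ennreal_powr_measurable [measurable]:
  assumes h [measurable]: "h \<in> borel_measurable M"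
  shows "(\<lambda>x. ennreal_powr (h x) a) \<in> borel_measurable M"
  unfolding ennreal_powr_def
proof (rule measurable_If)
  have "h -` {\<infinity>} \<inter> space M \<in> sets M" using h by (rule measurable_sets) simp
  moreover have "{x \<in> space M. h x = \<infinity>} = h -` {\<infinity>} \<inter> space M" by auto
  ultimately show "{x \<in> space M. h x = \<infinity>} \<in> sets M" by simp
  have "(\<lambda>x. enn2real (h x)) \<in> borel_measurable M" by measurable
  then show "(\<lambda>x. ennreal (enn2real (h x) powr a)) \<in> borel_measurable M" by simp
qed simp

lemma nn_integral_count_space_le_SUP:
  fixes I :: "'i::countable set"
  shows "(\<integral>\<^sup>+i. h i \<partial>count_space I) \<le> (SUP m::nat. \<Sum>i\<in>{i \<in> I. to_nat i < m}. h i)"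
proof -
  let ?F = "\<lambda>m. {i \<in> I. to_nat i < m}"
  have fin: "finite (?F m)" for m
  proof (rule finite_imageD)
    show "finite (to_nat ` ?F m)" by (rule finite_subset[of _ "{..<m}"]) auto
  qed (auto intro: inj_on_subset[OF inj_to_nat])
  have "(\<integral>\<^sup>+i. h i \<partial>count_space I) \<le> (\<integral>\<^sup>+i. (SUP m. h i * indicator (?F m) i) \<partial>count_space I)"
  proof (rule nn_integral_mono)
    fix i assume "i \<in> space (count_space I)"
    then have "h i = h i * indicator (?F (Suc (to_nat i))) i" by simp
    also have "\<dots> \<le> (SUP m. h i * indicator (?F m) i)" by (rule SUP_upper) simp
    finally show "h i \<le> (SUP m. h i * indicator (?F m) i)" .
  qed
  also have "\<dots> = (SUP m. \<integral>\<^sup>+i. h i * indicator (?F m) i \<partial>count_space I)"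
    by (rule nn_integral_monotone_convergence_SUP)
       (auto simp: incseq_def le_fun_def split: split_indicator)
  also have "\<dots> = (SUP m. \<Sum>i\<in>?F m. h i)"
  proof (rule SUP_cong[OF refl])
    fix m
    show "(\<integral>\<^sup>+i. h i * indicator (?F m) i \<partial>count_space I) = (\<Sum>i\<in>?F m. h i)"
      by (subst nn_integral_count_space'[OF fin[of m]]) (auto intro!: sum.cong)
  qed
  finally show ?thesis .
qed

lemma Lp_integral_SUP_le:
  assumes "0 < p" and X: "\<And>m::nat. X m \<in> borel_measurable lebesgue" and inc: "\<And>m x. X m x \<le> X (Suc m) x"
    and w: "w \<in> borel_measurable lebesgue"
    and le: "\<And>m. (\<integral>\<^sup>+x. ennreal_powr (X m x) p * ennreal (w x) \<partial>lebesgue) \<le> R"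
  shows "(\<integral>\<^sup>+x. ennreal_powr (SUP m. X m x) p * ennreal (w x) \<partial>lebesgue) \<le> R"
proof -
  note [measurable] = X w
  have "(\<integral>\<^sup>+x. ennreal_powr (SUP m. X m x) p * ennreal (w x) \<partial>lebesgue) \<le> (\<integral>\<^sup>+x. (SUP m. ennreal_powr (X m x) p * ennreal (w x)) \<partial>lebesgue)"
    using ennreal_powr_SUP[OF assms(1)] by (intro nn_integral_mono) (simp add: SUP_mult_right_ennreal[symmetric] mult_right_mono)
  also have "\<dots> = (SUP m. \<integral>\<^sup>+x. ennreal_powr (X m x) p * ennreal (w x) \<partial>lebesgue)"
  proof (rule nn_integral_monotone_convergence_SUP)
    show "incseq (\<lambda>m x. ennreal_powr (X m x) p * ennreal (w x))"
      using assms(1) inc by (intro incseq_SucI le_funI mult_right_mono ennreal_powr_mono) auto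
  qed measurable
  also have "\<dots> \<le> R" by (intro SUP_least le)
  finally show ?thesis .
qed

text \<open>Strict superlevel sets of an increasing sequence exhaust the strict superlevel set of
  its supremum, so the bound passes to the limit by monotone convergence.\<close>

lemma weight_SUP_le:
  assumes X: "\<And>m::nat. X m \<in> borel_measurable lebesgue" and inc: "\<And>m x. X m x \<le> X (Suc m) x"
    and w: "w \<in> borel_measurable lebesgue"
    and le: "\<And>m. weight_of w {x. a < X m x} \<le> R"
  shows "weight_of w {x. a < (SUP m. X m x :: ennreal)} \<le> R"
proof -
  note [measurable] = X w
  have S [measurable]: "{x. a < X m x} \<in> sets lebesgue" for m
  proof -
    have "{x \<in> space lebesgue. a < X m x} \<in> sets lebesgue" by measurable
    then show ?thesis by simp
  qed
  have "weight_of w {x. a < (SUP m. X m x)} = (\<integral>\<^sup>+x. (SUP m. ennreal (w x) * indicator {x. a < X m x} x) \<partial>lebesgue)"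
    unfolding weight_of_def
  proof (rule nn_integral_cong)
    fix x
    have "indicator {x. a < (SUP m. X m x)} x = (SUP m. indicator {x. a < X m x} x :: ennreal)"
    proof (cases "a < (SUP m. X m x)")
      case True
      then obtain m where "a < X m x" by (auto simp: less_SUP_iff)
      then have "(1::ennreal) \<le> (SUP m. indicator {x. a < X m x} x)" by (intro SUP_upper2[of m]) auto
      moreover have "(SUP m. indicator {x. a < X m x} x) \<le> (1::ennreal)" by (intro SUP_least) (simp split: split_indicator)
      ultimately have "(SUP m. indicator {x. a < X m x} x) = (1::ennreal)" by (intro antisym)
      then show ?thesis using True by simp
    next
      case False
      then have "\<not> a < X m x" for m by (auto simp: less_SUP_iff)
      then show ?thesis using False by simp
    qed
    then show "ennreal (w x) * indicator {x. a < (SUP m. X m x)} x = (SUP m. ennreal (w x) * indicator {x. a < X m x} x)"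
      by (simp add: SUP_mult_left_ennreal)
  qed
  also have "\<dots> = (SUP m. \<integral>\<^sup>+x. ennreal (w x) * indicator {x. a < X m x} x \<partial>lebesgue)"
  proof (rule nn_integral_monotone_convergence_SUP)
    show "incseq (\<lambda>m x. ennreal (w x) * indicator {x. a < X m x} x)"
      using inc by (intro incseq_SucI le_funI mult_left_mono) (auto split: split_indicator intro: less_le_trans)
  qed measurable
  also have "\<dots> \<le> R" using le unfolding weight_of_def by (intro SUP_least)
  finally show ?thesis .
qed

section \<open>Finite characteristics and the degenerate weight\<close>

lemma HL_maximal_mono:
  assumes "\<And>y. \<bar>g y\<bar> \<le> \<bar>h y\<bar>"
  shows "HL_maximal g x \<le> HL_maximal h x"
  unfolding HL_maximal_def modulus_def
  by (intro SUP_mono' divide_right_mono_ennreal nn_integral_mono mult_right_mono ennreal_leI) (use assms in auto)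

lemma cubes_emeasure:
  assumes "Q \<in> cubes"
  shows "Q \<in> sets lebesgue" "compact Q" "emeasure lebesgue Q \<noteq> 0" "emeasure lebesgue Q \<noteq> top"
proof -
  obtain a h where Q: "Q = cbox a (\<chi> i. a $ i + h)" "0 < h" using assms by (auto simp: cubes_def)
  have "emeasure lebesgue Q = ennreal (h ^ CARD('a))" unfolding Q(1) using Q(2) by (intro emeasure_cube) simp
  then show "emeasure lebesgue Q \<noteq> 0" "emeasure lebesgue Q \<noteq> top" using Q(2) by (simp_all add: ennreal_eq_0_iff not_le)
qed (use assms in \<open>auto simp: cubes_def compact_cbox\<close>)

text \<open>If \<open>w\<close> has mass 0 on one cube, the \<open>A\<^sub>1\<close> inequality on
  that cube forces mass 0 on every larger cube, so \<open>w\<close> vanishes almost everywhere.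
  Otherwise all cubes have positive mass, and the maximal function of the restricted weight is
  bounded through \<open>A1_const w\<close>, which makes the second characteristic finite.\<close>

lemma A1_weight_cases:
  fixes w :: "real ^ 'n \<Rightarrow> real"
  assumes "A1_weight w"
  shows "(AE x in lebesgue. w x = 0) \<or> a1_setting w (A1_const w) (Ainf_const w)"
proof -
  have w0: "\<And>x. 0 \<le> w x" and wint: "\<And>S. compact S \<Longrightarrow> set_integrable lebesgue S w"
    using assms by (auto simp: A1_weight_def weight_def)
  have wm [measurable]: "w \<in> borel_measurable lebesgue"
  proof (rule borel_measurable_LIMSEQ_metric)
    show "(\<lambda>x. indicat_real (cball 0 (real m)) x *\<^sub>R w x) \<in> borel_measurable lebesgue" for m
      using wint[of "cball 0 (real m)"] unfolding set_integrable_def by (intro borel_measurable_integrable) simp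
    show "(\<lambda>m. indicat_real (cball 0 (real m)) x *\<^sub>R w x) \<longlonglongrightarrow> w x" for x
    proof (rule tendsto_eventually)
      obtain m0 :: nat where "norm x < real m0" using reals_Archimedean2 by blast
      then show "\<forall>\<^sub>F m in sequentially. indicat_real (cball 0 (real m)) x *\<^sub>R w x = w x"
        by (intro eventually_sequentiallyI[of m0]) (auto simp: dist_norm)
    qed
  qed
  have wfin: "weight_of w S < \<infinity>" if "compact S" for S
  proof -
    have "(\<integral>\<^sup>+y. ennreal (norm (indicat_real S y *\<^sub>R w y)) \<partial>lebesgue) < \<infinity>"
      using wint[OF that] unfolding set_integrable_def integrable_iff_bounded by blast
    also have "(\<integral>\<^sup>+y. ennreal (norm (indicat_real S y *\<^sub>R w y)) \<partial>lebesgue) = weight_of w S"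
      unfolding weight_of_def using w0 by (intro nn_integral_cong) (auto split: split_indicator)
    finally show ?thesis .
  qed
  define V where "V = A1_const w"
  let ?C = "{c. A1_bound w c}"
  have ne: "?C \<noteq> {}" using assms by (auto simp: A1_weight_def)
  have bdd: "bdd_below ?C" by (rule bdd_belowI[of _ 0]) (simp add: A1_bound_def)
  have V0: "0 \<le> V" unfolding V_def A1_const_def using ne by (rule cInf_greatest) (simp add: A1_bound_def)
  \<comment> \<open>Admissible constants are positive by definition, whereas their infimum may be 0.
    The almost everywhere inequality is inherited by the infimum along a sequence, with countably
    many exceptional null sets.\<close>
  have "\<exists>c. A1_bound w c \<and> c < V + 1 / real (Suc m)" for m
  proof -
    have "Inf ?C < V + 1 / real (Suc m)" by (simp add: V_def A1_const_def)
    then show ?thesis using cInf_less_iff[OF ne bdd] by auto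
  qed
  then obtain c where c: "\<And>m. A1_bound w (c m)" "\<And>m. c m < V + 1 / real (Suc m)" by metis
  have "AE x in lebesgue. \<forall>m. HL_maximal w x \<le> ennreal (c m * w x)"
    using c(1) by (simp add: AE_all_countable A1_bound_def)
  then have hlV: "AE x in lebesgue. HL_maximal w x \<le> ennreal (V * w x)"
  proof eventually_elim
    case (elim x)
    have "(\<lambda>m. ennreal ((V + 1 / real (Suc m)) * w x)) \<longlonglongrightarrow> ennreal ((V + 0) * w x)"
      by (intro tendsto_ennrealI tendsto_mult tendsto_add tendsto_const LIMSEQ_Suc[OF lim_1_over_n])
    moreover have "HL_maximal w x \<le> ennreal ((V + 1 / real (Suc m)) * w x)" for m
    proof -
      have "c m * w x \<le> (V + 1 / real (Suc m)) * w x" using c(2)[of m] w0 by (intro mult_right_mono) auto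
      then show ?thesis using elim by (meson ennreal_leI order_trans)
    qed
    ultimately have "HL_maximal w x \<le> ennreal ((V + 0) * w x)" by (intro LIMSEQ_le_const) auto
    then show ?case by simp
  qed
  have HLge: "weight_of w S / emeasure lebesgue S \<le> HL_maximal g x"
    if "S \<in> cubes" "x \<in> S" "\<And>y. y \<in> S \<Longrightarrow> g y = w y" for S x and g :: "real ^ 'n \<Rightarrow> real"
  proof -
    have "weight_of w S = (\<integral>\<^sup>+y\<in>S. modulus g y \<partial>lebesgue)"
      unfolding weight_of_def modulus_def using that(3) w0 by (intro nn_integral_cong) (auto split: split_indicator)
    then show ?thesis unfolding HL_maximal_def using that(1,2)
      by (intro SUP_upper2[of S]) simp_all
  qed
  show ?thesis
  proof (cases "\<forall>S\<in>cubes. 0 < weight_of w S")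
    case True
    have ratio: "(\<integral>\<^sup>+x\<in>S. HL_maximal (\<lambda>y. indicator S y * w y) x \<partial>lebesgue) / weight_of w S \<le> ennreal V" if S: "S \<in> cubes" for S
    proof -
      have "(\<integral>\<^sup>+x\<in>S. HL_maximal (\<lambda>y. indicator S y * w y) x \<partial>lebesgue) \<le> (\<integral>\<^sup>+x. ennreal V * (ennreal (w x) * indicator S x) \<partial>lebesgue)"
      proof (rule nn_integral_mono_AE)
        show "AE x in lebesgue. HL_maximal (\<lambda>y. indicator S y * w y) x * indicator S x \<le> ennreal V * (ennreal (w x) * indicator S x)"
          using hlV
        proof eventually_elim
          case (elim x)
          have "HL_maximal (\<lambda>y. indicator S y * w y) x \<le> HL_maximal w x"
            by (rule HL_maximal_mono) (simp add: indicator_def)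
          then have "HL_maximal (\<lambda>y. indicator S y * w y) x \<le> ennreal (V * w x)" using elim by (rule order_trans)
          also have "\<dots> = ennreal V * ennreal (w x)" using V0 by (rule ennreal_mult')
          finally show ?case by (auto split: split_indicator)
        qed
      qed
      also have "\<dots> = ennreal V * weight_of w S"
        unfolding weight_of_def using cubes_emeasure(1)[OF S] by (intro nn_integral_cmult) simp
      finally have "(\<integral>\<^sup>+x\<in>S. HL_maximal (\<lambda>y. indicator S y * w y) x \<partial>lebesgue) / weight_of w S \<le> ennreal V * weight_of w S / weight_of w S"
        by (rule divide_right_mono_ennreal)
      also have "\<dots> = ennreal V"
        using True S wfin[OF cubes_emeasure(2)[OF S]] by (intro mult_divide_eq_ennreal) auto
      finally show ?thesis .
    qed
    then have "Ainf_char w \<le> ennreal V" unfolding Ainf_char_def by (intro SUP_least)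
    then have "Ainf_char w < \<infinity>" by (auto intro: le_less_trans)
    then have AW: "Ainf_char w = ennreal (Ainf_const w)" by (simp add: Ainf_const_def)
    have hlW: "(\<integral>\<^sup>+x\<in>S. HL_maximal (\<lambda>y. indicator S y * w y) x \<partial>lebesgue) \<le> ennreal (Ainf_const w) * weight_of w S" if S: "S \<in> cubes" for S
    proof -
      let ?x = "\<integral>\<^sup>+x\<in>S. HL_maximal (\<lambda>y. indicator S y * w y) x \<partial>lebesgue"
      have "?x / weight_of w S \<le> ennreal (Ainf_const w)"
        unfolding AW[symmetric] Ainf_char_def by (rule SUP_upper[OF S])
      then have "?x / weight_of w S * weight_of w S \<le> ennreal (Ainf_const w) * weight_of w S" by (rule mult_right_mono) simp
      also have "?x / weight_of w S * weight_of w S = ?x"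
      proof -
        have "weight_of w S / weight_of w S = 1"
          using True S wfin[OF cubes_emeasure(2)[OF S]] by (intro ennreal_divide_self) auto
        then show ?thesis by (simp add: ennreal_divide_times)
      qed
      finally show ?thesis .
    qed
    \<comment> \<open>A single cube suffices: on it the maximal function of the restricted weight is
      at least the average over the cube.\<close>
    have W1: "1 \<le> Ainf_const w"
    proof -
      define q :: "'n dyad" where "q = (0, 0)"
      let ?S = "ccube q"
      have S: "?S \<in> cubes" by (rule ccube_in_cubes)
      define a where "a = weight_of w ?S / emeasure lebesgue ?S"
      have "weight_of w ?S = weight_of w ?S * (emeasure lebesgue ?S / emeasure lebesgue ?S)"
        using ennreal_divide_self[OF cubes_emeasure(3)[OF S] cubes_emeasure(4)[OF S, unfolded top.not_eq_extremum]] by (simp only: mult_1_right)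
      also have "\<dots> = a * emeasure lebesgue ?S"
        unfolding a_def by (rule ennreal_divide_times[symmetric])
      also have "\<dots> = (\<integral>\<^sup>+x. a * indicator ?S x \<partial>lebesgue)"
        by (rule nn_integral_cmult_indicator[OF cubes_emeasure(1)[OF S], symmetric])
      also have "\<dots> \<le> (\<integral>\<^sup>+x\<in>?S. HL_maximal (\<lambda>y. indicator ?S y * w y) x \<partial>lebesgue)"
        using HLge[OF S, of _ "\<lambda>y. indicator ?S y * w y"] unfolding a_def by (intro nn_integral_mono) (auto split: split_indicator)
      finally have "weight_of w ?S / weight_of w ?S \<le> (\<integral>\<^sup>+x\<in>?S. HL_maximal (\<lambda>y. indicator ?S y * w y) x \<partial>lebesgue) / weight_of w ?S"
        by (rule divide_right_mono_ennreal)
      also have "\<dots> \<le> ennreal (Ainf_const w)" unfolding AW[symmetric] Ainf_char_def by (rule SUP_upper[OF S])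
      also have "weight_of w ?S / weight_of w ?S = 1"
        using True S wfin[OF cubes_emeasure(2)[OF S]] by (intro ennreal_divide_self) auto
      finally show ?thesis by simp
    qed
    have "a1_setting w (A1_const w) (Ainf_const w)"
      by unfold_locales (use w0 wm wfin V0[unfolded V_def] hlV[unfolded V_def] hlW W1 True in auto)
    then show ?thesis ..
  next
    case False
    then obtain S where S: "S \<in> cubes" "weight_of w S = 0" by (auto simp: zero_less_iff_neq_zero)
    \<comment> \<open>On \<open>S\<close> the average over \<open>Q\<close> is at most the maximal
      function, hence at most \<open>V * w\<close> almost everywhere; integrating over
      \<open>S\<close> gives 0.\<close>
    have zero: "weight_of w Q = 0" if Q: "Q \<in> cubes" "S \<subseteq> Q" for Q
    proof -
      have "weight_of w Q / emeasure lebesgue Q * emeasure lebesgue S = (\<integral>\<^sup>+x. weight_of w Q / emeasure lebesgue Q * indicator S x \<partial>lebesgue)"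
        by (rule nn_integral_cmult_indicator[OF cubes_emeasure(1)[OF S(1)], symmetric])
      also have "\<dots> \<le> (\<integral>\<^sup>+x. ennreal V * (ennreal (w x) * indicator S x) \<partial>lebesgue)"
      proof (rule nn_integral_mono_AE)
        show "AE x in lebesgue. weight_of w Q / emeasure lebesgue Q * indicator S x \<le> ennreal V * (ennreal (w x) * indicator S x)"
          using hlV
        proof eventually_elim
          case (elim x)
          show ?case
          proof (cases "x \<in> S")
            case True
            have "weight_of w Q / emeasure lebesgue Q \<le> HL_maximal w x" using True Q by (intro HLge) auto
            also have "\<dots> \<le> ennreal (V * w x)" by (rule elim)
            also have "\<dots> = ennreal V * ennreal (w x)" using V0 by (rule ennreal_mult')
            finally show ?thesis using True by simp
          qed simp
        qed
      qed
      also have "\<dots> = ennreal V * weight_of w S"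
        unfolding weight_of_def using cubes_emeasure(1)[OF S(1)] by (intro nn_integral_cmult) simp
      also have "\<dots> = 0" by (simp add: S(2))
      finally have "weight_of w Q / emeasure lebesgue Q * emeasure lebesgue S = 0" by simp
      then show ?thesis using cubes_emeasure[OF S(1)] cubes_emeasure[OF Q(1)] by auto
    qed
    obtain \<rho> where \<rho>: "S \<subseteq> ball 0 \<rho>" using bounded_subset_ballD[OF compact_imp_bounded[OF cubes_emeasure(2)[OF S(1)]]] by blast
    \<comment> \<open>Concentric cubes around the origin that contain \<open>S\<close> and exhaust
      the space, written in the literal form of \<open>cubes\<close>.\<close>
    define Q where "Q m = cbox (\<chi> i. - (\<bar>\<rho>\<bar> + real (Suc m))) (\<chi> i. (\<chi> i. - (\<bar>\<rho>\<bar> + real (Suc m)) :: real ^ 'n) $ i + 2 * (\<bar>\<rho>\<bar> + real (Suc m))) " for m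
    have Qc: "Q m \<in> cubes" for m
      unfolding Q_def cubes_def
      by (intro CollectI exI[of _ "\<chi> i. - (\<bar>\<rho>\<bar> + real (Suc m))"] exI[of _ "2 * (\<bar>\<rho>\<bar> + real (Suc m))"] conjI refl) simp
    have Qm: "x \<in> Q m" if "norm x \<le> \<bar>\<rho>\<bar> + real (Suc m)" for x m
    proof -
      have "- (\<bar>\<rho>\<bar> + real (Suc m)) \<le> x $ i \<and> x $ i \<le> \<bar>\<rho>\<bar> + real (Suc m)" for i
        using component_le_norm_cart[of x i] that by linarith
      then show ?thesis by (simp add: Q_def mem_box_cart)
    qed
    have SQ: "S \<subseteq> Q m" for m
    proof
      fix x assume "x \<in> S"
      then have "norm x < \<rho>" using \<rho> by (auto simp: dist_norm)
      then show "x \<in> Q m" by (intro Qm) linarith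
    qed
    have "AE x in lebesgue. x \<in> Q m \<longrightarrow> w x = 0" for m
    proof -
      have "(\<integral>\<^sup>+x. ennreal (w x) * indicator (Q m) x \<partial>lebesgue) = 0"
        using zero[OF Qc SQ] unfolding weight_of_def .
      then have "AE x in lebesgue. ennreal (w x) * indicator (Q m) x = 0"
        using cubes_emeasure(1)[OF Qc[of m]] by (subst (asm) nn_integral_0_iff_AE) auto
      then show ?thesis by eventually_elim (use w0 in \<open>auto simp: ennreal_eq_0_iff antisym\<close>)
    qed
    then have "AE x in lebesgue. \<forall>m. x \<in> Q m \<longrightarrow> w x = 0" unfolding AE_all_countable by blast
    then have "AE x in lebesgue. w x = 0"
    proof eventually_elim
      case (elim x)
      obtain m :: nat where "norm x < real m" using reals_Archimedean2 by blast
      then have "x \<in> Q m" by (intro Qm) simp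
      then show ?case using elim by blast
    qed
    then show ?thesis ..
  qed
qed

lemma Lp_norm_finite_iff: "Lp_norm p w g < \<infinity> \<longleftrightarrow> (\<integral>\<^sup>+x. ennreal_powr (g x) p * ennreal (w x) \<partial>lebesgue) < \<infinity>"
  unfolding Lp_norm_def ennreal_powr_def by (simp add: top.not_eq_extremum)

lemma ennreal_powr_modulus: "ennreal_powr (modulus f x) p = ennreal (norm (f x) powr p)"
  by (simp add: modulus_def ennreal_powr_ennreal)

lemma Lp_space_integral:
  assumes "f \<in> Lp_space p w"
  shows "f \<in> borel_measurable lebesgue" "(\<integral>\<^sup>+x. ennreal (norm (f x) powr p) * ennreal (w x) \<partial>lebesgue) < \<infinity>"
  using assms unfolding Lp_space_def Lp_norm_finite_iff ennreal_powr_modulus by auto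

text \<open>By the \<open>A\<^sub>1\<close> condition \<open>V * w\<close> is bounded below on each
  tripled cube by the positive constant \<open>mt q\<close>, so weighted integrability of the
  \<open>p\<close>-th power gives local Lebesgue integrability of it, and then of the
  function.\<close>

lemma (in a1_setting) Lp_loc_int:
  assumes p: "1 \<le> p" and f: "f \<in> Lp_space p w"
  shows "loc_int f"
  unfolding loc_int_def
proof (intro allI)
  fix x :: "real ^ 'n" and r :: real
  note [measurable] = Lp_space_integral(1)[OF f]
  obtain k :: nat where k: "r < 2 ^ k" using real_arch_pow[of 2 r] by auto
  define q :: "'n dyad" where "q = dyad_at (int k) x"
  have sub: "ball x r \<subseteq> tri q"
  proof
    fix y assume "y \<in> ball x r"
    then show "y \<in> tri q" using k by (intro near_dset_in_tri[of x]) (auto simp: q_def dist_norm)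
  qed
  have m0: "0 < mt q"
  proof -
    have "0 < ennreal (mt q * (3 * side q) ^ CARD('n))" using wpos[OF tri_in_cubes[of q]] unfolding weight_tri .
    then show ?thesis using mt_nonneg[of q] by (cases "mt q = 0") (auto simp: order.strict_iff_order)
  qed
  have pt: "norm (f y) \<le> 1 + norm (f y) powr p" for y
  proof (cases "norm (f y) \<le> 1")
    case True
    then show ?thesis by (simp add: add_increasing2)
  next
    case False
    then have "norm (f y) powr 1 \<le> norm (f y) powr p" using p by (intro powr_mono) auto
    then show ?thesis using False by simp
  qed
  have "ennreal (mt q) * (\<integral>\<^sup>+y. ennreal (norm (f y) powr p) * indicator (tri q) y \<partial>lebesgue)
     = (\<integral>\<^sup>+y. ennreal (mt q) * (ennreal (norm (f y) powr p) * indicator (tri q) y) \<partial>lebesgue)"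
    by (rule nn_integral_cmult[symmetric]) measurable
  also have "\<dots> \<le> (\<integral>\<^sup>+y. ennreal V * (ennreal (norm (f y) powr p) * ennreal (w y)) \<partial>lebesgue)"
  proof (rule nn_integral_mono_AE)
    show "AE y in lebesgue. ennreal (mt q) * (ennreal (norm (f y) powr p) * indicator (tri q) y) \<le> ennreal V * (ennreal (norm (f y) powr p) * ennreal (w y))"
      using mt_AE
    proof eventually_elim
      case (elim y)
      show ?case
      proof (cases "y \<in> tri q")
        case True
        then have "ennreal (mt q) \<le> ennreal (V * w y)" using elim by blast
        also have "\<dots> = ennreal V * ennreal (w y)" using V0 by (rule ennreal_mult')
        finally have "ennreal (mt q) * ennreal (norm (f y) powr p) \<le> ennreal V * ennreal (w y) * ennreal (norm (f y) powr p)"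
          by (rule mult_right_mono) simp
        then show ?thesis using True by (simp add: mult_ac)
      qed simp
    qed
  qed
  also have "\<dots> = ennreal V * (\<integral>\<^sup>+y. ennreal (norm (f y) powr p) * ennreal (w y) \<partial>lebesgue)"
    by (rule nn_integral_cmult) measurable
  also have "\<dots> < \<infinity>" using Lp_space_integral(2)[OF f] by (simp add: ennreal_mult_less_top)
  finally have fin: "(\<integral>\<^sup>+y. ennreal (norm (f y) powr p) * indicator (tri q) y \<partial>lebesgue) < \<infinity>"
    using m0 by (auto simp: ennreal_mult_less_top ennreal_eq_0_iff)
  have "(\<integral>\<^sup>+y. ennreal (norm (indicat_real (ball x r) y *\<^sub>R f y)) \<partial>lebesgue)
    \<le> (\<integral>\<^sup>+y. (indicator (tri q) y + ennreal (norm (f y) powr p) * indicator (tri q) y) \<partial>lebesgue)"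
  proof (rule nn_integral_mono)
    fix y
    have "ennreal (norm (f y)) \<le> ennreal (1 + norm (f y) powr p)" using pt[of y] by (rule ennreal_leI)
    also have "\<dots> = 1 + ennreal (norm (f y) powr p)" by simp
    finally show "ennreal (norm (indicat_real (ball x r) y *\<^sub>R f y)) \<le> indicator (tri q) y + ennreal (norm (f y) powr p) * indicator (tri q) y"
      using sub by (cases "y \<in> ball x r") auto
  qed
  also have "\<dots> = emeasure lebesgue (tri q) + (\<integral>\<^sup>+y. ennreal (norm (f y) powr p) * indicator (tri q) y \<partial>lebesgue)"
    by (subst nn_integral_add) auto
  also have "\<dots> < \<infinity>" using fin by (auto simp: emeasure_tri)
  finally show "set_integrable lebesgue (ball x r) f"
    unfolding set_integrable_def integrable_iff_bounded by simp
qed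

section \<open>Removing the restrictions on families and radii\<close>

context cz
begin

text \<open>A fixed truncation is dominated by the sparse sums of all sufficiently large generations
  \<open>N\<close>, hence by the limit inferior over \<open>N\<close>. Written as a supremum of
  infima it is an increasing limit, so together with the finite exhaustion \<open>F N m\<close> only
  monotone limits are taken.\<close>

lemma sparse_approximation:
  assumes f: "loc_int f"
  obtains F :: "nat \<Rightarrow> nat \<Rightarrow> (nat \<times> 'n dyad) set" and E where
    "\<And>N m. finite (F N m)" "\<And>N m. sparse_family (F N m) snd (E N)" "\<And>N m. F N m \<subseteq> F N (Suc m)"
    "AE x in lebesgue. max_truncation K f x \<le> (SUP N. INF M\<in>{N..}. SUP m. ennreal (domc * avgop f (F M m) snd x))"
proof -
  have "\<forall>N::nat. \<exists>(I :: (nat \<times> 'n dyad) set) E. sparse_family I snd E \<and>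
    (AE x in lebesgue. \<forall>e v. 0 < e \<and> e < v \<and> v \<le> 2 powi (int N) \<longrightarrow>
       ennreal (norm (tr K f e v x)) \<le> ennreal domc * (\<integral>\<^sup>+i. ennreal (tavg f (snd i)) * indicator (dset (snd i)) x \<partial>count_space I))"
    using sparse_domination[OF f] by blast
  from choice[OF this] obtain I :: "nat \<Rightarrow> (nat \<times> 'n dyad) set" where
    "\<forall>N. \<exists>E. sparse_family (I N) snd E \<and>
    (AE x in lebesgue. \<forall>e v. 0 < e \<and> e < v \<and> v \<le> 2 powi (int N) \<longrightarrow>
       ennreal (norm (tr K f e v x)) \<le> ennreal domc * (\<integral>\<^sup>+i. ennreal (tavg f (snd i)) * indicator (dset (snd i)) x \<partial>count_space (I N)))" ..
  from choice[OF this] obtain E where sp: "\<And>N. sparse_family (I N) snd (E N)"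
    and dom: "\<And>N. AE x in lebesgue. \<forall>e v. 0 < e \<and> e < v \<and> v \<le> 2 powi (int N) \<longrightarrow>
       ennreal (norm (tr K f e v x)) \<le> ennreal domc * (\<integral>\<^sup>+i. ennreal (tavg f (snd i)) * indicator (dset (snd i)) x \<partial>count_space (I N))"
    by blast
  \<comment> \<open>An increasing exhaustion of the countable family by finite subfamilies, which
    inherit the sparseness.\<close>
  define F where "F N m = {i \<in> I N. to_nat i < m}" for N m :: nat
  have fin: "finite (F N m)" for N m
  proof (rule finite_imageD)
    show "finite (to_nat ` F N m)" by (rule finite_subset[of _ "{..<m}"]) (auto simp: F_def)
  qed (auto intro: inj_on_subset[OF inj_to_nat])
  have le: "ennreal domc * (\<integral>\<^sup>+i. ennreal (tavg f (snd i)) * indicator (dset (snd i)) x \<partial>count_space (I N))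
     \<le> (SUP m. ennreal (domc * avgop f (F N m) snd x))" for N x
  proof -
    have "ennreal domc * (\<integral>\<^sup>+i. ennreal (tavg f (snd i)) * indicator (dset (snd i)) x \<partial>count_space (I N))
      \<le> ennreal domc * (SUP m. \<Sum>i\<in>F N m. ennreal (tavg f (snd i)) * indicator (dset (snd i)) x)"
      unfolding F_def by (intro mult_left_mono nn_integral_count_space_le_SUP) simp
    also have "\<dots> = (SUP m. ennreal domc * (\<Sum>i\<in>F N m. ennreal (tavg f (snd i)) * indicator (dset (snd i)) x))"
      by (rule SUP_mult_left_ennreal)
    also have "\<dots> = (SUP m. ennreal (domc * avgop f (F N m) snd x))"
    proof (rule SUP_cong[OF refl])
      fix m
      have "(\<Sum>i\<in>F N m. ennreal (tavg f (snd i)) * indicator (dset (snd i)) x) = (\<Sum>i\<in>F N m. ennreal (tavg f (snd i) * indicator (dset (snd i)) x))"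
        by (intro sum.cong refl) (simp add: indicator_def)
      also have "\<dots> = ennreal (avgop f (F N m) snd x)" unfolding avgop_def by (rule sum_ennreal) simp
      finally show "ennreal domc * (\<Sum>i\<in>F N m. ennreal (tavg f (snd i)) * indicator (dset (snd i)) x) = ennreal (domc * avgop f (F N m) snd x)"
        using domc_pos by (simp add: ennreal_mult)
    qed
    finally show ?thesis .
  qed
  have "AE x in lebesgue. \<forall>N e v. 0 < e \<and> e < v \<and> v \<le> 2 powi (int N) \<longrightarrow>
       ennreal (norm (tr K f e v x)) \<le> (SUP m. ennreal (domc * avgop f (F N m) snd x))"
    unfolding AE_all_countable
  proof
    fix N
    show "AE x in lebesgue. \<forall>e v. 0 < e \<and> e < v \<and> v \<le> 2 powi (int N) \<longrightarrow>
       ennreal (norm (tr K f e v x)) \<le> (SUP m. ennreal (domc * avgop f (F N m) snd x))"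
      using dom[of N] by eventually_elim (use le order_trans in blast)
  qed
  then have "AE x in lebesgue. max_truncation K f x \<le> (SUP N. INF M\<in>{N..}. SUP m. ennreal (domc * avgop f (F M m) snd x))"
  proof eventually_elim
    case (elim x)
    let ?G = "\<lambda>M. SUP m. ennreal (domc * avgop f (F M m) snd x)"
    have "ennreal (norm (tr K f e v x)) \<le> (SUP N. INF M\<in>{N..}. ?G M)" if ev: "0 < e" "e < v" for e v
    proof -
      obtain N :: nat where N: "v < 2 ^ N" using real_arch_pow[of 2 v] by auto
      have "ennreal (norm (tr K f e v x)) \<le> ?G M" if "M \<in> {N..}" for M
      proof -
        have "(2::real) ^ N \<le> 2 ^ M" using that by (intro power_increasing) auto
        then have "v \<le> 2 powi (int M)" using N unfolding power_int_of_nat by linarith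
        then show ?thesis using elim ev by blast
      qed
      then have "ennreal (norm (tr K f e v x)) \<le> (INF M\<in>{N..}. ?G M)" by (rule INF_greatest)
      also have "\<dots> \<le> (SUP N. INF M\<in>{N..}. ?G M)" by (rule SUP_upper) simp
      finally show ?thesis .
    qed
    then show ?case unfolding max_truncation_def
      by (auto intro!: SUP_least simp: tr_def ann_def)
  qed
  moreover have "sparse_family (F N m) snd (E N)" for N m
    by (rule sparse_subfamily[OF sp]) (auto simp: F_def)
  moreover have "F N m \<subseteq> F N (Suc m)" for N m by (auto simp: F_def)
  ultimately show ?thesis using fin by (intro that[of F E]) auto
qed

lemma avgop_mono: "J \<subseteq> J' \<Longrightarrow> finite J' \<Longrightarrow> avgop f J Q x \<le> avgop f J' Q x"
  unfolding avgop_def by (intro sum_mono2) auto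

text \<open>The finite bound is independent of \<open>N\<close> and \<open>m\<close>. It passes
  first to the supremum over \<open>m\<close>, then to each infimum over \<open>M \<ge> N\<close>,
  which lies below its term with \<open>M = N\<close>, and finally to the increasing supremum over
  \<open>N\<close>.\<close>

lemma strong_truncation:
  assumes a1: "a1_setting w V W" and f: "loc_int f" and p: "1 < p" and p': "p' = p / (p - 1)"
  shows "(\<integral>\<^sup>+x. ennreal_powr (max_truncation K f x) p * ennreal (w x) \<partial>lebesgue)
    \<le> ennreal (domc powr p * ((strc CARD('n) * p * p') powr p * V * W powr (p - 1))) * (\<integral>\<^sup>+x. ennreal (norm (f x) powr p) * ennreal (w x) \<partial>lebesgue)"
    (is "_ \<le> ?R")
proof -
  interpret a1_setting w V W by (rule a1)
  obtain F :: "nat \<Rightarrow> nat \<Rightarrow> (nat \<times> 'n dyad) set" and E where F: "\<And>N m. finite (F N m)" "\<And>N m. sparse_family (F N m) snd (E N)" "\<And>N m. F N m \<subseteq> F N (Suc m)"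
    "AE x in lebesgue. max_truncation K f x \<le> (SUP N. INF M\<in>{N..}. SUP m. ennreal (domc * avgop f (F M m) snd x))"
    by (rule sparse_approximation[OF f], rule that)
  have p0: "0 < p" using p by simp
  have c: "0 \<le> (strc CARD('n) * p * p') powr p * V * W powr (p - 1)" using V0 by simp
  let ?X = "\<lambda>N m x. ennreal (domc * avgop f (F N m) snd x)"
  have fin: "(\<integral>\<^sup>+x. ennreal_powr (?X N m x) p * ennreal (w x) \<partial>lebesgue) \<le> ?R" for N m
  proof -
    have "(\<integral>\<^sup>+x. ennreal_powr (?X N m x) p * ennreal (w x) \<partial>lebesgue) = (\<integral>\<^sup>+x. ennreal (domc powr p) * (ennreal (avgop f (F N m) snd x powr p) * ennreal (w x)) \<partial>lebesgue)"
      using domc_pos by (intro nn_integral_cong) (subst ennreal_powr_ennreal, simp_all add: powr_mult ennreal_mult mult.assoc)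
    also have "\<dots> = ennreal (domc powr p) * (\<integral>\<^sup>+x. ennreal (avgop f (F N m) snd x powr p) * ennreal (w x) \<partial>lebesgue)"
      by (rule nn_integral_cmult) measurable
    also have "\<dots> \<le> ennreal (domc powr p) * (ennreal ((strc CARD('n) * p * p') powr p * V * W powr (p - 1)) * (\<integral>\<^sup>+x. ennreal (norm (f x) powr p) * ennreal (w x) \<partial>lebesgue))"
      by (intro mult_left_mono strong_finite[OF f p p' F(1,2)]) simp
    also have "\<dots> = ?R" by (subst ennreal_mult[OF powr_ge_zero c]) (rule mult.assoc[symmetric])
    finally show ?thesis .
  qed
  have inc1: "?X N m x \<le> ?X N (Suc m) x" for N m x
    using domc_pos by (intro ennreal_leI mult_left_mono avgop_mono F) auto
  let ?G = "\<lambda>N x. SUP m. ?X N m x"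
  have G: "(\<integral>\<^sup>+x. ennreal_powr (?G N x) p * ennreal (w x) \<partial>lebesgue) \<le> ?R" for N
    by (rule Lp_integral_SUP_le[where X = "?X N", OF p0 _ inc1 wm fin]) measurable
  have Gm [measurable]: "?G N \<in> borel_measurable lebesgue" for N by measurable
  let ?H = "\<lambda>N x. INF M\<in>{N..}. ?G M x"
  have H: "(\<integral>\<^sup>+x. ennreal_powr (SUP N. ?H N x) p * ennreal (w x) \<partial>lebesgue) \<le> ?R"
  proof (rule Lp_integral_SUP_le[OF p0 _ _ wm])
    show "?H N \<in> borel_measurable lebesgue" for N by (intro borel_measurable_INF Gm) auto
    show "?H N x \<le> ?H (Suc N) x" for N x by (intro INF_superset_mono) auto
    fix N
    have "(\<integral>\<^sup>+x. ennreal_powr (?H N x) p * ennreal (w x) \<partial>lebesgue) \<le> (\<integral>\<^sup>+x. ennreal_powr (?G N x) p * ennreal (w x) \<partial>lebesgue)"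
      using p0 by (intro nn_integral_mono mult_right_mono ennreal_powr_mono INF_lower) auto
    then show "(\<integral>\<^sup>+x. ennreal_powr (?H N x) p * ennreal (w x) \<partial>lebesgue) \<le> ?R" using G by (rule order_trans)
  qed
  have "(\<integral>\<^sup>+x. ennreal_powr (max_truncation K f x) p * ennreal (w x) \<partial>lebesgue) \<le> (\<integral>\<^sup>+x. ennreal_powr (SUP N. ?H N x) p * ennreal (w x) \<partial>lebesgue)"
  proof (rule nn_integral_mono_AE)
    show "AE x in lebesgue. ennreal_powr (max_truncation K f x) p * ennreal (w x) \<le> ennreal_powr (SUP N. ?H N x) p * ennreal (w x)"
      using F(4) by eventually_elim (use p0 in \<open>intro mult_right_mono ennreal_powr_mono; simp\<close>)
  qed
  then show ?thesis using H by (rule order_trans)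
qed

text \<open>The same two limits as for the strong bound, now for strict superlevel sets. The finite
  estimate is used at height \<alpha> / \<open>domc\<close>, which turns the domination constant
  into a factor of the bound.\<close>

lemma weak_truncation:
  assumes a1: "a1_setting w V W" and f: "loc_int f" and al: "0 < \<alpha>"
  shows "ennreal \<alpha> * weight_of w {x. ennreal \<alpha> < max_truncation K f x}
    \<le> ennreal (domc * (wkc CARD('n) * V * ln (1 + W))) * (\<integral>\<^sup>+x. modulus f x * ennreal (w x) \<partial>lebesgue)"
proof -
  interpret a1_setting w V W by (rule a1)
  obtain F :: "nat \<Rightarrow> nat \<Rightarrow> (nat \<times> 'n dyad) set" and E where F: "\<And>N m. finite (F N m)" "\<And>N m. sparse_family (F N m) snd (E N)" "\<And>N m. F N m \<subseteq> F N (Suc m)"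
    "AE x in lebesgue. max_truncation K f x \<le> (SUP N. INF M\<in>{N..}. SUP m. ennreal (domc * avgop f (F M m) snd x))"
    by (rule sparse_approximation[OF f], rule that)
  let ?I = "\<integral>\<^sup>+x. modulus f x * ennreal (w x) \<partial>lebesgue"
  let ?c = "wkc CARD('n) * V * ln (1 + W)"
  have c0: "0 \<le> ?c" using V0 W1 by (auto simp: wkc_def maxc_pos less_imp_le intro!: mult_nonneg_nonneg add_nonneg_nonneg)
  let ?R = "ennreal (domc / \<alpha>) * (ennreal ?c * ?I)"
  let ?X = "\<lambda>N m x. ennreal (domc * avgop f (F N m) snd x)"
  have fin: "weight_of w {x. ennreal \<alpha> < ?X N m x} \<le> ?R" for N m
  proof -
    have "{x. ennreal \<alpha> < ?X N m x} = {x. \<alpha> / domc < avgop f (F N m) snd x}"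
      using al domc_pos by (auto simp: ennreal_less_iff pos_divide_less_eq mult.commute)
    moreover have "ennreal (domc / \<alpha>) * (ennreal (\<alpha> / domc) * weight_of w {x. \<alpha> / domc < avgop f (F N m) snd x}) \<le> ?R"
      using al domc_pos by (intro mult_left_mono weak_finite[OF f F(1,2)]) auto
    moreover have "ennreal (domc / \<alpha>) * (ennreal (\<alpha> / domc) * weight_of w {x. \<alpha> / domc < avgop f (F N m) snd x}) = weight_of w {x. \<alpha> / domc < avgop f (F N m) snd x}"
    proof -
      have "ennreal (domc / \<alpha>) * ennreal (\<alpha> / domc) = 1" using al domc_pos by (subst ennreal_mult[symmetric]) auto
      then show ?thesis by (simp add: mult.assoc[symmetric])
    qed
    ultimately show ?thesis by simp
  qed
  have inc1: "?X N m x \<le> ?X N (Suc m) x" for N m x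
    using domc_pos by (intro ennreal_leI mult_left_mono avgop_mono F) auto
  let ?G = "\<lambda>N x. SUP m. ?X N m x"
  have G: "weight_of w {x. ennreal \<alpha> < ?G N x} \<le> ?R" for N
    by (rule weight_SUP_le[where X = "?X N", OF _ inc1 wm fin]) measurable
  have Gm [measurable]: "?G N \<in> borel_measurable lebesgue" for N by measurable
  let ?H = "\<lambda>N x. INF M\<in>{N..}. ?G M x"
  have H: "weight_of w {x. ennreal \<alpha> < (SUP N. ?H N x)} \<le> ?R"
  proof (rule weight_SUP_le[OF _ _ wm])
    show "?H N \<in> borel_measurable lebesgue" for N by (intro borel_measurable_INF Gm) auto
    show "?H N x \<le> ?H (Suc N) x" for N x by (intro INF_superset_mono) auto
    fix N
    have "?H N x \<le> ?G N x" for x by (rule INF_lower) simp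
    then have "{x. ennreal \<alpha> < ?H N x} \<subseteq> {x. ennreal \<alpha> < ?G N x}" by (auto intro: less_le_trans)
    then have "weight_of w {x. ennreal \<alpha> < ?H N x} \<le> weight_of w {x. ennreal \<alpha> < ?G N x}" by (rule weight_of_mono)
    then show "weight_of w {x. ennreal \<alpha> < ?H N x} \<le> ?R" using G by (rule order_trans)
  qed
  have "weight_of w {x. ennreal \<alpha> < max_truncation K f x} \<le> weight_of w {x. ennreal \<alpha> < (SUP N. ?H N x)}"
    unfolding weight_of_def
  proof (rule nn_integral_mono_AE)
    show "AE x in lebesgue. ennreal (w x) * indicator {x. ennreal \<alpha> < max_truncation K f x} x \<le> ennreal (w x) * indicator {x. ennreal \<alpha> < (SUP N. ?H N x)} x"
      using F(4)
    proof eventually_elim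
      case (elim x)
      have "indicator {x. ennreal \<alpha> < max_truncation K f x} x \<le> (indicator {x. ennreal \<alpha> < (SUP N. ?H N x)} x :: ennreal)"
        using less_le_trans[OF _ elim, of "ennreal \<alpha>"] by (auto simp: indicator_def)
      then show ?case by (rule mult_left_mono) simp
    qed
  qed
  also note H
  finally have "ennreal \<alpha> * weight_of w {x. ennreal \<alpha> < max_truncation K f x} \<le> ennreal \<alpha> * ?R" by (rule mult_left_mono) simp
  also have "\<dots> = ennreal (\<alpha> * (domc / \<alpha>)) * (ennreal ?c * ?I)"
    using al domc_pos by (subst ennreal_mult) (simp_all only: mult.assoc less_imp_le divide_nonneg_pos)
  also have "\<alpha> * (domc / \<alpha>) = domc" using al by simp
  also have "ennreal domc * (ennreal ?c * ?I) = ennreal (domc * ?c) * ?I"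
    by (subst ennreal_mult[OF less_imp_le[OF domc_pos] c0]) (rule mult.assoc[symmetric])
  finally show ?thesis .
qed

end

section \<open>From the given operator to the two inequalities\<close>

lemma L2_iff_sqint: "f \<in> L2 \<longleftrightarrow> sqint f"
proof -
  have "ennreal_powr (modulus f x) 2 * ennreal 1 = sqf f x" for x
    by (simp add: ennreal_powr_modulus sqf_def)
  then show ?thesis by (simp only: Lp_space_def Lp_norm_finite_iff sqint_def mem_Collect_eq)
qed

lemma L2_norm_sqf: "Lp_norm 2 (\<lambda>_. 1) (modulus f) = ennreal_powr (\<integral>\<^sup>+x. sqf f x \<partial>lebesgue) (1 / 2)"
proof -
  have "ennreal_powr (modulus f x) 2 * ennreal 1 = sqf f x" for x
    by (simp add: ennreal_powr_modulus sqf_def)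
  then show ?thesis by (simp add: Lp_norm_def)
qed

lemma CZ_operator_cz:
  fixes K :: "real ^ 'n \<Rightarrow> real ^ 'n \<Rightarrow> complex"
  assumes "CZ_operator T K"
  shows "\<exists>c \<delta> B. cz K c \<delta> T B"
proof -
  have std: "standard_kernel K" and bdd: "L2_bounded_operator T"
    and ker: "\<And>f. f \<in> L2 \<Longrightarrow> AE x in lebesgue. x \<notin> closure {y. f y \<noteq> 0} \<longrightarrow> T f x = (LINT y|lebesgue. K x y * f y)"
    using assms by (auto simp: CZ_operator_def)
  obtain c \<delta> where \<delta>: "0 < \<delta>"
    and size: "\<And>x y. x \<noteq> y \<Longrightarrow> norm (K x y) \<le> c / norm (x - y) ^ CARD('n)"
    and reg: "\<And>x x' y. norm (x - x') < norm (x - y) / 2 \<Longrightarrow> norm (K x y - K x' y) + norm (K y x - K y x')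
             \<le> c * norm (x - x') powr \<delta> / norm (x - y) powr (real CARD('n) + \<delta>)"
    using std unfolding standard_kernel_def by blast
  \<comment> \<open>The constant of a standard kernel carries no sign condition in its definition;
    enlarging it makes it positive.\<close>
  define c' where "c' = \<bar>c\<bar> + 1"
  have cc: "c \<le> c'" by (simp add: c'_def)
  obtain B where B: "0 \<le> B" and bd: "\<And>f. f \<in> L2 \<Longrightarrow> Lp_norm 2 (\<lambda>_. 1) (modulus (T f)) \<le> ennreal B * Lp_norm 2 (\<lambda>_. 1) (modulus f)"
    using bdd unfolding L2_bounded_operator_def by blast
  have "cz K c' \<delta> T B"
  proof
    show "0 < c'" by (simp add: c'_def)
    show "0 < \<delta>" by (rule \<delta>)
    show "0 \<le> B" by (rule B)
    show "norm (K x y) \<le> c' / norm (x - y) ^ CARD('n)" if "x \<noteq> y" for x y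
      using size[OF that] divide_right_mono[OF cc, of "norm (x - y) ^ CARD('n)"] by simp
    show "norm (K x y - K x' y) + norm (K y x - K y x') \<le> c' * norm (x - x') powr \<delta> / norm (x - y) powr (real CARD('n) + \<delta>)"
      if "norm (x - x') < norm (x - y) / 2" for x x' y
    proof -
      have "c * norm (x - x') powr \<delta> / norm (x - y) powr (real CARD('n) + \<delta>) \<le> c' * norm (x - x') powr \<delta> / norm (x - y) powr (real CARD('n) + \<delta>)"
        by (intro divide_right_mono mult_right_mono cc) auto
      then show ?thesis using reg[OF that] by linarith
    qed
    show "AE x in lebesgue. T (\<lambda>y. f y + g y) x = T f x + T g x" if "sqint f" "sqint g" for f g
      using bdd that[folded L2_iff_sqint] unfolding L2_bounded_operator_def by blast
    show sT: "sqint (T f)" if "sqint f" for f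
      using bdd that unfolding L2_bounded_operator_def L2_iff_sqint[symmetric] by blast
    show "AE x in lebesgue. x \<notin> closure {y. f y \<noteq> 0} \<longrightarrow> T f x = (LINT y|lebesgue. K x y * f y)" if "sqint f" for f
      by (rule ker) (use that L2_iff_sqint in blast)
    fix f :: "real ^ 'n \<Rightarrow> complex" assume f: "sqint f"
    have le: "ennreal_powr (\<integral>\<^sup>+x. sqf (T f) x \<partial>lebesgue) (1 / 2) \<le> ennreal B * ennreal_powr (\<integral>\<^sup>+x. sqf f x \<partial>lebesgue) (1 / 2)"
      using bd[of f] f unfolding L2_iff_sqint L2_norm_sqf by blast
    obtain a where a: "(\<integral>\<^sup>+x. sqf (T f) x \<partial>lebesgue) = ennreal a" "0 \<le> a"
      using ennreal_less_topE[of "\<integral>\<^sup>+x. sqf (T f) x \<partial>lebesgue"] sT[OF f] unfolding sqint_def by blast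
    obtain b where b: "(\<integral>\<^sup>+x. sqf f x \<partial>lebesgue) = ennreal b" "0 \<le> b"
      using ennreal_less_topE[of "\<integral>\<^sup>+x. sqf f x \<partial>lebesgue"] f unfolding sqint_def by blast
    have "ennreal (a powr (1 / 2)) \<le> ennreal (B * b powr (1 / 2))"
      using le a b B by (simp add: ennreal_powr_ennreal ennreal_mult)
    then have "sqrt a \<le> B * sqrt b" using a b B by (simp add: powr_half_sqrt)
    then have "(sqrt a)\<^sup>2 \<le> (B * sqrt b)\<^sup>2" using a by (intro power_mono) auto
    then have "a \<le> B\<^sup>2 * b" using a b by (simp add: power_mult_distrib)
    then have "ennreal a \<le> ennreal (B\<^sup>2 * b)" by (rule ennreal_leI)
    then show "(\<integral>\<^sup>+x. sqf (T f) x \<partial>lebesgue) \<le> ennreal (B\<^sup>2) * (\<integral>\<^sup>+x. sqf f x \<partial>lebesgue)"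
      unfolding a(1) b(1) by (simp add: ennreal_mult')
  qed
  then show ?thesis by blast
qed

theorem theorem2p1:
  fixes T :: "(real ^ 'n \<Rightarrow> complex) \<Rightarrow> (real ^ 'n \<Rightarrow> complex)"
    and K :: "real ^ 'n \<Rightarrow> real ^ 'n \<Rightarrow> complex"
  assumes "CZ_operator T K"
  shows "\<exists>C>0. \<forall>w. A1_weight w \<longrightarrow>
    (\<forall>p p' f. 1 < p \<and> p' = p / (p - 1) \<and> f \<in> Lp_space p w \<longrightarrow>
       Lp_norm p w (max_truncation K f)
         \<le> ennreal (C * p * p' * A1_const w powr (1 / p) * Ainf_const w powr (1 / p'))
             * Lp_norm p w (modulus f)) \<and>
    (\<forall>f. f \<in> Lp_space 1 w \<longrightarrow>
       weak_L1_norm w (max_truncation K f)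
         \<le> ennreal (C * A1_const w * ln (1 + Ainf_const w)) * Lp_norm 1 w (modulus f))"
proof -
  obtain c \<delta> B where "cz K c \<delta> T B" using CZ_operator_cz[OF assms] by blast
  then interpret cz K c \<delta> T B .
  let ?s = "strc CARD('n)" and ?k = "wkc CARD('n)"
  have s0: "0 < ?s" by (simp add: strc_def maxc_pos)
  have k0: "0 < ?k" by (auto simp: wkc_def maxc_pos intro!: mult_pos_pos add_pos_pos divide_pos_pos)
  \<comment> \<open>The domination constant comes from the kernel bounds, the operator norm and the
    dimension; the other two factors from the dimension alone. All are fixed before the weight, the
    exponent and the function.\<close>
  define C where "C = domc * (?s + ?k)"
  have C0: "0 < C" using domc_pos s0 k0 by (simp add: C_def)
  have Cs: "domc * ?s \<le> C" and Ck: "domc * ?k \<le> C"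
    using domc_pos s0 k0 by (simp_all add: C_def distrib_left)
  have strong: "Lp_norm p w (max_truncation K f)
         \<le> ennreal (C * p * p' * A1_const w powr (1 / p) * Ainf_const w powr (1 / p')) * Lp_norm p w (modulus f)"
    if A: "A1_weight w" and p: "1 < p" and p': "p' = p / (p - 1)" and f: "f \<in> Lp_space p w" for w p p' f
    using A1_weight_cases[OF A]
  proof
    \<comment> \<open>For the degenerate weight the left side is 0, whatever values the
      characteristics take.\<close>
    assume w: "AE x in lebesgue. w x = 0"
    have "(\<integral>\<^sup>+x. ennreal_powr (max_truncation K f x) p * ennreal (w x) \<partial>lebesgue) = (\<integral>\<^sup>+x. 0 \<partial>(lebesgue :: (real ^ 'n) measure))"
    proof (rule nn_integral_cong_AE)
      show "AE x in lebesgue. ennreal_powr (max_truncation K f x) p * ennreal (w x) = 0"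
        using w by eventually_elim simp
    qed
    then have "Lp_norm p w (max_truncation K f) = 0" unfolding Lp_norm_def by (simp add: ennreal_powr_def)
    then show ?thesis by simp
  next
    assume a1: "a1_setting w (A1_const w) (Ainf_const w)"
    let ?V = "A1_const w" and ?W = "Ainf_const w"
    interpret A: a1_setting w ?V ?W by (rule a1)
    have fl: "loc_int f" using p f by (intro A.Lp_loc_int[of p]) auto
    have p'1: "1 < p'" unfolding p' using p by (simp add: less_divide_eq)
    let ?I = "\<integral>\<^sup>+x. ennreal (norm (f x) powr p) * ennreal (w x) \<partial>lebesgue"
    let ?c = "domc powr p * ((?s * p * p') powr p * ?V * ?W powr (p - 1))"
    have "(?s * p * p') powr p \<noteq> 0" using s0 p p'1 by simp
    then have c0: "0 < ?c" using domc_pos A.V_pos A.W1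
      by (intro mult_pos_pos) (auto simp: order_less_le)
    have "Lp_norm p w (max_truncation K f) \<le> ennreal_powr (ennreal ?c * ?I) (1 / p)"
      unfolding Lp_norm_def using p by (intro ennreal_powr_mono strong_truncation[OF a1 fl p p']) auto
    also have "\<dots> = ennreal (?c powr (1 / p)) * ennreal_powr ?I (1 / p)"
      using c0 p by (intro ennreal_powr_mult) auto
    also have "ennreal_powr ?I (1 / p) = Lp_norm p w (modulus f)"
      unfolding Lp_norm_def ennreal_powr_modulus ..
    also have "ennreal (?c powr (1 / p)) * Lp_norm p w (modulus f)
      \<le> ennreal (C * p * p' * ?V powr (1 / p) * ?W powr (1 / p')) * Lp_norm p w (modulus f)"
    proof (intro mult_right_mono ennreal_leI)
      \<comment> \<open>The root of order \<open>p\<close> turns the exponents 1 and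
        \<open>p - 1\<close> of the two characteristics into \<open>1 / p\<close> and
        \<open>1 / p'\<close>.\<close>
      have e: "(p - 1) * (1 / p) = 1 / p'" unfolding p' by simp
      have "?c powr (1 / p) = domc * (?s * p * p') * ?V powr (1 / p) * ?W powr (1 / p')"
        using p p'1 s0 domc_pos A.V_pos A.W1 e by (simp add: powr_mult powr_powr)
      also have "\<dots> = (domc * ?s) * (p * p' * ?V powr (1 / p) * ?W powr (1 / p'))" by (simp add: mult_ac)
      also have "\<dots> \<le> C * (p * p' * ?V powr (1 / p) * ?W powr (1 / p'))"
        using p p'1 by (intro mult_right_mono Cs) auto
      finally show "?c powr (1 / p) \<le> C * p * p' * ?V powr (1 / p) * ?W powr (1 / p')" by (simp add: mult_ac)
    qed simp
    finally show ?thesis .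
  qed
  have weak: "weak_L1_norm w (max_truncation K f) \<le> ennreal (C * A1_const w * ln (1 + Ainf_const w)) * Lp_norm 1 w (modulus f)"
    if A: "A1_weight w" and f: "f \<in> Lp_space 1 w" for w f
    using A1_weight_cases[OF A]
  proof
    assume w: "AE x in lebesgue. w x = 0"
    have "weight_of w S = 0" for S
    proof -
      have "weight_of w S = (\<integral>\<^sup>+x. 0 \<partial>(lebesgue :: (real ^ 'n) measure))"
        unfolding weight_of_def
      proof (rule nn_integral_cong_AE)
        show "AE x in lebesgue. ennreal (w x) * indicator S x = 0" using w by eventually_elim simp
      qed
      then show ?thesis by simp
    qed
    then have "weak_L1_norm w (max_truncation K f) \<le> 0" unfolding weak_L1_norm_def by (intro SUP_least) simp
    then show ?thesis by simp
  next
    assume a1: "a1_setting w (A1_const w) (Ainf_const w)"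
    let ?V = "A1_const w" and ?W = "Ainf_const w"
    interpret A: a1_setting w ?V ?W by (rule a1)
    have fl: "loc_int f" using f by (intro A.Lp_loc_int[of 1]) auto
    have "(\<integral>\<^sup>+x. modulus f x * ennreal (w x) \<partial>lebesgue) = (\<integral>\<^sup>+x. ennreal_powr (modulus f x) 1 * ennreal (w x) \<partial>lebesgue)"
      unfolding ennreal_powr_modulus by (simp add: modulus_def)
    then have I: "(\<integral>\<^sup>+x. modulus f x * ennreal (w x) \<partial>lebesgue) = Lp_norm 1 w (modulus f)"
      unfolding Lp_norm_def using ennreal_powr_inverse(1)[of 1 "\<integral>\<^sup>+x. ennreal_powr (modulus f x) 1 * ennreal (w x) \<partial>lebesgue"]
      by (simp add: ennreal_powr_def split: if_splits)
    have "weak_L1_norm w (max_truncation K f) \<le> ennreal (domc * (?k * ?V * ln (1 + ?W))) * Lp_norm 1 w (modulus f)"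
      unfolding weak_L1_norm_def I[symmetric]
      by (intro SUP_least weak_truncation[OF a1 fl]) simp
    also have "\<dots> \<le> ennreal (C * ?V * ln (1 + ?W)) * Lp_norm 1 w (modulus f)"
    proof (intro mult_right_mono ennreal_leI)
      have "(domc * ?k) * (?V * ln (1 + ?W)) \<le> C * (?V * ln (1 + ?W))"
        using A.V0 A.W1 by (intro mult_right_mono Ck) auto
      then show "domc * (?k * ?V * ln (1 + ?W)) \<le> C * ?V * ln (1 + ?W)" by (simp add: mult_ac)
    qed simp
    finally show ?thesis .
  qed
  show ?thesis
    using C0 strong weak by (intro exI[of _ C]) blast
qed

end
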